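(* Let $i:R\to S$ be a ring homomorphism. The induction functor $F=S\otimes_R\bullet:{}_R\mathcal{M}\to{}_S\mathcal{M}$ and the restriction of scalars functor ${}_S\mathcal{M}\to{}_R\mathcal{M}$ form a Frobenius pair of the second kind if and only if there exist strict Morita contexts $\underline{U}=(R,R,U,U',f,f')$ and $\underline{V}=(S,S,V,V',g,g')$ such that one of the following conditions holds; moreover, for given $\underline{U}$ and $\underline{V}$ these conditions are equivalent: i) $V\otimes_RU\otimes_R\bullet\cong{}_R\mathrm{Hom}(S,\bullet)$ as functors ${}_R\mathcal{M}\to{}_S\mathcal{M}$; ii) $\bullet\otimes_RS\cong\mathrm{Hom}_R(V\otimes_RU,\bullet)$ as functors $\mathcal{M}_R\to\mathcal{M}_S$; iii) $S$ is finitely generated and projective as a left $R$-module and $V\otimes_RU\cong{}_R\mathrm{Hom}(S,R)$ in ${}_S\mathcal{M}_R$; iv) $S$ is finitely generated and projective as a right $R$-module and $S\cong\mathrm{Hom}_R(V\otimes_RU,R)$ in ${}_R\mathcal{M}_S$; v) there exist $z=\sum_iv_i\otimes_Ru_i\otimes_Rs_i\in C_S(V\otimes_RU\otimes_RS)$ and $\omega:V\otimes_RU\to R$ in ${}_R\mathcal{M}_R$ such that $$\sum_i\omega(v_i\otimes_Ru_i)s_i=1\quad\text{and}\quad\sum_iv_i\otimes_Ru_i\,\omega(s_iv\otimes_Ru)=v\otimes_Ru$$ for all $u\in U$ and $v\in V$; vi) there exist $z=\sum_iv_i\otimes_Ru_i\otimes_Rs_i\in V\otimes_RU\otimes_RS$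 and $\omega:V\otimes_RU\to R$ in ${}_R\mathcal{M}_R$ such that $$\sum_i\omega(sv_i\otimes_Ru_i)s_i=s\quad\text{and}\quad\sum_iv_i\otimes_Ru_i\,\omega(s_iv\otimes_Ru)=v\otimes_Ru$$ for all $s\in S$, $u\in U$ and $v\in V$.
   Context: ${}_R\mathcal{M}$, $\mathcal{M}_R$, ${}_R\mathcal{M}_S$ denote the categories of left $R$-modules, right $R$-modules and $(R,S)$-bimodules. $S$ and every $S$-module are regarded as $R$-modules via $i$; in particular $V\otimes_RU$ is an $(S,R)$-bimodule and, by restriction, an $(R,R)$-bimodule. A pair of functors $F:\mathcal{C}\to\mathcal{D}$, $G:\mathcal{D}\to\mathcal{C}$ is a Frobenius pair of the second kind if there are equivalences of categories $\alpha:\mathcal{C}\to\mathcal{C}$, $\beta:\mathcal{D}\to\mathcal{D}$ such that $G$ is a right adjoint of $F$ and a left adjoint of $\beta F\alpha$. A strict Morita context $(R,S,P,Q,f,g)$ consists of $P\in{}_R\mathcal{M}_S$, $Q\in{}_S\mathcal{M}_R$ and bimodule isomorphisms $f:P\otimes_SQ\to R$, $g:Q\otimes_RP\to S$ with $f(p\otimes q)p'=p\,g(q\otimes p')$ and $g(q\otimes p)q'=q\,f(p\otimes q')$; thus $U,U'\in{}_R\mathcal{M}_R$ and $V,V'\in{}_S\mathcal{M}_S$. For an $S$-bimodule $M$, $C_S(M)=\{m\in M\mid sm=ms\text{ for all }s\in S\}$; on $V\otimes_RU\otimes_RS$, $S$ acts on the left on $V$ and on the right on $S$. Left linear maps are written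 on the right: ${}_R\mathrm{Hom}(S,M)$ is a left $S$-module via $(t)(sf)=(ts)f$, and ${}_R\mathrm{Hom}(S,R)$ is an $(S,R)$-bimodule via $(t)(sfr)=((ts)f)r$. For $M\in\mathcal{M}_R$, $\mathrm{Hom}_R(V\otimes_RU,M)$ is a right $S$-module via $(\varphi s)(y)=\varphi(sy)$, and $\mathrm{Hom}_R(V\otimes_RU,R)$ is an $(R,S)$-bimodule via $(r\varphi s)(y)=r\varphi(sy)$. *)

theory Defs
  imports
    "HOL-Algebra.Algebra"
    "HOL-Algebra.Free_Abelian_Groups"
    "HOL-Library.Infinite_Typeclass"
begin

section \<open>Categories\<close>

record ('o, 'a) category =
  Ob :: "'o set"
  Ar :: "'a set"
  Dom :: "'a \<Rightarrow> 'o"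
  Cod :: "'a \<Rightarrow> 'o"
  Idt :: "'o \<Rightarrow> 'a"
  Comp :: "'a \<Rightarrow> 'a \<Rightarrow> 'a"  (* Comp g f is g after f, meaningful when Dom g = Cod f *)

definition Hom :: "('o, 'a) category \<Rightarrow> 'o \<Rightarrow> 'o \<Rightarrow> 'a set" where
  "Hom C A B = {f \<in> Ar C. Dom C f = A \<and> Cod C f = B}"

definition is_category :: "('o, 'a) category \<Rightarrow> bool" where
  "is_category C \<longleftrightarrow>
     (\<forall>f\<in>Ar C. Dom C f \<in> Ob C \<and> Cod C f \<in> Ob C) \<and>
     (\<forall>A\<in>Ob C. Idt C A \<in> Hom C A A) \<and>
     (\<forall>f\<in>Ar C. \<forall>g\<in>Ar C. Dom C g = Cod C f \<longrightarrow> Comp C g f \<in> Hom C (Dom C f) (Cod C g)) \<and>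
     (\<forall>f\<in>Ar C. Comp C f (Idt C (Dom C f)) = f \<and> Comp C (Idt C (Cod C f)) f = f) \<and>
     (\<forall>f\<in>Ar C. \<forall>g\<in>Ar C. \<forall>h\<in>Ar C. Dom C g = Cod C f \<and> Dom C h = Cod C g \<longrightarrow>
        Comp C h (Comp C g f) = Comp C (Comp C h g) f)"

record ('o, 'a, 'p, 'b) cfunctor =
  on_ob :: "'o \<Rightarrow> 'p"
  on_ar :: "'a \<Rightarrow> 'b"

definition is_functor ::
  "('o, 'a) category \<Rightarrow> ('p, 'b) category \<Rightarrow> ('o, 'a, 'p, 'b) cfunctor \<Rightarrow> bool" where
  "is_functor C D F \<longleftrightarrow>
     (\<forall>A\<in>Ob C. on_ob F A \<in> Ob D) \<and>
     (\<forall>f\<in>Ar C. on_ar F f \<in> Hom D (on_ob F (Dom C f)) (on_ob F (Cod C f))) \<and>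
     (\<forall>A\<in>Ob C. on_ar F (Idt C A) = Idt D (on_ob F A)) \<and>
     (\<forall>f\<in>Ar C. \<forall>g\<in>Ar C. Dom C g = Cod C f \<longrightarrow>
        on_ar F (Comp C g f) = Comp D (on_ar F g) (on_ar F f))"

definition id_functor :: "('o, 'a, 'o, 'a) cfunctor" where
  "id_functor = \<lparr>on_ob = (\<lambda>A. A), on_ar = (\<lambda>f. f)\<rparr>"

definition comp_functor ::
  "('p, 'b, 'q, 'c) cfunctor \<Rightarrow> ('o, 'a, 'p, 'b) cfunctor \<Rightarrow> ('o, 'a, 'q, 'c) cfunctor" where
  "comp_functor G F = \<lparr>on_ob = (\<lambda>A. on_ob G (on_ob F A)), on_ar = (\<lambda>f. on_ar G (on_ar F f))\<rparr>"

definition isomorphism :: "('o, 'a) category \<Rightarrow> 'a \<Rightarrow> bool" where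
  "isomorphism C f \<longleftrightarrow> f \<in> Ar C \<and>
     (\<exists>g\<in>Hom C (Cod C f) (Dom C f). Comp C g f = Idt C (Dom C f) \<and> Comp C f g = Idt C (Cod C f))"

definition naturally_isomorphic ::
  "('o, 'a) category \<Rightarrow> ('p, 'b) category \<Rightarrow>
   ('o, 'a, 'p, 'b) cfunctor \<Rightarrow> ('o, 'a, 'p, 'b) cfunctor \<Rightarrow> bool" where
  "naturally_isomorphic C D F G \<longleftrightarrow>
     (\<exists>\<theta>. (\<forall>A\<in>Ob C. \<theta> A \<in> Hom D (on_ob F A) (on_ob G A) \<and> isomorphism D (\<theta> A)) \<and>
          (\<forall>f\<in>Ar C. Comp D (\<theta> (Cod C f)) (on_ar F f) = Comp D (on_ar G f) (\<theta> (Dom C f))))"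

definition is_equivalence ::
  "('o, 'a) category \<Rightarrow> ('p, 'b) category \<Rightarrow> ('o, 'a, 'p, 'b) cfunctor \<Rightarrow> bool" where
  "is_equivalence C D F \<longleftrightarrow> is_functor C D F \<and>
     (\<exists>G. is_functor D C G \<and>
          naturally_isomorphic C C (comp_functor G F) id_functor \<and>
          naturally_isomorphic D D (comp_functor F G) id_functor)"

text \<open>\<open>adjoint C D F G\<close>: \<open>F : C \<rightarrow> D\<close> is a left adjoint of \<open>G : D \<rightarrow> C\<close>.\<close>

definition adjoint ::
  "('o, 'a) category \<Rightarrow> ('p, 'b) category \<Rightarrow>
   ('o, 'a, 'p, 'b) cfunctor \<Rightarrow> ('p, 'b, 'o, 'a) cfunctor \<Rightarrow> bool" where
  "adjoint C D F G \<longleftrightarrow> is_functor C D F \<and> is_functor D C G \<and>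
     (\<exists>\<phi>. (\<forall>A\<in>Ob C. \<forall>B\<in>Ob D. bij_betw (\<phi> A B) (Hom D (on_ob F A) B) (Hom C A (on_ob G B))) \<and>
          (\<forall>f\<in>Ar C. \<forall>B\<in>Ob D. \<forall>h\<in>Hom D (on_ob F (Cod C f)) B.
             \<phi> (Dom C f) B (Comp D h (on_ar F f)) = Comp C (\<phi> (Cod C f) B h) f) \<and>
          (\<forall>A\<in>Ob C. \<forall>g\<in>Ar D. \<forall>h\<in>Hom D (on_ob F A) (Dom D g).
             \<phi> A (Cod D g) (Comp D g h) = Comp C (on_ar G g) (\<phi> A (Dom D g) h)))"

definition frobenius_pair_second_kind ::
  "('o, 'a) category \<Rightarrow> ('p, 'b) category \<Rightarrow>
   ('o, 'a, 'p, 'b) cfunctor \<Rightarrow> ('p, 'b, 'o, 'a) cfunctor \<Rightarrow> bool" where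
  "frobenius_pair_second_kind C D F G \<longleftrightarrow>
     (\<exists>\<alpha> \<beta>. is_equivalence C C \<alpha> \<and> is_equivalence D D \<beta> \<and>
        adjoint C D F G \<and>
        adjoint D C G (comp_functor \<beta> (comp_functor F \<alpha>)))"


section \<open>Modules and bimodules over noncommutative rings\<close>

text \<open>
  The library locale for modules assumes a commutative ring, so only its record is used. As everywhere
  in HOL-Algebra, the underlying abelian group of a module is a ring record whose fields for
  multiplication and unit carry no information; where a record is built here from scratch they are
  set to \<open>undefined\<close>. All actions are only meaningful on carriers.
\<close>

record ('r, 'm) rmodule = "'m ring" +
  rsmult :: "'m \<Rightarrow> 'r \<Rightarrow> 'm"  (infixl "\<star>\<index>" 70)

record ('l, 'r, 'm) bimodule = "('l, 'm) module" +
  bract :: "'m \<Rightarrow> 'r \<Rightarrow> 'm"  (infixl "\<triangleleft>\<index>" 70)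

locale left_module = R?: ring R + M?: abelian_group M
  for R :: "('r, 'a) ring_scheme" (structure) and M :: "('r, 'm, 'z) module_scheme" (structure) +
  assumes smult_closed: "a \<in> carrier R \<Longrightarrow> x \<in> carrier M \<Longrightarrow> a \<odot>\<^bsub>M\<^esub> x \<in> carrier M"
    and smult_l_distr: "a \<in> carrier R \<Longrightarrow> b \<in> carrier R \<Longrightarrow> x \<in> carrier M \<Longrightarrow>
      (a \<oplus>\<^bsub>R\<^esub> b) \<odot>\<^bsub>M\<^esub> x = a \<odot>\<^bsub>M\<^esub> x \<oplus>\<^bsub>M\<^esub> b \<odot>\<^bsub>M\<^esub> x"
    and smult_r_distr: "a \<in> carrier R \<Longrightarrow> x \<in> carrier M \<Longrightarrow> y \<in> carrier M \<Longrightarrow>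
      a \<odot>\<^bsub>M\<^esub> (x \<oplus>\<^bsub>M\<^esub> y) = a \<odot>\<^bsub>M\<^esub> x \<oplus>\<^bsub>M\<^esub> a \<odot>\<^bsub>M\<^esub> y"
    and smult_assoc: "a \<in> carrier R \<Longrightarrow> b \<in> carrier R \<Longrightarrow> x \<in> carrier M \<Longrightarrow>
      (a \<otimes>\<^bsub>R\<^esub> b) \<odot>\<^bsub>M\<^esub> x = a \<odot>\<^bsub>M\<^esub> (b \<odot>\<^bsub>M\<^esub> x)"
    and smult_one: "x \<in> carrier M \<Longrightarrow> \<one>\<^bsub>R\<^esub> \<odot>\<^bsub>M\<^esub> x = x"

locale right_module = R?: ring R + M?: abelian_group M
  for R :: "('r, 'a) ring_scheme" (structure) and M :: "('r, 'm, 'z) rmodule_scheme" (structure) +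
  assumes rsmult_closed: "a \<in> carrier R \<Longrightarrow> x \<in> carrier M \<Longrightarrow> x \<star>\<^bsub>M\<^esub> a \<in> carrier M"
    and rsmult_r_distr: "a \<in> carrier R \<Longrightarrow> b \<in> carrier R \<Longrightarrow> x \<in> carrier M \<Longrightarrow>
      x \<star>\<^bsub>M\<^esub> (a \<oplus>\<^bsub>R\<^esub> b) = x \<star>\<^bsub>M\<^esub> a \<oplus>\<^bsub>M\<^esub> x \<star>\<^bsub>M\<^esub> b"
    and rsmult_l_distr: "a \<in> carrier R \<Longrightarrow> x \<in> carrier M \<Longrightarrow> y \<in> carrier M \<Longrightarrow>
      (x \<oplus>\<^bsub>M\<^esub> y) \<star>\<^bsub>M\<^esub> a = x \<star>\<^bsub>M\<^esub> a \<oplus>\<^bsub>M\<^esub> y \<star>\<^bsub>M\<^esub> a"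
    and rsmult_assoc: "a \<in> carrier R \<Longrightarrow> b \<in> carrier R \<Longrightarrow> x \<in> carrier M \<Longrightarrow>
      x \<star>\<^bsub>M\<^esub> (a \<otimes>\<^bsub>R\<^esub> b) = (x \<star>\<^bsub>M\<^esub> a) \<star>\<^bsub>M\<^esub> b"
    and rsmult_one: "x \<in> carrier M \<Longrightarrow> x \<star>\<^bsub>M\<^esub> \<one>\<^bsub>R\<^esub> = x"

text \<open>A bimodule is a left module by forgetting a record extension; its right module needs a name.\<close>

definition right_part :: "('l, 'r, 'm) bimodule \<Rightarrow> ('r, 'm) rmodule" where
  "right_part B = \<lparr>carrier = carrier B, monoid.mult = monoid.mult B, one = one B, ring.zero = ring.zero B, ring.add = ring.add B,
     rsmult = bract B\<rparr>"

definition is_bimodule ::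
  "('l, 'a) ring_scheme \<Rightarrow> ('r, 'b) ring_scheme \<Rightarrow> ('l, 'r, 'm) bimodule \<Rightarrow> bool" where
  "is_bimodule L R B \<longleftrightarrow> left_module L B \<and> right_module R (right_part B) \<and>
     (\<forall>l\<in>carrier L. \<forall>x\<in>carrier B. \<forall>r\<in>carrier R. (l \<odot>\<^bsub>B\<^esub> x) \<triangleleft>\<^bsub>B\<^esub> r = l \<odot>\<^bsub>B\<^esub> (x \<triangleleft>\<^bsub>B\<^esub> r))"

definition lmod_hom ::
  "('r, 'a) ring_scheme \<Rightarrow> ('r, 'm, 'b) module_scheme \<Rightarrow> ('r, 'n, 'c) module_scheme \<Rightarrow> ('m \<Rightarrow> 'n) set" where
  "lmod_hom R M N = {h \<in> hom (add_monoid M) (add_monoid N).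
     \<forall>r\<in>carrier R. \<forall>x\<in>carrier M. h (r \<odot>\<^bsub>M\<^esub> x) = r \<odot>\<^bsub>N\<^esub> h x}"

definition rmod_hom ::
  "('r, 'a) ring_scheme \<Rightarrow> ('r, 'm, 'b) rmodule_scheme \<Rightarrow> ('r, 'n, 'c) rmodule_scheme \<Rightarrow> ('m \<Rightarrow> 'n) set" where
  "rmod_hom R M N = {h \<in> hom (add_monoid M) (add_monoid N).
     \<forall>r\<in>carrier R. \<forall>x\<in>carrier M. h (x \<star>\<^bsub>M\<^esub> r) = h x \<star>\<^bsub>N\<^esub> r}"

definition bimod_hom ::
  "('l, 'a) ring_scheme \<Rightarrow> ('r, 'b) ring_scheme \<Rightarrow>
   ('l, 'r, 'm) bimodule \<Rightarrow> ('l, 'r, 'n) bimodule \<Rightarrow> ('m \<Rightarrow> 'n) set" where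
  "bimod_hom L R M N = lmod_hom L M N \<inter> rmod_hom R (right_part M) (right_part N)"

definition lmod_iso ::
  "('r, 'a) ring_scheme \<Rightarrow> ('r, 'm, 'b) module_scheme \<Rightarrow> ('r, 'n, 'c) module_scheme \<Rightarrow> ('m \<Rightarrow> 'n) set" where
  "lmod_iso R M N = {h \<in> lmod_hom R M N. bij_betw h (carrier M) (carrier N)}"

definition rmod_iso ::
  "('r, 'a) ring_scheme \<Rightarrow> ('r, 'm, 'b) rmodule_scheme \<Rightarrow> ('r, 'n, 'c) rmodule_scheme \<Rightarrow> ('m \<Rightarrow> 'n) set" where
  "rmod_iso R M N = {h \<in> rmod_hom R M N. bij_betw h (carrier M) (carrier N)}"

definition bimod_iso ::
  "('l, 'a) ring_scheme \<Rightarrow> ('r, 'b) ring_scheme \<Rightarrow>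
   ('l, 'r, 'm) bimodule \<Rightarrow> ('l, 'r, 'n) bimodule \<Rightarrow> ('m \<Rightarrow> 'n) set" where
  "bimod_iso L R M N = {h \<in> bimod_hom L R M N. bij_betw h (carrier M) (carrier N)}"

text \<open>
  Restriction of scalars, and the ring \<open>S\<close> as a bimodule through ring homomorphisms \<open>j\<close> (left)
  and \<open>k\<close> (right) into it.
\<close>

definition restrict_lmod :: "('r \<Rightarrow> 's) \<Rightarrow> ('s, 'm) module \<Rightarrow> ('r, 'm) module" where
  "restrict_lmod j M = \<lparr>carrier = carrier M, monoid.mult = monoid.mult M, one = one M, ring.zero = ring.zero M, ring.add = ring.add M,
     smult = (\<lambda>r x. j r \<odot>\<^bsub>M\<^esub> x)\<rparr>"

definition restrict_bimod ::
  "('l \<Rightarrow> 'k) \<Rightarrow> ('r \<Rightarrow> 's) \<Rightarrow> ('k, 's, 'm) bimodule \<Rightarrow> ('l, 'r, 'm) bimodule" where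
  "restrict_bimod j k B = \<lparr>carrier = carrier B, monoid.mult = monoid.mult B, one = one B, ring.zero = ring.zero B, ring.add = ring.add B,
     smult = (\<lambda>l x. j l \<odot>\<^bsub>B\<^esub> x), bract = (\<lambda>x r. x \<triangleleft>\<^bsub>B\<^esub> k r)\<rparr>"

definition ring_bimod ::
  "('s, 'a) ring_scheme \<Rightarrow> ('l \<Rightarrow> 's) \<Rightarrow> ('r \<Rightarrow> 's) \<Rightarrow> ('l, 'r, 's) bimodule" where
  "ring_bimod S j k = \<lparr>carrier = carrier S, monoid.mult = monoid.mult S, one = one S, ring.zero = ring.zero S, ring.add = ring.add S,
     smult = (\<lambda>l x. j l \<otimes>\<^bsub>S\<^esub> x), bract = (\<lambda>x r. x \<otimes>\<^bsub>S\<^esub> k r)\<rparr>"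

definition centralizer ::
  "('s, 'a) ring_scheme \<Rightarrow> ('s, 's, 'm) bimodule \<Rightarrow> 'm set" where
  "centralizer S M = {m \<in> carrier M. \<forall>s\<in>carrier S. s \<odot>\<^bsub>M\<^esub> m = m \<triangleleft>\<^bsub>M\<^esub> s}"


subsection \<open>Finitely generated and projective modules\<close>

definition fin_gen_left :: "('r, 'a) ring_scheme \<Rightarrow> ('r, 'm, 'b) module_scheme \<Rightarrow> bool" where
  "fin_gen_left R M \<longleftrightarrow> (\<exists>E. finite E \<and> E \<subseteq> carrier M \<and>
     (\<forall>m\<in>carrier M. \<exists>c\<in>E \<rightarrow> carrier R. m = (\<Oplus>\<^bsub>M\<^esub>x\<in>E. c x \<odot>\<^bsub>M\<^esub> x)))"

definition fin_gen_right :: "('r, 'a) ring_scheme \<Rightarrow> ('r, 'm, 'b) rmodule_scheme \<Rightarrow> bool" where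
  "fin_gen_right R M \<longleftrightarrow> (\<exists>E. finite E \<and> E \<subseteq> carrier M \<and>
     (\<forall>m\<in>carrier M. \<exists>c\<in>E \<rightarrow> carrier R. m = (\<Oplus>\<^bsub>M\<^esub>x\<in>E. x \<star>\<^bsub>M\<^esub> c x)))"

text \<open>
  Projectivity is the lifting property against surjections between modules with carriers in the type
  of \<open>P\<close>. If that type is infinite and contains \<open>R\<close>, a free module mapping onto \<open>P\<close> lives in it, so
  this is projectivity against all modules.
\<close>

definition projective_left :: "('r, 'a) ring_scheme \<Rightarrow> ('r, 'm, 'b) module_scheme \<Rightarrow> bool" where
  "projective_left R P \<longleftrightarrow>
     (\<forall>(M :: ('r, 'm) module) (N :: ('r, 'm) module). left_module R M \<and> left_module R N \<longrightarrow>
        (\<forall>e\<in>lmod_hom R M N. \<forall>h\<in>lmod_hom R P N. e ` carrier M = carrier N \<longrightarrow>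
           (\<exists>k\<in>lmod_hom R P M. \<forall>x\<in>carrier P. e (k x) = h x)))"

definition projective_right :: "('r, 'a) ring_scheme \<Rightarrow> ('r, 'm, 'b) rmodule_scheme \<Rightarrow> bool" where
  "projective_right R P \<longleftrightarrow>
     (\<forall>(M :: ('r, 'm) rmodule) (N :: ('r, 'm) rmodule). right_module R M \<and> right_module R N \<longrightarrow>
        (\<forall>e\<in>rmod_hom R M N. \<forall>h\<in>rmod_hom R P N. e ` carrier M = carrier N \<longrightarrow>
           (\<exists>k\<in>rmod_hom R P M. \<forall>x\<in>carrier P. e (k x) = h x)))"


section \<open>Tensor products\<close>

text \<open>
  \<open>A \<otimes>\<^sub>R B\<close> is the free abelian group on \<open>A \<times> B\<close> modulo the subgroup generated by the
  relations of biadditivity and \<open>R\<close>-balancedness.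
\<close>

type_synonym ('m, 'n) tens = "(('m \<times> 'n) \<Rightarrow>\<^sub>0 int) set"

definition tensor_relations ::
  "('r, 'a) ring_scheme \<Rightarrow> ('r, 'm, 'b) rmodule_scheme \<Rightarrow> ('r, 'n, 'c) module_scheme \<Rightarrow>
   (('m \<times> 'n) \<Rightarrow>\<^sub>0 int) set" where
  "tensor_relations R A B =
     {frag_of (a \<oplus>\<^bsub>A\<^esub> a', b) - frag_of (a, b) - frag_of (a', b) | a a' b.
        a \<in> carrier A \<and> a' \<in> carrier A \<and> b \<in> carrier B} \<union>
     {frag_of (a, b \<oplus>\<^bsub>B\<^esub> b') - frag_of (a, b) - frag_of (a, b') | a b b'.
        a \<in> carrier A \<and> b \<in> carrier B \<and> b' \<in> carrier B} \<union>
     {frag_of (a \<star>\<^bsub>A\<^esub> r, b) - frag_of (a, r \<odot>\<^bsub>B\<^esub> b) | a r b.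
        a \<in> carrier A \<and> r \<in> carrier R \<and> b \<in> carrier B}"

definition tensor_kernel ::
  "('r, 'a) ring_scheme \<Rightarrow> ('r, 'm, 'b) rmodule_scheme \<Rightarrow> ('r, 'n, 'c) module_scheme \<Rightarrow>
   (('m \<times> 'n) \<Rightarrow>\<^sub>0 int) set" where
  "tensor_kernel R A B =
     generate (free_Abelian_group (carrier A \<times> carrier B)) (tensor_relations R A B)"

definition tensor_group ::
  "('r, 'a) ring_scheme \<Rightarrow> ('r, 'm, 'b) rmodule_scheme \<Rightarrow> ('r, 'n, 'c) module_scheme \<Rightarrow>
   ('m, 'n) tens monoid" where
  "tensor_group R A B = free_Abelian_group (carrier A \<times> carrier B) Mod tensor_kernel R A B"

definition pure_tensor ::
  "('r, 'a) ring_scheme \<Rightarrow> ('r, 'm, 'b) rmodule_scheme \<Rightarrow> ('r, 'n, 'c) module_scheme \<Rightarrow>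
   'm \<Rightarrow> 'n \<Rightarrow> ('m, 'n) tens" where
  "pure_tensor R A B a b =
     tensor_kernel R A B #>\<^bsub>free_Abelian_group (carrier A \<times> carrier B)\<^esub> frag_of (a, b)"

text \<open>
  The map \<open>f \<otimes> g\<close> into \<open>A' \<otimes>\<^sub>R B'\<close>: on a coset \<open>c\<close> of the source, apply the map of free
  abelian groups to all of \<open>c\<close> and saturate by the kernel of the target.
\<close>

definition tensor_map ::
  "('r, 'a) ring_scheme \<Rightarrow> ('r, 'm2, 'b) rmodule_scheme \<Rightarrow> ('r, 'n2, 'c) module_scheme \<Rightarrow>
   ('m1 \<Rightarrow> 'm2) \<Rightarrow> ('n1 \<Rightarrow> 'n2) \<Rightarrow> ('m1, 'n1) tens \<Rightarrow> ('m2, 'n2) tens" where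
  "tensor_map R A' B' f g c =
     tensor_kernel R A' B' <#>\<^bsub>free_Abelian_group (carrier A' \<times> carrier B')\<^esub>
       (frag_extend (\<lambda>(a, b). frag_of (f a, g b)) ` c)"

text \<open>Tensor products carrying the left action of the first factor, the right action of the second, or both.\<close>

definition tensor_lmod ::
  "('r, 'a) ring_scheme \<Rightarrow> ('l, 'r, 'm) bimodule \<Rightarrow> ('r, 'n) module \<Rightarrow> ('l, ('m, 'n) tens) module" where
  "tensor_lmod R A M =
     \<lparr>carrier = carrier (tensor_group R (right_part A) M), monoid.mult = undefined, one = undefined,
      ring.zero = one (tensor_group R (right_part A) M), ring.add = monoid.mult (tensor_group R (right_part A) M),
      smult = (\<lambda>l. tensor_map R (right_part A) M (\<lambda>a. l \<odot>\<^bsub>A\<^esub> a) (\<lambda>m. m))\<rparr>"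

definition tensor_rmod ::
  "('r, 'a) ring_scheme \<Rightarrow> ('r, 'm) rmodule \<Rightarrow> ('r, 't, 'n) bimodule \<Rightarrow> ('t, ('m, 'n) tens) rmodule" where
  "tensor_rmod R M B =
     \<lparr>carrier = carrier (tensor_group R M B), monoid.mult = undefined, one = undefined,
      ring.zero = one (tensor_group R M B), ring.add = monoid.mult (tensor_group R M B),
      rsmult = (\<lambda>x t. tensor_map R M B (\<lambda>m. m) (\<lambda>b. b \<triangleleft>\<^bsub>B\<^esub> t) x)\<rparr>"

definition tensor_bimod ::
  "('r, 'a) ring_scheme \<Rightarrow> ('l, 'r, 'm) bimodule \<Rightarrow> ('r, 't, 'n) bimodule \<Rightarrow>
   ('l, 't, ('m, 'n) tens) bimodule" where
  "tensor_bimod R A B =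
     \<lparr>carrier = carrier (tensor_group R (right_part A) B), monoid.mult = undefined, one = undefined,
      ring.zero = one (tensor_group R (right_part A) B), ring.add = monoid.mult (tensor_group R (right_part A) B),
      smult = (\<lambda>l. tensor_map R (right_part A) B (\<lambda>a. l \<odot>\<^bsub>A\<^esub> a) (\<lambda>b. b)),
      bract = (\<lambda>x t. tensor_map R (right_part A) B (\<lambda>a. a) (\<lambda>b. b \<triangleleft>\<^bsub>B\<^esub> t) x)\<rparr>"


section \<open>Modules of homomorphisms\<close>

text \<open>
  Homomorphisms are made extensional so that equality in the carrier is pointwise equality. For an
  \<open>(R,S)\<close>-bimodule \<open>B\<close> and left \<open>R\<close>-module \<open>M\<close>, \<open>lHom R B M\<close> is a left \<open>S\<close>-module;
  for an \<open>(S,R)\<close>-bimodule \<open>B\<close> and right \<open>R\<close>-module \<open>M\<close>, \<open>rHom R B M\<close> is a right \<open>S\<close>-module.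
\<close>

definition lHom ::
  "('r, 'a) ring_scheme \<Rightarrow> ('r, 's, 'b) bimodule \<Rightarrow> ('r, 'm) module \<Rightarrow> ('s, 'b \<Rightarrow> 'm) module" where
  "lHom R B M =
     \<lparr>carrier = lmod_hom R B M \<inter> extensional (carrier B), monoid.mult = undefined, one = undefined,
      ring.zero = (\<lambda>t\<in>carrier B. \<zero>\<^bsub>M\<^esub>), ring.add = (\<lambda>f g. \<lambda>t\<in>carrier B. f t \<oplus>\<^bsub>M\<^esub> g t),
      smult = (\<lambda>s f. \<lambda>t\<in>carrier B. f (t \<triangleleft>\<^bsub>B\<^esub> s))\<rparr>"

definition lHom_bimod ::
  "('r, 'a) ring_scheme \<Rightarrow> ('r, 's, 'b) bimodule \<Rightarrow> ('r, 't, 'm) bimodule \<Rightarrow>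
   ('s, 't, 'b \<Rightarrow> 'm) bimodule" where
  "lHom_bimod R B M =
     \<lparr>carrier = lmod_hom R B M \<inter> extensional (carrier B), monoid.mult = undefined, one = undefined,
      ring.zero = (\<lambda>t\<in>carrier B. \<zero>\<^bsub>M\<^esub>), ring.add = (\<lambda>f g. \<lambda>t\<in>carrier B. f t \<oplus>\<^bsub>M\<^esub> g t),
      smult = (\<lambda>s f. \<lambda>t\<in>carrier B. f (t \<triangleleft>\<^bsub>B\<^esub> s)),
      bract = (\<lambda>f r. \<lambda>t\<in>carrier B. f t \<triangleleft>\<^bsub>M\<^esub> r)\<rparr>"

definition rHom ::
  "('r, 'a) ring_scheme \<Rightarrow> ('s, 'r, 'b) bimodule \<Rightarrow> ('r, 'm) rmodule \<Rightarrow> ('s, 'b \<Rightarrow> 'm) rmodule" where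
  "rHom R B M =
     \<lparr>carrier = rmod_hom R (right_part B) M \<inter> extensional (carrier B), monoid.mult = undefined, one = undefined,
      ring.zero = (\<lambda>y\<in>carrier B. \<zero>\<^bsub>M\<^esub>), ring.add = (\<lambda>f g. \<lambda>y\<in>carrier B. f y \<oplus>\<^bsub>M\<^esub> g y),
      rsmult = (\<lambda>f s. \<lambda>y\<in>carrier B. f (s \<odot>\<^bsub>B\<^esub> y))\<rparr>"

definition rHom_bimod ::
  "('r, 'a) ring_scheme \<Rightarrow> ('s, 'r, 'b) bimodule \<Rightarrow> ('t, 'r, 'm) bimodule \<Rightarrow>
   ('t, 's, 'b \<Rightarrow> 'm) bimodule" where
  "rHom_bimod R B M =
     \<lparr>carrier = rmod_hom R (right_part B) (right_part M) \<inter> extensional (carrier B),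
      monoid.mult = undefined, one = undefined,
      ring.zero = (\<lambda>y\<in>carrier B. \<zero>\<^bsub>M\<^esub>), ring.add = (\<lambda>f g. \<lambda>y\<in>carrier B. f y \<oplus>\<^bsub>M\<^esub> g y),
      smult = (\<lambda>r f. \<lambda>y\<in>carrier B. r \<odot>\<^bsub>M\<^esub> f y),
      bract = (\<lambda>f s. \<lambda>y\<in>carrier B. f (s \<odot>\<^bsub>B\<^esub> y))\<rparr>"


section \<open>Module categories and functors between them\<close>

text \<open>
  The type \<open>'m\<close> is the universe: objects are the modules whose carrier is a set of elements of
  \<open>'m\<close>. For \<open>R\<close> and \<open>S\<close> themselves in an arbitrary infinite universe, these categories
  contain the rings, free modules on the elements of any object, and (up to isomorphism) all tensor
  products formed from their objects. An arrow is a triple of source, extensional homomorphism and target.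
\<close>

type_synonym ('r, 'm) lmod_arrow = "('r, 'm) module \<times> ('m \<Rightarrow> 'm) \<times> ('r, 'm) module"
type_synonym ('r, 'm) rmod_arrow = "('r, 'm) rmodule \<times> ('m \<Rightarrow> 'm) \<times> ('r, 'm) rmodule"

definition lmod_cat :: "('r, 'a) ring_scheme \<Rightarrow> (('r, 'm) module, ('r, 'm) lmod_arrow) category" where
  "lmod_cat R =
     \<lparr>Ob = {M. left_module R M},
      Ar = {(M, f, N). left_module R M \<and> left_module R N \<and> f \<in> lmod_hom R M N \<inter> extensional (carrier M)},
      Dom = (\<lambda>(M, f, N). M),
      Cod = (\<lambda>(M, f, N). N),
      Idt = (\<lambda>M. (M, \<lambda>x\<in>carrier M. x, M)),
      Comp = (\<lambda>(_, g, K) (M, f, _). (M, compose (carrier M) g f, K))\<rparr>"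

definition rmod_cat :: "('r, 'a) ring_scheme \<Rightarrow> (('r, 'm) rmodule, ('r, 'm) rmod_arrow) category" where
  "rmod_cat R =
     \<lparr>Ob = {M. right_module R M},
      Ar = {(M, f, N). right_module R M \<and> right_module R N \<and> f \<in> rmod_hom R M N \<inter> extensional (carrier M)},
      Dom = (\<lambda>(M, f, N). M),
      Cod = (\<lambda>(M, f, N). N),
      Idt = (\<lambda>M. (M, \<lambda>x\<in>carrier M. x, M)),
      Comp = (\<lambda>(_, g, K) (M, f, _). (M, compose (carrier M) g f, K))\<rparr>"

type_synonym ('r, 'm, 's, 'n) lmod_functor =
  "(('r, 'm) module, ('r, 'm) lmod_arrow, ('s, 'n) module, ('s, 'n) lmod_arrow) cfunctor"
type_synonym ('r, 'm, 's, 'n) rmod_functor =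
  "(('r, 'm) rmodule, ('r, 'm) rmod_arrow, ('s, 'n) rmodule, ('s, 'n) rmod_arrow) cfunctor"

definition restriction_functor :: "('r \<Rightarrow> 's) \<Rightarrow> ('s, 'm, 'r, 'm) lmod_functor" where
  "restriction_functor i =
     \<lparr>on_ob = restrict_lmod i, on_ar = (\<lambda>(M, f, N). (restrict_lmod i M, f, restrict_lmod i N))\<rparr>"

definition tensor_functor_left ::
  "('r, 'a) ring_scheme \<Rightarrow> ('s, 'r, 'b) bimodule \<Rightarrow> ('r, 'm, 's, ('b, 'm) tens) lmod_functor" where
  "tensor_functor_left R A =
     \<lparr>on_ob = tensor_lmod R A,
      on_ar = (\<lambda>(M, f, N). (tensor_lmod R A M,
        restrict (tensor_map R (right_part A) N (\<lambda>a. a) f) (carrier (tensor_lmod R A M)),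
        tensor_lmod R A N))\<rparr>"

definition tensor_functor_right ::
  "('r, 'a) ring_scheme \<Rightarrow> ('r, 's, 'b) bimodule \<Rightarrow> ('r, 'm, 's, ('m, 'b) tens) rmod_functor" where
  "tensor_functor_right R B =
     \<lparr>on_ob = (\<lambda>M. tensor_rmod R M B),
      on_ar = (\<lambda>(M, f, N). (tensor_rmod R M B,
        restrict (tensor_map R N B f (\<lambda>b. b)) (carrier (tensor_rmod R M B)),
        tensor_rmod R N B))\<rparr>"

definition lHom_functor ::
  "('r, 'a) ring_scheme \<Rightarrow> ('r, 's, 'b) bimodule \<Rightarrow> ('r, 'm, 's, 'b \<Rightarrow> 'm) lmod_functor" where
  "lHom_functor R B =
     \<lparr>on_ob = lHom R B,
      on_ar = (\<lambda>(M, f, N). (lHom R B M,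
        \<lambda>\<phi>\<in>carrier (lHom R B M). compose (carrier B) f \<phi>, lHom R B N))\<rparr>"

definition rHom_functor ::
  "('r, 'a) ring_scheme \<Rightarrow> ('s, 'r, 'b) bimodule \<Rightarrow> ('r, 'm, 's, 'b \<Rightarrow> 'm) rmod_functor" where
  "rHom_functor R B =
     \<lparr>on_ob = rHom R B,
      on_ar = (\<lambda>(M, f, N). (rHom R B M,
        \<lambda>\<phi>\<in>carrier (rHom R B M). compose (carrier B) f \<phi>, rHom R B N))\<rparr>"

text \<open>
  Tensor and Hom functors out of one category of modules take values in modules over the same ring
  with carriers in different types. Natural isomorphism of module-valued functors therefore means a
  natural family of module isomorphisms, where the two functors may use different carrier types.
\<close>

definition lmod_functors_isomorphic ::
  "('r, 'a) ring_scheme \<Rightarrow> ('s, 'b) ring_scheme \<Rightarrow>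
   ('r, 'm, 's, 'n1) lmod_functor \<Rightarrow> ('r, 'm, 's, 'n2) lmod_functor \<Rightarrow> bool" where
  "lmod_functors_isomorphic R S F G \<longleftrightarrow>
     (\<exists>\<theta>. (\<forall>M\<in>Ob (lmod_cat R). \<theta> M \<in> lmod_iso S (on_ob F M) (on_ob G M)) \<and>
          (\<forall>(M, f, N)\<in>Ar (lmod_cat R). \<forall>x\<in>carrier (on_ob F M).
             \<theta> N (fst (snd (on_ar F (M, f, N))) x) = fst (snd (on_ar G (M, f, N))) (\<theta> M x)))"

definition rmod_functors_isomorphic ::
  "('r, 'a) ring_scheme \<Rightarrow> ('s, 'b) ring_scheme \<Rightarrow>
   ('r, 'm, 's, 'n1) rmod_functor \<Rightarrow> ('r, 'm, 's, 'n2) rmod_functor \<Rightarrow> bool" where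
  "rmod_functors_isomorphic R S F G \<longleftrightarrow>
     (\<exists>\<theta>. (\<forall>M\<in>Ob (rmod_cat R). \<theta> M \<in> rmod_iso S (on_ob F M) (on_ob G M)) \<and>
          (\<forall>(M, f, N)\<in>Ar (rmod_cat R). \<forall>x\<in>carrier (on_ob F M).
             \<theta> N (fst (snd (on_ar F (M, f, N))) x) = fst (snd (on_ar G (M, f, N))) (\<theta> M x)))"

text \<open>
  For the induction functor to be a functor into modules over the universe \<open>'u\<close> itself, the module
  \<open>S \<otimes>\<^sub>R M\<close>, whose carrier consists of cosets, is replaced by an isomorphic copy with carrier in
  \<open>'u\<close>, along a chosen injection. Such an injection exists if \<open>'u\<close> is infinite.
\<close>

definition universe_inj :: "('s, 'n) module \<Rightarrow> 'n \<Rightarrow> 'u" where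
  "universe_inj N = (SOME e. inj_on e (carrier N))"

definition universe_copy :: "('s, 'n) module \<Rightarrow> ('s, 'u) module" where
  "universe_copy N = (let e = universe_inj N; d = inv_into (carrier N) e in
     \<lparr>carrier = e ` carrier N, monoid.mult = undefined, one = undefined, ring.zero = e \<zero>\<^bsub>N\<^esub>,
      ring.add = (\<lambda>x y. e (d x \<oplus>\<^bsub>N\<^esub> d y)), smult = (\<lambda>s x. e (s \<odot>\<^bsub>N\<^esub> d x))\<rparr>)"

definition universe_copy_functor :: "('s, 'n, 's, 'u) lmod_functor" where
  "universe_copy_functor =
     \<lparr>on_ob = universe_copy,
      on_ar = (\<lambda>(M, f, N). (universe_copy M,
        \<lambda>x\<in>carrier (universe_copy M). universe_inj N (f (inv_into (carrier M) (universe_inj M) x)),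
        universe_copy N))\<rparr>"

definition induction_functor ::
  "('r, 'a) ring_scheme \<Rightarrow> ('u, 'b) ring_scheme \<Rightarrow> ('r \<Rightarrow> 'u) \<Rightarrow> ('r, 'u, 'u, 'u) lmod_functor" where
  "induction_functor R S i =
     comp_functor universe_copy_functor (tensor_functor_left R (ring_bimod S (\<lambda>s. s) i))"

lemma universe_inj_tensor:
  fixes A :: "('l, 'r, 'u::infinite) bimodule" and M :: "('r, 'u) module"
  shows "inj_on (universe_inj (tensor_lmod R A M) :: ('u, 'u) tens \<Rightarrow> 'u) (carrier (tensor_lmod R A M))"
proof -
  have "carrier (tensor_lmod R A M)
        \<subseteq> (\<lambda>c. tensor_kernel R (right_part A) M #>\<^bsub>free_Abelian_group (carrier A \<times> carrier M)\<^esub> c)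
            ` carrier (free_Abelian_group (carrier A \<times> carrier M))"
    by (auto simp: tensor_lmod_def tensor_group_def FactGroup_def RCOSETS_def right_part_def)
  then have "carrier (tensor_lmod R A M) \<lesssim> carrier (free_Abelian_group (carrier A \<times> carrier M))"
    by (meson image_lepoll lepoll_trans subset_imp_lepoll)
  also have "\<dots> \<lesssim> carrier (free_Abelian_group (UNIV :: ('u \<times> 'u) set))"
    by (rule subset_imp_lepoll) auto
  also have "\<dots> \<approx> (UNIV :: ('u \<times> 'u) set)"
    by (rule eqpoll_free_Abelian_group_infinite) (simp add: finite_prod infinite_UNIV)
  also have "\<dots> \<approx> (UNIV :: 'u set)"
    using card_of_Times_same_infinite[OF infinite_UNIV[where 'a = 'u]]
    by (simp add: eqpoll_iff_card_of_ordIso)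
  finally obtain e :: "('u, 'u) tens \<Rightarrow> 'u" where "inj_on e (carrier (tensor_lmod R A M))"
    by (auto simp: lepoll_def)
  then show ?thesis
    unfolding universe_inj_def by (rule someI[where P = "\<lambda>e. inj_on e (carrier (tensor_lmod R A M))"])
qed

lemma is_category_lmod_cat: "is_category (lmod_cat R)"
  unfolding is_category_def lmod_cat_def Hom_def
  by (auto simp: lmod_hom_def hom_def compose_def Pi_def left_module.smult_closed
        abelian_groupE(1) left_module_def fun_eq_iff extensional_def)


section \<open>Morita contexts and the six conditions\<close>

definition strict_morita_context ::
  "('r, 'a) ring_scheme \<Rightarrow> ('s, 'b) ring_scheme \<Rightarrow> ('r, 's, 'p) bimodule \<Rightarrow> ('s, 'r, 'q) bimodule \<Rightarrow>
   (('p, 'q) tens \<Rightarrow> 'r) \<Rightarrow> (('q, 'p) tens \<Rightarrow> 's) \<Rightarrow> bool" where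
  "strict_morita_context R S P Q f g \<longleftrightarrow>
     is_bimodule R S P \<and> is_bimodule S R Q \<and>
     f \<in> bimod_iso R R (tensor_bimod S P Q) (ring_bimod R (\<lambda>r. r) (\<lambda>r. r)) \<and>
     g \<in> bimod_iso S S (tensor_bimod R Q P) (ring_bimod S (\<lambda>s. s) (\<lambda>s. s)) \<and>
     (\<forall>p\<in>carrier P. \<forall>q\<in>carrier Q. \<forall>p'\<in>carrier P.
        f (pure_tensor S (right_part P) Q p q) \<odot>\<^bsub>P\<^esub> p' = p \<triangleleft>\<^bsub>P\<^esub> g (pure_tensor R (right_part Q) P q p')) \<and>
     (\<forall>q\<in>carrier Q. \<forall>p\<in>carrier P. \<forall>q'\<in>carrier Q.
        g (pure_tensor R (right_part Q) P q p) \<odot>\<^bsub>Q\<^esub> q' = q \<triangleleft>\<^bsub>Q\<^esub> f (pure_tensor S (right_part P) Q p q'))"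

text \<open>
  \<open>VU R i V U\<close> is \<open>V \<otimes>\<^sub>R U\<close> as an \<open>(S,R)\<close>-bimodule and \<open>VUS R S i V U\<close> is
  \<open>V \<otimes>\<^sub>R U \<otimes>\<^sub>R S\<close> as an \<open>(S,S)\<close>-bimodule, with pure tensors \<open>vu\<close> and \<open>vus\<close>.
\<close>

definition VU ::
  "('r, 'a) ring_scheme \<Rightarrow> ('r \<Rightarrow> 's) \<Rightarrow> ('s, 's, 'v) bimodule \<Rightarrow> ('r, 'r, 'u) bimodule \<Rightarrow>
   ('s, 'r, ('v, 'u) tens) bimodule" where
  "VU R i V U = tensor_bimod R (restrict_bimod (\<lambda>s. s) i V) U"

definition vu ::
  "('r, 'a) ring_scheme \<Rightarrow> ('r \<Rightarrow> 's) \<Rightarrow> ('s, 's, 'v) bimodule \<Rightarrow> ('r, 'r, 'u) bimodule \<Rightarrow>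
   'v \<Rightarrow> 'u \<Rightarrow> ('v, 'u) tens" where
  "vu R i V U = pure_tensor R (right_part (restrict_bimod (\<lambda>s. s) i V)) U"

definition VUS ::
  "('r, 'a) ring_scheme \<Rightarrow> ('s, 'b) ring_scheme \<Rightarrow> ('r \<Rightarrow> 's) \<Rightarrow>
   ('s, 's, 'v) bimodule \<Rightarrow> ('r, 'r, 'u) bimodule \<Rightarrow> ('s, 's, (('v, 'u) tens, 's) tens) bimodule" where
  "VUS R S i V U = tensor_bimod R (VU R i V U) (ring_bimod S i (\<lambda>s. s))"

definition vus ::
  "('r, 'a) ring_scheme \<Rightarrow> ('s, 'b) ring_scheme \<Rightarrow> ('r \<Rightarrow> 's) \<Rightarrow>
   ('s, 's, 'v) bimodule \<Rightarrow> ('r, 'r, 'u) bimodule \<Rightarrow> 'v \<Rightarrow> 'u \<Rightarrow> 's \<Rightarrow> (('v, 'u) tens, 's) tens" where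
  "vus R S i V U v u s =
     pure_tensor R (right_part (VU R i V U)) (ring_bimod S i (\<lambda>s. s)) (vu R i V U v u) s"

text \<open>
  The universe of the module categories in the first two conditions is the type \<open>'u\<close> of the
  elements of \<open>R\<close>, \<open>S\<close>, \<open>U\<close> and \<open>V\<close>.
\<close>

definition condition_i ::
  "'u ring \<Rightarrow> 'u ring \<Rightarrow> ('u \<Rightarrow> 'u) \<Rightarrow> ('u, 'u, 'u) bimodule \<Rightarrow> ('u, 'u, 'u) bimodule \<Rightarrow> bool" where
  "condition_i R S i U V \<longleftrightarrow>
     lmod_functors_isomorphic R S
       (tensor_functor_left R (VU R i V U) :: ('u, 'u, 'u, (('u, 'u) tens, 'u) tens) lmod_functor)
       (lHom_functor R (ring_bimod S i (\<lambda>s. s)))"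

definition condition_ii ::
  "'u ring \<Rightarrow> 'u ring \<Rightarrow> ('u \<Rightarrow> 'u) \<Rightarrow> ('u, 'u, 'u) bimodule \<Rightarrow> ('u, 'u, 'u) bimodule \<Rightarrow> bool" where
  "condition_ii R S i U V \<longleftrightarrow>
     rmod_functors_isomorphic R S
       (tensor_functor_right R (ring_bimod S i (\<lambda>s. s)) :: ('u, 'u, 'u, ('u, 'u) tens) rmod_functor)
       (rHom_functor R (VU R i V U))"

definition condition_iii ::
  "'u ring \<Rightarrow> 'u ring \<Rightarrow> ('u \<Rightarrow> 'u) \<Rightarrow> ('u, 'u, 'u) bimodule \<Rightarrow> ('u, 'u, 'u) bimodule \<Rightarrow> bool" where
  "condition_iii R S i U V \<longleftrightarrow>
     fin_gen_left R (ring_bimod S i (\<lambda>s. s)) \<and> projective_left R (ring_bimod S i (\<lambda>s. s)) \<and>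
     bimod_iso S R (VU R i V U)
       (lHom_bimod R (ring_bimod S i (\<lambda>s. s)) (ring_bimod R (\<lambda>r. r) (\<lambda>r. r))) \<noteq> {}"

definition condition_iv ::
  "'u ring \<Rightarrow> 'u ring \<Rightarrow> ('u \<Rightarrow> 'u) \<Rightarrow> ('u, 'u, 'u) bimodule \<Rightarrow> ('u, 'u, 'u) bimodule \<Rightarrow> bool" where
  "condition_iv R S i U V \<longleftrightarrow>
     fin_gen_right R (right_part (ring_bimod S (\<lambda>s. s) i)) \<and>
     projective_right R (right_part (ring_bimod S (\<lambda>s. s) i)) \<and>
     bimod_iso R S (ring_bimod S i (\<lambda>s. s))
       (rHom_bimod R (VU R i V U) (ring_bimod R (\<lambda>r. r) (\<lambda>r. r))) \<noteq> {}"

definition condition_v ::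
  "'u ring \<Rightarrow> 'u ring \<Rightarrow> ('u \<Rightarrow> 'u) \<Rightarrow> ('u, 'u, 'u) bimodule \<Rightarrow> ('u, 'u, 'u) bimodule \<Rightarrow> bool" where
  "condition_v R S i U V \<longleftrightarrow>
     (\<exists>z (n::nat) v u s \<omega>.
        v \<in> {..<n} \<rightarrow> carrier V \<and> u \<in> {..<n} \<rightarrow> carrier U \<and> s \<in> {..<n} \<rightarrow> carrier S \<and>
        z = (\<Oplus>\<^bsub>VUS R S i V U\<^esub>j\<in>{..<n}. vus R S i V U (v j) (u j) (s j)) \<and>
        z \<in> centralizer S (VUS R S i V U) \<and>
        \<omega> \<in> bimod_hom R R (restrict_bimod i (\<lambda>r. r) (VU R i V U)) (ring_bimod R (\<lambda>r. r) (\<lambda>r. r)) \<and>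
        (\<Oplus>\<^bsub>S\<^esub>j\<in>{..<n}. i (\<omega> (vu R i V U (v j) (u j))) \<otimes>\<^bsub>S\<^esub> s j) = \<one>\<^bsub>S\<^esub> \<and>
        (\<forall>u'\<in>carrier U. \<forall>v'\<in>carrier V.
           (\<Oplus>\<^bsub>VU R i V U\<^esub>j\<in>{..<n}.
              vu R i V U (v j) (u j) \<triangleleft>\<^bsub>VU R i V U\<^esub> \<omega> (vu R i V U (s j \<odot>\<^bsub>V\<^esub> v') u')) = vu R i V U v' u'))"

definition condition_vi ::
  "'u ring \<Rightarrow> 'u ring \<Rightarrow> ('u \<Rightarrow> 'u) \<Rightarrow> ('u, 'u, 'u) bimodule \<Rightarrow> ('u, 'u, 'u) bimodule \<Rightarrow> bool" where
  "condition_vi R S i U V \<longleftrightarrow>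
     (\<exists>z (n::nat) v u s \<omega>.
        v \<in> {..<n} \<rightarrow> carrier V \<and> u \<in> {..<n} \<rightarrow> carrier U \<and> s \<in> {..<n} \<rightarrow> carrier S \<and>
        z = (\<Oplus>\<^bsub>VUS R S i V U\<^esub>j\<in>{..<n}. vus R S i V U (v j) (u j) (s j)) \<and>
        z \<in> carrier (VUS R S i V U) \<and>
        \<omega> \<in> bimod_hom R R (restrict_bimod i (\<lambda>r. r) (VU R i V U)) (ring_bimod R (\<lambda>r. r) (\<lambda>r. r)) \<and>
        (\<forall>t\<in>carrier S.
           (\<Oplus>\<^bsub>S\<^esub>j\<in>{..<n}. i (\<omega> (vu R i V U (t \<odot>\<^bsub>V\<^esub> v j) (u j))) \<otimes>\<^bsub>S\<^esub> s j) = t) \<and>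
        (\<forall>u'\<in>carrier U. \<forall>v'\<in>carrier V.
           (\<Oplus>\<^bsub>VU R i V U\<^esub>j\<in>{..<n}.
              vu R i V U (v j) (u j) \<triangleleft>\<^bsub>VU R i V U\<^esub> \<omega> (vu R i V U (s j \<odot>\<^bsub>V\<^esub> v') u')) = vu R i V U v' u'))"

end

theory Submission
 imports Defs
begin

text \<open>
 Put \<open>W = V \<otimes>\<^sub>R U\<close>. All six conditions describe one piece of data, called a dual system below: a
 bimodule map \<open>om : W \<rightarrow> R\<close> and finitely many \<open>(w\<^sub>j, s\<^sub>j)\<close> in \<open>W \<times> S\<close> with
 \<open>\<Sum> om (t w\<^sub>j) s\<^sub>j = t\<close> and \<open>\<Sum> w\<^sub>j om (s\<^sub>j w) = w\<close>. Such data make \<open>W\<close> and \<open>S\<close> finitely generated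
 projective and dual to each other through the pairing \<open>(w, t) \<mapsto> om (t w)\<close>. Condition vi is this
 definition on pure tensors. In condition v the first identity is required only for \<open>t = 1\<close>, but
 \<open>\<Sum> w\<^sub>j \<otimes> s\<^sub>j\<close> is required to be central, which gives it for every \<open>t\<close>; conversely the tensor of a dual
 system is always central (\<open>casimir_central\<close>). Conditions i and iii amount to
 \<open>w \<otimes> m \<mapsto> (t \<mapsto> om (t w) m)\<close> being an isomorphism onto \<open>Hom(S, M)\<close>, for all \<open>M\<close> or for \<open>M = R\<close>, and
 ii and iv to the same for \<open>m \<otimes> s \<mapsto> (w \<mapsto> m om (s w))\<close>. A dual system is recovered from a
 natural isomorphism by evaluating it at \<open>R\<close> and at \<open>S\<close>, respectively at a copy of \<open>W\<close>. Condition iv speaks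
 of \<open>S\<close> as a right \<open>R\<close>-module, whereas the isomorphism needs a dual basis of \<open>W\<close>; since \<open>U\<close> and \<open>V\<close> are
 invertible, \<open>S\<close> has a right dual basis if and only if \<open>V\<close> has one, if and only if \<open>W\<close> has one.

 A dual system gives a Frobenius pair: \<open>U \<otimes> -\<close> and \<open>V \<otimes> -\<close> are equivalences, and
 \<open>M \<mapsto> V \<otimes>\<^sub>S (S \<otimes>\<^sub>R (U \<otimes>\<^sub>R M))\<close>, which is \<open>W \<otimes>\<^sub>R M\<close>, is right adjoint to restriction with unit
 \<open>n \<mapsto> \<Sum> w\<^sub>j \<otimes> s\<^sub>j n\<close> and counit \<open>w \<otimes> m \<mapsto> om(w) m\<close>; the triangle identities are the two
 identities of the dual system.

 Conversely let \<open>\<alpha>\<close> and \<open>\<beta>\<close> be equivalences such that \<open>K = \<beta> F \<alpha>\<close> is right adjoint to restriction.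
 Equivalences preserve families of maps whose images generate (\<open>span_image\<close>), hence are additive, and
 \<open>\<alpha>(R)\<close> with the right action obtained from functoriality belongs to a strict Morita context
 (\<open>morita_context\<close>). Put \<open>U = \<alpha>(R)\<close> and \<open>V = \<beta>(S)\<close>; then \<open>W\<close> is isomorphic to \<open>K(R)\<close>. The adjunction
 provides a universal element \<open>z\<close> of \<open>K(S)\<close> (\<open>universal_element\<close>). Writing \<open>z\<close> as the sum of the images of
 \<open>x\<^sub>j \<in> K(R)\<close> under \<open>K\<close> of the maps \<open>r \<mapsto> i(r) s\<^sub>j\<close> yields the family \<open>(x\<^sub>j, s\<^sub>j)\<close>, and \<open>om (y)\<close> is the value
 at \<open>1\<close> of the map \<open>S \<rightarrow> R\<close> that represents \<open>y \<in> K(R)\<close>.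
\<close>

section \<open>Sums over lists and module calculus\<close>

text \<open>
 Long formulas are kept readable by a second notation for structure indices and by short names.
\<close>

syntax "_index" :: "logic => index" ("\<^sub>_" [1000] 1000)

abbreviation elem :: "'a => ('a, 'b) partial_object_scheme => bool" (infix "\<in>." 50) where
 "x \<in>. M \<equiv> x \<in> carrier M"

abbreviation "lfunctor R S \<equiv> is_functor (lmod_cat R) (lmod_cat S)"
abbreviation "lmod \<equiv> left_module"
abbreviation "rmod \<equiv> right_module"
abbreviation "lhom \<equiv> lmod_hom"
abbreviation "rhom \<equiv> rmod_hom"
abbreviation "rpart \<equiv> right_part"
abbreviation "ptens \<equiv> pure_tensor"

text \<open>Lists index finite sums, so that concatenated and nested sums need no index set.\<close>

primrec lsum :: "('m, 'z) ring_scheme => ('a => 'm) => 'a list => 'm" where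
 "lsum M f [] = \<zero>\<^sub>M"
| "lsum M f (x # xs) = f x \<oplus>\<^sub>M lsum M f xs"

abbreviation add_homs :: "('m, 'y) ring_scheme => ('n, 'z) ring_scheme => ('m => 'n) set" where
 "add_homs M N \<equiv> hom (add_monoid M) (add_monoid N)"

lemma lsum_cong [fundef_cong]:
 "xs = ys ==> (!!x. x \<in> set ys ==> f x = g x) ==> lsum M f xs = lsum M g ys"
proof (induction xs arbitrary: ys)
 case (Cons a xs)
 then show ?case by (cases ys) auto
qed auto

lemma lsum_map: "lsum M f (map g xs) = lsum M (%x. f (g x)) xs"
 by (induction xs) auto

lemma add_carrier [simp]: "abelian_group M ==> x \<in>. M ==> y \<in>. M ==> x \<oplus>\<^sub>M y \<in>. M"
 by (simp add: abelian_groupE)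

lemma zero_carrier [simp]: "abelian_group M ==> \<zero>\<^sub>M \<in>. M"
 by (simp add: abelian_groupE)

lemma minus_carrier [simp]: "abelian_group M ==> x \<in>. M ==> \<ominus>\<^sub>M x \<in>. M"
 by (simp add: abelian_group.a_inv_closed)

lemma add_zero [simp]:
 "abelian_group M ==> x \<in>. M ==> \<zero>\<^sub>M \<oplus>\<^sub>M x = x"
 "abelian_group M ==> x \<in>. M ==> x \<oplus>\<^sub>M \<zero>\<^sub>M = x"
 by (simp_all add: abelian_group.axioms(1) abelian_monoid.l_zero abelian_monoid.r_zero)

lemma add_minus [simp]:
 "abelian_group M ==> x \<in>. M ==> (\<ominus>\<^sub>M x) \<oplus>\<^sub>M x = \<zero>\<^sub>M"
 "abelian_group M ==> x \<in>. M ==> x \<oplus>\<^sub>M (\<ominus>\<^sub>M x) = \<zero>\<^sub>M"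
 by (simp_all add: abelian_group.l_neg abelian_group.r_neg)

lemma add_left_cancel:
 assumes "abelian_group M" "x \<in>. M" "y \<in>. M" "z \<in>. M"
 shows "x \<oplus>\<^sub>M y = x \<oplus>\<^sub>M z \<longleftrightarrow> y = z"
 using assms by (metis abelian_group.r_neg1)

lemma idempotent_zero:
 assumes "abelian_group M" "x \<in>. M" "x \<oplus>\<^sub>M x = x"
 shows "x = \<zero>\<^sub>M"
 using assms add_left_cancel[of M x x "\<zero>\<^sub>M"] by simp

lemma add_exchange:
 assumes "abelian_group M" "a \<in>. M" "b \<in>. M" "c \<in>. M" "d \<in>. M"
 shows "(a \<oplus>\<^sub>M b) \<oplus>\<^sub>M (c \<oplus>\<^sub>M d) = (a \<oplus>\<^sub>M c) \<oplus>\<^sub>M (b \<oplus>\<^sub>M d)"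
 using assms by (simp add: abelian_group.axioms abelian_monoid.a_ac)

lemma lsum_closed [simp]:
 "abelian_group M ==> (!!x. x \<in> set xs ==> f x \<in>. M) ==> lsum M f xs \<in>. M"
 by (induction xs) auto

lemma lsum_append:
 "abelian_group M ==> (!!x. x \<in> set xs \<union> set ys ==> f x \<in>. M) ==>
  lsum M f (xs @ ys) = lsum M f xs \<oplus>\<^sub>M lsum M f ys"
 by (induction xs) (auto simp: abelian_group.axioms abelian_monoid.a_assoc)

lemma lsum_concat:
 "abelian_group M ==> (!!xs x. xs \<in> set xss ==> x \<in> set xs ==> f x \<in>. M) ==>
  lsum M f (concat xss) = lsum M (lsum M f) xss"
proof (induction xss)
 case (Cons a xss)
 have "lsum M f (concat xss) = lsum M (lsum M f) xss"
  by (rule Cons.IH) (use Cons.prems in auto)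
 with Cons.prems show ?case using Cons.prems by (simp, subst lsum_append) auto
qed simp

lemma lsum_add:
 "abelian_group M ==> (!!x. x \<in> set xs ==> f x \<in>. M) ==> (!!x. x \<in> set xs ==> g x \<in>. M) ==>
  lsum M (%x. f x \<oplus>\<^sub>M g x) xs = lsum M f xs \<oplus>\<^sub>M lsum M g xs"
 by (induction xs) (auto simp: add_exchange)

lemma lsum_zero: "abelian_group M ==> (!!x. x \<in> set xs ==> f x = \<zero>\<^sub>M) ==> lsum M f xs = \<zero>\<^sub>M"
 by (induction xs) auto

lemma lsum_swap:
 assumes "abelian_group M" "!!x y. x \<in> set xs ==> y \<in> set ys ==> f x y \<in>. M"
 shows "lsum M (%x. lsum M (%y. f x y) ys) xs = lsum M (%y. lsum M (%x. f x y) xs) ys"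
 using assms
proof (induction xs)
 case Nil
 then show ?case by (simp add: lsum_zero)
next
 case (Cons a xs)
 then show ?case by (subst lsum_add[symmetric] | simp)+
qed

lemma lsum_conv_finsum:
 assumes "abelian_group M" "!!x. x \<in> set xs ==> f x \<in>. M"
 shows "(\<Oplus>\<^bsub>M\<^esub>j\<in>{..<length xs}. f (xs ! j)) = lsum M f xs"
 using assms(2)
proof (induction xs rule: rev_induct)
 case Nil
 then show ?case by (simp add: assms(1) abelian_group.axioms abelian_monoid.finsum_empty)
next
 case (snoc x xs)
 have am: "abelian_monoid M" using assms(1) by (rule abelian_group.axioms)
 have in_M: "f (xs ! j) \<in>. M" if "j < length xs" for j
  using snoc.prems[of "xs ! j"] that by auto
 have "(\<Oplus>\<^bsub>M\<^esub>j\<in>insert (length xs) {..<length xs}. f ((xs @ [x]) ! j))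
   = f x \<oplus>\<^sub>M (\<Oplus>\<^bsub>M\<^esub>j\<in>{..<length xs}. f ((xs @ [x]) ! j))"
  using snoc.prems by (subst abelian_monoid.finsum_insert[OF am])
   (use in_M in \<open>auto simp: nth_append\<close>)
 also have "(\<Oplus>\<^bsub>M\<^esub>j\<in>{..<length xs}. f ((xs @ [x]) ! j)) = (\<Oplus>\<^bsub>M\<^esub>j\<in>{..<length xs}. f (xs ! j))"
  using in_M by (intro abelian_monoid.finsum_cong'[OF am]) (auto simp: nth_append)
 also have "... = lsum M f xs" using snoc by auto
 also have "f x \<oplus>\<^sub>M lsum M f xs = lsum M f (xs @ [x])"
  using snoc.prems assms(1)
  by (subst lsum_append) (auto intro!: abelian_monoid.a_comm[OF am] simp del: lsum.simps(2) simp: lsum.simps(2)[of _ _ _ "[]"])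
 finally show ?case by (simp add: lessThan_Suc)
qed

lemma finsum_conv_lsum:
 assumes "abelian_group M" "f \<in> {..<n::nat} \<rightarrow> carrier M"
 shows "(\<Oplus>\<^bsub>M\<^esub>j\<in>{..<n}. f j) = lsum M f [0..<n]"
proof -
 have "(\<Oplus>\<^bsub>M\<^esub>j\<in>{..<n}. f j) = (\<Oplus>\<^bsub>M\<^esub>j\<in>{..<length [0..<n]}. f ([0..<n] ! j))"
  using assms by (intro abelian_monoid.finsum_cong'[OF abelian_group.axioms(1)]) auto
 also have "... = lsum M f [0..<n]"
  using assms by (intro lsum_conv_finsum) auto
 finally show ?thesis .
qed

lemma addI:
 "(!!x. x \<in>. M ==> h x \<in>. N) ==>
  (!!x y. x \<in>. M ==> y \<in>. M ==> h (x \<oplus>\<^sub>M y) = h x \<oplus>\<^sub>N h y) ==> h \<in> add_homs M N"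
 by (auto simp: hom_def)

lemma addD:
 assumes "h \<in> add_homs M N"
 shows "x \<in>. M ==> h x \<in>. N"
  "x \<in>. M ==> y \<in>. M ==> h (x \<oplus>\<^sub>M y) = h x \<oplus>\<^sub>N h y"
 using assms by (auto simp: hom_def)

lemma add_homs_zero:
 assumes "h \<in> add_homs M N" "abelian_group M" "abelian_group N"
 shows "h \<zero>\<^sub>M = \<zero>\<^sub>N"
 using assms addD(2)[OF assms(1), of "\<zero>\<^sub>M" "\<zero>\<^sub>M"] addD(1)[OF assms(1), of "\<zero>\<^sub>M"]
 by (intro idempotent_zero) auto

lemma add_homs_minus:
 assumes "h \<in> add_homs M N" "abelian_group M" "abelian_group N" "x \<in>. M"
 shows "h (\<ominus>\<^sub>M x) = \<ominus>\<^sub>N h x"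
proof -
 have "h (\<ominus>\<^sub>M x) \<oplus>\<^sub>N h x = \<zero>\<^sub>N"
  using assms addD(2)[OF assms(1), of "\<ominus>\<^sub>M x" x] add_homs_zero[OF assms(1-3)] by auto
 then show ?thesis
  using assms by (metis abelian_group.minus_equality minus_carrier addD(1))
qed

lemma add_lsum:
 assumes "h \<in> add_homs M N" "abelian_group M" "abelian_group N" "!!x. x \<in> set xs ==> f x \<in>. M"
 shows "h (lsum M f xs) = lsum N (%x. h (f x)) xs"
 using assms(4)
proof (induction xs)
 case Nil
 then show ?case using add_homs_zero[OF assms(1-3)] by simp
next
 case (Cons a xs)
 then show ?case using addD(2)[OF assms(1)] assms(2) by simp
qed

lemma add_homs_comp:
 "f \<in> add_homs M N ==> g \<in> add_homs N K ==> (%x. g (f x)) \<in> add_homs M K"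
 by (auto simp: hom_def Pi_def)

lemma add_homs_lsum_pointwise:
 assumes "!!x. x \<in> set xs ==> f x \<in> add_homs M N" "abelian_group N"  "abelian_group M"
 shows "(%m. lsum N (%x. f x m) xs) \<in> add_homs M N"
proof (rule addI)
 fix x y assume "x \<in>. M" "y \<in>. M"
 then have "lsum N (%z. f z (x \<oplus>\<^sub>M y)) xs = lsum N (%z. f z x \<oplus>\<^sub>N f z y) xs"
  using addD(2)[OF assms(1)] by (intro lsum_cong) auto
 also have "... = lsum N (%z. f z x) xs \<oplus>\<^sub>N lsum N (%z. f z y) xs"
  using \<open>x \<in>. M\<close> \<open>y \<in>. M\<close> addD(1)[OF assms(1)] assms(2)
  by (intro lsum_add) auto
 finally show "lsum N (%z. f z (x \<oplus>\<^sub>M y)) xs = lsum N (%z. f z x) xs \<oplus>\<^sub>N lsum N (%z. f z y) xs" .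
qed (use assms addD(1)[OF assms(1)] in \<open>auto intro!: lsum_closed\<close>)

lemma ring_abelian [simp]: "ring R ==> abelian_group R"
 by (simp add: ring.is_abelian_group)

lemma ring_simps:
 assumes "ring R"
 shows "x \<in>. R ==> y \<in>. R ==> x \<otimes>\<^sub>R y \<in>. R"
  "\<one>\<^sub>R \<in>. R"
  "x \<in>. R ==> \<one>\<^sub>R \<otimes>\<^sub>R x = x" "x \<in>. R ==> x \<otimes>\<^sub>R \<one>\<^sub>R = x"
  "x \<in>. R ==> y \<in>. R ==> z \<in>. R ==> (x \<otimes>\<^sub>R y) \<otimes>\<^sub>R z = x \<otimes>\<^sub>R (y \<otimes>\<^sub>R z)"
 using assms by (auto simp: ring_def monoid.m_closed monoid.one_closed monoid.l_one monoid.r_one monoid.m_assoc)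

lemma ring_distrib:
 assumes "ring R" "x \<in>. R" "y \<in>. R" "z \<in>. R"
 shows "(x \<oplus>\<^sub>R y) \<otimes>\<^sub>R z = x \<otimes>\<^sub>R z \<oplus>\<^sub>R y \<otimes>\<^sub>R z"
  "x \<otimes>\<^sub>R (y \<oplus>\<^sub>R z) = x \<otimes>\<^sub>R y \<oplus>\<^sub>R x \<otimes>\<^sub>R z"
 using assms by (auto simp: ring.ring_simprules)

lemma lmodD:
 assumes "lmod R M"
 shows "ring R" "abelian_group M"
  "a \<in>. R ==> x \<in>. M ==> a \<odot>\<^sub>M x \<in>. M"
  "a \<in>. R ==> b \<in>. R ==> x \<in>. M ==> (a \<oplus>\<^sub>R b) \<odot>\<^sub>M x = a \<odot>\<^sub>M x \<oplus>\<^sub>M b \<odot>\<^sub>M x"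
  "a \<in>. R ==> x \<in>. M ==> y \<in>. M ==> a \<odot>\<^sub>M (x \<oplus>\<^sub>M y) = a \<odot>\<^sub>M x \<oplus>\<^sub>M a \<odot>\<^sub>M y"
  "a \<in>. R ==> b \<in>. R ==> x \<in>. M ==> (a \<otimes>\<^sub>R b) \<odot>\<^sub>M x = a \<odot>\<^sub>M (b \<odot>\<^sub>M x)"
  "x \<in>. M ==> \<one>\<^sub>R \<odot>\<^sub>M x = x"
 using assms by (auto simp: left_module_def left_module_axioms_def)

lemma rmodD:
 assumes "rmod R M"
 shows "ring R" "abelian_group M"
  "a \<in>. R ==> x \<in>. M ==> x \<star>\<^sub>M a \<in>. M"
  "a \<in>. R ==> b \<in>. R ==> x \<in>. M ==> x \<star>\<^sub>M (a \<oplus>\<^sub>R b) = x \<star>\<^sub>M a \<oplus>\<^sub>M x \<star>\<^sub>M b"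
  "a \<in>. R ==> x \<in>. M ==> y \<in>. M ==> (x \<oplus>\<^sub>M y) \<star>\<^sub>M a = x \<star>\<^sub>M a \<oplus>\<^sub>M y \<star>\<^sub>M a"
  "a \<in>. R ==> b \<in>. R ==> x \<in>. M ==> x \<star>\<^sub>M (a \<otimes>\<^sub>R b) = (x \<star>\<^sub>M a) \<star>\<^sub>M b"
  "x \<in>. M ==> x \<star>\<^sub>M \<one>\<^sub>R = x"
 using assms by (auto simp: right_module_def right_module_axioms_def)

lemma left_moduleI:
 assumes "ring R" "abelian_group M"
  "!!a x. a \<in>. R ==> x \<in>. M ==> a \<odot>\<^sub>M x \<in>. M"
  "!!a b x. a \<in>. R ==> b \<in>. R ==> x \<in>. M ==> (a \<oplus>\<^sub>R b) \<odot>\<^sub>M x = a \<odot>\<^sub>M x \<oplus>\<^sub>M b \<odot>\<^sub>M x"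
  "!!a x y. a \<in>. R ==> x \<in>. M ==> y \<in>. M ==> a \<odot>\<^sub>M (x \<oplus>\<^sub>M y) = a \<odot>\<^sub>M x \<oplus>\<^sub>M a \<odot>\<^sub>M y"
  "!!a b x. a \<in>. R ==> b \<in>. R ==> x \<in>. M ==> (a \<otimes>\<^sub>R b) \<odot>\<^sub>M x = a \<odot>\<^sub>M (b \<odot>\<^sub>M x)"
  "!!x. x \<in>. M ==> \<one>\<^sub>R \<odot>\<^sub>M x = x"
 shows "lmod R M"
 using assms by (auto simp: left_module_def left_module_axioms_def)

lemma right_moduleI:
 assumes "ring R" "abelian_group M"
  "!!a x. a \<in>. R ==> x \<in>. M ==> x \<star>\<^sub>M a \<in>. M"
  "!!a b x. a \<in>. R ==> b \<in>. R ==> x \<in>. M ==> x \<star>\<^sub>M (a \<oplus>\<^sub>R b) = x \<star>\<^sub>M a \<oplus>\<^sub>M x \<star>\<^sub>M b"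
  "!!a x y. a \<in>. R ==> x \<in>. M ==> y \<in>. M ==> (x \<oplus>\<^sub>M y) \<star>\<^sub>M a = x \<star>\<^sub>M a \<oplus>\<^sub>M y \<star>\<^sub>M a"
  "!!a b x. a \<in>. R ==> b \<in>. R ==> x \<in>. M ==> x \<star>\<^sub>M (a \<otimes>\<^sub>R b) = (x \<star>\<^sub>M a) \<star>\<^sub>M b"
  "!!x. x \<in>. M ==> x \<star>\<^sub>M \<one>\<^sub>R = x"
 shows "rmod R M"
 using assms by (auto simp: right_module_def right_module_axioms_def)

lemma left_module_add_homs:
 assumes "lmod R M"
 shows "a \<in>. R ==> (%x. a \<odot>\<^sub>M x) \<in> add_homs M M"
  "x \<in>. M ==> (%a. a \<odot>\<^sub>M x) \<in> add_homs R M"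
 using lmodD[OF assms] by (auto intro!: addI)

lemma left_module_lsum:
 assumes "lmod R M"
 shows "a \<in>. R ==> (!!y. y \<in> set ys ==> f y \<in>. M) ==>
   a \<odot>\<^sub>M lsum M f ys = lsum M (%y. a \<odot>\<^sub>M f y) ys"
  "x \<in>. M ==> (!!y. y \<in> set ys ==> g y \<in>. R) ==>
   lsum R g ys \<odot>\<^sub>M x = lsum M (%y. g y \<odot>\<^sub>M x) ys"
  "a \<in>. R ==> a \<odot>\<^sub>M \<zero>\<^sub>M = \<zero>\<^sub>M" "x \<in>. M ==> \<zero>\<^sub>R \<odot>\<^sub>M x = \<zero>\<^sub>M"
 using add_lsum[OF left_module_add_homs(1)[OF assms], of a ys f]
  add_lsum[OF left_module_add_homs(2)[OF assms], of x ys g]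
  add_homs_zero[OF left_module_add_homs(1)[OF assms], of a]
  add_homs_zero[OF left_module_add_homs(2)[OF assms], of x]
  lmodD[OF assms] by auto

lemma right_module_add_homs:
 assumes "rmod R M"
 shows "a \<in>. R ==> (%x. x \<star>\<^sub>M a) \<in> add_homs M M"
  "x \<in>. M ==> (%a. x \<star>\<^sub>M a) \<in> add_homs R M"
 using rmodD[OF assms] by (auto intro!: addI)

lemma right_module_lsum:
 assumes "rmod R M"
 shows "a \<in>. R ==> (!!y. y \<in> set ys ==> f y \<in>. M) ==>
   lsum M f ys \<star>\<^sub>M a = lsum M (%y. f y \<star>\<^sub>M a) ys"
  "x \<in>. M ==> (!!y. y \<in> set ys ==> g y \<in>. R) ==>
   x \<star>\<^sub>M lsum R g ys = lsum M (%y. x \<star>\<^sub>M g y) ys"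
  "a \<in>. R ==> \<zero>\<^sub>M \<star>\<^sub>M a = \<zero>\<^sub>M" "x \<in>. M ==> x \<star>\<^sub>M \<zero>\<^sub>R = \<zero>\<^sub>M"
 using add_lsum[OF right_module_add_homs(1)[OF assms], of a ys f]
  add_lsum[OF right_module_add_homs(2)[OF assms], of x ys g]
  add_homs_zero[OF right_module_add_homs(1)[OF assms], of a]
  add_homs_zero[OF right_module_add_homs(2)[OF assms], of x]
  rmodD[OF assms] by auto

lemma right_part_simps [simp]:
 "carrier (rpart B) = carrier B" "\<zero>\<^sub>(rpart B) = \<zero>\<^sub>B"
 "x \<oplus>\<^sub>(rpart B) y = x \<oplus>\<^sub>B y" "x \<star>\<^sub>(rpart B) r = x \<triangleleft>\<^sub>B r"
 by (auto simp: right_part_def)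

lemma lsum_right_part [simp]: "lsum (rpart B) f xs = lsum B f xs"
 by (induction xs) auto

lemma bimoduleD:
 assumes "is_bimodule L R B"
 shows "lmod L B" "rmod R (rpart B)"
  "l \<in>. L ==> x \<in>. B ==> r \<in>. R ==> (l \<odot>\<^sub>B x) \<triangleleft>\<^sub>B r = l \<odot>\<^sub>B (x \<triangleleft>\<^sub>B r)"
 using assms by (auto simp: is_bimodule_def)

lemmas bimodule_left = lmodD[OF bimoduleD(1)]
lemmas bimodule_right = rmodD[OF bimoduleD(2), simplified]
lemmas bimodule_left_lsum = left_module_lsum[OF bimoduleD(1)]
lemmas bimodule_right_lsum = right_module_lsum[OF bimoduleD(2), simplified]

section \<open>Tensor products\<close>

definition balanced ::
 "('r, 'a) ring_scheme => ('r, 'm, 'b) rmodule_scheme => ('r, 'n, 'c) module_scheme =>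
  ('x, 'd) ring_scheme => ('m => 'n => 'x) => bool" where
 "balanced R A B Y \<beta> \<longleftrightarrow>
   (\<forall>a\<in>carrier A. \<forall>b\<in>carrier B. \<beta> a b \<in>. Y) \<and>
   (\<forall>a\<in>carrier A. \<forall>a'\<in>carrier A. \<forall>b\<in>carrier B. \<beta> (a \<oplus>\<^sub>A a') b = \<beta> a b \<oplus>\<^sub>Y \<beta> a' b) \<and>
   (\<forall>a\<in>carrier A. \<forall>b\<in>carrier B. \<forall>b'\<in>carrier B. \<beta> a (b \<oplus>\<^sub>B b') = \<beta> a b \<oplus>\<^sub>Y \<beta> a b') \<and>
   (\<forall>a\<in>carrier A. \<forall>r\<in>carrier R. \<forall>b\<in>carrier B. \<beta> (a \<star>\<^sub>A r) b = \<beta> a (r \<odot>\<^sub>B b))"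

context
 fixes R :: "('r, 'a) ring_scheme" and A :: "('r, 'm, 'b) rmodule_scheme" and B :: "('r, 'n, 'c) module_scheme"
 assumes A: "rmod R A" and B: "lmod R B"
begin

abbreviation (input) "FAG \<equiv> free_Abelian_group (carrier A \<times> carrier B)"
abbreviation (input) "quot x \<equiv> tensor_kernel R A B #>\<^sub>FAG x"

lemma tensor_relations_subset: "tensor_relations R A B \<subseteq> carrier FAG"
proof -
 have diff: "x - y \<in>. FAG" if "x \<in>. FAG" "y \<in>. FAG" for x y
  using that keys_diff[of x y] by auto
 show ?thesis
  using rmodD[OF A] lmodD[OF B]
  by (auto simp: tensor_relations_def simp del: carrier_free_Abelian_group_iff intro!: diff)
qed

lemma tensor_kernel_normal: "tensor_kernel R A B \<lhd> FAG"
 unfolding tensor_kernel_def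
 by (intro comm_group.subgroup_imp_normal abelian_free_Abelian_group group.generate_is_subgroup
   group_free_Abelian_group tensor_relations_subset)

lemma comm_group_tensor_group: "comm_group (tensor_group R A B)"
 unfolding tensor_group_def
 by (intro comm_group.abelian_FactGroup abelian_free_Abelian_group normal_imp_subgroup tensor_kernel_normal)

lemma quot_hom: "(%x. quot x) \<in> hom FAG (tensor_group R A B)"
 unfolding tensor_group_def by (rule normal.r_coset_hom_Mod[OF tensor_kernel_normal])

lemma carrier_tensor_group: "carrier (tensor_group R A B) = (%x. quot x) ` carrier FAG"
 by (auto simp: tensor_group_def FactGroup_def RCOSETS_def)

lemma quot_add:
 assumes "x \<in>. FAG" "y \<in>. FAG"
 shows "quot (x + y) = quot x \<otimes>\<^sub>(tensor_group R A B) quot y"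
 using quot_hom assms by (auto simp: hom_def simp del: carrier_free_Abelian_group_iff)

lemma quot_kernel:
 assumes "x \<in> tensor_kernel R A B"
 shows "quot x = \<one>\<^sub>(tensor_group R A B)"
 using assms group.coset_join2[OF group_free_Abelian_group _ normal_imp_subgroup[OF tensor_kernel_normal], of x]
  subgroup.subset[OF normal_imp_subgroup[OF tensor_kernel_normal]]
 by (auto simp: tensor_group_def FactGroup_def)

lemma pure_tensor_closed [simp]:
 "a \<in>. A ==> b \<in>. B ==> ptens R A B a b \<in>. (tensor_group R A B)"
 by (auto simp: pure_tensor_def carrier_tensor_group)

lemma pure_tensor_balanced:
 shows "a \<in>. A ==> a' \<in>. A ==> b \<in>. B ==>
   ptens R A B (a \<oplus>\<^sub>A a') b = ptens R A B a b \<otimes>\<^sub>(tensor_group R A B) ptens R A B a' b" (is "_ ==> _ ==> _ ==> ?t1")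
  "a \<in>. A ==> b \<in>. B ==> b' \<in>. B ==>
   ptens R A B a (b \<oplus>\<^sub>B b') = ptens R A B a b \<otimes>\<^sub>(tensor_group R A B) ptens R A B a b'" (is "_ ==> _ ==> _ ==> ?t2")
  "a \<in>. A ==> r \<in>. R ==> b \<in>. B ==>
   ptens R A B (a \<star>\<^sub>A r) b = ptens R A B a (r \<odot>\<^sub>B b)" (is "_ ==> _ ==> _ ==> ?t3")
proof -
 interpret T: comm_group "tensor_group R A B" by (rule comm_group_tensor_group)
 have gen: "quot x = \<one>\<^sub>(tensor_group R A B)" if "x \<in> tensor_relations R A B" for x
  using that by (intro quot_kernel) (auto simp: tensor_kernel_def intro: generate.incl)
 have split: "quot x = quot y" if "x - y \<in> tensor_relations R A B" "y \<in>. FAG" for x y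
 proof -
  have "quot ((x - y) + y) = quot (x - y) \<otimes>\<^sub>(tensor_group R A B) quot y"
   using that tensor_relations_subset by (intro quot_add) (auto simp del: carrier_free_Abelian_group_iff)
  then show ?thesis using gen[OF that(1)] that carrier_tensor_group by auto
 qed
 show ?t1 if "a \<in>. A" "a' \<in>. A" "b \<in>. B"
 proof -
  have "quot (frag_of (a \<oplus>\<^sub>A a', b)) = quot (frag_of (a, b) + frag_of (a', b))"
   using that by (intro split) (auto simp: tensor_relations_def dest!: subsetD[OF keys_add])
  then show ?thesis using that by (subst (asm) quot_add) (auto simp: pure_tensor_def)
 qed
 show ?t2 if "a \<in>. A" "b \<in>. B" "b' \<in>. B"
 proof -
  have "quot (frag_of (a, b \<oplus>\<^sub>B b')) = quot (frag_of (a, b) + frag_of (a, b'))"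
   using that by (intro split) (auto simp: tensor_relations_def dest!: subsetD[OF keys_add])
  then show ?thesis using that by (subst (asm) quot_add) (auto simp: pure_tensor_def)
 qed
 show ?t3 if "a \<in>. A" "r \<in>. R" "b \<in>. B"
  using that lmodD[OF B] unfolding pure_tensor_def
  by (intro split) (auto simp: tensor_relations_def)
qed

lemma tensor_group_induct:
 assumes "x \<in>. (tensor_group R A B)"
  and pure: "!!a b. a \<in>. A ==> b \<in>. B ==> P (ptens R A B a b)"
  and add: "!!x y. x \<in>. (tensor_group R A B) ==> y \<in>. (tensor_group R A B) ==> P x ==> P y ==>
   P (x \<otimes>\<^sub>(tensor_group R A B) y)"
 shows "P x"
proof -
 interpret T: comm_group "tensor_group R A B" by (rule comm_group_tensor_group)
 note AG = rmodD(2)[OF A] lmodD(2)[OF B]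
 obtain f where f: "f \<in>. FAG" "x = quot f"
  using assms(1) carrier_tensor_group by auto
 have "P (quot f) \<and> P (quot (- f))"
 proof (rule free_Abelian_group_induct[of f "carrier A \<times> carrier B"])
  show "Poly_Mapping.keys f \<subseteq> carrier A \<times> carrier B" using f by simp
  have "ptens R A B \<zero>\<^sub>A \<zero>\<^sub>B = \<one>\<^sub>(tensor_group R A B)"
   using pure_tensor_balanced(1)[of "\<zero>\<^sub>A" "\<zero>\<^sub>A" "\<zero>\<^sub>B"] AG
   by (metis T.l_cancel_one' add_zero(1) pure_tensor_closed zero_carrier)
  moreover have "quot 0 = \<one>\<^sub>(tensor_group R A B)"
   by (rule quot_kernel) (metis generate.one one_free_Abelian_group tensor_kernel_def)
  ultimately show "P (quot 0) \<and> P (quot (- 0))"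
   using pure[of "\<zero>\<^sub>A" "\<zero>\<^sub>B"] AG by auto
 next
  fix u v :: "('m \<times> 'n) \<Rightarrow>\<^sub>0 int"
  assume uv: "Poly_Mapping.keys u \<subseteq> carrier A \<times> carrier B" "Poly_Mapping.keys v \<subseteq> carrier A \<times> carrier B"
   "P (quot u) \<and> P (quot (- u))" "P (quot v) \<and> P (quot (- v))"
  then have "quot (u - v) = quot u \<otimes>\<^sub>(tensor_group R A B) quot (- v)"
   "quot (- (u - v)) = quot v \<otimes>\<^sub>(tensor_group R A B) quot (- u)"
   using quot_add[of u "- v"] quot_add[of v "- u"] by auto
  then show "P (quot (u - v)) \<and> P (quot (- (u - v)))"
   using uv by (auto intro!: add simp: carrier_tensor_group)
 next
  fix c assume "c \<in> carrier A \<times> carrier B"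
  then obtain a b where c: "c = (a, b)" "a \<in>. A" "b \<in>. B" by auto
  have "\<zero>\<^sub>A \<oplus>\<^sub>A \<zero>\<^sub>A = \<zero>\<^sub>A" using AG by simp
  then have z: "ptens R A B \<zero>\<^sub>A b = \<one>\<^sub>(tensor_group R A B)"
   using pure_tensor_balanced(1)[of "\<zero>\<^sub>A" "\<zero>\<^sub>A" b] c AG
   by (metis T.l_cancel_one' pure_tensor_closed zero_carrier)
  have "ptens R A B (\<ominus>\<^sub>A a) b \<otimes>\<^sub>(tensor_group R A B) quot (frag_of c) = \<one>\<^sub>(tensor_group R A B)"
   using pure_tensor_balanced(1)[of "\<ominus>\<^sub>A a" a b] c AG z by (simp add: pure_tensor_def)
  moreover have "quot (- frag_of c) \<otimes>\<^sub>(tensor_group R A B) quot (frag_of c) = \<one>\<^sub>(tensor_group R A B)"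
  proof -
   have "quot (- frag_of c) \<otimes>\<^sub>(tensor_group R A B) quot (frag_of c) = quot 0"
   using quot_add[of "- frag_of c" "frag_of c"] c by simp
   also have "... = \<one>\<^sub>(tensor_group R A B)"
   by (rule quot_kernel) (metis generate.one one_free_Abelian_group tensor_kernel_def)
   finally show ?thesis .
  qed
  ultimately have "quot (- frag_of c) = ptens R A B (\<ominus>\<^sub>A a) b"
   using c AG by (intro T.r_cancel[of "quot (- frag_of c)" "quot (frag_of c)" "ptens R A B (\<ominus>\<^sub>A a) b"])
   (auto simp: carrier_tensor_group pure_tensor_def)
  then show "P (quot (frag_of c)) \<and> P (quot (- frag_of c))"
   using pure[of a b] pure[of "\<ominus>\<^sub>A a" b] c AG by (auto simp: pure_tensor_def)
 qed
 then show ?thesis using f by simp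
qed

lemma tensor_group_lift:
 fixes Y :: "('x, 'd) ring_scheme"
 assumes Y: "abelian_group Y" and bal: "balanced R A B Y \<beta>"
 obtains h where "h \<in> hom (tensor_group R A B) (add_monoid Y)"
  "!!a b. a \<in>. A ==> b \<in>. B ==> h (ptens R A B a b) = \<beta> a b"
proof -
 interpret Y: comm_group "add_monoid Y" by (rule abelian_group.a_comm_group[OF Y])
 have "(%(a, b). \<beta> a b) ` (carrier A \<times> carrier B) \<subseteq> carrier (add_monoid Y)"
  using bal by (auto simp: balanced_def)
 then obtain h where h: "h \<in> hom FAG (add_monoid Y)"
   "!!p. p \<in> carrier A \<times> carrier B ==> h (frag_of p) = (%(a, b). \<beta> a b) p"
  using Y.free_Abelian_group_universal by metis
 interpret h: group_hom FAG "add_monoid Y" h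
  using h(1) by (auto simp: group_hom_def group_hom_axioms_def Y.is_group)
 have minus: "h (x - y) = h x \<otimes>\<^sub>(add_monoid Y) inv\<^sub>(add_monoid Y) h y"
  if "x \<in>. FAG" "y \<in>. FAG" for x y
  using h.hom_mult[of x "- y"] h.hom_inv[of y] that by auto
 have "h x = \<one>\<^sub>(add_monoid Y)" if x: "x \<in> tensor_relations R A B" for x
 proof -
  have triple: "h (u - v - w) = \<one>\<^sub>(add_monoid Y)"
   if "u \<in>. FAG" "v \<in>. FAG" "w \<in>. FAG" "h u = h v \<otimes>\<^sub>(add_monoid Y) h w" for u v w
  proof -
   have "u - v \<in>. FAG" using that keys_diff[of u v] by auto
   then show ?thesis using that h.hom_closed
   by (simp add: minus Y.inv_mult_group Y.m_assoc Y.m_comm Y.m_lcomm del: carrier_free_Abelian_group_iff)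
   (metis Y.inv_closed Y.m_comm Y.r_inv Y.inv_solve_right h.hom_closed partial_object.select_convs(1) monoid.simps(1,2))
  qed
  have dbl: "h (u - v) = \<one>\<^sub>(add_monoid Y)" if "u \<in>. FAG" "v \<in>. FAG" "h u = h v" for u v
   using that minus[of u v] h.hom_closed[of v] Y.r_inv by (simp del: carrier_free_Abelian_group_iff)
  show ?thesis
   using x rmodD[OF A] lmodD[OF B] unfolding tensor_relations_def
   by (elim UnE CollectE exE conjE; hypsubst)
   (intro triple dbl; use bal in \<open>auto simp: h(2) balanced_def\<close>)+
 qed
 then have "tensor_relations R A B \<subseteq> kernel FAG (add_monoid Y) h"
  using tensor_relations_subset by (auto simp: kernel_def simp del: carrier_free_Abelian_group_iff)
 then have "tensor_kernel R A B \<subseteq> kernel FAG (add_monoid Y) h"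
  unfolding tensor_kernel_def
  by (intro group.generate_subgroup_incl group_free_Abelian_group h.subgroup_kernel)
 then obtain g where "g \<in> hom (FAG Mod tensor_kernel R A B) (add_monoid Y)"
   "!!x. x \<in>. FAG ==> g (quot x) = h x"
  using h.FactGroup_universal_kernel[OF tensor_kernel_normal] by metis
 with h(2) show thesis
  by (intro that[of g]) (auto simp: tensor_group_def pure_tensor_def)
qed

end

lemma lhomD:
 assumes "h \<in> lhom R M N"
 shows "h \<in> add_homs M N" "x \<in>. M ==> h x \<in>. N"
  "x \<in>. M ==> y \<in>. M ==> h (x \<oplus>\<^sub>M y) = h x \<oplus>\<^sub>N h y"
  "r \<in>. R ==> x \<in>. M ==> h (r \<odot>\<^sub>M x) = r \<odot>\<^sub>N h x"
 using assms by (auto simp: lmod_hom_def hom_def)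

lemma rmod_homD:
 assumes "h \<in> rhom R M N"
 shows "h \<in> add_homs M N" "x \<in>. M ==> h x \<in>. N"
  "x \<in>. M ==> y \<in>. M ==> h (x \<oplus>\<^sub>M y) = h x \<oplus>\<^sub>N h y"
  "r \<in>. R ==> x \<in>. M ==> h (x \<star>\<^sub>M r) = h x \<star>\<^sub>N r"
 using assms by (auto simp: rmod_hom_def hom_def)

lemma lhomI:
 assumes "h \<in> add_homs M N" "!!r x. r \<in>. R ==> x \<in>. M ==> h (r \<odot>\<^sub>M x) = r \<odot>\<^sub>N h x"
 shows "h \<in> lhom R M N"
 using assms by (auto simp: lmod_hom_def)

lemma rmod_homI:
 assumes "h \<in> add_homs M N" "!!r x. r \<in>. R ==> x \<in>. M ==> h (x \<star>\<^sub>M r) = h x \<star>\<^sub>N r"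
 shows "h \<in> rhom R M N"
 using assms by (auto simp: rmod_hom_def)

lemma balancedI:
 assumes "!!a b. a \<in>. A ==> b \<in>. B ==> \<beta> a b \<in>. Y"
  "!!a a' b. a \<in>. A ==> a' \<in>. A ==> b \<in>. B ==> \<beta> (a \<oplus>\<^sub>A a') b = \<beta> a b \<oplus>\<^sub>Y \<beta> a' b"
  "!!a b b'. a \<in>. A ==> b \<in>. B ==> b' \<in>. B ==> \<beta> a (b \<oplus>\<^sub>B b') = \<beta> a b \<oplus>\<^sub>Y \<beta> a b'"
  "!!a r b. a \<in>. A ==> r \<in>. R ==> b \<in>. B ==> \<beta> (a \<star>\<^sub>A r) b = \<beta> a (r \<odot>\<^sub>B b)"
 shows "balanced R A B Y \<beta>"
 using assms by (auto simp: balanced_def)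

text \<open>Stated for an arbitrary group \<open>T\<close>, to cover the copies of tensor products in other types.\<close>

definition is_tensor ::
 "('r, 'a) ring_scheme => ('r, 'm, 'b) rmodule_scheme => ('r, 'n, 'c) module_scheme =>
  ('t, 'd) ring_scheme => ('m => 'n => 't) => bool" where
 "is_tensor R A B T ta \<longleftrightarrow> abelian_group T \<and>
   (\<exists>\<psi>. bij_betw \<psi> (carrier (tensor_group R A B)) (carrier T) \<and>
   \<psi> \<in> hom (tensor_group R A B) (add_monoid T) \<and>
   (\<forall>a\<in>carrier A. \<forall>b\<in>carrier B. ta a b = \<psi> (ptens R A B a b)))"

definition tlift ::
 "('m, 'b) ring_scheme => ('n, 'c) ring_scheme => ('t, 'd) ring_scheme => ('m => 'n => 't) =>
  ('y, 'e) ring_scheme => ('m => 'n => 'y) => 't => 'y" where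
 "tlift A B T ta Y \<beta> =
   (SOME h. h \<in> add_homs T Y \<and> (\<forall>a\<in>carrier A. \<forall>b\<in>carrier B. h (ta a b) = \<beta> a b))"

locale tensor =
 fixes R :: "('r, 'a) ring_scheme" and A :: "('r, 'm, 'b) rmodule_scheme" and B :: "('r, 'n, 'c) module_scheme"
  and T :: "('t, 'd) ring_scheme" and ta :: "'m => 'n => 't"
 assumes A: "rmod R A" and B: "lmod R B" and is_tensor: "is_tensor R A B T ta"
begin

lemma T_abelian: "abelian_group T"
 using is_tensor by (simp add: is_tensor_def)

lemma balanced: "balanced R A B T ta"
proof -
 obtain \<psi> where psi: "\<psi> \<in> hom (tensor_group R A B) (add_monoid T)"
   "!!a b. a \<in>. A ==> b \<in>. B ==> ta a b = \<psi> (ptens R A B a b)"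
  using is_tensor by (auto simp: is_tensor_def)
 show ?thesis
  using psi(1) rmodD[OF A] lmodD[OF B]
  by (intro balancedI) (auto simp: psi(2) hom_def pure_tensor_balanced[OF A B] pure_tensor_closed[OF A B])
qed

lemma closed: "a \<in>. A ==> b \<in>. B ==> ta a b \<in>. T"
 and add_left: "a \<in>. A ==> a' \<in>. A ==> b \<in>. B ==> ta (a \<oplus>\<^sub>A a') b = ta a b \<oplus>\<^sub>T ta a' b"
 and add_right: "a \<in>. A ==> b \<in>. B ==> b' \<in>. B ==> ta a (b \<oplus>\<^sub>B b') = ta a b \<oplus>\<^sub>T ta a b'"
 and move: "a \<in>. A ==> r \<in>. R ==> b \<in>. B ==> ta (a \<star>\<^sub>A r) b = ta a (r \<odot>\<^sub>B b)"
 using balanced by (auto simp: balanced_def)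

lemma hom_left: "b \<in>. B ==> (%a. ta a b) \<in> add_homs A T"
 and hom_right: "a \<in>. A ==> (%b. ta a b) \<in> add_homs B T"
 by (auto intro!: addI simp: closed add_left add_right)

lemma lsum_left: "b \<in>. B ==> (!!x. x \<in> set xs ==> f x \<in>. A) ==>
  ta (lsum A f xs) b = lsum T (%x. ta (f x) b) xs"
 using add_lsum[OF hom_left _ T_abelian] rmodD(2)[OF A] by auto

lemma lsum_right: "a \<in>. A ==> (!!x. x \<in> set xs ==> f x \<in>. B) ==>
  ta a (lsum B f xs) = lsum T (%x. ta a (f x)) xs"
 using add_lsum[OF hom_right _ T_abelian] lmodD(2)[OF B] by auto

lemma induct [consumes 1, case_names pure add]:
 assumes "x \<in>. T"
  and pure: "!!a b. a \<in>. A ==> b \<in>. B ==> P (ta a b)"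
  and add: "!!x y. x \<in>. T ==> y \<in>. T ==> P x ==> P y ==> P (x \<oplus>\<^sub>T y)"
 shows "P x"
proof -
 obtain \<psi> where psi: "\<psi> \<in> hom (tensor_group R A B) (add_monoid T)"
   "bij_betw \<psi> (carrier (tensor_group R A B)) (carrier T)"
   "!!a b. a \<in>. A ==> b \<in>. B ==> ta a b = \<psi> (ptens R A B a b)"
  using is_tensor by (auto simp: is_tensor_def)
 from assms(1) psi(2) obtain y where y: "y \<in>. (tensor_group R A B)" "x = \<psi> y"
  by (auto simp: bij_betw_def)
 have "P (\<psi> y)"
  by (rule tensor_group_induct[OF A B y(1)])
   (use psi in \<open>auto simp: hom_def Pi_def intro!: add pure simp flip: psi(3)\<close>)
 with y show ?thesis by simp
qed

lemma expand:
 assumes "x \<in>. T"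
 obtains ps where "set ps \<subseteq> carrier A \<times> carrier B" "x = lsum T (%p. ta (fst p) (snd p)) ps"
proof -
 have "\<exists>ps. set ps \<subseteq> carrier A \<times> carrier B \<and> x = lsum T (%p. ta (fst p) (snd p)) ps"
  using assms
 proof (induction x rule: induct)
  case (pure a b)
  then show ?case by (intro exI[of _ "[(a, b)]"]) (auto simp: T_abelian closed)
 next
  case (add x y)
  then obtain ps qs where "set ps \<subseteq> carrier A \<times> carrier B" "x = lsum T (%p. ta (fst p) (snd p)) ps"
   "set qs \<subseteq> carrier A \<times> carrier B" "y = lsum T (%p. ta (fst p) (snd p)) qs" by auto
  then show ?case
   by (intro exI[of _ "ps @ qs"]) (auto intro!: lsum_append[symmetric] T_abelian closed)
 qed
 with that show thesis by blast
qed

lemma tlift: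
 assumes Y: "abelian_group Y" and bal: "balanced R A B Y \<beta>"
 shows "tlift A B T ta Y \<beta> \<in> add_homs T Y"
  "!!a b. a \<in>. A ==> b \<in>. B ==> tlift A B T ta Y \<beta> (ta a b) = \<beta> a b"
proof -
 obtain \<psi> where psi: "\<psi> \<in> hom (tensor_group R A B) (add_monoid T)"
   "bij_betw \<psi> (carrier (tensor_group R A B)) (carrier T)"
   "!!a b. a \<in>. A ==> b \<in>. B ==> ta a b = \<psi> (ptens R A B a b)"
  using is_tensor by (auto simp: is_tensor_def)
 obtain h where h: "h \<in> hom (tensor_group R A B) (add_monoid Y)"
  "!!a b. a \<in>. A ==> b \<in>. B ==> h (ptens R A B a b) = \<beta> a b"
  using tensor_group_lift[OF A B Y bal] by metis
 interpret G: comm_group "tensor_group R A B" by (rule comm_group_tensor_group[OF A B])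
 have "\<psi> \<in> iso (tensor_group R A B) (add_monoid T)" using psi by (simp add: iso_def)
 then have "inv_into (carrier (tensor_group R A B)) \<psi> \<in> iso (add_monoid T) (tensor_group R A B)"
  by (rule G.iso_set_sym)
 then have "h \<circ> inv_into (carrier (tensor_group R A B)) \<psi> \<in> add_homs T Y"
  using h(1) hom_compose by (auto simp: iso_def)
 moreover have "(h \<circ> inv_into (carrier (tensor_group R A B)) \<psi>) (ta a b) = \<beta> a b"
  if "a \<in>. A" "b \<in>. B" for a b
  using that psi h by (simp add: bij_betw_def inv_into_f_f pure_tensor_closed[OF A B])
 ultimately have "\<exists>h. h \<in> add_homs T Y \<and> (\<forall>a\<in>carrier A. \<forall>b\<in>carrier B. h (ta a b) = \<beta> a b)"
  by blast
 from someI_ex[OF this, folded tlift_def]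
 show "tlift A B T ta Y \<beta> \<in> add_homs T Y"
  "!!a b. a \<in>. A ==> b \<in>. B ==> tlift A B T ta Y \<beta> (ta a b) = \<beta> a b" by auto
qed

lemma ext:
 assumes "h \<in> add_homs T Y" "h' \<in> add_homs T Y" "x \<in>. T"
  "!!a b. a \<in>. A ==> b \<in>. B ==> h (ta a b) = h' (ta a b)"
 shows "h x = h' x"
 using assms(3)
 by (induction x rule: induct) (auto simp: assms(4) addD(2)[OF assms(1)] addD(2)[OF assms(2)])

lemma transport:
 assumes "abelian_group T'" "e \<in> add_homs T T'" "bij_betw e (carrier T) (carrier T')"
 shows "tensor R A B T' (%a b. e (ta a b))"
proof (rule tensor.intro[OF A B])
 obtain \<psi> where psi: "\<psi> \<in> hom (tensor_group R A B) (add_monoid T)"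
   "bij_betw \<psi> (carrier (tensor_group R A B)) (carrier T)"
   "!!a b. a \<in>. A ==> b \<in>. B ==> ta a b = \<psi> (ptens R A B a b)"
  using is_tensor by (auto simp: is_tensor_def)
 show "is_tensor R A B T' (%a b. e (ta a b))"
  unfolding is_tensor_def
  using assms hom_compose[OF psi(1) assms(2)] bij_betw_trans[OF psi(2) assms(3)] psi(3)
  by (auto intro!: exI[of _ "e \<circ> \<psi>"])
qed

end

lemma tensor_map_on_pure:
 assumes A: "rmod R A" and B: "lmod R B"
  and A': "rmod R A'" and B': "lmod R B'"
  and f: "f \<in> rhom R A A'" and g: "g \<in> lhom R B B'"
 shows "tensor_map R A' B' f g \<in> hom (tensor_group R A B) (tensor_group R A' B')"
  "a \<in>. A ==> b \<in>. B ==>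
   tensor_map R A' B' f g (ptens R A B a b) = ptens R A' B' (f a) (g b)"
proof -
 let ?G = "free_Abelian_group (carrier A \<times> carrier B)"
 let ?G' = "free_Abelian_group (carrier A' \<times> carrier B')"
 let ?K = "tensor_kernel R A B" and ?K' = "tensor_kernel R A' B'"
 define F where "F = frag_extend (%(a, b). frag_of (f a, g b))"
 note fD = rmod_homD[OF f] and gD = lhomD[OF g]
 interpret T': comm_group "tensor_group R A' B'" by (rule comm_group_tensor_group[OF A' B'])
 have F_closed: "F x \<in>. ?G'" if "x \<in>. ?G" for x
 proof -
  have "Poly_Mapping.keys (F x) \<subseteq> (\<Union>p\<in>Poly_Mapping.keys x. {(f (fst p), g (snd p))})"
   using keys_frag_extend[of "%(a, b). frag_of (f a, g b)" x] by (simp add: F_def case_prod_beta)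
  also have "... \<subseteq> carrier A' \<times> carrier B'"
   using that fD(2) gD(2) by auto
  finally show ?thesis by simp
 qed
 have "F \<in> hom ?G ?G'"
  using F_closed by (auto simp: hom_def F_def frag_extend_add simp del: carrier_free_Abelian_group_iff)
 then have qF: "(%x. ?K' #>\<^sub>(?G') F x) \<in> hom ?G (tensor_group R A' B')"
  using hom_compose[OF _ quot_hom[OF A' B']] by (auto simp: comp_def)
 interpret qF: group_hom ?G "tensor_group R A' B'" "%x. ?K' #>\<^sub>(?G') F x"
  using qF by (simp add: group_hom_def group_hom_axioms_def T'.is_group)
 have "F x \<in> tensor_relations R A' B'" if "x \<in> tensor_relations R A B" for x
  using that unfolding tensor_relations_def[of R A B]
 proof (elim UnE CollectE exE conjE; hypsubst)
  fix a a' b assume *: "a \<in>. A" "a' \<in>. A" "b \<in>. B"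
  have "F (frag_of (a \<oplus>\<^sub>A a', b) - frag_of (a, b) - frag_of (a', b)) =
   frag_of (f a \<oplus>\<^sub>A' f a', g b) - frag_of (f a, g b) - frag_of (f a', g b)"
   using * fD by (simp add: F_def frag_extend_diff)
  then show "F (frag_of (a \<oplus>\<^sub>A a', b) - frag_of (a, b) - frag_of (a', b)) \<in> tensor_relations R A' B'"
   using * fD(2) gD(2) unfolding tensor_relations_def by blast
 next
  fix a b b' assume *: "a \<in>. A" "b \<in>. B" "b' \<in>. B"
  have "F (frag_of (a, b \<oplus>\<^sub>B b') - frag_of (a, b) - frag_of (a, b')) =
   frag_of (f a, g b \<oplus>\<^sub>B' g b') - frag_of (f a, g b) - frag_of (f a, g b')"
   using * gD by (simp add: F_def frag_extend_diff)
  then show "F (frag_of (a, b \<oplus>\<^sub>B b') - frag_of (a, b) - frag_of (a, b')) \<in> tensor_relations R A' B'"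
   using * fD(2) gD(2) unfolding tensor_relations_def by blast
 next
  fix a r b assume *: "a \<in>. A" "r \<in>. R" "b \<in>. B"
  have "F (frag_of (a \<star>\<^sub>A r, b) - frag_of (a, r \<odot>\<^sub>B b)) =
   frag_of (f a \<star>\<^sub>A' r, g b) - frag_of (f a, r \<odot>\<^sub>B' g b)"
   using * fD gD by (simp add: F_def frag_extend_diff)
  then show "F (frag_of (a \<star>\<^sub>A r, b) - frag_of (a, r \<odot>\<^sub>B b)) \<in> tensor_relations R A' B'"
   using * fD(2) gD(2) unfolding tensor_relations_def by blast
 qed
 then have "tensor_relations R A B \<subseteq> kernel ?G (tensor_group R A' B') (%x. ?K' #>\<^sub>(?G') F x)"
  using tensor_relations_subset[OF A B] quot_kernel[OF A' B']
  by (auto simp: kernel_def tensor_kernel_def intro: generate.incl simp del: carrier_free_Abelian_group_iff)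
 then have "?K \<subseteq> kernel ?G (tensor_group R A' B') (%x. ?K' #>\<^sub>(?G') F x)"
  unfolding tensor_kernel_def[of R A B]
  by (intro group.generate_subgroup_incl group_free_Abelian_group qF.subgroup_kernel)
 then have "F k \<in> ?K'" if "k \<in> ?K" for k
  using that group.coset_join1[OF group_free_Abelian_group _ _ normal_imp_subgroup[OF tensor_kernel_normal[OF A' B']], of "F k"]
   F_closed[of k] subgroup.subset[OF normal_imp_subgroup[OF tensor_kernel_normal[OF A' B']]]
  by (auto simp: kernel_def tensor_group_def FactGroup_def simp del: carrier_free_Abelian_group_iff)
 moreover have "0 \<in> ?K" "!!k k'. k \<in> ?K' ==> k' \<in> ?K' ==> k + k' \<in> ?K'"
  using subgroup.one_closed[OF normal_imp_subgroup[OF tensor_kernel_normal[OF A B]]]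
   subgroup.m_closed[OF normal_imp_subgroup[OF tensor_kernel_normal[OF A' B']]] by auto
 ultimately have K: "0 \<in> ?K" "!!k k'. k \<in> ?K' ==> k' \<in> ?K' ==> k + k' \<in> ?K'" "!!k. k \<in> ?K ==> F k \<in> ?K'"
  by blast+
 have F_add: "F (x + y) = F x + F y" for x y by (simp add: F_def frag_extend_add)
 have F_0: "F 0 = 0" by (simp add: F_def)
 have tm: "tensor_map R A' B' f g (?K #>\<^sub>?G x) = ?K' #>\<^sub>(?G') F x" for x
 proof -
  have "tensor_map R A' B' f g (?K #>\<^sub>?G x) = {k' + F (k + x) |k' k. k' \<in> ?K' \<and> k \<in> ?K}"
   unfolding tensor_map_def F_def[symmetric] set_mult_def r_coset_def by auto
  also have "... = {k' + F x |k'. k' \<in> ?K'}"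
  proof (intro equalityI subsetI)
   fix y assume "y \<in> {k' + F (k + x) |k' k. k' \<in> ?K' \<and> k \<in> ?K}"
   then obtain k' k where "k' \<in> ?K'" "k \<in> ?K" "y = (k' + F k) + F x" by (auto simp: F_add add.assoc)
   then show "y \<in> {k' + F x |k'. k' \<in> ?K'}" using K by blast
  next
   fix y assume "y \<in> {k' + F x |k'. k' \<in> ?K'}"
   then obtain k' where "k' \<in> ?K'" "y = k' + F (0 + x)" by auto
   then show "y \<in> {k' + F (k + x) |k' k. k' \<in> ?K' \<and> k \<in> ?K}" using K(1) by blast
  qed
  also have "... = ?K' #>\<^sub>(?G') F x" by (auto simp: r_coset_def)
  finally show ?thesis .
 qed
 show "tensor_map R A' B' f g \<in> hom (tensor_group R A B) (tensor_group R A' B')"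
 proof (rule homI)
  fix u assume "u \<in>. (tensor_group R A B)"
  then show "tensor_map R A' B' f g u \<in>. (tensor_group R A' B')"
   using qF.hom_closed by (auto simp: carrier_tensor_group[OF A B] tm)
 next
  fix u v assume "u \<in>. (tensor_group R A B)" "v \<in>. (tensor_group R A B)"
  then obtain x y where xy: "x \<in>. ?G" "y \<in>. ?G" "u = ?K #>\<^sub>?G x" "v = ?K #>\<^sub>?G y"
   by (auto simp: carrier_tensor_group[OF A B])
  show "tensor_map R A' B' f g (u \<otimes>\<^sub>(tensor_group R A B) v) =
   tensor_map R A' B' f g u \<otimes>\<^sub>(tensor_group R A' B') tensor_map R A' B' f g v"
   using xy qF.hom_mult[of x y] by (simp add: quot_add[OF A B, symmetric] tm)
 qed
 show "tensor_map R A' B' f g (ptens R A B a b) = ptens R A' B' (f a) (g b)"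
  if "a \<in>. A" "b \<in>. B"
  using that by (simp add: pure_tensor_def tm) (simp add: F_def)
qed

lemma tensor_of_tensor_group:
 assumes "rmod R A" "lmod R B"
  and T: "carrier T = carrier (tensor_group R A B)" "\<zero>\<^sub>T = \<one>\<^sub>(tensor_group R A B)"
   "!!x y. x \<oplus>\<^sub>T y = x \<otimes>\<^sub>(tensor_group R A B) y"
 shows "tensor R A B T (ptens R A B)"
proof (rule tensor.intro[OF assms(1,2)])
 interpret comm_group "tensor_group R A B" by (rule comm_group_tensor_group[OF assms(1,2)])
 have "abelian_group T"
  by (rule abelian_groupI) (auto simp: T m_ac intro!: bexI[of _ "inv\<^sub>(tensor_group R A B) _"])
 moreover have "id \<in> hom (tensor_group R A B) (add_monoid T)"
  by (auto simp: hom_def T)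
 ultimately show "is_tensor R A B T (ptens R A B)"
  unfolding is_tensor_def by (intro conjI exI[of _ id]) (auto simp: T)
qed

lemma rmod_hom_id: "(%x. x) \<in> rhom R M M"
 by (auto simp: rmod_hom_def hom_def)

lemma lmod_hom_id: "(%x. x) \<in> lhom R M M"
 by (auto simp: lmod_hom_def hom_def)

lemma bimodule_left_rmod_hom:
 assumes "is_bimodule L R A" "l \<in>. L"
 shows "(%a. l \<odot>\<^sub>A a) \<in> rhom R (rpart A) (rpart A)"
 using assms bimodule_left[OF assms(1)] bimoduleD(3)[OF assms(1)]
 by (auto intro!: rmod_homI addI)

lemma bimodule_right_lmod_hom:
 assumes "is_bimodule L R A" "r \<in>. R"
 shows "(%a. a \<triangleleft>\<^sub>A r) \<in> lhom L A A"
 using assms bimodule_right[OF assms(1)] bimoduleD(3)[OF assms(1)]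
 by (auto intro!: lhomI addI)

text \<open>The module laws equate additive maps, so that pure tensors suffice to check them.\<close>

lemma left_module_by_generation:
 assumes "tensor R A B T ta" and L: "ring L"
  and hom: "!!l. l \<in>. L ==> (%x. l \<odot>\<^sub>T x) \<in> add_homs T T"
  and pure: "!!l a b. l \<in>. L ==> a \<in>. A ==> b \<in>. B ==> l \<odot>\<^sub>T ta a b = ta (l \<odot>\<^sub>P a) b"
  and P: "lmod L P" and AP: "carrier A = carrier P" "!!x y. x \<oplus>\<^sub>A y = x \<oplus>\<^sub>P y"
 shows "lmod L T"
proof -
 interpret tensor R A B T ta by fact
 note PD = lmodD[OF P] and ag = T_abelian
 note clo = addD(1)[OF hom] and dist = addD(2)[OF hom]
 show ?thesis
 proof (rule left_moduleI)
  fix l l' x assume ll: "l \<in>. L" "l' \<in>. L" and x: "x \<in>. T"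
  show "(l \<oplus>\<^sub>L l') \<odot>\<^sub>T x = l \<odot>\<^sub>T x \<oplus>\<^sub>T l' \<odot>\<^sub>T x" using x
  proof (induction x rule: induct)
   case (pure a b)
   then show ?case using ll L PD by (simp add: assms(4) add_left[symmetric] AP)
  next
   case (add x y)
   then show ?case using ll L ag by (simp add: dist clo add_exchange)
  qed
  show "(l \<otimes>\<^sub>L l') \<odot>\<^sub>T x = l \<odot>\<^sub>T (l' \<odot>\<^sub>T x)" using x
  proof (induction x rule: induct)
   case (pure a b)
   then show ?case using ll PD by (simp add: ring_simps[OF L] assms(4) AP)
  next
   case (add x y)
   then show ?case using ll by (simp add: ring_simps[OF L] dist clo)
  qed
 next
  fix x assume x: "x \<in>. T"
  then show "\<one>\<^sub>L \<odot>\<^sub>T x = x"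
  proof (induction x rule: induct)
   case (pure a b)
   then show ?case using PD by (simp add: ring_simps[OF L] assms(4) AP)
  next
   case (add x y)
   then show ?case by (simp add: ring_simps[OF L] dist)
  qed
 qed (use L ag clo dist in auto)
qed

lemma right_module_by_generation:
 assumes "tensor R A B T ta" and L: "ring L"
  and hom: "!!l. l \<in>. L ==> (%x. x \<star>\<^sub>T l) \<in> add_homs T T"
  and pure: "!!l a b. l \<in>. L ==> a \<in>. A ==> b \<in>. B ==> ta a b \<star>\<^sub>T l = ta a (b \<star>\<^sub>P l)"
  and P: "rmod L P" and BP: "carrier B = carrier P" "!!x y. x \<oplus>\<^sub>B y = x \<oplus>\<^sub>P y"
 shows "rmod L T"
proof -
 interpret tensor R A B T ta by fact
 note PD = rmodD[OF P] and ag = T_abelian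
 note clo = addD(1)[OF hom] and dist = addD(2)[OF hom]
 show ?thesis
 proof (rule right_moduleI)
  fix l l' x assume ll: "l \<in>. L" "l' \<in>. L" and x: "x \<in>. T"
  show "x \<star>\<^sub>T (l \<oplus>\<^sub>L l') = x \<star>\<^sub>T l \<oplus>\<^sub>T x \<star>\<^sub>T l'" using x
  proof (induction x rule: induct)
   case (pure a b)
   then show ?case using ll L PD by (simp add: assms(4) add_right[symmetric] BP)
  next
   case (add x y)
   then show ?case using ll L ag by (simp add: dist clo add_exchange)
  qed
  show "x \<star>\<^sub>T (l \<otimes>\<^sub>L l') = (x \<star>\<^sub>T l) \<star>\<^sub>T l'" using x
  proof (induction x rule: induct)
   case (pure a b)
   then show ?case using ll PD by (simp add: ring_simps[OF L] assms(4) BP)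
  next
   case (add x y)
   then show ?case using ll by (simp add: ring_simps[OF L] dist clo)
  qed
 next
  fix x assume x: "x \<in>. T"
  then show "x \<star>\<^sub>T \<one>\<^sub>L = x"
  proof (induction x rule: induct)
   case (pure a b)
   then show ?case using PD by (simp add: ring_simps[OF L] assms(4) BP)
  next
   case (add x y)
   then show ?case by (simp add: ring_simps[OF L] dist)
  qed
 qed (use L ag clo dist in auto)
qed

lemma tensor_lmod:
 assumes A: "is_bimodule L R A" and M: "lmod R M"
 shows "tensor R (rpart A) M (tensor_lmod R A M) (ptens R (rpart A) M)"
  "lmod L (tensor_lmod R A M)"
  "!!l a m. l \<in>. L ==> a \<in>. A ==> m \<in>. M ==>
   l \<odot>\<^sub>(tensor_lmod R A M) ptens R (rpart A) M a m = ptens R (rpart A) M (l \<odot>\<^sub>A a) m"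
proof -
 note A' = bimoduleD(2)[OF A] and tm = tensor_map_on_pure[OF bimoduleD(2)[OF A] M bimoduleD(2)[OF A] M]
 show *: "tensor R (rpart A) M (tensor_lmod R A M) (ptens R (rpart A) M)"
  by (rule tensor_of_tensor_group[OF A' M]) (auto simp: tensor_lmod_def)
 show **: "l \<odot>\<^sub>(tensor_lmod R A M) ptens R (rpart A) M a m = ptens R (rpart A) M (l \<odot>\<^sub>A a) m"
  if "l \<in>. L" "a \<in>. A" "m \<in>. M" for l a m
  using tm(2)[OF bimodule_left_rmod_hom[OF A that(1)] lmod_hom_id] that by (simp add: tensor_lmod_def)
 show "lmod L (tensor_lmod R A M)"
 proof (rule left_module_by_generation[OF * _ _ ** bimoduleD(1)[OF A]])
  show "(%x. l \<odot>\<^sub>(tensor_lmod R A M) x) \<in> add_homs (tensor_lmod R A M) (tensor_lmod R A M)"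
   if "l \<in>. L" for l
   using tm(1)[OF bimodule_left_rmod_hom[OF A that] lmod_hom_id] by (simp add: tensor_lmod_def hom_def)
 qed (use bimodule_left[OF A] in auto)
qed

lemma tensor_rmod:
 assumes M: "rmod R M" and B: "is_bimodule R L B"
 shows "tensor R M B (tensor_rmod R M B) (ptens R M B)"
  "rmod L (tensor_rmod R M B)"
  "!!l m b. l \<in>. L ==> m \<in>. M ==> b \<in>. B ==>
   ptens R M B m b \<star>\<^sub>(tensor_rmod R M B) l = ptens R M B m (b \<triangleleft>\<^sub>B l)"
proof -
 note B' = bimoduleD(1)[OF B] and tm = tensor_map_on_pure[OF M bimoduleD(1)[OF B] M bimoduleD(1)[OF B]]
 show *: "tensor R M B (tensor_rmod R M B) (ptens R M B)"
  by (rule tensor_of_tensor_group[OF M B']) (auto simp: tensor_rmod_def)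
 show **: "ptens R M B m b \<star>\<^sub>(tensor_rmod R M B) l = ptens R M B m (b \<triangleleft>\<^sub>B l)"
  if "l \<in>. L" "m \<in>. M" "b \<in>. B" for l m b
  using tm(2)[OF rmod_hom_id bimodule_right_lmod_hom[OF B that(1)]] that by (simp add: tensor_rmod_def)
 show "rmod L (tensor_rmod R M B)"
 proof (rule right_module_by_generation[OF * _ _ _ bimoduleD(2)[OF B]])
  show "(%x. x \<star>\<^sub>(tensor_rmod R M B) l) \<in> add_homs (tensor_rmod R M B) (tensor_rmod R M B)"
   if "l \<in>. L" for l
   using tm(1)[OF rmod_hom_id bimodule_right_lmod_hom[OF B that]] by (simp add: tensor_rmod_def hom_def)
 qed (use bimodule_right[OF B] ** in auto)
qed

lemma tensor_bimod:
 assumes A: "is_bimodule L R A" and B: "is_bimodule R K B"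
 shows "tensor R (rpart A) B (tensor_bimod R A B) (ptens R (rpart A) B)"
  "is_bimodule L K (tensor_bimod R A B)"
  "!!l a b. l \<in>. L ==> a \<in>. A ==> b \<in>. B ==>
   l \<odot>\<^sub>(tensor_bimod R A B) ptens R (rpart A) B a b = ptens R (rpart A) B (l \<odot>\<^sub>A a) b"
  "!!k a b. k \<in>. K ==> a \<in>. A ==> b \<in>. B ==>
   ptens R (rpart A) B a b \<triangleleft>\<^sub>(tensor_bimod R A B) k = ptens R (rpart A) B a (b \<triangleleft>\<^sub>B k)"
proof -
 let ?T = "tensor_bimod R A B"
 note A' = bimoduleD(2)[OF A] and B' = bimoduleD(1)[OF B]
  and tm = tensor_map_on_pure[OF bimoduleD(2)[OF A] bimoduleD(1)[OF B] bimoduleD(2)[OF A] bimoduleD(1)[OF B]]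
 show T: "tensor R (rpart A) B ?T (ptens R (rpart A) B)"
  by (rule tensor_of_tensor_group[OF A' B']) (auto simp: tensor_bimod_def)
 show l: "l \<odot>\<^sub>?T ptens R (rpart A) B a b = ptens R (rpart A) B (l \<odot>\<^sub>A a) b"
  if "l \<in>. L" "a \<in>. A" "b \<in>. B" for l a b
  using tm(2)[OF bimodule_left_rmod_hom[OF A that(1)] lmod_hom_id] that by (simp add: tensor_bimod_def)
 show r: "ptens R (rpart A) B a b \<triangleleft>\<^sub>?T k = ptens R (rpart A) B a (b \<triangleleft>\<^sub>B k)"
  if "k \<in>. K" "a \<in>. A" "b \<in>. B" for k a b
  using tm(2)[OF rmod_hom_id bimodule_right_lmod_hom[OF B that(1)]] that by (simp add: tensor_bimod_def)
 have lh: "(%x. l \<odot>\<^sub>?T x) \<in> add_homs ?T ?T" if "l \<in>. L" for l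
  using tm(1)[OF bimodule_left_rmod_hom[OF A that] lmod_hom_id] by (simp add: tensor_bimod_def hom_def)
 have rh: "(%x. x \<triangleleft>\<^sub>?T k) \<in> add_homs ?T ?T" if "k \<in>. K" for k
  using tm(1)[OF rmod_hom_id bimodule_right_lmod_hom[OF B that]] by (simp add: tensor_bimod_def hom_def)
 have "lmod L ?T"
  by (rule left_module_by_generation[OF T _ lh l bimoduleD(1)[OF A]]) (use bimodule_left[OF A] in auto)
 moreover have "rmod K (rpart ?T)"
 proof (rule right_module_by_generation[OF _ _ _ _ bimoduleD(2)[OF B]])
  show "tensor R (rpart A) B (rpart ?T) (ptens R (rpart A) B)"
   by (rule tensor_of_tensor_group[OF A' B']) (auto simp: tensor_bimod_def right_part_def)
  show "(%x. x \<star>\<^sub>(rpart ?T) k) \<in> add_homs (rpart ?T) (rpart ?T)" if "k \<in>. K" for k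
   using rh[OF that] by (auto simp: hom_def)
 qed (use bimodule_right[OF B] r in auto)
 moreover have "(l \<odot>\<^sub>?T x) \<triangleleft>\<^sub>?T k = l \<odot>\<^sub>?T (x \<triangleleft>\<^sub>?T k)"
  if "l \<in>. L" "k \<in>. K" "x \<in>. ?T" for l k x
  by (rule tensor.ext[OF T, where h = "%x. (l \<odot>\<^sub>?T x) \<triangleleft>\<^sub>?T k" and Y = ?T
   and h' = "%x. l \<odot>\<^sub>?T (x \<triangleleft>\<^sub>?T k)"])
   (use that l r bimodule_left[OF A] bimodule_right[OF B]
   add_homs_comp[OF lh rh, of l k] add_homs_comp[OF rh lh, of k l] in auto)
 ultimately show "is_bimodule L K ?T" by (auto simp: is_bimodule_def)
qed

lemma ring_bimod_simps [simp]:
 "carrier (ring_bimod S j k) = carrier S" "\<zero>\<^sub>(ring_bimod S j k) = \<zero>\<^sub>S"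
 "x \<oplus>\<^sub>(ring_bimod S j k) y = x \<oplus>\<^sub>S y" "l \<odot>\<^sub>(ring_bimod S j k) x = j l \<otimes>\<^sub>S x"
 "x \<triangleleft>\<^sub>(ring_bimod S j k) r = x \<otimes>\<^sub>S k r"
 by (auto simp: ring_bimod_def)

lemma lsum_ring_bimod [simp]: "lsum (ring_bimod S j k) f xs = lsum S f xs"
 by (induction xs) auto

lemma restrict_bimod_simps [simp]:
 "carrier (restrict_bimod j k M) = carrier M" "\<zero>\<^sub>(restrict_bimod j k M) = \<zero>\<^sub>M"
 "x \<oplus>\<^sub>(restrict_bimod j k M) y = x \<oplus>\<^sub>M y" "l \<odot>\<^sub>(restrict_bimod j k M) x = j l \<odot>\<^sub>M x"
 "x \<triangleleft>\<^sub>(restrict_bimod j k M) r = x \<triangleleft>\<^sub>M k r"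
 by (auto simp: restrict_bimod_def)

lemma restrict_lmod_simps [simp]:
 "carrier (restrict_lmod j M) = carrier M" "\<zero>\<^sub>(restrict_lmod j M) = \<zero>\<^sub>M"
 "x \<oplus>\<^sub>(restrict_lmod j M) y = x \<oplus>\<^sub>M y" "l \<odot>\<^sub>(restrict_lmod j M) x = j l \<odot>\<^sub>M x"
 by (auto simp: restrict_lmod_def)

lemma ring_homD:
 assumes "i \<in> ring_hom R S"
 shows "r \<in>. R ==> i r \<in>. S"
  "r \<in>. R ==> r' \<in>. R ==> i (r \<oplus>\<^sub>R r') = i r \<oplus>\<^sub>S i r'"
  "r \<in>. R ==> r' \<in>. R ==> i (r \<otimes>\<^sub>R r') = i r \<otimes>\<^sub>S i r'"
  "i \<one>\<^sub>R = \<one>\<^sub>S" "i \<in> add_homs R S"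
 using assms by (auto simp: ring_hom_def hom_def)

lemma id_ring_hom: "(%r. r) \<in> ring_hom R R"
 by (auto simp: ring_hom_def)

lemma abelian_group_cong:
 assumes "abelian_group M" "carrier N = carrier M" "\<zero>\<^sub>N = \<zero>\<^sub>M" "!!x y. x \<oplus>\<^sub>N y = x \<oplus>\<^sub>M y"
 shows "abelian_group N"
proof -
 have "\<exists>y\<in>carrier M. y \<oplus>\<^sub>M x = \<zero>\<^sub>M" if "x \<in>. M" for x
  using assms(1) that by (intro bexI[of _ "\<ominus>\<^sub>M x"]) auto
 then show ?thesis
  using assms(1)
  by (intro abelian_groupI) (auto simp: assms(2-4) abelian_group.axioms abelian_monoid.a_ac)
qed

lemma ring_bimod_bimodule:
 assumes "ring L" "ring R" "ring S" "j \<in> ring_hom L S" "k \<in> ring_hom R S"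
 shows "is_bimodule L R (ring_bimod S j k)"
proof -
 have ag: "abelian_group (ring_bimod S j k)" "abelian_group (rpart (ring_bimod S j k))"
  using abelian_group_cong[OF ring_abelian[OF assms(3)], of "ring_bimod S j k"]
   abelian_group_cong[OF ring_abelian[OF assms(3)], of "rpart (ring_bimod S j k)"] by auto
 have "lmod L (ring_bimod S j k)"
  by (rule left_moduleI)
   (auto simp: assms ag ring_homD[OF assms(4)] ring_homD[OF assms(5)] ring_distrib[OF assms(3)] ring_simps[OF assms(3)])
 moreover have "rmod R (rpart (ring_bimod S j k))"
  by (rule right_moduleI)
   (auto simp: assms ag ring_homD[OF assms(4)] ring_homD[OF assms(5)] ring_distrib[OF assms(3)] ring_simps[OF assms(3)])
 ultimately show ?thesis
  unfolding is_bimodule_def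
  by (auto simp: ring_homD[OF assms(4)] ring_homD[OF assms(5)] ring_simps[OF assms(3)])
qed

lemma restrict_lmod_module:
 assumes "ring R" "i \<in> ring_hom R S" "lmod S M"
 shows "lmod R (restrict_lmod i M)"
 using abelian_group_cong[OF lmodD(2)[OF assms(3)], of "restrict_lmod i M"]
  lmodD[OF assms(3)] ring_homD[OF assms(2)] assms(1)
 by (intro left_moduleI) auto

lemma restrict_bimod_bimodule:
 assumes "ring L" "ring R" "j \<in> ring_hom L K" "k \<in> ring_hom R S" "is_bimodule K S M"
 shows "is_bimodule L R (restrict_bimod j k M)"
proof -
 note lm = bimodule_left[OF assms(5)] and rm = bimodule_right[OF assms(5)]
 have ag: "abelian_group (restrict_bimod j k M)" "abelian_group (rpart (restrict_bimod j k M))"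
  using abelian_group_cong[OF lm(2), of "restrict_bimod j k M"]
   abelian_group_cong[OF lm(2), of "rpart (restrict_bimod j k M)"] by auto
 have "lmod L (restrict_bimod j k M)"
  by (rule left_moduleI) (auto simp: assms ag ring_homD[OF assms(3)] lm)
 moreover have "rmod R (rpart (restrict_bimod j k M))"
  by (rule right_moduleI) (auto simp: assms ag ring_homD[OF assms(4)] rm)
 ultimately show ?thesis
  unfolding is_bimodule_def
  using bimoduleD(3)[OF assms(5)] ring_homD[OF assms(3)] ring_homD[OF assms(4)] by auto
qed

section \<open>Modules of homomorphisms and copies in the universe\<close>

definition lmod_of :: "('r, 'm, 'z) module_scheme => ('r, 'm) module" where
 "lmod_of M = \<lparr>carrier = carrier M, monoid.mult = monoid.mult M, one = one M, ring.zero = ring.zero M,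
   ring.add = ring.add M, smult = smult M\<rparr>"

lemma lmod_of_simps [simp]:
 "carrier (lmod_of M) = carrier M" "\<zero>\<^sub>(lmod_of M) = \<zero>\<^sub>M" "x \<oplus>\<^sub>(lmod_of M) y = x \<oplus>\<^sub>M y"
 "r \<odot>\<^sub>(lmod_of M) x = r \<odot>\<^sub>M x"
 by (auto simp: lmod_of_def)

lemma lsum_lmod_of [simp]: "lsum (lmod_of M) f xs = lsum M f xs"
 by (induction xs) auto

lemma lmod_of_module:
 assumes "lmod R M" shows "lmod R (lmod_of M)"
 using lmodD[OF assms] abelian_group_cong[OF lmodD(2)[OF assms], of "lmod_of M"]
 by (intro left_moduleI) auto

lemma lmod_hom_lmod_of [simp]: "lhom R (lmod_of M) N = lhom R M N" "lhom R M (lmod_of N) = lhom R M N"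
 by (auto simp: lmod_hom_def hom_def)

lemma lmod_hom_cong:
 assumes "h \<in> lhom R M N" "abelian_group M" "lmod R M" "!!x. x \<in>. M ==> h' x = h x"
 shows "h' \<in> lhom R M N"
 using lhomD[OF assms(1)] assms(2,4) lmodD[OF assms(3)]
 by (intro lhomI addI) auto

lemma lhom_restrict:
 assumes "h \<in> lhom R M N" "lmod R M"
 shows "restrict h (carrier M) \<in> lhom R M N"
 by (rule lmod_hom_cong[OF assms(1) lmodD(2)[OF assms(2)] assms(2)]) auto

lemma lhom_comp:
 "f \<in> lhom R M N ==> g \<in> lhom R N K ==> (%x. g (f x)) \<in> lhom R M K"
 by (auto simp: lmod_hom_def hom_def Pi_def)

lemma pointwise_abelian_group:
 assumes M: "abelian_group M"
  and car: "carrier H \<subseteq> extensional D" "!!f t. f \<in>. H ==> t \<in> D ==> f t \<in>. M"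
  and zero: "\<zero>\<^sub>H = (\<lambda>t\<in>D. \<zero>\<^sub>M)" "\<zero>\<^sub>H \<in>. H"
  and add: "!!f g. f \<oplus>\<^sub>H g = (\<lambda>t\<in>D. f t \<oplus>\<^sub>M g t)" "!!f g. f \<in>. H ==> g \<in>. H ==> f \<oplus>\<^sub>H g \<in>. H"
  and minus: "!!f. f \<in>. H ==> (\<lambda>t\<in>D. \<ominus>\<^sub>M f t) \<in>. H"
 shows "abelian_group H"
proof (rule abelian_groupI)
 note am = abelian_group.axioms(1)[OF M]
 fix f assume f: "f \<in>. H"
 show "\<zero>\<^sub>H \<oplus>\<^sub>H f = f"
  using f car M by (intro extensionalityI[of _ D]) (auto simp: zero add(1))
 show "\<exists>g\<in>carrier H. g \<oplus>\<^sub>H f = \<zero>\<^sub>H"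
  using minus[OF f] car(2)[OF f] M by (intro bexI[of _ "\<lambda>t\<in>D. \<ominus>\<^sub>M f t"]) (auto simp: zero(1) add(1) restrict_def fun_eq_iff)
 fix g assume g: "g \<in>. H"
 show "f \<oplus>\<^sub>H g \<in>. H" using f g by (rule add(2))
 show "f \<oplus>\<^sub>H g = g \<oplus>\<^sub>H f"
  using car(2)[OF f] car(2)[OF g] by (auto simp: add(1) restrict_def fun_eq_iff abelian_monoid.a_comm[OF am])
 fix k assume k: "k \<in>. H"
 show "(f \<oplus>\<^sub>H g) \<oplus>\<^sub>H k = f \<oplus>\<^sub>H (g \<oplus>\<^sub>H k)"
  using car(2)[OF f] car(2)[OF g] car(2)[OF k]
  by (auto simp: add(1) restrict_def fun_eq_iff abelian_monoid.a_assoc[OF am])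
qed (rule zero(2))

lemma left_module_minus:
 assumes "lmod R M" "a \<in>. R" "x \<in>. M"
 shows "a \<odot>\<^sub>M (\<ominus>\<^sub>M x) = \<ominus>\<^sub>M (a \<odot>\<^sub>M x)"
 using add_homs_minus[OF left_module_add_homs(1)[OF assms(1,2)]] lmodD[OF assms(1)] assms(3) by simp

lemma right_module_minus:
 assumes "rmod R M" "a \<in>. R" "x \<in>. M"
 shows "(\<ominus>\<^sub>M x) \<star>\<^sub>M a = \<ominus>\<^sub>M (x \<star>\<^sub>M a)"
 using add_homs_minus[OF right_module_add_homs(1)[OF assms(1,2)]] rmodD[OF assms(1)] assms(3) by simp

lemma minus_add_distrib:
 assumes "abelian_group M" "x \<in>. M" "y \<in>. M"
 shows "\<ominus>\<^sub>M (x \<oplus>\<^sub>M y) = \<ominus>\<^sub>M x \<oplus>\<^sub>M \<ominus>\<^sub>M y"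
 using assms by (simp add: abelian_group.minus_add)

lemma lHom_simps [simp]:
 "carrier (lHom R B M) = lhom R B M \<inter> extensional (carrier B)"
 "\<zero>\<^sub>(lHom R B M) = (\<lambda>t\<in>carrier B. \<zero>\<^sub>M)" "f \<oplus>\<^sub>(lHom R B M) g = (\<lambda>t\<in>carrier B. f t \<oplus>\<^sub>M g t)"
 "s \<odot>\<^sub>(lHom R B M) f = (\<lambda>t\<in>carrier B. f (t \<triangleleft>\<^sub>B s))"
 by (auto simp: lHom_def)

lemma rHom_simps [simp]:
 "carrier (rHom R B M) = rhom R (rpart B) M \<inter> extensional (carrier B)"
 "\<zero>\<^sub>(rHom R B M) = (\<lambda>t\<in>carrier B. \<zero>\<^sub>M)" "f \<oplus>\<^sub>(rHom R B M) g = (\<lambda>t\<in>carrier B. f t \<oplus>\<^sub>M g t)"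
 "f \<star>\<^sub>(rHom R B M) s = (\<lambda>t\<in>carrier B. f (s \<odot>\<^sub>B t))"
 by (auto simp: rHom_def)

lemma lHom_abelian:
 assumes B: "lmod R B" and M: "lmod R M"
 shows "abelian_group (lHom R B M)"
proof -
 note BD = lmodD[OF B] and MD = lmodD[OF M]
 show ?thesis
  by (rule pointwise_abelian_group[OF MD(2), of _ "carrier B"])
   (use BD MD in \<open>auto simp: lhomD add_exchange minus_add_distrib left_module_minus[OF M] left_module_lsum(3)[OF M]
   intro!: lhomI addI\<close>)
qed

lemma lHom_module:
 assumes B: "is_bimodule R S B" and M: "lmod R M"
 shows "lmod S (lHom R B M)"
proof -
 note BL = bimodule_left[OF B] and BR = bimodule_right[OF B] and MD = lmodD[OF M]
  and BD = bimoduleD[OF B]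
 have *: "(\<lambda>t\<in>carrier B. f (t \<triangleleft>\<^sub>B s)) \<in> lhom R B M"
  if "f \<in> lhom R B M" "s \<in>. S" for f s
  using that BL BR BD(3) lhomD[OF that(1)] by (intro lhomI addI) auto
 show ?thesis
  by (rule left_moduleI)
   (use BL BR MD lHom_abelian[OF BD(1) M] * in
   \<open>auto simp: lhomD(3) ring_simps fun_eq_iff restrict_def extensional_def\<close>)
qed

lemma rHom_abelian:
 assumes B: "rmod R (rpart B)" and M: "rmod R M"
 shows "abelian_group (rHom R B M)"
proof -
 note BD = rmodD[OF B, simplified] and MD = rmodD[OF M]
 have [simp]: "abelian_group B" using abelian_group_cong[OF rmodD(2)[OF B], of B] by simp
 show ?thesis
 proof (rule pointwise_abelian_group[OF MD(2), of _ "carrier B"])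
  fix f assume "f \<in>. (rHom R B M)"
  then have f: "f \<in> rhom R (rpart B) M" by simp
  note fD = rmod_homD[OF f, simplified]
  show "(\<lambda>t\<in>carrier B. \<ominus>\<^sub>M f t) \<in>. (rHom R B M)"
   using fD BD MD by (auto simp: minus_add_distrib right_module_minus[OF M] intro!: rmod_homI addI)
  show "f t \<in>. M" if "t \<in>. B" for t using fD that by simp
  fix g assume "g \<in>. (rHom R B M)"
  then have g: "g \<in> rhom R (rpart B) M" by simp
  note gD = rmod_homD[OF g, simplified]
  show "f \<oplus>\<^sub>(rHom R B M) g \<in>. (rHom R B M)"
   using fD gD BD MD by (auto simp: add_exchange intro!: rmod_homI addI)
 next
  show "\<zero>\<^sub>(rHom R B M) \<in>. (rHom R B M)"
   using BD MD by (auto simp: right_module_lsum(3)[OF M] intro!: rmod_homI addI)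
 qed auto
qed

lemma rHom_module:
 assumes B: "is_bimodule S R B" and M: "rmod R M"
 shows "rmod S (rHom R B M)"
proof -
 note BL = bimodule_left[OF B] and BR = bimodule_right[OF B] and MD = rmodD[OF M]
  and BD = bimoduleD[OF B]
 have *: "(\<lambda>t\<in>carrier B. f (s \<odot>\<^sub>B t)) \<in> rhom R (rpart B) M"
  if "f \<in> rhom R (rpart B) M" "s \<in>. S" for f s
  using that BL BR BD(3) rmod_homD[OF that(1), simplified] by (intro rmod_homI addI) (auto simp flip: BD(3))
 have **: "f (x \<oplus>\<^sub>B y) = f x \<oplus>\<^sub>M f y"
  if "f \<in> rhom R (rpart B) M" "x \<in>. B" "y \<in>. B" for f x y
  using rmod_homD(3)[OF that(1)] that by simp
 show ?thesis
  by (rule right_moduleI)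
   (use BL BR MD rHom_abelian[OF BD(2) M] * in
   \<open>auto simp: ** ring_simps fun_eq_iff restrict_def extensional_def\<close>)
qed

lemma image_module:
 assumes N: "lmod S N"
  and C: "carrier C = e ` carrier N" "\<zero>\<^sub>C = e \<zero>\<^sub>N"
   "!!x y. x \<in>. N ==> y \<in>. N ==> e x \<oplus>\<^sub>C e y = e (x \<oplus>\<^sub>N y)"
   "!!s x. s \<in>. S ==> x \<in>. N ==> s \<odot>\<^sub>C e x = e (s \<odot>\<^sub>N x)"
 shows "lmod S C" "e \<in> lhom S N C"
proof -
 note ND = lmodD[OF N] and am = abelian_group.axioms(1)[OF lmodD(2)[OF N]]
 have "\<exists>z\<in>carrier N. e (z \<oplus>\<^sub>N x) = e \<zero>\<^sub>N" if "x \<in>. N" for x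
  using that ND by (intro bexI[of _ "\<ominus>\<^sub>N x"]) auto
 then have "abelian_group C"
  using ND by (intro abelian_groupI) (auto simp: C abelian_monoid.a_ac[OF am])
 then show "lmod S C"
  using ND by (intro left_moduleI) (auto simp: C ring_simps[OF ND(1)])
 show "e \<in> lhom S N C" using C by (auto simp: lmod_hom_def hom_def)
qed

lemma transport_module:
 fixes e :: "'n => 'k"
 assumes N: "lmod S N" and inj: "inj_on e (carrier N)"
  and C: "carrier C = e ` carrier N" "\<zero>\<^sub>C = e \<zero>\<^sub>N"
   "!!x y. x \<in>. N ==> y \<in>. N ==> e x \<oplus>\<^sub>C e y = e (x \<oplus>\<^sub>N y)"
   "!!s x. s \<in>. S ==> x \<in>. N ==> s \<odot>\<^sub>C e x = e (s \<odot>\<^sub>N x)"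
 shows "lmod S C" "e \<in> lmod_iso S N C"
 using image_module[OF N C] inj C(1) by (simp_all add: lmod_iso_def bij_betw_def)

lemma universe_copy_module:
 fixes N :: "('s, 'n) module"
 assumes N: "lmod S N" and inj: "inj_on (universe_inj N :: 'n => 'u) (carrier N)"
 shows "lmod S (universe_copy N :: ('s, 'u) module)"
  "(universe_inj N :: 'n => 'u) \<in> lmod_iso S N (universe_copy N)"
proof -
 have *: "carrier (universe_copy N :: ('s, 'u) module) = universe_inj N ` carrier N"
  "\<zero>\<^sub>(universe_copy N :: ('s, 'u) module) = universe_inj N \<zero>\<^sub>N"
  by (auto simp: universe_copy_def Let_def)
 have **: "universe_inj N x \<oplus>\<^sub>(universe_copy N :: ('s, 'u) module) universe_inj N y = universe_inj N (x \<oplus>\<^sub>N y)"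
  if "x \<in>. N" "y \<in>. N" for x y
  using that inj by (simp add: universe_copy_def Let_def)
 have ***: "s \<odot>\<^sub>(universe_copy N :: ('s, 'u) module) universe_inj N x = universe_inj N (s \<odot>\<^sub>N x)"
  if "s \<in>. S" "x \<in>. N" for s x
  using that inj by (simp add: universe_copy_def Let_def)
 show "lmod S (universe_copy N :: ('s, 'u) module)"
  "(universe_inj N :: 'n => 'u) \<in> lmod_iso S N (universe_copy N)"
  by (rule transport_module[OF N inj * ** ***]; assumption)+
qed

lemma universe_inj_inj:
 fixes N :: "('s, 'n) module"
 assumes "carrier N \<lesssim> (UNIV :: 'u set)"
 shows "inj_on (universe_inj N :: 'n => 'u) (carrier N)"
proof -
 obtain e :: "'n => 'u" where "inj_on e (carrier N)"
  using assms by (auto simp: lepoll_def)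
 then show ?thesis
  unfolding universe_inj_def by (rule someI[where P = "%e. inj_on e (carrier N)"])
qed

section \<open>Dual systems\<close>

abbreviation "regular R \<equiv> ring_bimod R (%r. r) (%r. r)"

text \<open>The identities are dual basis expansions of \<open>t \<in> S\<close> and of \<open>w \<in> W\<close> for the pairing \<open>om (t w)\<close>.\<close>

definition dual_system ::
 "('r, 'a) ring_scheme => ('s, 'b) ring_scheme => ('r => 's) => ('s, 'r, 'w) bimodule =>
  ('w \<times> 's) list => ('w => 'r) => bool" where
 "dual_system R S i W ws om \<longleftrightarrow>
   set ws \<subseteq> carrier W \<times> carrier S \<and>
   om \<in> bimod_hom R R (restrict_bimod i (%r. r) W) (regular R) \<and>
   (\<forall>t\<in>carrier S. lsum S (%p. i (om (t \<odot>\<^sub>W fst p)) \<otimes>\<^sub>S snd p) ws = t) \<and>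
   (\<forall>w\<in>carrier W. lsum W (%p. fst p \<triangleleft>\<^sub>W om (snd p \<odot>\<^sub>W w)) ws = w)"

locale extension =
 fixes R :: "('r, 'a) ring_scheme" and S :: "('s, 'b) ring_scheme" and i :: "'r => 's"
  and W :: "('s, 'r, 'w) bimodule"
 assumes R: "ring R" and S: "ring S" and i: "i \<in> ring_hom R S" and W: "is_bimodule S R W"
begin

lemmas iD = ring_homD[OF i]
lemmas WL = bimodule_left[OF W]
lemmas WR = bimodule_right[OF W]
lemmas WB = bimoduleD[OF W]
lemmas RS = ring_simps[OF R]
lemmas SS = ring_simps[OF S]

abbreviation "SB \<equiv> ring_bimod S i (%s. s)"

lemma ag [simp]: "abelian_group R" "abelian_group S" "abelian_group W"
 using R S WL by auto

lemma SB: "is_bimodule R S SB"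
 by (rule ring_bimod_bimodule[OF R S S i id_ring_hom])

lemma RB: "is_bimodule R R (regular R)"
 by (rule ring_bimod_bimodule[OF R R R id_ring_hom id_ring_hom])

lemma omega_homI:
 assumes "!!w. w \<in>. W ==> om w \<in>. R"
  "!!w w'. w \<in>. W ==> w' \<in>. W ==> om (w \<oplus>\<^sub>W w') = om w \<oplus>\<^sub>R om w'"
  "!!r w. r \<in>. R ==> w \<in>. W ==> om (i r \<odot>\<^sub>W w) = r \<otimes>\<^sub>R om w"
  "!!r w. r \<in>. R ==> w \<in>. W ==> om (w \<triangleleft>\<^sub>W r) = om w \<otimes>\<^sub>R r"
 shows "om \<in> bimod_hom R R (restrict_bimod i (%r. r) W) (regular R)"
 using assms by (auto simp: bimod_hom_def lmod_hom_def rmod_hom_def hom_def)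

lemma omega_homD:
 assumes "om \<in> bimod_hom R R (restrict_bimod i (%r. r) W) (regular R)"
 shows "w \<in>. W ==> om w \<in>. R"
  "w \<in>. W ==> w' \<in>. W ==> om (w \<oplus>\<^sub>W w') = om w \<oplus>\<^sub>R om w'"
  "r \<in>. R ==> w \<in>. W ==> om (i r \<odot>\<^sub>W w) = r \<otimes>\<^sub>R om w"
  "r \<in>. R ==> w \<in>. W ==> om (w \<triangleleft>\<^sub>W r) = om w \<otimes>\<^sub>R r"
  "om \<in> add_homs W R"
 using assms by (auto simp: bimod_hom_def lmod_hom_def rmod_hom_def hom_def)

end

locale dual = extension R S i W
 for R :: "('r, 'a) ring_scheme" and S :: "('s, 'b) ring_scheme" and i :: "'r => 's"
  and W :: "('s, 'r, 'w) bimodule" +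
 fixes ws :: "('w \<times> 's) list" and om :: "'w => 'r"
 assumes dual: "dual_system R S i W ws om"
begin

lemma omega: "om \<in> bimod_hom R R (restrict_bimod i (%r. r) W) (regular R)"
 using dual by (simp add: dual_system_def)

lemmas omegaD = omega_homD[OF omega]

lemma ws: "p \<in> set ws ==> fst p \<in>. W" "p \<in> set ws ==> snd p \<in>. S"
 using dual by (auto simp: dual_system_def)

lemma sum_S: "t \<in>. S ==> lsum S (%p. i (om (t \<odot>\<^sub>W fst p)) \<otimes>\<^sub>S snd p) ws = t"
 and sum_W: "w \<in>. W ==> lsum W (%p. fst p \<triangleleft>\<^sub>W om (snd p \<odot>\<^sub>W w)) ws = w"
 using dual by (auto simp: dual_system_def)

end

lemma lHom_eval: "t \<in>. B ==> (%f. f t) \<in> add_homs (lHom R B M) M"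
 by (rule addI) (auto simp: lhomD)

lemma rHom_eval: "t \<in>. B ==> (%f. f t) \<in> add_homs (rHom R B M) M"
 by (rule addI) (auto dest: rmod_homD(2))

lemma restrict_add_homs: "h \<in> add_homs M N ==> abelian_group M ==> restrict h (carrier M) \<in> add_homs M N"
 by (rule addI) (auto dest: addD)

context dual begin

lemma i_hom_sum: "s \<in>. S ==> t \<in>. S ==> (%w. i (om (t \<odot>\<^sub>W w)) \<otimes>\<^sub>S s) \<in> add_homs W S"
 by (rule addI) (auto simp: WL omegaD iD SS ring_distrib[OF S])

text \<open>The map \<open>w \<otimes> m \<mapsto> (t \<mapsto> om (t w) m)\<close>.\<close>

definition hom_iso :: "('r, 'm) module => ('w, 'm) tens => 's => 'm" where
 "hom_iso M = tlift (rpart W) M (tensor_lmod R W M) (ptens R (rpart W) M) (lHom R SB M)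
   (%w m. \<lambda>t\<in>carrier S. om (t \<odot>\<^sub>W w) \<odot>\<^sub>M m)"

lemma hom_iso:
 assumes M: "lmod R M"
 shows "hom_iso M \<in> add_homs (tensor_lmod R W M) (lHom R SB M)"
  "w \<in>. W ==> m \<in>. M ==>
   hom_iso M (ptens R (rpart W) M w m) = (\<lambda>t\<in>carrier S. om (t \<odot>\<^sub>W w) \<odot>\<^sub>M m)"
proof -
 note MD = lmodD[OF M]
 interpret T: tensor R "rpart W" M "tensor_lmod R W M" "ptens R (rpart W) M"
  by (rule tensor_lmod(1)[OF W M])
 have "(\<lambda>t\<in>carrier S. om (t \<odot>\<^sub>W w) \<odot>\<^sub>M m) \<in> lhom R SB M" if "w \<in>. W" "m \<in>. M" for w m
  using that MD WL omegaD iD SS by (intro lhomI addI) auto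
 then have bal: "balanced R (rpart W) M (lHom R SB M) (%w m. \<lambda>t\<in>carrier S. om (t \<odot>\<^sub>W w) \<odot>\<^sub>M m)"
  using MD WL WR omegaD by (intro balancedI) (auto simp: WB(3)[symmetric])
 note tl = T.tlift[OF lHom_abelian[OF bimoduleD(1)[OF SB] M] bal, folded hom_iso_def]
 show "hom_iso M \<in> add_homs (tensor_lmod R W M) (lHom R SB M)"
  "w \<in>. W ==> m \<in>. M ==>
   hom_iso M (ptens R (rpart W) M w m) = (\<lambda>t\<in>carrier S. om (t \<odot>\<^sub>W w) \<odot>\<^sub>M m)"
  using tl by auto
qed

text \<open>The inverse is \<open>h \<mapsto> \<Sum> w\<^sub>j \<otimes> h(s\<^sub>j)\<close>.\<close>

lemma hom_iso_lmod_iso: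
 assumes M: "lmod R M"
 shows "hom_iso M \<in> lmod_iso S (tensor_lmod R W M) (lHom R SB M)"
proof -
 note MD = lmodD[OF M] and tm = tensor_lmod[OF W M] and LD = lmodD[OF lHom_module[OF SB M]]
 note TD = lmodD[OF tensor_lmod(2)[OF W M]]
 interpret T: tensor R "rpart W" M "tensor_lmod R W M" "ptens R (rpart W) M"
  by (rule tm(1))
 let ?tt = "hom_iso M" and ?p = "ptens R (rpart W) M"
 note th = hom_iso[OF M]
 have "?tt (s \<odot>\<^sub>(tensor_lmod R W M) x) = s \<odot>\<^sub>(lHom R SB M) ?tt x"
  if s: "s \<in>. S" and x: "x \<in>. (tensor_lmod R W M)" for s x
  using x
 proof (induction x rule: T.induct)
  case (pure w m)
  then show ?case using s by (auto simp: tm th WL SS)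
 next
  case (add x y)
  then show ?case using s TD LD by (simp add: addD[OF th(1)] del: lHom_simps)
 qed
 then have hom: "?tt \<in> lhom S (tensor_lmod R W M) (lHom R SB M)"
  using th(1) by (intro lhomI)
 define G where "G f = lsum (tensor_lmod R W M) (%p. ?p (fst p) (f (snd p))) ws" for f
 have G: "G f \<in>. (tensor_lmod R W M)" if "f \<in>. (lHom R SB M)" for f
  using that T.T_abelian ws T.closed lhomD(2)[of f R SB M] by (auto simp: G_def)
 have Ghom: "G \<in> add_homs (lHom R SB M) (tensor_lmod R W M)"
  unfolding G_def
 proof (rule add_homs_lsum_pointwise[OF _ T.T_abelian LD(2)])
  fix p assume p: "p \<in> set ws"
  show "(%f. ?p (fst p) (f (snd p))) \<in> add_homs (lHom R SB M) (tensor_lmod R W M)"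
   using add_homs_comp[OF lHom_eval[of "snd p" SB R M] T.hom_right[of "fst p"]] ws[OF p] by simp
 qed
 have GT: "G (?tt x) = x" if x: "x \<in>. (tensor_lmod R W M)" for x
  using x
 proof (induction x rule: T.induct)
  case (pure w m)
  then have wm: "w \<in>. W" "m \<in>. M" by auto
  have "G (?tt (?p w m)) = lsum (tensor_lmod R W M) (%p. ?p (fst p \<triangleleft>\<^sub>W om (snd p \<odot>\<^sub>W w)) m) ws"
   unfolding G_def using ws wm by (intro lsum_cong) (auto simp: th WL WR omegaD T.move[simplified])
  also have "... = ?p (lsum W (%p. fst p \<triangleleft>\<^sub>W om (snd p \<odot>\<^sub>W w)) ws) m"
   using ws wm by (subst T.lsum_left[simplified]) (auto simp: WL WR omegaD)
  also have "... = ?p w m" using wm by (simp add: sum_W)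
  finally show ?case .
 next
  case (add x y)
  then show ?case by (simp add: addD[OF Ghom] addD[OF th(1)] del: lHom_simps)
 qed
 have TG: "?tt (G f) = f" if f: "f \<in>. (lHom R SB M)" for f
 proof (rule extensionalityI[of _ "carrier S"])
  have fh: "f \<in> lhom R SB M" using f by simp
  note fD = lhomD[OF fh, simplified]
  show "f \<in> extensional (carrier S)" "?tt (G f) \<in> extensional (carrier S)"
   using f addD(1)[OF th(1) G[OF f]] by auto
  fix t assume t: "t \<in>. S"
  have "?tt (G f) t = lsum M (%p. ?tt (?p (fst p) (f (snd p))) t) ws"
   unfolding G_def using t ws T.closed fD MD
   by (subst add_lsum[OF add_homs_comp[OF th(1) lHom_eval[of t]] T.T_abelian]) auto
  also have "... = lsum M (%p. f (i (om (t \<odot>\<^sub>W fst p)) \<otimes>\<^sub>S snd p)) ws"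
   using t ws fD by (intro lsum_cong) (auto simp: th WL omegaD)
  also have "... = f (lsum S (%p. i (om (t \<odot>\<^sub>W fst p)) \<otimes>\<^sub>S snd p) ws)"
   using t ws MD WL omegaD iD SS add_lsum[OF lhomD(1)[OF fh], of ws "%p. i (om (t \<odot>\<^sub>W fst p)) \<otimes>\<^sub>S snd p"]
   abelian_group_cong[of S SB] by auto
  also have "... = f t" using t by (simp add: sum_S)
  finally show "?tt (G f) t = f t" .
 qed
 have "bij_betw ?tt (carrier (tensor_lmod R W M)) (carrier (lHom R SB M))"
  using GT TG G addD(1)[OF th(1)] by (intro bij_betw_byWitness[where f' = G]) blast+
 with hom show ?thesis by (simp add: lmod_iso_def)
qed

end

lemma tensor_functor_left_on_pure:
 assumes W: "is_bimodule S R W" and M: "lmod R M" "lmod R N" "h \<in> lhom R M N"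
  and wm: "w \<in>. W" "m \<in>. M"
 shows "fst (snd (on_ar (tensor_functor_left R W) (M, h, N))) (ptens R (rpart W) M w m)
  = ptens R (rpart W) N w (h m)"
proof -
 interpret T: tensor R "rpart W" M "tensor_lmod R W M" "ptens R (rpart W) M"
  by (rule tensor_lmod(1)[OF W M(1)])
 note WB = bimoduleD(2)[OF W]
 show ?thesis
  using M wm tensor_map_on_pure(2)[OF WB M(1) WB M(2) rmod_hom_id M(3)] T.closed
  by (simp add: tensor_functor_left_def)
qed

lemma tensor_functor_left_hom:
 assumes W: "is_bimodule S R W" and M: "lmod R M" "lmod R N" "h \<in> lhom R M N"
 shows "fst (snd (on_ar (tensor_functor_left R W) (M, h, N))) \<in> lhom S (tensor_lmod R W M) (tensor_lmod R W N)"
proof -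
 interpret T: tensor R "rpart W" M "tensor_lmod R W M" "ptens R (rpart W) M"
  by (rule tensor_lmod(1)[OF W M(1)])
 interpret T': tensor R "rpart W" N "tensor_lmod R W N" "ptens R (rpart W) N"
  by (rule tensor_lmod(1)[OF W M(2)])
 let ?f = "fst (snd (on_ar (tensor_functor_left R W) (M, h, N)))"
 note TD = lmodD[OF tensor_lmod(2)[OF W M(1)]] and TD' = lmodD[OF tensor_lmod(2)[OF W M(2)]]
  and WB = bimoduleD(2)[OF W] and WL = bimodule_left[OF W]
 have f: "?f \<in> add_homs (tensor_lmod R W M) (tensor_lmod R W N)"
 proof -
  have "tensor_map R (rpart W) N (%a. a) h \<in> add_homs (tensor_lmod R W M) (tensor_lmod R W N)"
   using tensor_map_on_pure(1)[OF WB M(1) WB M(2) rmod_hom_id M(3)]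
   by (simp add: tensor_lmod_def hom_def)
  from restrict_add_homs[OF this TD(2)] show ?thesis by (simp add: tensor_functor_left_def)
 qed
 show ?thesis
 proof (rule lhomI[OF f])
  fix s x assume s: "s \<in>. S" and "x \<in>. (tensor_lmod R W M)"
  from this(2) show "?f (s \<odot>\<^sub>(tensor_lmod R W M) x) = s \<odot>\<^sub>(tensor_lmod R W N) ?f x"
  proof (induction x rule: T.induct)
   case (pure w m)
   then show ?case using s lhomD(2)[OF M(3)]
   by (simp add: tensor_lmod[OF W] M tensor_functor_left_on_pure[OF W] WL del: fst_conv snd_conv)
  next
   case (add x y)
   then show ?case using s TD TD' by (simp add: addD[OF f])
  qed
 qed
qed

lemma (in dual) tensor_Hom_isomorphic:
 "lmod_functors_isomorphic R S
   (tensor_functor_left R W :: ('r, 'm, 's, ('w, 'm) tens) lmod_functor) (lHom_functor R SB)"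
 unfolding lmod_functors_isomorphic_def
proof (intro exI[of _ hom_iso] conjI ballI)
 fix M :: "('r, 'm) module" assume "M \<in> Ob (lmod_cat R)"
 then show "hom_iso M \<in> lmod_iso S (on_ob (tensor_functor_left R W) M) (on_ob (lHom_functor R SB) M)"
  using hom_iso_lmod_iso by (simp add: lmod_cat_def tensor_functor_left_def lHom_functor_def)
next
 fix a :: "('r, 'm) lmod_arrow" assume "a \<in> Ar (lmod_cat R)"
 then obtain M h N where a: "a = (M, h, N)" "lmod R M" "lmod R N" "h \<in> lhom R M N"
  by (auto simp: lmod_cat_def)
 interpret T: tensor R "rpart W" M "tensor_lmod R W M" "ptens R (rpart W) M"
  by (rule tensor_lmod(1)[OF W a(2)])
 note hi = hom_iso[OF a(2)] and hi' = hom_iso[OF a(3)] and hD = lhomD[OF a(4)]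
 let ?F = "fst (snd (on_ar (tensor_functor_left R W) (M, h, N)))"
 let ?G = "fst (snd (on_ar (lHom_functor R SB) (M, h, N)))"
 have F: "?F \<in> add_homs (tensor_lmod R W M) (tensor_lmod R W N)"
  using lhomD(1)[OF tensor_functor_left_hom[OF W a(2-4)]] .
 have car: "?F x \<in>. (tensor_lmod R W N)" if "x \<in>. (tensor_lmod R W M)" for x
  using addD(1)[OF F that] .
 have G: "?G f t = h (f t)" if "f \<in>. (lHom R SB M)" "t \<in>. S" for f t
  using that by (auto simp: lHom_functor_def compose_def)
 have pointwise: "hom_iso N (?F x) t = h (hom_iso M x t)"
  if x: "x \<in>. (tensor_lmod R W M)" and t: "t \<in>. S" for x t
 proof (rule T.ext[where Y = N, OF _ _ x])
  show "(%x. hom_iso N (?F x) t) \<in> add_homs (tensor_lmod R W M) N"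
   using add_homs_comp[OF F add_homs_comp[OF hi'(1) lHom_eval[of t]]] t by simp
  show "(%x. h (hom_iso M x t)) \<in> add_homs (tensor_lmod R W M) N"
   using add_homs_comp[OF add_homs_comp[OF hi(1) lHom_eval[of t]] hD(1)] t by simp
 qed (use t hD in \<open>simp add: tensor_functor_left_on_pure[OF W a(2-4)] hi hi' WL omegaD del: fst_conv snd_conv\<close>)
 have "hom_iso N (?F x) = ?G (hom_iso M x)" if x: "x \<in>. (tensor_lmod R W M)" for x
 proof (rule extensionalityI[of _ "carrier S"])
  show "hom_iso N (?F x) \<in> extensional (carrier S)"
   using addD(1)[OF hi'(1) car[OF x]] by simp
  show "?G (hom_iso M x) \<in> extensional (carrier S)"
   using addD(1)[OF hi(1) x] by (simp add: lHom_functor_def compose_def)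
 qed (use pointwise[OF x] G[OF addD(1)[OF hi(1) x]] in simp)
 then show "case a of (M, h, N) => \<forall>x\<in>carrier (on_ob (tensor_functor_left R W) M).
   hom_iso N (fst (snd (on_ar (tensor_functor_left R W) (M, h, N))) x) =
   fst (snd (on_ar (lHom_functor R SB) (M, h, N))) (hom_iso M x)"
  by (simp add: a(1) del: fst_conv snd_conv) (simp add: tensor_functor_left_def)
qed

text \<open>At \<open>R\<close> the isomorphism turns \<open>w\<close> into a functional on \<open>S\<close>, whose value at \<open>1\<close> is \<open>om w\<close>; the family is the preimage of the identity of \<open>S\<close>.\<close>

lemma dual_system_of_tensor_Hom_iso:
 fixes R :: "('u, 'a) ring_scheme" and S :: "('u, 'b) ring_scheme" and W :: "('u, 'u, 'w) bimodule"
 assumes ext: "extension R S i W"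
  and iso: "lmod_functors_isomorphic R S
   (tensor_functor_left R W :: ('u, 'u, 'u, ('w, 'u) tens) lmod_functor) (lHom_functor R (ring_bimod S i (%s. s)))"
 shows "\<exists>ws om. dual_system R S i W ws om"
proof -
 interpret extension R S i W by fact
 let ?p = "%M. ptens R (rpart W) M"
 let ?T = "%M. tensor_lmod R W M"
 define RL where "RL = lmod_of (regular R)"
 define SL where "SL = lmod_of SB"
 have RL: "lmod R RL" and SL: "lmod R SL"
  using lmod_of_module[OF bimoduleD(1)[OF RB]] lmod_of_module[OF bimoduleD(1)[OF SB]] by (auto simp: RL_def SL_def)
 have RL_simps [simp]: "carrier RL = carrier R" "x \<oplus>\<^sub>RL y = x \<oplus>\<^sub>R y" "r \<odot>\<^sub>RL x = r \<otimes>\<^sub>R x" for x y r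
  by (auto simp: RL_def)
 have SL_simps [simp]: "carrier SL = carrier S" "x \<oplus>\<^sub>SL y = x \<oplus>\<^sub>S y" "r \<odot>\<^sub>SL x = i r \<otimes>\<^sub>S x" for x y r
  by (auto simp: SL_def)
 have lsum_simps [simp]: "lsum RL f xs = lsum R f xs" "lsum SL f xs = lsum S f xs" for f :: "'z => 'u" and xs
  by (auto simp: RL_def SL_def)
 from iso obtain tt where tt_ob: "\<forall>M\<in>(Ob (lmod_cat R) :: ('u, 'u) module set). tt M \<in> lmod_iso S (on_ob (tensor_functor_left R W) M) (on_ob (lHom_functor R SB) M)"
  and tt_ar: "\<forall>(M, f, N)\<in>(Ar (lmod_cat R) :: ('u, 'u) lmod_arrow set). \<forall>x\<in>carrier (on_ob (tensor_functor_left R W) M).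
   tt N (fst (snd (on_ar (tensor_functor_left R W) (M, f, N))) x) = fst (snd (on_ar (lHom_functor R SB) (M, f, N))) (tt M x)"
  unfolding lmod_functors_isomorphic_def by blast
 have tt: "tt M \<in> lmod_iso S (?T M) (lHom R SB M)" if "lmod R M" for M
  using tt_ob that by (auto simp: lmod_cat_def tensor_functor_left_def lHom_functor_def)
 have nat: "tt N (fst (snd (on_ar (tensor_functor_left R W) (M, h, N))) x) = fst (snd (on_ar (lHom_functor R SB) (M, h, N))) (tt M x)"
  if "lmod R M" "lmod R N" "h \<in> lhom R M N \<inter> extensional (carrier M)" "x \<in>. (?T M)" for M h N x
 proof -
  have "(M, h, N) \<in> Ar (lmod_cat R)" using that by (simp add: lmod_cat_def)
  from tt_ar[rule_format, OF this] that(4) show ?thesis by (auto simp: tensor_functor_left_def)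
 qed
 have tt_hom: "tt M \<in> lhom S (?T M) (lHom R SB M)" if "lmod R M" for M
  using tt[OF that] by (simp add: lmod_iso_def)
 have tt_car: "tt M x \<in> lhom R SB M \<inter> extensional (carrier S)"
  if "lmod R M" "x \<in>. (?T M)" for M x
  using lhomD(2)[OF tt_hom[OF that(1)] that(2)] by simp
 have closed: "?p M w m \<in>. (?T M)" if "lmod R M" "w \<in>. W" "m \<in>. M" for M w m
  using tensor.closed[OF tensor_lmod(1)[OF W that(1)]] that by simp
 have T_ag: "abelian_group (?T M)" if "lmod R M" for M
  by (rule tensor.T_abelian[OF tensor_lmod(1)[OF W that]])
 have natural: "tt N (?p N w (h m)) t = h (tt M (?p M w m) t)"
  if M: "lmod R M" and N: "lmod R N" and h: "h \<in> lhom R M N"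
   and wm: "w \<in>. W" "m \<in>. M" "t \<in>. S" for M N h w m t
 proof -
  let ?h = "restrict h (carrier M)"
  have h': "?h \<in> lhom R M N" using lhom_restrict[OF h M] .
  have "tt N (?p N w (?h m)) = fst (snd (on_ar (lHom_functor R SB) (M, ?h, N))) (tt M (?p M w m))"
   using nat[OF M N _ closed[OF M wm(1,2)], of ?h] h' tensor_functor_left_on_pure[OF W M N h' wm(1,2)] by simp
  then show ?thesis
   using tt_car[OF M closed[OF M wm(1,2)]] wm lhomD(2)[of "tt M (?p M w m)" R SB M t]
   by (simp add: lHom_functor_def compose_def)
 qed
 define om where "om w = tt RL (?p RL w \<one>\<^sub>R) \<one>\<^sub>S" for w
 have shift: "tt RL (?p RL w \<one>\<^sub>R) t = om (t \<odot>\<^sub>W w)" if "w \<in>. W" "t \<in>. S" for w t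
 proof -
  have "om (t \<odot>\<^sub>W w) = tt RL (t \<odot>\<^sub>(?T RL) ?p RL w \<one>\<^sub>R) \<one>\<^sub>S"
   using that RS by (simp add: om_def tensor_lmod(3)[OF W RL])
  also have "... = (t \<odot>\<^sub>(lHom R SB RL) tt RL (?p RL w \<one>\<^sub>R)) \<one>\<^sub>S"
   using that RS by (simp add: lhomD(4)[OF tt_hom[OF RL]] closed[OF RL] del: lHom_simps)
  also have "... = tt RL (?p RL w \<one>\<^sub>R) t" using that SS by simp
  finally show ?thesis by simp
 qed
 have om_closed: "om w \<in>. R" if "w \<in>. W" for w
  using tt_car[OF RL closed[OF RL that, of "\<one>\<^sub>R"]] lhomD(2)[of _ R SB RL "\<one>\<^sub>S"] RS SS by (auto simp: om_def)
 have key: "tt M (?p M w m) t = om (t \<odot>\<^sub>W w) \<odot>\<^sub>M m"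
  if M: "lmod R M" and wm: "w \<in>. W" "m \<in>. M" "t \<in>. S" for M w m t
 proof -
  have "(%r. r \<odot>\<^sub>M m) \<in> lhom R RL M"
   using lmodD[OF M] wm RS by (auto intro!: lhomI addI)
  from natural[OF RL M this wm(1) _ wm(3), of "\<one>\<^sub>R"] show ?thesis
   using lmodD(7)[OF M wm(2)] RS by (simp add: shift[OF wm(1,3)])
 qed
 have om_add: "om (w \<oplus>\<^sub>W w') = om w \<oplus>\<^sub>R om w'" if "w \<in>. W" "w' \<in>. W" for w w'
  using that RS SS tensor.add_left[OF tensor_lmod(1)[OF W RL], of w w' "\<one>\<^sub>R"]
  by (simp add: om_def lhomD(3)[OF tt_hom[OF RL]] closed[OF RL])
 have om_hom: "om \<in> bimod_hom R R (restrict_bimod i (%r. r) W) (regular R)"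
 proof (rule omega_homI[OF om_closed om_add])
  fix r w assume rw: "r \<in>. R" "w \<in>. W"
  have "om (i r \<odot>\<^sub>W w) = tt RL (?p RL w \<one>\<^sub>R) (r \<odot>\<^sub>SB \<one>\<^sub>S)"
   using rw iD SS by (simp add: shift)
  also have "... = r \<otimes>\<^sub>R om w"
   using tt_car[OF RL closed[OF RL rw(2), of "\<one>\<^sub>R"]] rw RS SS lhomD(4)[of _ R SB RL r "\<one>\<^sub>S"]
   by (auto simp: om_def simp del: ring_bimod_simps(4))
  finally show "om (i r \<odot>\<^sub>W w) = r \<otimes>\<^sub>R om w" .
  have "om (w \<triangleleft>\<^sub>W r) = tt RL (?p RL w r) \<one>\<^sub>S"
   using rw RS tensor.move[OF tensor_lmod(1)[OF W RL], of w r "\<one>\<^sub>R"] by (simp add: om_def)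
  also have "... = om w \<otimes>\<^sub>R r" using rw SS WL by (simp add: key[OF RL])
  finally show "om (w \<triangleleft>\<^sub>W r) = om w \<otimes>\<^sub>R r" .
 qed
 note omD = omega_homD[OF om_hom]
 have "(\<lambda>t\<in>carrier S. t) \<in>. (lHom R SB SL)"
  using iD SS by (auto intro!: lhomI addI)
 then have "(\<lambda>t\<in>carrier S. t) \<in> tt SL ` carrier (?T SL)"
  using tt[OF SL] by (simp add: lmod_iso_def bij_betw_def del: lHom_simps)
 then obtain z where z: "z \<in>. (?T SL)" "tt SL z = (\<lambda>t\<in>carrier S. t)"
  by (elim imageE) simp
 obtain ws where ws: "set ws \<subseteq> carrier W \<times> carrier S" "z = lsum (?T SL) (%p. ?p SL (fst p) (snd p)) ws"
  using tensor.expand[OF tensor_lmod(1)[OF W SL] z(1)] by auto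
 have evaluate: "tt M (lsum (?T M) f xs) t = lsum M (%x. tt M (f x) t) xs"
  if "lmod R M" "t \<in>. S" "!!x. x \<in> set xs ==> f x \<in>. (?T M)"
  for M t xs and f :: "'w \<times> 'u => ('w, 'u) tens"
  using add_lsum[OF add_homs_comp[OF lhomD(1)[OF tt_hom[OF that(1)]] lHom_eval[of t]] T_ag[OF that(1)] lmodD(2)[OF that(1)] that(3)]
   that(2) by simp
 have sum_S: "lsum S (%p. i (om (t \<odot>\<^sub>W fst p)) \<otimes>\<^sub>S snd p) ws = t" if t: "t \<in>. S" for t
 proof -
  have "t = tt SL z t" using z(2) t by simp
  also have "... = lsum SL (%p. tt SL (?p SL (fst p) (snd p)) t) ws"
   unfolding ws(2) using ws(1) closed[OF SL] by (intro evaluate[OF SL t]) auto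
  also have "... = lsum S (%p. i (om (t \<odot>\<^sub>W fst p)) \<otimes>\<^sub>S snd p) ws"
   using ws(1) t by (simp, intro lsum_cong) (auto simp: key[OF SL])
  finally show ?thesis by simp
 qed
 have sum_W: "lsum W (%p. fst p \<triangleleft>\<^sub>W om (snd p \<odot>\<^sub>W w)) ws = w" if w: "w \<in>. W" for w
 proof -
  interpret T: tensor R "rpart W" RL "?T RL" "?p RL" by (rule tensor_lmod(1)[OF W RL])
  let ?y = "lsum (?T RL) (%p. ?p RL (fst p) (om (snd p \<odot>\<^sub>W w))) ws"
  have y: "?y \<in>. (?T RL)"
   using ws(1) w WL omD by (intro lsum_closed T_ag RL closed) auto
  have "tt RL ?y = tt RL (?p RL w \<one>\<^sub>R)"
  proof (rule extensionalityI[of _ "carrier S"])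
   show "tt RL ?y \<in> extensional (carrier S)" "tt RL (?p RL w \<one>\<^sub>R) \<in> extensional (carrier S)"
   using tt_car[OF RL y] tt_car[OF RL closed[OF RL w, of "\<one>\<^sub>R"]] RS by auto
   fix t assume t: "t \<in>. S"
   have "tt RL ?y t = lsum R (%p. tt RL (?p RL (fst p) (om (snd p \<odot>\<^sub>W w))) t) ws"
   using ws(1) w WL omD closed[OF RL] by (subst evaluate[OF RL t]) auto
   also have "... = lsum R (%p. om (i (om (t \<odot>\<^sub>W fst p)) \<odot>\<^sub>W (snd p \<odot>\<^sub>W w))) ws"
   using ws(1) w WL omD t by (intro lsum_cong) (auto simp: key[OF RL])
   also have "... = om (lsum W (%p. (i (om (t \<odot>\<^sub>W fst p)) \<otimes>\<^sub>S snd p) \<odot>\<^sub>W w) ws)"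
   using ws(1) w WL omD t iD SS by (subst add_lsum[OF omD(5)]) (auto intro!: lsum_cong)
   also have "... = om (lsum S (%p. i (om (t \<odot>\<^sub>W fst p)) \<otimes>\<^sub>S snd p) ws \<odot>\<^sub>W w)"
   using ws(1) w WL omD t iD SS by (subst bimodule_left_lsum(2)[OF W]) auto
   also have "... = tt RL (?p RL w \<one>\<^sub>R) t" using t w by (simp add: sum_S shift)
   finally show "tt RL ?y t = tt RL (?p RL w \<one>\<^sub>R) t" .
  qed
  then have eq: "?y = ?p RL w \<one>\<^sub>R"
   using tt[OF RL] y closed[OF RL w, of "\<one>\<^sub>R"] RS by (auto simp: lmod_iso_def bij_betw_def inj_on_def)
  have "balanced R (rpart W) RL W (%w r. w \<triangleleft>\<^sub>W r)"
   using WR by (intro balancedI) auto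
  note lift = T.tlift[OF ag(3) this]
  have "tlift (rpart W) RL (?T RL) (?p RL) W (%w r. w \<triangleleft>\<^sub>W r) ?y = lsum W (%p. fst p \<triangleleft>\<^sub>W om (snd p \<odot>\<^sub>W w)) ws"
   using ws(1) w WL omD closed[OF RL] lift(2) by (subst add_lsum[OF lift(1) T.T_abelian]) (auto intro!: lsum_cong)
  moreover have "tlift (rpart W) RL (?T RL) (?p RL) W (%w r. w \<triangleleft>\<^sub>W r) (?p RL w \<one>\<^sub>R) = w"
   using w WR RS lift(2) by auto
  ultimately show ?thesis unfolding eq by simp
 qed
 show ?thesis
  using ws(1) om_hom sum_S sum_W by (intro exI[of _ ws] exI[of _ om]) (simp add: dual_system_def)
qed

text \<open>The map \<open>m \<otimes> s \<mapsto> (w \<mapsto> m om (s w))\<close>.\<close>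

definition (in dual) right_iso :: "('r, 'm) rmodule => ('m, 's) tens => 'w => 'm" where
 "right_iso M = tlift M SB (tensor_rmod R M SB) (ptens R M SB) (rHom R W M)
   (%m s. \<lambda>w\<in>carrier W. m \<star>\<^sub>M om (s \<odot>\<^sub>W w))"

lemma (in dual) right_iso:
 assumes M: "rmod R M"
 shows "right_iso M \<in> add_homs (tensor_rmod R M SB) (rHom R W M)"
  "s \<in>. S ==> m \<in>. M ==>
   right_iso M (ptens R M SB m s) = (\<lambda>w\<in>carrier W. m \<star>\<^sub>M om (s \<odot>\<^sub>W w))"
proof -
 note MD = rmodD[OF M]
 interpret T: tensor R M SB "tensor_rmod R M SB" "ptens R M SB"
  by (rule tensor_rmod(1)[OF M SB])
 have "(\<lambda>w\<in>carrier W. m \<star>\<^sub>M om (s \<odot>\<^sub>W w)) \<in> rhom R (rpart W) M" if "s \<in>. S" "m \<in>. M" for s m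
  using that MD WL WR omegaD iD SS by (intro rmod_homI addI) (auto simp flip: WB(3))
 then have bal: "balanced R M SB (rHom R W M) (%m s. \<lambda>w\<in>carrier W. m \<star>\<^sub>M om (s \<odot>\<^sub>W w))"
  using MD WL WR omegaD iD by (intro balancedI) auto
 note tl = T.tlift[OF rHom_abelian[OF WB(2) M] bal, folded right_iso_def]
 show "right_iso M \<in> add_homs (tensor_rmod R M SB) (rHom R W M)"
  "s \<in>. S ==> m \<in>. M ==>
   right_iso M (ptens R M SB m s) = (\<lambda>w\<in>carrier W. m \<star>\<^sub>M om (s \<odot>\<^sub>W w))"
  using tl by auto
qed

lemma (in dual) right_iso_rmod_iso:
 assumes M: "rmod R M"
 shows "right_iso M \<in> rmod_iso S (tensor_rmod R M SB) (rHom R W M)"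
proof -
 note MD = rmodD[OF M] and tm = tensor_rmod[OF M SB] and LD = rmodD[OF rHom_module[OF W M]]
 note TD = rmodD[OF tensor_rmod(2)[OF M SB]]
 interpret T: tensor R M SB "tensor_rmod R M SB" "ptens R M SB"
  by (rule tm(1))
 let ?tt = "right_iso M" and ?p = "ptens R M SB"
 note th = right_iso[OF M]
 have "?tt (x \<star>\<^sub>(tensor_rmod R M SB) s) = ?tt x \<star>\<^sub>(rHom R W M) s"
  if s: "s \<in>. S" and x: "x \<in>. (tensor_rmod R M SB)" for s x
  using x
 proof (induction x rule: T.induct)
  case (pure m u)
  then show ?case using s by (auto simp: tm th WL SS)
 next
  case (add x y)
  then show ?case using s TD LD by (simp add: addD[OF th(1)] del: rHom_simps)
 qed
 then have hom: "?tt \<in> rhom S (tensor_rmod R M SB) (rHom R W M)"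
  using th(1) by (intro rmod_homI)
 define G where "G f = lsum (tensor_rmod R M SB) (%p. ?p (f (fst p)) (snd p)) ws" for f
 have G: "G f \<in>. (tensor_rmod R M SB)" if "f \<in>. (rHom R W M)" for f
  using that T.T_abelian ws T.closed rmod_homD(2)[of f R "rpart W" M] by (auto simp: G_def)
 have Ghom: "G \<in> add_homs (rHom R W M) (tensor_rmod R M SB)"
  unfolding G_def
 proof (rule add_homs_lsum_pointwise[OF _ T.T_abelian LD(2)])
  fix p assume p: "p \<in> set ws"
  show "(%f. ?p (f (fst p)) (snd p)) \<in> add_homs (rHom R W M) (tensor_rmod R M SB)"
   using add_homs_comp[OF rHom_eval[of "fst p" W R M] T.hom_left[of "snd p"]] ws[OF p] by simp
 qed
 have GT: "G (?tt x) = x" if x: "x \<in>. (tensor_rmod R M SB)" for x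
  using x
 proof (induction x rule: T.induct)
  case (pure m s)
  then have wm: "s \<in>. S" "m \<in>. M" by auto
  have "G (?tt (?p m s)) = lsum (tensor_rmod R M SB) (%p. ?p m (i (om (s \<odot>\<^sub>W fst p)) \<otimes>\<^sub>S snd p)) ws"
   unfolding G_def using ws wm by (intro lsum_cong) (auto simp: th WL WR omegaD T.move[simplified])
  also have "... = ?p m (lsum S (%p. i (om (s \<odot>\<^sub>W fst p)) \<otimes>\<^sub>S snd p) ws)"
   using ws wm by (subst T.lsum_right[simplified]) (auto simp: WL WR omegaD iD SS)
  also have "... = ?p m s" using wm by (simp add: sum_S)
  finally show ?case .
 next
  case (add x y)
  then show ?case by (simp add: addD[OF Ghom] addD[OF th(1)] del: rHom_simps)
 qed
 have TG: "?tt (G f) = f" if f: "f \<in>. (rHom R W M)" for f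
 proof (rule extensionalityI[of _ "carrier W"])
  have fh: "f \<in> rhom R (rpart W) M" using f by simp
  note fD = rmod_homD[OF fh, simplified]
  show "f \<in> extensional (carrier W)" "?tt (G f) \<in> extensional (carrier W)"
   using f addD(1)[OF th(1) G[OF f]] by auto
  fix t assume t: "t \<in>. W"
  have "?tt (G f) t = lsum M (%p. ?tt (?p (f (fst p)) (snd p)) t) ws"
   unfolding G_def using t ws T.closed fD MD
   by (subst add_lsum[OF add_homs_comp[OF th(1) rHom_eval[of t]] T.T_abelian]) auto
  also have "... = lsum M (%p. f (fst p \<triangleleft>\<^sub>W om (snd p \<odot>\<^sub>W t))) ws"
   using t ws fD by (intro lsum_cong) (auto simp: th WL omegaD)
  also have "... = f (lsum W (%p. fst p \<triangleleft>\<^sub>W om (snd p \<odot>\<^sub>W t)) ws)"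
   using t ws MD WL omegaD iD SS WR add_lsum[OF rmod_homD(1)[OF fh], of ws "%p. fst p \<triangleleft>\<^sub>W om (snd p \<odot>\<^sub>W t)"]
   by auto
  also have "... = f t" using t by (simp add: sum_W)
  finally show "?tt (G f) t = f t" .
 qed
 have "bij_betw ?tt (carrier (tensor_rmod R M SB)) (carrier (rHom R W M))"
  using GT TG G addD(1)[OF th(1)] by (intro bij_betw_byWitness[where f' = G]) blast+
 with hom show ?thesis by (simp add: rmod_iso_def)
qed

lemma (in extension) tensor_functor_right_on_pure:
 assumes "rmod R M" "rmod R N" "h \<in> rhom R M N" "m \<in>. M" "s \<in>. S"
 shows "fst (snd (on_ar (tensor_functor_right R SB) (M, h, N))) (ptens R M SB m s)
  = ptens R N SB (h m) s"
proof -
 interpret T: tensor R M SB "tensor_rmod R M SB" "ptens R M SB"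
  by (rule tensor_rmod(1)[OF assms(1) SB])
 show ?thesis
  using assms tensor_map_on_pure(2)[OF assms(1) bimoduleD(1)[OF SB] assms(2) bimoduleD(1)[OF SB] assms(3) lmod_hom_id] T.closed
  by (simp add: tensor_functor_right_def)
qed

lemma (in extension) tensor_functor_right_hom:
 assumes "rmod R M" "rmod R N" "h \<in> rhom R M N"
 shows "fst (snd (on_ar (tensor_functor_right R SB) (M, h, N))) \<in> add_homs (tensor_rmod R M SB) (tensor_rmod R N SB)"
proof -
 have "tensor_map R N SB h (%a. a) \<in> add_homs (tensor_rmod R M SB) (tensor_rmod R N SB)"
  using tensor_map_on_pure(1)[OF assms(1) bimoduleD(1)[OF SB] assms(2) bimoduleD(1)[OF SB] assms(3) lmod_hom_id]
  by (simp add: tensor_rmod_def hom_def)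
 from restrict_add_homs[OF this rmodD(2)[OF tensor_rmod(2)[OF assms(1) SB]]]
 show ?thesis by (simp add: tensor_functor_right_def)
qed

lemma (in dual) right_tensor_Hom_isomorphic:
 "rmod_functors_isomorphic R S
   (tensor_functor_right R SB :: ('r, 'm, 's, ('m, 's) tens) rmod_functor) (rHom_functor R W)"
 unfolding rmod_functors_isomorphic_def
proof (intro exI[of _ right_iso] conjI ballI)
 fix M :: "('r, 'm) rmodule" assume "M \<in> Ob (rmod_cat R)"
 then show "right_iso M \<in> rmod_iso S (on_ob (tensor_functor_right R SB) M) (on_ob (rHom_functor R W) M)"
  using right_iso_rmod_iso by (simp add: rmod_cat_def tensor_functor_right_def rHom_functor_def)
next
 fix a :: "('r, 'm) rmod_arrow" assume "a \<in> Ar (rmod_cat R)"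
 then obtain M h N where a: "a = (M, h, N)" "rmod R M" "rmod R N" "h \<in> rhom R M N"
  by (auto simp: rmod_cat_def)
 interpret T: tensor R M SB "tensor_rmod R M SB" "ptens R M SB"
  by (rule tensor_rmod(1)[OF a(2) SB])
 note hi = right_iso[OF a(2)] and hi' = right_iso[OF a(3)] and hD = rmod_homD[OF a(4)]
 let ?F = "fst (snd (on_ar (tensor_functor_right R SB) (M, h, N)))"
 let ?G = "fst (snd (on_ar (rHom_functor R W) (M, h, N)))"
 have F: "?F \<in> add_homs (tensor_rmod R M SB) (tensor_rmod R N SB)"
  by (rule tensor_functor_right_hom[OF a(2-4)])
 have car: "?F x \<in>. (tensor_rmod R N SB)" if "x \<in>. (tensor_rmod R M SB)" for x
  using addD(1)[OF F that] .
 have G: "?G f t = h (f t)" if "f \<in>. (rHom R W M)" "t \<in>. W" for f t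
  using that by (auto simp: rHom_functor_def compose_def)
 have pointwise: "right_iso N (?F x) t = h (right_iso M x t)"
  if x: "x \<in>. (tensor_rmod R M SB)" and t: "t \<in>. W" for x t
 proof (rule T.ext[where Y = N, OF _ _ x])
  show "(%x. right_iso N (?F x) t) \<in> add_homs (tensor_rmod R M SB) N"
   using add_homs_comp[OF F add_homs_comp[OF hi'(1) rHom_eval[of t]]] t by simp
  show "(%x. h (right_iso M x t)) \<in> add_homs (tensor_rmod R M SB) N"
   using add_homs_comp[OF add_homs_comp[OF hi(1) rHom_eval[of t]] hD(1)] t by simp
 qed (use t hD in \<open>simp add: tensor_functor_right_on_pure[OF a(2-4)] hi hi' WL omegaD del: fst_conv snd_conv\<close>)
 have "right_iso N (?F x) = ?G (right_iso M x)" if x: "x \<in>. (tensor_rmod R M SB)" for x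
 proof (rule extensionalityI[of _ "carrier W"])
  show "right_iso N (?F x) \<in> extensional (carrier W)"
   using addD(1)[OF hi'(1) car[OF x]] by simp
  show "?G (right_iso M x) \<in> extensional (carrier W)"
   using addD(1)[OF hi(1) x] by (simp add: rHom_functor_def compose_def)
 qed (use pointwise[OF x] G[OF addD(1)[OF hi(1) x]] in simp)
 then show "case a of (M, h, N) => \<forall>x\<in>carrier (on_ob (tensor_functor_right R SB) M).
   right_iso N (fst (snd (on_ar (tensor_functor_right R SB) (M, h, N))) x) =
   fst (snd (on_ar (rHom_functor R W) (M, h, N))) (right_iso M x)"
  by (simp add: a(1) del: fst_conv snd_conv) (simp add: tensor_functor_right_def)
qed

lemma transport_rmodule:
 fixes e :: "'n => 'k"
 assumes N: "rmod S N" and inj: "inj_on e (carrier N)"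
  and C: "carrier C = e ` carrier N" "\<zero>\<^sub>C = e \<zero>\<^sub>N"
   "!!x y. x \<in>. N ==> y \<in>. N ==> e x \<oplus>\<^sub>C e y = e (x \<oplus>\<^sub>N y)"
   "!!s x. s \<in>. S ==> x \<in>. N ==> e x \<star>\<^sub>C s = e (x \<star>\<^sub>N s)"
 shows "rmod S C" "e \<in> rmod_iso S N C"
proof -
 note ND = rmodD[OF N] and am = abelian_group.axioms(1)[OF rmodD(2)[OF N]]
 have "\<exists>z\<in>carrier N. e (z \<oplus>\<^sub>N x) = e \<zero>\<^sub>N" if "x \<in>. N" for x
  using that ND by (intro bexI[of _ "\<ominus>\<^sub>N x"]) auto
 then have "abelian_group C"
  using ND by (intro abelian_groupI) (auto simp: C abelian_monoid.a_ac[OF am])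
 then show "rmod S C"
  using ND by (intro right_moduleI) (auto simp: C ring_simps[OF ND(1)])
 show "e \<in> rmod_iso S N C"
  using inj C by (auto simp: rmod_iso_def rmod_hom_def hom_def bij_betw_def)
qed

lemma rmod_hom_restrict:
 assumes "h \<in> rhom R M N" "rmod R M"
 shows "restrict h (carrier M) \<in> rhom R M N"
 using rmod_homD[OF assms(1)] rmodD[OF assms(2)] by (intro rmod_homI addI) auto

text \<open>Here \<open>om\<close> is the image of \<open>1 \<otimes> 1\<close> at \<open>R\<close>. The carrier of \<open>W\<close> may lie outside the universe of the categories; the family is the preimage of the map \<open>e\<close> from \<open>W\<close> onto its copy.\<close>

lemma dual_system_of_right_tensor_Hom_iso:
 fixes R :: "('u, 'a) ring_scheme" and S :: "('u, 'b) ring_scheme" and W :: "('u, 'u, 'w) bimodule"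
 assumes ext: "extension R S i W" and e: "inj_on (e :: 'w => 'u) (carrier W)"
  and iso: "rmod_functors_isomorphic R S
   (tensor_functor_right R (ring_bimod S i (%s. s)) :: ('u, 'u, 'u, ('u, 'u) tens) rmod_functor) (rHom_functor R W)"
 shows "\<exists>ws om. dual_system R S i W ws om"
proof -
 interpret extension R S i W by fact
 let ?p = "%M. ptens R M SB"
 let ?T = "%M. tensor_rmod R M SB"
 define RR where "RR = rpart (regular R)"
 have RR: "rmod R RR" using bimoduleD(2)[OF RB] by (simp add: RR_def)
 have RR_simps [simp]: "carrier RR = carrier R" "x \<oplus>\<^sub>RR y = x \<oplus>\<^sub>R y" "x \<star>\<^sub>RR r = x \<otimes>\<^sub>R r" for x y r
  by (auto simp: RR_def)
 have lsum_simps [simp]: "lsum RR f xs = lsum R f xs" for f :: "'z => 'u" and xs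
  by (auto simp: RR_def)
 from iso obtain tt where tt_ob: "\<forall>M\<in>(Ob (rmod_cat R) :: ('u, 'u) rmodule set). tt M \<in> rmod_iso S (on_ob (tensor_functor_right R SB) M) (on_ob (rHom_functor R W) M)"
  and tt_ar: "\<forall>(M, f, N)\<in>(Ar (rmod_cat R) :: ('u, 'u) rmod_arrow set). \<forall>x\<in>carrier (on_ob (tensor_functor_right R SB) M).
   tt N (fst (snd (on_ar (tensor_functor_right R SB) (M, f, N))) x) = fst (snd (on_ar (rHom_functor R W) (M, f, N))) (tt M x)"
  unfolding rmod_functors_isomorphic_def by blast
 have tt: "tt M \<in> rmod_iso S (?T M) (rHom R W M)" if "rmod R M" for M
  using tt_ob that by (auto simp: rmod_cat_def tensor_functor_right_def rHom_functor_def)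
 have nat: "tt N (fst (snd (on_ar (tensor_functor_right R SB) (M, h, N))) x) = fst (snd (on_ar (rHom_functor R W) (M, h, N))) (tt M x)"
  if "rmod R M" "rmod R N" "h \<in> rhom R M N \<inter> extensional (carrier M)" "x \<in>. (?T M)" for M h N x
 proof -
  have "(M, h, N) \<in> Ar (rmod_cat R)" using that by (simp add: rmod_cat_def)
  from tt_ar[rule_format, OF this] that(4) show ?thesis by (auto simp: tensor_functor_right_def)
 qed
 have tt_hom: "tt M \<in> rhom S (?T M) (rHom R W M)" if "rmod R M" for M
  using tt[OF that] by (simp add: rmod_iso_def)
 have tt_car: "tt M x \<in> rhom R (rpart W) M \<inter> extensional (carrier W)"
  if "rmod R M" "x \<in>. (?T M)" for M x
  using rmod_homD(2)[OF tt_hom[OF that(1)] that(2)] by simp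
 have closed: "?p M m s \<in>. (?T M)" if "rmod R M" "s \<in>. S" "m \<in>. M" for M s m
  using tensor.closed[OF tensor_rmod(1)[OF that(1) SB]] that by simp
 have T_ag: "abelian_group (?T M)" if "rmod R M" for M
  by (rule tensor.T_abelian[OF tensor_rmod(1)[OF that SB]])
 have natural: "tt N (?p N (h m) s) w = h (tt M (?p M m s) w)"
  if M: "rmod R M" and N: "rmod R N" and h: "h \<in> rhom R M N"
   and sm: "s \<in>. S" "m \<in>. M" "w \<in>. W" for M N h w m s
 proof -
  let ?h = "restrict h (carrier M)"
  have h': "?h \<in> rhom R M N" using rmod_hom_restrict[OF h M] .
  have "tt N (?p N (?h m) s) = fst (snd (on_ar (rHom_functor R W) (M, ?h, N))) (tt M (?p M m s))"
   using nat[OF M N _ closed[OF M sm(1,2)], of ?h] h' tensor_functor_right_on_pure[OF M N h' sm(2,1)] by simp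
  then show ?thesis
   using tt_car[OF M closed[OF M sm(1,2)]] sm rmod_homD(2)[of "tt M (?p M m s)" R "rpart W" M w]
   by (simp add: rHom_functor_def compose_def)
 qed
 define om where "om = tt RR (?p RR \<one>\<^sub>R \<one>\<^sub>S)"
 have om_rhom: "om \<in> rhom R (rpart W) RR"
  using tt_car[OF RR closed[OF RR]] RS SS by (simp add: om_def)
 note omR = rmod_homD[OF om_rhom, simplified]
 have shift: "tt RR (?p RR \<one>\<^sub>R s) w = om (s \<odot>\<^sub>W w)" if "w \<in>. W" "s \<in>. S" for w s
 proof -
  have "tt RR (?p RR \<one>\<^sub>R s) = tt RR (?p RR \<one>\<^sub>R \<one>\<^sub>S \<star>\<^sub>(?T RR) s)"
   using that RS SS by (simp add: tensor_rmod(3)[OF RR SB])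
  also have "... = om \<star>\<^sub>(rHom R W RR) s"
   using that RS SS by (simp add: rmod_homD(4)[OF tt_hom[OF RR]] closed[OF RR] om_def del: rHom_simps)
  finally show ?thesis using that by simp
 qed
 have key: "tt M (?p M m s) w = m \<star>\<^sub>M om (s \<odot>\<^sub>W w)"
  if M: "rmod R M" and wm: "w \<in>. W" "m \<in>. M" "s \<in>. S" for M w m s
 proof -
  have "(%r. m \<star>\<^sub>M r) \<in> rhom R RR M"
   using rmodD[OF M] wm RS by (auto intro!: rmod_homI addI)
  from natural[OF RR M this wm(3) _ wm(1), of "\<one>\<^sub>R"] show ?thesis
   using rmodD(7)[OF M wm(2)] RS by (simp add: shift[OF wm(1,3)])
 qed
 have om_hom: "om \<in> bimod_hom R R (restrict_bimod i (%r. r) W) (regular R)"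
 proof (rule omega_homI)
  fix r w assume rw: "r \<in>. R" "w \<in>. W"
  have "om (i r \<odot>\<^sub>W w) = tt RR (?p RR \<one>\<^sub>R (r \<odot>\<^sub>SB \<one>\<^sub>S)) w"
   using rw iD SS by (simp add: shift)
  also have "... = tt RR (?p RR r \<one>\<^sub>S) w"
   using rw RS SS tensor.move[OF tensor_rmod(1)[OF RR SB], of "\<one>\<^sub>R" r "\<one>\<^sub>S"] by simp
  also have "... = r \<otimes>\<^sub>R om w"
   using rw RS SS WL by (simp add: key[OF RR])
  finally show "om (i r \<odot>\<^sub>W w) = r \<otimes>\<^sub>R om w" .
 qed (use omR in auto)
 note omD = omega_homD[OF om_hom]
 define d where "d = inv_into (carrier W) e"
 have de: "d (e w) = w" if "w \<in>. W" for w
  using e that by (simp add: d_def)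
 define C :: "('u, 'u) rmodule" where "C = \<lparr>carrier = e ` carrier W, monoid.mult = undefined, one = undefined, ring.zero = e \<zero>\<^sub>W,
   ring.add = (%x y. e (d x \<oplus>\<^sub>W d y)), rsmult = (%x r. e (d x \<triangleleft>\<^sub>W r))\<rparr>"
 have C: "rmod R C" "e \<in> rmod_iso R (rpart W) C"
  by (rule transport_rmodule[OF WB(2), where e = e and C = C]; simp add: C_def e de)+
 have Ccar: "carrier C = e ` carrier W" by (simp add: C_def)
 have e_hom: "e \<in> rhom R (rpart W) C" using C(2) by (simp add: rmod_iso_def)
 note eD = rmod_homD[OF e_hom, simplified]
 have "(\<lambda>w\<in>carrier W. e w) \<in>. (rHom R W C)"
  using rmod_hom_restrict[OF e_hom WB(2)] by simp
 then have "(\<lambda>w\<in>carrier W. e w) \<in> tt C ` carrier (?T C)"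
  using tt[OF C(1)] by (simp add: rmod_iso_def bij_betw_def del: rHom_simps)
 then obtain z where z: "z \<in>. (?T C)" "tt C z = (\<lambda>w\<in>carrier W. e w)"
  by (elim imageE) simp
 obtain cs where cs: "set cs \<subseteq> carrier C \<times> carrier S" "z = lsum (?T C) (%p. ?p C (fst p) (snd p)) cs"
  using tensor.expand[OF tensor_rmod(1)[OF C(1) SB] z(1)] by auto
 define ws where "ws = map (%p. (d (fst p), snd p)) cs"
 have ws: "set ws \<subseteq> carrier W \<times> carrier S"
  using cs(1) by (auto simp: ws_def Ccar de)
 have ws': "fst p \<in>. W" "snd p \<in>. S" if "p \<in> set ws" for p using ws that by auto
 have "cs = map (%p. (e (fst p), snd p)) ws"
  using cs(1) by (auto simp: ws_def map_idI Ccar de intro!: map_idI[symmetric])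
 with cs(2) have z_ws: "z = lsum (?T C) (%p. ?p C (e (fst p)) (snd p)) ws"
  by (simp add: lsum_map)
 have evaluate: "tt M (lsum (?T M) f xs) w = lsum M (%x. tt M (f x) w) xs"
  if "rmod R M" "w \<in>. W" "!!x. x \<in> set xs ==> f x \<in>. (?T M)"
  for M w xs and f :: "'w \<times> 'u => ('u, 'u) tens"
  using add_lsum[OF add_homs_comp[OF rmod_homD(1)[OF tt_hom[OF that(1)]] rHom_eval[of w]] T_ag[OF that(1)] rmodD(2)[OF that(1)] that(3)]
   that(2) by simp
 have sum_W: "lsum W (%p. fst p \<triangleleft>\<^sub>W om (snd p \<odot>\<^sub>W w)) ws = w" if w: "w \<in>. W" for w
 proof -
  have "e w = tt C z w" using z(2) w by simp
  also have "... = lsum C (%p. tt C (?p C (e (fst p)) (snd p)) w) ws"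
   unfolding z_ws using ws' closed[OF C(1)] Ccar by (intro evaluate[OF C(1) w]) auto
  also have "... = lsum C (%p. e (fst p \<triangleleft>\<^sub>W om (snd p \<odot>\<^sub>W w))) ws"
   using ws' w Ccar WL omD eD by (intro lsum_cong) (auto simp: key[OF C(1)])
  also have "... = e (lsum W (%p. fst p \<triangleleft>\<^sub>W om (snd p \<odot>\<^sub>W w)) ws)"
   using ws' w WL WR omD rmodD(2)[OF C(1)]
   add_lsum[OF rmod_homD(1)[OF e_hom], of ws "%p. fst p \<triangleleft>\<^sub>W om (snd p \<odot>\<^sub>W w)"] by auto
  finally have "e w = e (lsum W (%p. fst p \<triangleleft>\<^sub>W om (snd p \<odot>\<^sub>W w)) ws)" .
  moreover have "lsum W (%p. fst p \<triangleleft>\<^sub>W om (snd p \<odot>\<^sub>W w)) ws \<in>. W"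
   using w ws' WL WR omD by (intro lsum_closed) auto
  ultimately show ?thesis using inj_onD[OF e] w by metis
 qed
 have sum_S: "lsum S (%p. i (om (t \<odot>\<^sub>W fst p)) \<otimes>\<^sub>S snd p) ws = t" if t: "t \<in>. S" for t
 proof -
  interpret T: tensor R RR SB "?T RR" "?p RR" by (rule tensor_rmod(1)[OF RR SB])
  let ?y = "lsum (?T RR) (%p. ?p RR (om (t \<odot>\<^sub>W fst p)) (snd p)) ws"
  have y: "?y \<in>. (?T RR)"
   using ws' t WL omD by (intro lsum_closed T_ag RR closed) auto
  have "tt RR ?y = tt RR (?p RR \<one>\<^sub>R t)"
  proof (rule extensionalityI[of _ "carrier W"])
   show "tt RR ?y \<in> extensional (carrier W)" "tt RR (?p RR \<one>\<^sub>R t) \<in> extensional (carrier W)"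
   using tt_car[OF RR y] tt_car[OF RR closed[OF RR t, of "\<one>\<^sub>R"]] RS by auto
   fix w assume w: "w \<in>. W"
   have "tt RR ?y w = lsum R (%p. tt RR (?p RR (om (t \<odot>\<^sub>W fst p)) (snd p)) w) ws"
   using ws' t WL omD closed[OF RR] by (subst evaluate[OF RR w]) auto
   also have "... = lsum R (%p. om ((t \<odot>\<^sub>W fst p) \<triangleleft>\<^sub>W om (snd p \<odot>\<^sub>W w))) ws"
   using ws' w WL omD t by (intro lsum_cong) (auto simp: key[OF RR])
   also have "... = om (lsum W (%p. t \<odot>\<^sub>W (fst p \<triangleleft>\<^sub>W om (snd p \<odot>\<^sub>W w))) ws)"
   using ws' w WL WR WB(3) omD t by (subst add_lsum[OF omD(5)]) (auto intro!: lsum_cong)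
   also have "... = om (t \<odot>\<^sub>W lsum W (%p. fst p \<triangleleft>\<^sub>W om (snd p \<odot>\<^sub>W w)) ws)"
   using ws' w WL WR omD t iD SS by (subst bimodule_left_lsum(1)[OF W]) auto
   also have "... = tt RR (?p RR \<one>\<^sub>R t) w" using t w by (simp add: sum_W shift)
   finally show "tt RR ?y w = tt RR (?p RR \<one>\<^sub>R t) w" .
  qed
  then have eq: "?y = ?p RR \<one>\<^sub>R t"
   using tt[OF RR] y closed[OF RR t, of "\<one>\<^sub>R"] RS by (auto simp: rmod_iso_def bij_betw_def inj_on_def)
  have "balanced R RR SB S (%r s. i r \<otimes>\<^sub>S s)"
   using iD SS ring_distrib[OF S] by (intro balancedI) auto
  note lift = T.tlift[OF ag(2) this]
  have "tlift RR SB (?T RR) (?p RR) S (%r s. i r \<otimes>\<^sub>S s) ?y = lsum S (%p. i (om (t \<odot>\<^sub>W fst p)) \<otimes>\<^sub>S snd p) ws"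
   using ws' t WL omD closed[OF RR] lift(2) by (subst add_lsum[OF lift(1) T.T_abelian]) (auto intro!: lsum_cong)
  moreover have "tlift RR SB (?T RR) (?p RR) S (%r s. i r \<otimes>\<^sub>S s) (?p RR \<one>\<^sub>R t) = t"
   using t SS iD RS lift(2) by auto
  ultimately show ?thesis unfolding eq by simp
 qed
 show ?thesis
  using ws om_hom sum_S sum_W by (intro exI[of _ ws] exI[of _ om]) (simp add: dual_system_def)
qed

section \<open>Central elements\<close>

text \<open>Both \<open>t z\<close> and \<open>z t\<close> equal \<open>\<Sum> w\<^sub>k \<otimes> om (s\<^sub>k t w\<^sub>j) s\<^sub>j\<close>: expand \<open>t w\<^sub>j\<close> by the second identity, or \<open>s\<^sub>k t\<close> by the first.\<close>

lemma (in dual) casimir_central: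
 defines "z \<equiv> lsum (tensor_bimod R W SB) (%p. ptens R (rpart W) SB (fst p) (snd p)) ws"
 shows "z \<in> centralizer S (tensor_bimod R W SB)"
proof -
 let ?T = "tensor_bimod R W SB" and ?p = "ptens R (rpart W) SB"
 note TB = tensor_bimod[OF W SB]
 interpret T: tensor R "rpart W" SB ?T ?p by (rule TB(1))
 note [simp] = T.T_abelian
 have z: "z \<in>. ?T" unfolding z_def using ws T.closed by auto
 moreover have "t \<odot>\<^sub>?T z = z \<triangleleft>\<^sub>?T t" if t: "t \<in>. S" for t
 proof -
  have "t \<odot>\<^sub>?T z = lsum ?T (%p. ?p (t \<odot>\<^sub>W fst p) (snd p)) ws"
   unfolding z_def using t ws T.closed
   by (subst bimodule_left_lsum(1)[OF TB(2)]) (auto intro!: lsum_cong simp: TB(3))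
  also have "... = lsum ?T (%p. lsum ?T (%q. ?p (fst q) (i (om (snd q \<odot>\<^sub>W (t \<odot>\<^sub>W fst p))) \<otimes>\<^sub>S snd p)) ws) ws"
  proof (rule lsum_cong[OF refl])
   fix p assume p: "p \<in> set ws"
   have "?p (t \<odot>\<^sub>W fst p) (snd p) = ?p (lsum W (%q. fst q \<triangleleft>\<^sub>W om (snd q \<odot>\<^sub>W (t \<odot>\<^sub>W fst p))) ws) (snd p)"
   using sum_W t ws[OF p] WL by simp
   also have "... = lsum ?T (%q. ?p (fst q \<triangleleft>\<^sub>W om (snd q \<odot>\<^sub>W (t \<odot>\<^sub>W fst p))) (snd p)) ws"
   using t ws ws[OF p] WL WR omegaD by (subst T.lsum_left[simplified]) auto
   also have "... = lsum ?T (%q. ?p (fst q) (i (om (snd q \<odot>\<^sub>W (t \<odot>\<^sub>W fst p))) \<otimes>\<^sub>S snd p)) ws"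
   using t ws ws[OF p] WL WR omegaD by (intro lsum_cong) (auto simp: T.move[simplified])
   finally show "?p (t \<odot>\<^sub>W fst p) (snd p) =
   lsum ?T (%q. ?p (fst q) (i (om (snd q \<odot>\<^sub>W (t \<odot>\<^sub>W fst p))) \<otimes>\<^sub>S snd p)) ws" .
  qed
  also have "... = lsum ?T (%q. lsum ?T (%p. ?p (fst q) (i (om ((snd q \<otimes>\<^sub>S t) \<odot>\<^sub>W fst p)) \<otimes>\<^sub>S snd p)) ws) ws"
   using t ws WL omegaD iD SS T.closed by (subst lsum_swap) (auto intro!: lsum_cong)
  also have "... = lsum ?T (%q. ?p (fst q) (lsum S (%p. i (om ((snd q \<otimes>\<^sub>S t) \<odot>\<^sub>W fst p)) \<otimes>\<^sub>S snd p) ws)) ws"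
  proof (rule lsum_cong[OF refl])
   fix q assume q: "q \<in> set ws"
   show "lsum ?T (%p. ?p (fst q) (i (om ((snd q \<otimes>\<^sub>S t) \<odot>\<^sub>W fst p)) \<otimes>\<^sub>S snd p)) ws =
   ?p (fst q) (lsum S (%p. i (om ((snd q \<otimes>\<^sub>S t) \<odot>\<^sub>W fst p)) \<otimes>\<^sub>S snd p) ws)"
   using q t ws WL omegaD iD SS by (intro T.lsum_right[simplified, symmetric]) auto
  qed
  also have "... = lsum ?T (%q. ?p (fst q) (snd q \<otimes>\<^sub>S t)) ws"
   using t ws SS by (intro lsum_cong) (auto simp: sum_S)
  also have "... = z \<triangleleft>\<^sub>?T t"
   unfolding z_def using t ws T.closed
   by (subst bimodule_right_lsum(1)[OF TB(2)]) (auto intro!: lsum_cong simp: TB(4))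
  finally show ?thesis .
 qed
 ultimately show ?thesis by (simp add: centralizer_def)
qed

text \<open>The map \<open>w \<otimes> s \<mapsto> om(w) s\<close> is applied to \<open>t z = z t\<close>.\<close>

lemma (in extension) sum_of_central:
 assumes ws: "set ws \<subseteq> carrier W \<times> carrier S"
  and om: "om \<in> bimod_hom R R (restrict_bimod i (%r. r) W) (regular R)"
  and central: "lsum (tensor_bimod R W SB) (%p. ptens R (rpart W) SB (fst p) (snd p)) ws
   \<in> centralizer S (tensor_bimod R W SB)"
  and one: "lsum S (%p. i (om (fst p)) \<otimes>\<^sub>S snd p) ws = \<one>\<^sub>S" and t: "t \<in>. S"
 shows "lsum S (%p. i (om (t \<odot>\<^sub>W fst p)) \<otimes>\<^sub>S snd p) ws = t"
proof -
 let ?T = "tensor_bimod R W SB" and ?p = "ptens R (rpart W) SB"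
 let ?z = "lsum ?T (%p. ?p (fst p) (snd p)) ws"
 note TB = tensor_bimod[OF W SB] and omD = omega_homD[OF om]
 have ws': "fst p \<in>. W" "snd p \<in>. S" if "p \<in> set ws" for p using ws that by auto
 interpret T: tensor R "rpart W" SB ?T ?p by (rule TB(1))
 note [simp] = T.T_abelian
 have "balanced R (rpart W) SB S (%w s. i (om w) \<otimes>\<^sub>S s)"
  using omD iD SS ring_distrib[OF S] by (intro balancedI) auto
 note E = T.tlift[OF ag(2) this, simplified]
 let ?E = "tlift (rpart W) SB ?T ?p S (%w s. i (om w) \<otimes>\<^sub>S s)"
 have E_lsum: "?E (lsum ?T f ws) = lsum S (%p. ?E (f p)) ws" if "!!p. p \<in> set ws ==> f p \<in>. ?T" for f
  by (rule add_lsum) (use E that in auto)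
 have "lsum S (%p. i (om (t \<odot>\<^sub>W fst p)) \<otimes>\<^sub>S snd p) ws = ?E (lsum ?T (%p. ?p (t \<odot>\<^sub>W fst p) (snd p)) ws)"
  using ws' t WL T.closed by (subst E_lsum) (auto intro!: lsum_cong simp: E)
 also have "lsum ?T (%p. ?p (t \<odot>\<^sub>W fst p) (snd p)) ws = t \<odot>\<^sub>?T ?z"
  using t ws' T.closed by (subst bimodule_left_lsum(1)[OF TB(2)]) (auto intro!: lsum_cong simp: TB(3))
 also have "... = ?z \<triangleleft>\<^sub>?T t" using central t by (simp add: centralizer_def)
 also have "... = lsum ?T (%p. ?p (fst p) (snd p \<otimes>\<^sub>S t)) ws"
  using t ws' T.closed by (subst bimodule_right_lsum(1)[OF TB(2)]) (auto intro!: lsum_cong simp: TB(4))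
 also have "?E ... = lsum S (%p. (i (om (fst p)) \<otimes>\<^sub>S snd p) \<otimes>\<^sub>S t) ws"
  using ws' t SS omD iD T.closed by (subst E_lsum) (auto intro!: lsum_cong simp: E)
 also have "... = lsum S (%p. i (om (fst p)) \<otimes>\<^sub>S snd p) ws \<otimes>\<^sub>S t"
  using ws' t SS omD iD bimodule_right_lsum(1)[OF SB, of t ws "%p. i (om (fst p)) \<otimes>\<^sub>S snd p"] by auto
 finally show ?thesis using t SS by (simp add: one)
qed

section \<open>Dual bases\<close>

definition dual_basis_left ::
 "('r, 'a) ring_scheme => ('r, 'm, 'z) module_scheme => ('m \<times> ('m => 'r)) list => bool" where
 "dual_basis_left R P bs \<longleftrightarrow> set bs \<subseteq> carrier P \<times> lhom R P (regular R) \<and>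
   (\<forall>x\<in>carrier P. lsum P (%b. snd b x \<odot>\<^sub>P fst b) bs = x)"

definition dual_basis_right ::
 "('r, 'a) ring_scheme => ('r, 'm, 'z) rmodule_scheme => ('m \<times> ('m => 'r)) list => bool" where
 "dual_basis_right R P bs \<longleftrightarrow> set bs \<subseteq> carrier P \<times> rhom R P (rpart (regular R)) \<and>
   (\<forall>x\<in>carrier P. lsum P (%b. fst b \<star>\<^sub>P snd b x) bs = x)"

lemma finsum_set_conv_lsum:
 assumes "abelian_group M" "distinct xs" "f \<in> set xs \<rightarrow> carrier M"
 shows "(\<Oplus>\<^bsub>M\<^esub>x\<in>set xs. f x) = lsum M f xs"
 using assms(2,3)
proof (induction xs)
 case Nil
 then show ?case by (simp add: assms(1) abelian_group.axioms abelian_monoid.finsum_empty)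
next
 case (Cons x xs)
 then show ?case
  using assms(1) by (simp add: abelian_monoid.finsum_insert[OF abelian_group.axioms(1)] Pi_def)
qed

lemma fin_gen_left_of_dual_basis:
 fixes R :: "('r, 'a) ring_scheme" and P :: "('r, 'm, 'z) module_scheme"
 assumes P: "lmod R P" and bs: "dual_basis_left R P bs"
 shows "fin_gen_left R P"
proof -
 define E where "E = fst ` set bs"
 note PD = lmodD[OF P] and am = abelian_group.axioms(1)[OF lmodD(2)[OF P]]
 have E: "E \<subseteq> carrier P" using bs by (auto simp: dual_basis_left_def E_def)
 have fin: "finite E" by (simp add: E_def)
 define A where "A = {m. \<exists>c\<in>E \<rightarrow> carrier R. m = (\<Oplus>\<^bsub>P\<^esub>x\<in>E. c x \<odot>\<^sub>P x)}"
 have zero: "\<zero>\<^sub>P \<in> A" unfolding A_def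
 proof (intro CollectI bexI)
  have "(\<Oplus>\<^bsub>P\<^esub>x\<in>E. \<zero>\<^sub>R \<odot>\<^sub>P x) = (\<Oplus>\<^bsub>P\<^esub>x\<in>E. \<zero>\<^sub>P)"
   using E PD left_module_lsum(4)[OF P] by (intro abelian_monoid.finsum_cong'[OF am]) auto
  then show "\<zero>\<^sub>P = (\<Oplus>\<^bsub>P\<^esub>x\<in>E. \<zero>\<^sub>R \<odot>\<^sub>P x)"
   by (simp add: abelian_monoid.finsum_zero[OF am])
 qed (use PD in auto)
 have add: "x \<oplus>\<^sub>P y \<in> A" if xy: "x \<in> A" "y \<in> A" for x y
 proof -
  obtain c d where c: "c \<in> E \<rightarrow> carrier R" "x = (\<Oplus>\<^bsub>P\<^esub>x\<in>E. c x \<odot>\<^sub>P x)"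
   and d: "d \<in> E \<rightarrow> carrier R" "y = (\<Oplus>\<^bsub>P\<^esub>x\<in>E. d x \<odot>\<^sub>P x)"
   using xy by (auto simp: A_def)
  have "(\<Oplus>\<^bsub>P\<^esub>x\<in>E. (c x \<oplus>\<^sub>R d x) \<odot>\<^sub>P x) = (\<Oplus>\<^bsub>P\<^esub>x\<in>E. c x \<odot>\<^sub>P x \<oplus>\<^sub>P d x \<odot>\<^sub>P x)"
   using E PD c d by (intro abelian_monoid.finsum_cong'[OF am]) (auto simp: Pi_def subset_iff)
  also have "... = x \<oplus>\<^sub>P y"
   unfolding c(2) d(2) using E PD c d by (intro abelian_monoid.finsum_addf[OF am]) (auto simp: Pi_def subset_iff)
  finally show ?thesis
   unfolding A_def using c d PD by (intro CollectI bexI[of _ "%x. c x \<oplus>\<^sub>R d x"]) (auto simp: Pi_def)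
 qed
 have scale: "r \<odot>\<^sub>P x \<in> A" if "r \<in>. R" "x \<in> E" for r x
 proof -
  have "(\<Oplus>\<^bsub>P\<^esub>y\<in>E. (if x = y then r else \<zero>\<^sub>R) \<odot>\<^sub>P y) = (\<Oplus>\<^bsub>P\<^esub>y\<in>E. if x = y then r \<odot>\<^sub>P y else \<zero>\<^sub>P)"
   using E PD that left_module_lsum(4)[OF P] by (intro abelian_monoid.finsum_cong'[OF am]) auto
  also have "... = r \<odot>\<^sub>P x"
   using E PD that fin by (intro abelian_monoid.finsum_singleton[OF am]) auto
  finally show ?thesis
   unfolding A_def using that PD by (intro CollectI bexI[of _ "%y. if x = y then r else \<zero>\<^sub>R"]) auto
 qed
 have lsum_A: "lsum P f xs \<in> A" if "!!x. x \<in> set xs ==> f x \<in> A" for f and xs :: "('m \<times> ('m => 'r)) list"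
  using that by (induction xs) (auto intro: zero add)
 have "\<exists>c\<in>E \<rightarrow> carrier R. m = (\<Oplus>\<^bsub>P\<^esub>x\<in>E. c x \<odot>\<^sub>P x)" if m: "m \<in>. P" for m
 proof -
  have "lsum P (%b. snd b m \<odot>\<^sub>P fst b) bs \<in> A"
   using bs m by (intro lsum_A scale) (auto simp: dual_basis_left_def E_def dest!: lhomD(2))
  then show ?thesis using bs m by (simp add: dual_basis_left_def A_def)
 qed
 with E fin show ?thesis unfolding fin_gen_left_def by blast
qed

lemma projective_left_of_dual_basis:
 fixes R :: "('r, 'a) ring_scheme" and P :: "('r, 'm, 'z) module_scheme"
 assumes P: "lmod R P" and bs: "dual_basis_left R P bs"
 shows "projective_left R P"
 unfolding projective_left_def
proof (intro allI impI ballI)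
 fix M N :: "('r, 'm) module" and e h
 assume "lmod R M \<and> lmod R N"
  and e: "e \<in> lhom R M N" and h: "h \<in> lhom R P N" and surj: "e ` carrier M = carrier N"
 then have M: "lmod R M" and N: "lmod R N" by auto
 note PD = lmodD[OF P] and MD = lmodD[OF M] and ND = lmodD[OF N] and hD = lhomD[OF h] and eD = lhomD[OF e]
 have b: "fst b \<in>. P" "snd b \<in> lhom R P (regular R)" if "b \<in> set bs" for b
  using bs that by (auto simp: dual_basis_left_def)
 note sD = lhomD[OF b(2), simplified]
 define g where "g b = inv_into (carrier M) e (h (fst b))" for b :: "'m \<times> ('m => 'r)"
 have g: "g b \<in>. M" "e (g b) = h (fst b)" if "b \<in> set bs" for b
  using surj hD(2)[OF b(1)[OF that]] by (auto simp: g_def f_inv_into_f inv_into_into)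
 define k where "k x = lsum M (%b. snd b x \<odot>\<^sub>M g b) bs" for x
 have "k \<in> lhom R P M"
 proof (rule lhomI)
  show "k \<in> add_homs P M" unfolding k_def
  proof (rule add_homs_lsum_pointwise[OF _ MD(2) PD(2)])
   fix b assume "b \<in> set bs"
   then show "(%x. snd b x \<odot>\<^sub>M g b) \<in> add_homs P M"
   using sD g MD PD by (intro addI) auto
  qed
  show "k (r \<odot>\<^sub>P x) = r \<odot>\<^sub>M k x" if "r \<in>. R" "x \<in>. P" for r x
   unfolding k_def using that sD g MD PD by (subst left_module_lsum(1)[OF M]) (simp_all cong: lsum_cong)
 qed
 moreover have "e (k x) = h x" if x: "x \<in>. P" for x
 proof -
  have "e (k x) = lsum N (%b. h (snd b x \<odot>\<^sub>P fst b)) bs"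
   unfolding k_def using x sD g MD ND b eD hD by (subst add_lsum[OF eD(1)]) (auto intro!: lsum_cong)
  also have "... = h (lsum P (%b. snd b x \<odot>\<^sub>P fst b) bs)"
   using x sD PD ND b by (subst add_lsum[OF hD(1)]) auto
  finally show ?thesis using bs x by (simp add: dual_basis_left_def)
 qed
 ultimately show "\<exists>k\<in>lhom R P M. \<forall>x\<in>carrier P. e (k x) = h x" by auto
qed

definition free_lmod :: "('r, 'a) ring_scheme => 'b set => ('r, 'b => 'r) module" where
 "free_lmod R D = \<lparr>carrier = D \<rightarrow>\<^sub>E carrier R, monoid.mult = undefined, one = undefined,
   ring.zero = (\<lambda>x\<in>D. \<zero>\<^sub>R), ring.add = (%f g. \<lambda>x\<in>D. f x \<oplus>\<^sub>R g x), smult = (%r f. \<lambda>x\<in>D. r \<otimes>\<^sub>R f x)\<rparr>"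

lemma free_lmod_module:
 assumes R: "ring R"
 shows "lmod R (free_lmod R D)"
proof (rule left_moduleI[OF R])
 show "abelian_group (free_lmod R D)"
  by (rule pointwise_abelian_group[of R, where D = D]) (use R in \<open>auto simp: free_lmod_def PiE_def Pi_def\<close>)
qed (use R ring_simps[OF R] ring_distrib[OF R] in \<open>auto simp: free_lmod_def restrict_def fun_eq_iff PiE_def extensional_def Pi_def\<close>)

lemma lmod_iso_inv:
 assumes M: "lmod R M" and e: "e \<in> lmod_iso R M N"
 shows "inv_into (carrier M) e \<in> lmod_iso R N M"
proof -
 have eh: "e \<in> lhom R M N" and bij: "bij_betw e (carrier M) (carrier N)" using e by (auto simp: lmod_iso_def)
 note eD = lhomD[OF eh] and MD = lmodD[OF M]
 let ?d = "inv_into (carrier M) e"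
 have inj: "inj_on e (carrier M)" and im: "e ` carrier M = carrier N" using bij by (auto simp: bij_betw_def)
 have d: "?d (e x) = x" if "x \<in>. M" for x using inj that by simp
 have N: "\<exists>x\<in>carrier M. y = e x" if "y \<in>. N" for y using im that by auto
 have "?d (y \<oplus>\<^sub>N y') = ?d y \<oplus>\<^sub>M ?d y'" if "y \<in>. N" "y' \<in>. N" for y y'
  using N[OF that(1)] N[OF that(2)] MD by (auto simp: d simp flip: eD(3))
 moreover have "?d (r \<odot>\<^sub>N y) = r \<odot>\<^sub>M ?d y" if "y \<in>. N" "r \<in>. R" for y r
  using N[OF that(1)] that MD by (auto simp: d simp flip: eD(4))
 moreover have "?d y \<in>. M" if "y \<in>. N" for y using N[OF that] by (auto simp: d)
 ultimately show ?thesis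
  using bij_betw_inv_into[OF bij] by (auto simp: lmod_iso_def intro!: lhomI addI)
qed

lemma lists_lepoll: "(UNIV :: 'u list set) \<lesssim> (UNIV :: 'u::infinite set)"
proof -
 have "|lists (UNIV :: 'u set)| =o |UNIV :: 'u set|"
  by (rule card_of_lists_infinite) (rule infinite_UNIV)
 then have "lists (UNIV :: 'u set) \<approx> (UNIV :: 'u set)" by (simp add: eqpoll_iff_card_of_ordIso)
 then show ?thesis by (simp add: lists_UNIV eqpoll_imp_lepoll)
qed

text \<open>A free module onto \<open>P\<close> splits. Projectivity lifts only along maps within the universe, which contains a copy of a free module of finite rank because it is infinite.\<close>

lemma dual_basis_left_exists:
 fixes R :: "('u::infinite, 'a) ring_scheme" and P :: "('u, 'u, 'z) module_scheme"
 assumes P: "lmod R P" and fg: "fin_gen_left R P" and proj: "projective_left R P"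
 shows "\<exists>bs. dual_basis_left R P bs"
proof -
 note PD = lmodD[OF P]
 obtain E where E: "finite E" "E \<subseteq> carrier P"
  and gen: "!!m. m \<in>. P ==> \<exists>c\<in>E \<rightarrow> carrier R. m = (\<Oplus>\<^bsub>P\<^esub>x\<in>E. c x \<odot>\<^sub>P x)"
  using fg by (auto simp: fin_gen_left_def)
 obtain xs where xs: "set xs = E" "distinct xs" using finite_distinct_list[OF E(1)] by auto
 let ?F = "free_lmod R E"
 have F: "lmod R ?F" by (rule free_lmod_module[OF PD(1)])
 have Fcar: "carrier ?F = E \<rightarrow>\<^sub>E carrier R" by (simp add: free_lmod_def)
 have "inj_on (%f. map f xs) (carrier ?F)"
  using xs(1) by (intro inj_onI extensionalityI[of _ E]) (auto simp: Fcar PiE_def)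
 then have "carrier ?F \<lesssim> (UNIV :: 'u list set)"
  unfolding lepoll_def by (intro exI[of _ "%f. map f xs"]) auto
 then have "carrier ?F \<lesssim> (UNIV :: 'u set)" using lists_lepoll lepoll_trans by blast
 note inj = universe_inj_inj[OF this]
 define C :: "('u, 'u) module" where "C = universe_copy ?F"
 define u where "u = (universe_inj ?F :: _ => 'u)"
 note cp = universe_copy_module[OF F inj, folded C_def u_def]
 define d where "d = inv_into (carrier ?F) u"
 have d_iso: "d \<in> lmod_iso R C ?F" unfolding d_def by (rule lmod_iso_inv[OF F cp(2)])
 then have d: "d \<in> lhom R C ?F" and d_surj: "d ` carrier C = carrier ?F" by (auto simp: lmod_iso_def bij_betw_def)
 define \<pi> where "\<pi> f = lsum P (%x. f x \<odot>\<^sub>P x) xs" for f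
 have \<pi>: "\<pi> \<in> lhom R ?F P"
 proof (rule lhomI)
  show "\<pi> \<in> add_homs ?F P" unfolding \<pi>_def
  proof (rule add_homs_lsum_pointwise[OF _ PD(2) lmodD(2)[OF F]])
   fix x assume "x \<in> set xs"
   then show "(%f. f x \<odot>\<^sub>P x) \<in> add_homs ?F P"
   using PD xs E by (intro addI) (auto simp: free_lmod_def PiE_def Pi_def)
  qed
  show "\<pi> (r \<odot>\<^sub>?F f) = r \<odot>\<^sub>P \<pi> f" if "r \<in>. R" "f \<in>. ?F" for r f
   unfolding \<pi>_def using that xs E PD
   by (subst left_module_lsum(1)[OF P]) (auto simp: free_lmod_def PiE_def Pi_def intro!: lsum_cong)
 qed
 have "m \<in> \<pi> ` carrier ?F" if m: "m \<in>. P" for m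
 proof -
  obtain c where c: "c \<in> E \<rightarrow> carrier R" "m = (\<Oplus>\<^bsub>P\<^esub>x\<in>E. c x \<odot>\<^sub>P x)" using gen[OF m] by auto
  have "(\<Oplus>\<^bsub>P\<^esub>x\<in>set xs. c x \<odot>\<^sub>P x) = lsum P (%x. c x \<odot>\<^sub>P x) xs"
   using c xs E PD by (intro finsum_set_conv_lsum) auto
  then have "m = lsum P (%x. c x \<odot>\<^sub>P x) xs" using c(2) xs by simp
  also have "... = \<pi> (restrict c E)" unfolding \<pi>_def using xs by (intro lsum_cong) auto
  finally show ?thesis using c(1) by (auto simp: Fcar)
 qed
 then have "(%x. \<pi> (d x)) ` carrier C = carrier (lmod_of P)"
  using d_surj lhomD(2)[OF \<pi>] by (auto simp: image_image[symmetric])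
 moreover have "(%x. \<pi> (d x)) \<in> lhom R C (lmod_of P)"
  using lhom_comp[OF d \<pi>] by simp
 moreover have "(%x. x) \<in> lhom R P (lmod_of P)" using lmod_hom_id by simp
 ultimately obtain k where k: "k \<in> lhom R P C" "!!x. x \<in>. P ==> \<pi> (d (k x)) = x"
  using proj cp(1) lmod_of_module[OF P] unfolding projective_left_def by meson
 have dk: "(%p. d (k p)) \<in> lhom R P ?F" by (rule lhom_comp[OF k(1) d])
 have coord: "(%p. d (k p) x) \<in> lhom R P (regular R)" if "x \<in> E" for x
 proof -
  have "(%f. f x) \<in> lhom R ?F (regular R)"
   using that by (auto simp: lmod_hom_def hom_def free_lmod_def PiE_def Pi_def)
  from lhom_comp[OF dk this] show ?thesis .
 qed
 have "dual_basis_left R P (map (%x. (x, %p. d (k p) x)) xs)"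
  unfolding dual_basis_left_def
  using coord xs E k(2) by (auto simp: lsum_map \<pi>_def)
 then show ?thesis by blast
qed

theorem fin_gen_projective_left_iff:
 fixes R :: "('u::infinite, 'a) ring_scheme" and P :: "('u, 'u, 'z) module_scheme"
 assumes "lmod R P"
 shows "fin_gen_left R P \<and> projective_left R P \<longleftrightarrow> (\<exists>bs. dual_basis_left R P bs)"
 using assms dual_basis_left_exists fin_gen_left_of_dual_basis projective_left_of_dual_basis by metis

subsection \<open>Right modules as left modules over the opposite ring\<close>

definition op_ring :: "('r, 'a) ring_scheme => 'r ring" where
 "op_ring R = \<lparr>carrier = carrier R, monoid.mult = (%x y. y \<otimes>\<^sub>R x), one = \<one>\<^sub>R, ring.zero = \<zero>\<^sub>R, ring.add = ring.add R\<rparr>"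

definition flip :: "('r, 'm, 'z) rmodule_scheme => ('r, 'm) module" where
 "flip M = \<lparr>carrier = carrier M, monoid.mult = monoid.mult M, one = one M, ring.zero = \<zero>\<^sub>M, ring.add = ring.add M,
   smult = (%r x. x \<star>\<^sub>M r)\<rparr>"

definition unflip :: "('r, 'm) module => ('r, 'm) rmodule" where
 "unflip M = \<lparr>carrier = carrier M, monoid.mult = monoid.mult M, one = one M, ring.zero = \<zero>\<^sub>M, ring.add = ring.add M,
   rsmult = (%x r. r \<odot>\<^sub>M x)\<rparr>"

lemma op_simps [simp]:
 "carrier (op_ring R) = carrier R" "x \<otimes>\<^sub>(op_ring R) y = y \<otimes>\<^sub>R x" "\<one>\<^sub>(op_ring R) = \<one>\<^sub>R" "\<zero>\<^sub>(op_ring R) = \<zero>\<^sub>R"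
 "x \<oplus>\<^sub>(op_ring R) y = x \<oplus>\<^sub>R y"
 "carrier (flip M) = carrier M" "\<zero>\<^sub>(flip M) = \<zero>\<^sub>M" "u \<oplus>\<^sub>(flip M) v = u \<oplus>\<^sub>M v" "r \<odot>\<^sub>(flip M) u = u \<star>\<^sub>M r"
 "carrier (unflip N) = carrier N" "\<zero>\<^sub>(unflip N) = \<zero>\<^sub>N" "p \<oplus>\<^sub>(unflip N) q = p \<oplus>\<^sub>N q" "p \<star>\<^sub>(unflip N) r = r \<odot>\<^sub>N p"
 by (auto simp: op_ring_def flip_def unflip_def)

lemma flip_unflip: "flip (unflip M) = M" "unflip (flip N) = N"
 by (auto simp: flip_def unflip_def)

lemma ring_op_ring:
 assumes "ring R" shows "ring (op_ring R)"
proof (rule ringI)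
 show "abelian_group (op_ring R)" using abelian_group_cong[of R "op_ring R"] assms by simp
 show "monoid (op_ring R)" using ring_simps[OF assms] by (intro monoidI) auto
qed (use ring_distrib[OF assms] in auto)

lemma left_module_flip:
 assumes "rmod R M" shows "lmod (op_ring R) (flip M)"
 using rmodD[OF assms] abelian_group_cong[of M "flip M"] ring_op_ring by (intro left_moduleI) auto

lemma right_module_unflip:
 assumes "ring R" "lmod (op_ring R) M" shows "rmod R (unflip M)"
 using lmodD[OF assms(2)] abelian_group_cong[of M "unflip M"] assms(1) by (intro right_moduleI) auto

lemma lmod_hom_flip: "lhom (op_ring R) (flip M) (flip N) = rhom R M N"
 by (auto simp: lmod_hom_def rmod_hom_def hom_def)

lemma projective_right_iff:
 fixes P :: "('r, 'm, 'z) rmodule_scheme"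
 assumes "ring R"
 shows "projective_right R P \<longleftrightarrow> projective_left (op_ring R) (flip P)"
proof
 assume L: "projective_right R P"
 show "projective_left (op_ring R) (flip P)" unfolding projective_left_def
 proof (intro allI impI ballI)
  fix M N :: "('r, 'm) module" and e h
  assume MN: "lmod (op_ring R) M \<and> lmod (op_ring R) N"
   and eh: "e \<in> lhom (op_ring R) M N" "h \<in> lhom (op_ring R) (flip P) N" "e ` carrier M = carrier N"
  have "e \<in> rhom R (unflip M) (unflip N)" "h \<in> rhom R P (unflip N)"
   using eh by (simp_all add: lmod_hom_flip[symmetric] flip_unflip)
  then have "\<exists>k\<in>rhom R P (unflip M). \<forall>x\<in>carrier P. e (k x) = h x"
   using L[unfolded projective_right_def, rule_format, of "unflip M" "unflip N" e h] eh(3)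
   right_module_unflip[OF assms conjunct1[OF MN]] right_module_unflip[OF assms conjunct2[OF MN]] by simp
  then show "\<exists>k\<in>lhom (op_ring R) (flip P) M. \<forall>x\<in>carrier (flip P). e (k x) = h x"
   by (simp add: lmod_hom_flip[symmetric] flip_unflip)
 qed
next
 assume L: "projective_left (op_ring R) (flip P)"
 show "projective_right R P" unfolding projective_right_def
 proof (intro allI impI ballI)
  fix M N :: "('r, 'm) rmodule" and e h
  assume MN: "rmod R M \<and> rmod R N"
   and eh: "e \<in> rhom R M N" "h \<in> rhom R P N" "e ` carrier M = carrier N"
  have "\<exists>k\<in>lhom (op_ring R) (flip P) (flip M). \<forall>x\<in>carrier (flip P). e (k x) = h x"
   using L[unfolded projective_left_def, rule_format, of "flip M" "flip N" e h] eh
   left_module_flip[OF conjunct1[OF MN]] left_module_flip[OF conjunct2[OF MN]] by (simp add: lmod_hom_flip)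
  then show "\<exists>k\<in>rhom R P M. \<forall>x\<in>carrier P. e (k x) = h x" by (simp add: lmod_hom_flip)
 qed
qed

lemma lsum_flip [simp]: "lsum (flip M) f xs = lsum M f xs"
 by (induction xs) auto

lemma dual_basis_right_iff: "dual_basis_right R P bs \<longleftrightarrow> dual_basis_left (op_ring R) (flip P) bs"
proof -
 have "lhom (op_ring R) (flip P) (regular (op_ring R)) = rhom R P (rpart (regular R))"
  by (auto simp: lmod_hom_def rmod_hom_def hom_def)
 then show ?thesis by (simp add: dual_basis_left_def dual_basis_right_def)
qed

lemma fin_gen_right_iff:
 assumes P: "rmod R P"
 shows "fin_gen_right R P \<longleftrightarrow> fin_gen_left (op_ring R) (flip P)"
proof -
 note PD = rmodD[OF P] and FD = lmodD[OF left_module_flip[OF P]]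
 have "(\<Oplus>\<^bsub>flip P\<^esub>x\<in>E. x \<star>\<^sub>P c x) = (\<Oplus>\<^bsub>P\<^esub>x\<in>E. x \<star>\<^sub>P c x)"
  if E: "finite E" "E \<subseteq> carrier P" "c \<in> E \<rightarrow> carrier R" for E c
 proof -
  obtain xs where xs: "set xs = E" "distinct xs" using finite_distinct_list[OF E(1)] by auto
  have closed: "(%x. x \<star>\<^sub>P c x) \<in> set xs \<rightarrow> carrier P"
   using E xs PD by (auto simp: Pi_def)
  show ?thesis
   using finsum_set_conv_lsum[OF PD(2) xs(2) closed] finsum_set_conv_lsum[OF FD(2) xs(2)] closed xs(1) by simp
 qed
 then show ?thesis unfolding fin_gen_right_def fin_gen_left_def by (simp cong: conj_cong bex_cong)
qed

theorem fin_gen_projective_right_iff: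
 fixes R :: "('u::infinite, 'a) ring_scheme" and P :: "('u, 'u, 'z) rmodule_scheme"
 assumes "rmod R P"
 shows "fin_gen_right R P \<and> projective_right R P \<longleftrightarrow> (\<exists>bs. dual_basis_right R P bs)"
 using fin_gen_projective_left_iff[OF left_module_flip[OF assms]] rmodD(1)[OF assms]
 by (simp add: fin_gen_right_iff[OF assms] projective_right_iff dual_basis_right_iff)

lemma lHom_bimod_simps [simp]:
 "carrier (lHom_bimod R B M) = lhom R B M \<inter> extensional (carrier B)"
 "\<zero>\<^sub>(lHom_bimod R B M) = (\<lambda>t\<in>carrier B. \<zero>\<^sub>M)" "f \<oplus>\<^sub>(lHom_bimod R B M) g = (\<lambda>t\<in>carrier B. f t \<oplus>\<^sub>M g t)"
 "s \<odot>\<^sub>(lHom_bimod R B M) f = (\<lambda>t\<in>carrier B. f (t \<triangleleft>\<^sub>B s))" "f \<triangleleft>\<^sub>(lHom_bimod R B M) r = (\<lambda>t\<in>carrier B. f t \<triangleleft>\<^sub>M r)"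
 by (auto simp: lHom_bimod_def)

lemma rHom_bimod_simps [simp]:
 "carrier (rHom_bimod R B M) = rhom R (rpart B) (rpart M) \<inter> extensional (carrier B)"
 "\<zero>\<^sub>(rHom_bimod R B M) = (\<lambda>t\<in>carrier B. \<zero>\<^sub>M)" "f \<oplus>\<^sub>(rHom_bimod R B M) g = (\<lambda>t\<in>carrier B. f t \<oplus>\<^sub>M g t)"
 "r \<odot>\<^sub>(rHom_bimod R B M) f = (\<lambda>t\<in>carrier B. r \<odot>\<^sub>M f t)" "f \<triangleleft>\<^sub>(rHom_bimod R B M) s = (\<lambda>t\<in>carrier B. f (s \<odot>\<^sub>B t))"
 by (auto simp: rHom_bimod_def)

lemma bimod_isoD:
 assumes "h \<in> bimod_iso L R M N"
 shows "h \<in> lhom L M N" "h \<in> rhom R (rpart M) (rpart N)" "bij_betw h (carrier M) (carrier N)"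
 using assms by (auto simp: bimod_iso_def bimod_hom_def)

context dual begin

lemma dual_basis_S: "dual_basis_left R SB (map (%p. (snd p, %t. om (t \<odot>\<^sub>W fst p))) ws)"
proof -
 have "(%t. om (t \<odot>\<^sub>W fst p)) \<in> lhom R SB (regular R)" if p: "p \<in> set ws" for p
 proof (rule lhomI)
  show "(%t. om (t \<odot>\<^sub>W fst p)) \<in> add_homs SB (regular R)"
   by (rule addI) (use ws[OF p] omegaD WL in auto)
 qed (use ws[OF p] omegaD WL iD in auto)
 then show ?thesis
  using ws by (auto simp: dual_basis_left_def lsum_map sum_S)
qed

lemma dual_basis_W: "dual_basis_right R (rpart W) (map (%p. (fst p, %w. om (snd p \<odot>\<^sub>W w))) ws)"
proof -
 have "(%w. om (snd p \<odot>\<^sub>W w)) \<in> rhom R (rpart W) (rpart (regular R))" if p: "p \<in> set ws" for p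
 proof (rule rmod_homI)
  show "(%w. om (snd p \<odot>\<^sub>W w)) \<in> add_homs (rpart W) (rpart (regular R))"
   by (rule addI) (use ws[OF p] omegaD WL in auto)
 qed (use ws[OF p] omegaD WL WR in \<open>auto simp flip: WB(3)\<close>)
 then show ?thesis
  using ws by (auto simp: dual_basis_right_def lsum_map sum_W)
qed

text \<open>The isomorphism is \<open>w \<mapsto> (t \<mapsto> om (t w))\<close>, with inverse \<open>h \<mapsto> \<Sum> w\<^sub>j h(s\<^sub>j)\<close>.\<close>

lemma lHom_iso: "bimod_iso S R W (lHom_bimod R SB (regular R)) \<noteq> {}"
proof -
 let ?L = "lHom_bimod R SB (regular R)"
 define \<Psi> where "\<Psi> w = (\<lambda>t\<in>carrier S. om (t \<odot>\<^sub>W w))" for w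
 have car: "\<Psi> w \<in>. ?L" if w: "w \<in>. W" for w
 proof -
  have "\<Psi> w \<in> lhom R SB (regular R)"
  proof (rule lhomI)
   show "\<Psi> w \<in> add_homs SB (regular R)"
   by (rule addI) (use w omegaD WL in \<open>auto simp: \<Psi>_def\<close>)
  qed (use w omegaD WL iD SS in \<open>auto simp: \<Psi>_def\<close>)
  then show ?thesis by (simp add: \<Psi>_def)
 qed
 have add: "\<Psi> (w \<oplus>\<^sub>W w') = \<Psi> w \<oplus>\<^sub>?L \<Psi> w'" if "w \<in>. W" "w' \<in>. W" for w w'
  using that omegaD WL by (auto simp: \<Psi>_def)
 have lin: "\<Psi> (s \<odot>\<^sub>W w) = s \<odot>\<^sub>?L \<Psi> w" if "s \<in>. S" "w \<in>. W" for s w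
  using that omegaD WL SS by (auto simp: \<Psi>_def)
 have rlin: "\<Psi> (w \<triangleleft>\<^sub>W r) = \<Psi> w \<triangleleft>\<^sub>?L r" if "r \<in>. R" "w \<in>. W" for r w
  using that omegaD WL WR SS by (auto simp: \<Psi>_def simp flip: WB(3))
 have "\<Psi> \<in> bimod_hom S R W ?L"
  unfolding bimod_hom_def
  by (intro IntI lhomI rmod_homI; (rule addI)?; use car add lin rlin in \<open>simp del: lHom_bimod_simps\<close>)
 moreover have "bij_betw \<Psi> (carrier W) (carrier ?L)"
 proof (rule bij_betw_byWitness[where f' = "%h. lsum W (%p. fst p \<triangleleft>\<^sub>W h (snd p)) ws"])
  show "\<forall>w\<in>carrier W. lsum W (%p. fst p \<triangleleft>\<^sub>W \<Psi> w (snd p)) ws = w"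
  proof
   fix w assume w: "w \<in>. W"
   have "lsum W (%p. fst p \<triangleleft>\<^sub>W \<Psi> w (snd p)) ws = lsum W (%p. fst p \<triangleleft>\<^sub>W om (snd p \<odot>\<^sub>W w)) ws"
   using ws by (intro lsum_cong) (auto simp: \<Psi>_def)
   then show "lsum W (%p. fst p \<triangleleft>\<^sub>W \<Psi> w (snd p)) ws = w" using w by (simp add: sum_W)
  qed
  have hD: "h \<in> add_homs SB (regular R)" "s \<in>. S ==> h s \<in>. R"
   "r \<in>. R ==> s \<in>. S ==> h (i r \<otimes>\<^sub>S s) = r \<otimes>\<^sub>R h s" if "h \<in>. ?L" for h r s
   using that lhomD[of h R SB "regular R"] by auto
  show img: "(%h. lsum W (%p. fst p \<triangleleft>\<^sub>W h (snd p)) ws) ` carrier ?L \<subseteq> carrier W"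
   using ws WR hD by (auto intro!: lsum_closed simp del: lHom_bimod_simps)
  show "\<Psi> ` carrier W \<subseteq> carrier ?L" using car by blast
  show "\<forall>h\<in>carrier ?L. \<Psi> (lsum W (%p. fst p \<triangleleft>\<^sub>W h (snd p)) ws) = h"
  proof
   fix h assume h: "h \<in>. ?L"
   show "\<Psi> (lsum W (%p. fst p \<triangleleft>\<^sub>W h (snd p)) ws) = h"
   proof (rule extensionalityI[of _ "carrier S"])
   fix t assume t: "t \<in>. S"
   have "\<Psi> (lsum W (%p. fst p \<triangleleft>\<^sub>W h (snd p)) ws) t = om (lsum W (%p. (t \<odot>\<^sub>W fst p) \<triangleleft>\<^sub>W h (snd p)) ws)"
   using t ws WL WR WB(3) hD[OF h] by (simp add: \<Psi>_def bimodule_left_lsum(1)[OF W] cong: lsum_cong)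
   also have "... = lsum R (%p. h (i (om (t \<odot>\<^sub>W fst p)) \<otimes>\<^sub>S snd p)) ws"
   using t ws WL WR hD[OF h] omegaD by (subst add_lsum[OF omegaD(5)]) (simp_all cong: lsum_cong)
   also have "... = h (lsum S (%p. i (om (t \<odot>\<^sub>W fst p)) \<otimes>\<^sub>S snd p) ws)"
   using t ws WL WR iD SS omegaD bimodule_left(2)[OF SB] bimodule_left(2)[OF RB]
   add_lsum[OF hD(1)[OF h], of ws "%p. i (om (t \<odot>\<^sub>W fst p)) \<otimes>\<^sub>S snd p"] by simp
   finally show "\<Psi> (lsum W (%p. fst p \<triangleleft>\<^sub>W h (snd p)) ws) t = h t" using t by (simp add: sum_S)
   qed (use h in \<open>auto simp: \<Psi>_def\<close>)
  qed
 qed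
 ultimately show ?thesis by (auto simp: bimod_iso_def)
qed

text \<open>The isomorphism is \<open>s \<mapsto> (w \<mapsto> om (s w))\<close>, with inverse \<open>h \<mapsto> \<Sum> h(w\<^sub>j) s\<^sub>j\<close>.\<close>

lemma rHom_iso: "bimod_iso R S SB (rHom_bimod R W (regular R)) \<noteq> {}"
proof -
 let ?L = "rHom_bimod R W (regular R)"
 define \<Phi> where "\<Phi> s = (\<lambda>w\<in>carrier W. om (s \<odot>\<^sub>W w))" for s
 have car: "\<Phi> s \<in>. ?L" if s: "s \<in>. S" for s
 proof -
  have "\<Phi> s \<in> rhom R (rpart W) (rpart (regular R))"
  proof (rule rmod_homI)
   show "\<Phi> s \<in> add_homs (rpart W) (rpart (regular R))"
   by (rule addI) (use s omegaD WL in \<open>auto simp: \<Phi>_def\<close>)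
  qed (use s omegaD WL WR in \<open>auto simp: \<Phi>_def simp flip: WB(3)\<close>)
  then show ?thesis by (simp add: \<Phi>_def)
 qed
 have add: "\<Phi> (s \<oplus>\<^sub>S s') = \<Phi> s \<oplus>\<^sub>?L \<Phi> s'" if "s \<in>. S" "s' \<in>. S" for s s'
  using that omegaD WL by (auto simp: \<Phi>_def)
 have lin: "\<Phi> (i r \<otimes>\<^sub>S s) = r \<odot>\<^sub>?L \<Phi> s" if "r \<in>. R" "s \<in>. S" for r s
  using that omegaD WL iD by (auto simp: \<Phi>_def)
 have rlin: "\<Phi> (s \<otimes>\<^sub>S t) = \<Phi> s \<triangleleft>\<^sub>?L t" if "s \<in>. S" "t \<in>. S" for s t
  using that omegaD WL by (auto simp: \<Phi>_def)
 have "\<Phi> \<in> bimod_hom R S SB ?L"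
  unfolding bimod_hom_def
  by (intro IntI lhomI rmod_homI; (rule addI)?; use car add lin rlin in \<open>simp del: rHom_bimod_simps\<close>)
 moreover have "bij_betw \<Phi> (carrier SB) (carrier ?L)"
 proof (rule bij_betw_byWitness[where f' = "%h. lsum S (%p. i (h (fst p)) \<otimes>\<^sub>S snd p) ws"])
  show "\<forall>s\<in>carrier SB. lsum S (%p. i (\<Phi> s (fst p)) \<otimes>\<^sub>S snd p) ws = s"
  proof
   fix s assume s: "s \<in>. SB"
   have "lsum S (%p. i (\<Phi> s (fst p)) \<otimes>\<^sub>S snd p) ws = lsum S (%p. i (om (s \<odot>\<^sub>W fst p)) \<otimes>\<^sub>S snd p) ws"
   using ws by (intro lsum_cong) (auto simp: \<Phi>_def)
   then show "lsum S (%p. i (\<Phi> s (fst p)) \<otimes>\<^sub>S snd p) ws = s" using s by (simp add: sum_S)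
  qed
  have hD: "h \<in> add_homs (rpart W) (rpart (regular R))" "w \<in>. W ==> h w \<in>. R"
   "r \<in>. R ==> w \<in>. W ==> h (w \<triangleleft>\<^sub>W r) = h w \<otimes>\<^sub>R r" if "h \<in>. ?L" for h r w
   using that rmod_homD[of h R "rpart W" "rpart (regular R)"] by auto
  show img: "(%h. lsum S (%p. i (h (fst p)) \<otimes>\<^sub>S snd p) ws) ` carrier ?L \<subseteq> carrier SB"
   using ws iD SS hD by (auto intro!: lsum_closed simp del: rHom_bimod_simps)
  show "\<Phi> ` carrier SB \<subseteq> carrier ?L" using car by auto
  show "\<forall>h\<in>carrier ?L. \<Phi> (lsum S (%p. i (h (fst p)) \<otimes>\<^sub>S snd p) ws) = h"
  proof
   fix h assume h: "h \<in>. ?L"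
   show "\<Phi> (lsum S (%p. i (h (fst p)) \<otimes>\<^sub>S snd p) ws) = h"
   proof (rule extensionalityI[of _ "carrier W"])
   fix w assume w: "w \<in>. W"
   have "\<Phi> (lsum S (%p. i (h (fst p)) \<otimes>\<^sub>S snd p) ws) w = om (lsum W (%p. i (h (fst p)) \<odot>\<^sub>W (snd p \<odot>\<^sub>W w)) ws)"
   using w ws WL iD SS hD[OF h] by (simp add: \<Phi>_def bimodule_left_lsum(2)[OF W] cong: lsum_cong)
   also have "... = lsum R (%p. h (fst p \<triangleleft>\<^sub>W om (snd p \<odot>\<^sub>W w))) ws"
   using w ws WL WR iD hD[OF h] omegaD by (subst add_lsum[OF omegaD(5)]) (simp_all cong: lsum_cong)
   also have "... = h (lsum W (%p. fst p \<triangleleft>\<^sub>W om (snd p \<odot>\<^sub>W w)) ws)"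
   using w ws WL WR omegaD bimodule_right(2)[OF RB]
   add_lsum[OF hD(1)[OF h], of ws "%p. fst p \<triangleleft>\<^sub>W om (snd p \<odot>\<^sub>W w)"] by simp
   finally show "\<Phi> (lsum S (%p. i (h (fst p)) \<otimes>\<^sub>S snd p) ws) w = h w" using w by (simp add: sum_W)
   qed (use h in \<open>auto simp: \<Phi>_def\<close>)
  qed
 qed
 ultimately show ?thesis by (auto simp: bimod_iso_def)
qed

end

context extension begin

text \<open>\<open>om w\<close> is the value at \<open>1\<close> of the functional \<open>\<Psi> w\<close>, and the \<open>w\<^sub>j\<close> correspond to the coordinate functionals of the dual basis.\<close>

lemma dual_system_of_lHom_iso:
 assumes bs: "dual_basis_left R SB bs" and \<Psi>: "\<Psi> \<in> bimod_iso S R W (lHom_bimod R SB (regular R))"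
 shows "\<exists>ws om. dual_system R S i W ws om"
proof -
 let ?L = "lHom_bimod R SB (regular R)"
 note \<Psi>L = lhomD[OF bimod_isoD(1)[OF \<Psi>]] and \<Psi>R = rmod_homD[OF bimod_isoD(2)[OF \<Psi>], simplified]
  and bij = bimod_isoD(3)[OF \<Psi>]
 define om where "om w = \<Psi> w \<one>\<^sub>S" for w
 have car: "\<Psi> w \<in> lhom R SB (regular R)" "\<Psi> w \<in> extensional (carrier S)" if "w \<in>. W" for w
  using \<Psi>L(2)[OF that] by auto
 have shift: "om (t \<odot>\<^sub>W w) = \<Psi> w t" if "t \<in>. S" "w \<in>. W" for t w
  using that SS by (simp add: om_def \<Psi>L(4))
 have om: "om \<in> bimod_hom R R (restrict_bimod i (%r. r) W) (regular R)"
 proof (rule omega_homI)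
  fix w assume w: "w \<in>. W"
  show "om w \<in>. R" using lhomD(2)[OF car(1)[OF w], of "\<one>\<^sub>S"] SS by (simp add: om_def)
  fix r assume r: "r \<in>. R"
  show "om (i r \<odot>\<^sub>W w) = r \<otimes>\<^sub>R om w"
   using lhomD(4)[OF car(1)[OF w] r, of "\<one>\<^sub>S"] w r SS iD by (simp add: shift) (simp add: om_def)
  show "om (w \<triangleleft>\<^sub>W r) = om w \<otimes>\<^sub>R r" using w r SS by (simp add: om_def \<Psi>R(4))
 next
  fix w w' assume "w \<in>. W" "w' \<in>. W"
  then show "om (w \<oplus>\<^sub>W w') = om w \<oplus>\<^sub>R om w'" using SS by (simp add: om_def \<Psi>L(3))
 qed
 note omD = omega_homD[OF om]
 have b: "fst b \<in>. S" "snd b \<in> lhom R SB (regular R)" if "b \<in> set bs" for b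
  using bs that by (auto simp: dual_basis_left_def)
 define x where "x b = inv_into (carrier W) \<Psi> (restrict (snd b) (carrier S))" for b :: "'s \<times> ('s => 'r)"
 have x: "x b \<in>. W" "\<Psi> (x b) = restrict (snd b) (carrier S)" if "b \<in> set bs" for b
 proof -
  have "restrict (snd b) (carrier S) \<in> \<Psi> ` carrier W"
   using bij lhom_restrict[OF b(2)[OF that] bimoduleD(1)[OF SB]] by (simp add: bij_betw_def)
  then show "x b \<in>. W" "\<Psi> (x b) = restrict (snd b) (carrier S)"
   by (simp_all add: x_def inv_into_into f_inv_into_f)
 qed
 have dual_b: "lsum S (%b. i (snd b t) \<otimes>\<^sub>S fst b) bs = t" if "t \<in>. S" for t
  using bs that by (simp add: dual_basis_left_def)
 have sum_S: "lsum S (%b. i (om (t \<odot>\<^sub>W x b)) \<otimes>\<^sub>S fst b) bs = t" if "t \<in>. S" for t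
  using dual_b[OF that] that x b by (simp add: shift cong: lsum_cong)
 have sum_W: "lsum W (%b. x b \<triangleleft>\<^sub>W om (fst b \<odot>\<^sub>W w)) bs = w" if w: "w \<in>. W" for w
 proof -
  let ?y = "lsum W (%b. x b \<triangleleft>\<^sub>W om (fst b \<odot>\<^sub>W w)) bs"
  have y: "?y \<in>. W" using x b w WL WR omD by (intro lsum_closed) auto
  have "\<Psi> ?y = \<Psi> w"
  proof (rule extensionalityI[OF car(2)[OF y] car(2)[OF w]])
   fix t assume t: "t \<in>. S"
   have "\<Psi> ?y t = om (lsum W (%b. (t \<odot>\<^sub>W x b) \<triangleleft>\<^sub>W om (fst b \<odot>\<^sub>W w)) bs)"
   using t x b w WL WR omD y WB(3) by (simp add: shift[symmetric] bimodule_left_lsum(1)[OF W] cong: lsum_cong)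
   also have "... = lsum R (%b. om (i (om (t \<odot>\<^sub>W x b)) \<odot>\<^sub>W (fst b \<odot>\<^sub>W w))) bs"
   using t x b w WL WR omD by (subst add_lsum[OF omD(5)]) (simp_all cong: lsum_cong)
   also have "... = om (lsum W (%b. (i (om (t \<odot>\<^sub>W x b)) \<otimes>\<^sub>S fst b) \<odot>\<^sub>W w) bs)"
   using t x b w WL WR omD iD SS by (subst add_lsum[OF omD(5)]) (simp_all cong: lsum_cong)
   also have "... = om (lsum S (%b. i (om (t \<odot>\<^sub>W x b)) \<otimes>\<^sub>S fst b) bs \<odot>\<^sub>W w)"
   using t x b w WL WR omD iD SS by (subst bimodule_left_lsum(2)[OF W]) simp_all
   finally show "\<Psi> ?y t = \<Psi> w t" using t w by (simp add: sum_S shift)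
  qed
  then show ?thesis using bij y w by (auto simp: bij_betw_def inj_on_def)
 qed
 have "dual_system R S i W (map (%b. (x b, fst b)) bs) om"
  using x b om sum_S sum_W by (auto simp: dual_system_def lsum_map)
 then show ?thesis by blast
qed

text \<open>\<open>om\<close> is the functional that corresponds to \<open>1 \<in> S\<close>, and the \<open>s\<^sub>j\<close> correspond to the coordinate functionals of the dual basis.\<close>

lemma dual_system_of_rHom_iso:
 assumes bs: "dual_basis_right R (rpart W) bs" and \<Phi>: "\<Phi> \<in> bimod_iso R S SB (rHom_bimod R W (regular R))"
 shows "\<exists>ws om. dual_system R S i W ws om"
proof -
 let ?L = "rHom_bimod R W (regular R)"
 note \<Phi>L = lhomD[OF bimod_isoD(1)[OF \<Phi>], simplified ring_bimod_simps] and \<Phi>R = rmod_homD[OF bimod_isoD(2)[OF \<Phi>], simplified right_part_simps ring_bimod_simps]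
  and bij = bimod_isoD(3)[OF \<Phi>]
 define om where "om = \<Phi> \<one>\<^sub>S"
 have car: "\<Phi> s \<in> rhom R (rpart W) (rpart (regular R))" "\<Phi> s \<in> extensional (carrier W)" if "s \<in>. S" for s
  using \<Phi>L(2)[OF that] by auto
 have shift: "om (s \<odot>\<^sub>W w) = \<Phi> s w" if "s \<in>. S" "w \<in>. W" for s w
  using \<Phi>R(4)[of s "\<one>\<^sub>S"] that SS by (simp add: om_def)
 have om: "om \<in> bimod_hom R R (restrict_bimod i (%r. r) W) (regular R)"
 proof (rule omega_homI)
  note omR = rmod_homD[OF car(1)[OF SS(2)], folded om_def, simplified]
  fix w assume w: "w \<in>. W"
  show "om w \<in>. R" using omR(2) w by simp
  fix r assume r: "r \<in>. R"
  show "om (w \<triangleleft>\<^sub>W r) = om w \<otimes>\<^sub>R r" using omR(4) w r by simp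
  show "om (i r \<odot>\<^sub>W w) = r \<otimes>\<^sub>R om w"
   using \<Phi>L(4)[OF r, of "\<one>\<^sub>S"] w r SS iD by (simp add: shift) (simp add: om_def)
 next
  note omR = rmod_homD[OF car(1)[OF SS(2)], folded om_def, simplified]
  fix w w' assume "w \<in>. W" "w' \<in>. W"
  then show "om (w \<oplus>\<^sub>W w') = om w \<oplus>\<^sub>R om w'" using omR(3) by simp
 qed
 note omD = omega_homD[OF om]
 have b: "fst b \<in>. W" "snd b \<in> rhom R (rpart W) (rpart (regular R))" if "b \<in> set bs" for b
  using bs that by (auto simp: dual_basis_right_def)
 define x where "x b = inv_into (carrier S) \<Phi> (restrict (snd b) (carrier W))" for b :: "'w \<times> ('w => 'r)"
 have x: "x b \<in>. S" "\<Phi> (x b) = restrict (snd b) (carrier W)" if "b \<in> set bs" for b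
 proof -
  have "restrict (snd b) (carrier W) \<in> \<Phi> ` carrier S"
   using bij rmod_hom_restrict[OF b(2)[OF that] WB(2)] by (simp add: bij_betw_def)
  then show "x b \<in>. S" "\<Phi> (x b) = restrict (snd b) (carrier W)"
   by (simp_all add: x_def inv_into_into f_inv_into_f)
 qed
 have dual_b: "lsum W (%b. fst b \<triangleleft>\<^sub>W snd b w) bs = w" if "w \<in>. W" for w
  using bs that by (simp add: dual_basis_right_def)
 have sum_W: "lsum W (%b. fst b \<triangleleft>\<^sub>W om (x b \<odot>\<^sub>W w)) bs = w" if "w \<in>. W" for w
  using dual_b[OF that] that x b by (simp add: shift cong: lsum_cong)
 have sum_S: "lsum S (%b. i (om (t \<odot>\<^sub>W fst b)) \<otimes>\<^sub>S x b) bs = t" if t: "t \<in>. S" for t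
 proof -
  let ?y = "lsum S (%b. i (om (t \<odot>\<^sub>W fst b)) \<otimes>\<^sub>S x b) bs"
  have y: "?y \<in>. S" using x b t WL omD iD SS by (intro lsum_closed) auto
  have "\<Phi> ?y = \<Phi> t"
  proof (rule extensionalityI[OF car(2)[OF y] car(2)[OF t]])
   fix w assume w: "w \<in>. W"
   have "\<Phi> ?y w = om (lsum W (%b. i (om (t \<odot>\<^sub>W fst b)) \<odot>\<^sub>W (x b \<odot>\<^sub>W w)) bs)"
   using t x b w WL iD SS omD y by (simp add: shift[symmetric] bimodule_left_lsum(2)[OF W] cong: lsum_cong)
   also have "... = lsum R (%b. om ((t \<odot>\<^sub>W fst b) \<triangleleft>\<^sub>W om (x b \<odot>\<^sub>W w))) bs"
   using t x b w WL iD omD by (subst add_lsum[OF omD(5)]) (simp_all cong: lsum_cong)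
   also have "... = om (lsum W (%b. t \<odot>\<^sub>W (fst b \<triangleleft>\<^sub>W om (x b \<odot>\<^sub>W w))) bs)"
   using t x b w WL WR omD WB(3) by (subst add_lsum[OF omD(5)]) (simp_all cong: lsum_cong)
   also have "... = om (t \<odot>\<^sub>W lsum W (%b. fst b \<triangleleft>\<^sub>W om (x b \<odot>\<^sub>W w)) bs)"
   using t x b w WL WR omD by (subst bimodule_left_lsum(1)[OF W]) simp_all
   finally show "\<Phi> ?y w = \<Phi> t w" using t w by (simp add: sum_W shift)
  qed
  then show ?thesis using bij y t by (auto simp: bij_betw_def inj_on_def)
 qed
 have "dual_system R S i W (map (%b. (fst b, x b)) bs) om"
  using x b om sum_S sum_W by (auto simp: dual_system_def lsum_map)
 then show ?thesis by blast
qed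

end

section \<open>Dual bases of tensor products and retracts\<close>

lemma dual_basis_right_retract:
 assumes P: "rmod R P" and Q: "rmod R Q" and bs: "dual_basis_right R P bs"
  and ka: "ka \<in> rhom R Q P" and \<mu>: "\<mu> \<in> rhom R P Q" and id: "!!q. q \<in>. Q ==> \<mu> (ka q) = q"
 shows "dual_basis_right R Q (map (%b. (\<mu> (fst b), %q. snd b (ka q))) bs)"
proof -
 note kaD = rmod_homD[OF ka] and \<mu>D = rmod_homD[OF \<mu>] and PD = rmodD[OF P] and QD = rmodD[OF Q]
 have b: "fst b \<in>. P" "snd b \<in> rhom R P (rpart (regular R))" if "b \<in> set bs" for b
  using bs that by (auto simp: dual_basis_right_def)
 note sD = rmod_homD[OF b(2), simplified]
 have "(%q. snd b (ka q)) \<in> rhom R Q (rpart (regular R))" if "b \<in> set bs" for b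
  using kaD sD[OF that] by (intro rmod_homI addI) simp_all
 moreover have "lsum Q (%b. \<mu> (fst b) \<star>\<^sub>Q snd b (ka q)) bs = q" if q: "q \<in>. Q" for q
 proof -
  have "lsum Q (%b. \<mu> (fst b) \<star>\<^sub>Q snd b (ka q)) bs = lsum Q (%b. \<mu> (fst b \<star>\<^sub>P snd b (ka q))) bs"
   using q b sD kaD \<mu>D by (intro lsum_cong) simp_all
  also have "... = \<mu> (lsum P (%b. fst b \<star>\<^sub>P snd b (ka q)) bs)"
   using q b sD kaD PD QD by (subst add_lsum[OF \<mu>D(1)]) simp_all
  also have "... = q" using bs q kaD id by (simp add: dual_basis_right_def)
  finally show ?thesis .
 qed
 ultimately show ?thesis using b \<mu>D by (auto simp: dual_basis_right_def lsum_map)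
qed

lemma dual_basis_right_tensor:
 fixes S :: "('s, 'b) ring_scheme" and R :: "('r, 'a) ring_scheme" and A :: "('s, 'm) rmodule" and B :: "('s, 'r, 'n) bimodule"
 assumes A: "rmod S A" and as: "dual_basis_right S A as"
  and B: "is_bimodule S R B" and bs: "dual_basis_right R (rpart B) bs"
 shows "\<exists>cs. dual_basis_right R (tensor_rmod S A B) cs"
proof -
 let ?T = "tensor_rmod S A B" and ?p = "ptens S A B"
 note TB = tensor_rmod[OF A B] and TD = rmodD[OF tensor_rmod(2)[OF A B]]
 interpret T: tensor S A B ?T ?p by (rule TB(1))
 note AD = rmodD[OF A] and BL = bimodule_left[OF B] and BR = bimodule_right[OF B] and BB = bimoduleD(3)[OF B]
 have a: "fst a \<in>. A" "snd a \<in> rhom S A (rpart (regular S))" if "a \<in> set as" for a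
  using as that by (auto simp: dual_basis_right_def)
 have b: "fst b \<in>. B" "snd b \<in> rhom R (rpart B) (rpart (regular R))" if "b \<in> set bs" for b
  using bs that by (auto simp: dual_basis_right_def)
 note aD = rmod_homD[OF a(2), simplified] and bD = rmod_homD[OF b(2), simplified]
 define ch where "ch a b = tlift A B ?T ?p R (%x y. snd b (snd a x \<odot>\<^sub>B y))" for a :: "'m \<times> ('m => 's)" and b :: "'n \<times> ('n => 'r)"
 have ch: "ch a b \<in> add_homs ?T R" "!!x y. x \<in>. A ==> y \<in>. B ==> ch a b (?p x y) = snd b (snd a x \<odot>\<^sub>B y)"
  if ab: "a \<in> set as" "b \<in> set bs" for a b
 proof -
  have "balanced S A B R (%x y. snd b (snd a x \<odot>\<^sub>B y))"
   using aD[OF ab(1)] bD[OF ab(2)] BL by (intro balancedI) simp_all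
  from T.tlift[OF _ this] BR(1) show "ch a b \<in> add_homs ?T R"
   "!!x y. x \<in>. A ==> y \<in>. B ==> ch a b (?p x y) = snd b (snd a x \<odot>\<^sub>B y)"
   by (simp_all add: ch_def)
 qed
 define cs where "cs = concat (map (%a. map (%b. (?p (fst a) (fst b), ch a b)) bs) as)"
 have ch_rmod: "ch a b \<in> rhom R ?T (rpart (regular R))" if ab: "a \<in> set as" "b \<in> set bs" for a b
 proof (rule rmod_homI)
  show "ch a b \<in> add_homs ?T (rpart (regular R))"
   using addD[OF ch(1)[OF ab]] by (intro addI) simp_all
  fix r x assume r: "r \<in>. R" and "x \<in>. ?T"
  from this(2) have "ch a b (x \<star>\<^sub>?T r) = ch a b x \<otimes>\<^sub>R r"
  proof (induction x rule: T.induct)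
   case (pure x y)
   then show ?case using r BR BL BB aD[OF ab(1)] bD[OF ab(2)] by (simp add: TB(3) ch[OF ab] flip: BB)
  next
   case (add x y)
   then show ?case using r TD ring_distrib[OF BR(1)] by (simp add: addD[OF ch(1)[OF ab]])
  qed
  then show "ch a b (x \<star>\<^sub>?T r) = ch a b x \<star>\<^sub>(rpart (regular R)) r" by simp
 qed
 have sum: "lsum ?T (%c. fst c \<star>\<^sub>?T snd c x) cs = lsum ?T (%a. lsum ?T (%b. ?p (fst a) (fst b) \<star>\<^sub>?T ch a b x) bs) as"
  if x: "x \<in>. ?T" for x
  unfolding cs_def using x a b T.closed addD(1)[OF ch(1)] TD(3)
  by (subst lsum_concat[OF T.T_abelian]) (auto simp: lsum_map)
 have "lsum ?T (%c. fst c \<star>\<^sub>?T snd c x) cs = x" if x: "x \<in>. ?T" for x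
  unfolding sum[OF x]
 proof (rule T.ext[OF _ _ x])
  show "(%x. lsum ?T (%a. lsum ?T (%b. ?p (fst a) (fst b) \<star>\<^sub>?T ch a b x) bs) as) \<in> add_homs ?T ?T"
  proof (intro add_homs_lsum_pointwise T.T_abelian)
   fix a b assume ab: "a \<in> set as" "b \<in> set bs"
   have "(%r. ?p (fst a) (fst b) \<star>\<^sub>?T r) \<in> add_homs R ?T"
   using right_module_add_homs(2)[OF TB(2) T.closed[OF a(1)[OF ab(1)] b(1)[OF ab(2)]]] .
   from add_homs_comp[OF ch(1)[OF ab] this] show "(%x. ?p (fst a) (fst b) \<star>\<^sub>?T ch a b x) \<in> add_homs ?T ?T" .
  qed
  show "(%x. x) \<in> add_homs ?T ?T" by (rule addI) auto
  fix x y assume xy: "x \<in>. A" "y \<in>. B"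
  have "lsum ?T (%b. ?p (fst a) (fst b) \<star>\<^sub>?T ch a b (?p x y)) bs = ?p (fst a \<star>\<^sub>A snd a x) y" if aa: "a \<in> set as" for a
  proof -
   have "lsum ?T (%b. ?p (fst a) (fst b) \<star>\<^sub>?T ch a b (?p x y)) bs = lsum ?T (%b. ?p (fst a) (fst b \<triangleleft>\<^sub>B snd b (snd a x \<odot>\<^sub>B y))) bs"
   using a[OF aa] aD[OF aa] b bD xy BL by (intro lsum_cong) (simp_all add: ch[OF aa] TB(3))
   also have "... = ?p (fst a) (lsum B (%b. fst b \<triangleleft>\<^sub>B snd b (snd a x \<odot>\<^sub>B y)) bs)"
   using a[OF aa] aD[OF aa] b bD xy BL BR by (subst T.lsum_right) simp_all
   also have "lsum B (%b. fst b \<triangleleft>\<^sub>B snd b (snd a x \<odot>\<^sub>B y)) bs = snd a x \<odot>\<^sub>B y"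
   using bs aD[OF aa] xy BL by (simp add: dual_basis_right_def)
   finally show ?thesis using a[OF aa] aD[OF aa] xy by (simp add: T.move)
  qed
  then have "lsum ?T (%a. lsum ?T (%b. ?p (fst a) (fst b) \<star>\<^sub>?T ch a b (?p x y)) bs) as = lsum ?T (%a. ?p (fst a \<star>\<^sub>A snd a x) y) as"
   by (intro lsum_cong) simp_all
  also have "... = ?p (lsum A (%a. fst a \<star>\<^sub>A snd a x) as) y"
   using a aD xy AD by (subst T.lsum_left) simp_all
  finally show "lsum ?T (%a. lsum ?T (%b. ?p (fst a) (fst b) \<star>\<^sub>?T ch a b (?p x y)) bs) as = ?p x y"
   using as xy by (simp add: dual_basis_right_def)
 qed
 then have "dual_basis_right R ?T cs"
  using a b ch_rmod T.closed by (auto simp: dual_basis_right_def cs_def)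
 then show ?thesis by blast
qed

section \<open>Strict Morita contexts\<close>

lemma strict_morita_context_sym:
 "strict_morita_context R S P Q f g ==> strict_morita_context S R Q P g f"
 by (auto simp: strict_morita_context_def)

locale morita =
 fixes R :: "('r, 'a) ring_scheme" and S :: "('s, 'b) ring_scheme" and P :: "('r, 's, 'p) bimodule"
  and Q :: "('s, 'r, 'q) bimodule" and f :: "('p, 'q) tens => 'r" and g :: "('q, 'p) tens => 's"
 assumes morita: "strict_morita_context R S P Q f g"
begin

lemma P: "is_bimodule R S P" and Q: "is_bimodule S R Q"
 using morita by (auto simp: strict_morita_context_def)

lemmas PL = bimodule_left[OF P] and PR = bimodule_right[OF P] and PB = bimoduleD[OF P]
lemmas QL = bimodule_left[OF Q] and QR = bimodule_right[OF Q] and QB = bimoduleD[OF Q]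

lemma ag [simp]: "abelian_group R" "abelian_group S" "abelian_group P" "abelian_group Q"
 using PL(1,2) QL(1,2) by auto

abbreviation "pf p q \<equiv> f (ptens S (rpart P) Q p q)"
abbreviation "pg q p \<equiv> g (ptens R (rpart Q) P q p)"

lemma f: "f \<in> bimod_iso R R (tensor_bimod S P Q) (regular R)"
 and g: "g \<in> bimod_iso S S (tensor_bimod R Q P) (regular S)"
 and fg: "p \<in>. P ==> q \<in>. Q ==> p' \<in>. P ==> pf p q \<odot>\<^sub>P p' = p \<triangleleft>\<^sub>P pg q p'"
 and gf: "q \<in>. Q ==> p \<in>. P ==> q' \<in>. Q ==> pg q p \<odot>\<^sub>Q q' = q \<triangleleft>\<^sub>Q pf p q'"
 using morita by (auto simp: strict_morita_context_def)

lemmas fL = lhomD[OF bimod_isoD(1)[OF f], simplified ring_bimod_simps]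
lemmas fR = rmod_homD[OF bimod_isoD(2)[OF f], simplified right_part_simps ring_bimod_simps]
lemmas gL = lhomD[OF bimod_isoD(1)[OF g], simplified ring_bimod_simps]
lemmas gR = rmod_homD[OF bimod_isoD(2)[OF g], simplified right_part_simps ring_bimod_simps]

lemma f_add_hom: "f \<in> add_homs (tensor_bimod S P Q) R"
 by (rule addI) (auto simp: fL)

sublocale T: tensor S "rpart P" Q "tensor_bimod S P Q" "ptens S (rpart P) Q"
 by (rule tensor_bimod(1)[OF P Q])

sublocale T': tensor R "rpart Q" P "tensor_bimod R Q P" "ptens R (rpart Q) P"
 by (rule tensor_bimod(1)[OF Q P])

lemma pf_closed: "p \<in>. P ==> q \<in>. Q ==> pf p q \<in>. R"
 and pg_closed: "q \<in>. Q ==> p \<in>. P ==> pg q p \<in>. S"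
 using fL(2)[OF T.closed] gL(2)[OF T'.closed] by auto

lemma pg_left: "q \<in>. Q ==> p \<in>. P ==> s \<in>. S ==> pg (s \<odot>\<^sub>Q q) p = s \<otimes>\<^sub>S pg q p"
 using gL(4)[of s, OF _ T'.closed[of q p]] tensor_bimod(3)[OF Q P, of s q p] by simp

lemma pg_right: "q \<in>. Q ==> p \<in>. P ==> s \<in>. S ==> pg q (p \<triangleleft>\<^sub>P s) = pg q p \<otimes>\<^sub>S s"
 using gR(4)[of s, OF _ T'.closed[of q p]] tensor_bimod(4)[OF Q P, of s q p] by simp

lemma pg_add: "q \<in>. Q ==> p \<in>. P ==> p' \<in>. P ==> pg q (p \<oplus>\<^sub>P p') = pg q p \<oplus>\<^sub>S pg q p'"
 using T'.closed by (simp add: T'.add_right gL(3))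

lemma pf_left: "p \<in>. P ==> q \<in>. Q ==> r \<in>. R ==> pf (r \<odot>\<^sub>P p) q = r \<otimes>\<^sub>R pf p q"
 using fL(4)[of r, OF _ T.closed[of p q]] tensor_bimod(3)[OF P Q, of r p q] by simp

lemma pf_right: "p \<in>. P ==> q \<in>. Q ==> r \<in>. R ==> pf p (q \<triangleleft>\<^sub>Q r) = pf p q \<otimes>\<^sub>R r"
 using fR(4)[of r, OF _ T.closed[of p q]] tensor_bimod(4)[OF P Q, of r p q] by simp

lemma unit_element:
 obtains e where "e \<in>. (tensor_bimod S P Q)" "f e = \<one>\<^sub>R"
  "\<forall>r\<in>carrier R. r \<odot>\<^sub>(tensor_bimod S P Q) e = e \<triangleleft>\<^sub>(tensor_bimod S P Q) r"
proof -
 let ?T = "tensor_bimod S P Q"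
 note RS = ring_simps[OF PL(1)]
 have bij: "bij_betw f (carrier ?T) (carrier R)" using bimod_isoD(3)[OF f, unfolded ring_bimod_simps] .
 have "\<one>\<^sub>R \<in> f ` carrier ?T" using bij RS(2) by (simp add: bij_betw_def)
 then obtain e where e: "e \<in>. ?T" "f e = \<one>\<^sub>R" by (elim imageE) simp
 have central: "r \<odot>\<^sub>?T e = e \<triangleleft>\<^sub>?T r" if r: "r \<in>. R" for r
 proof (rule inj_onD[OF bij_betw_imp_inj_on[OF bij]])
  show "f (r \<odot>\<^sub>?T e) = f (e \<triangleleft>\<^sub>?T r)" using r e RS by (simp add: fL(4) fR(4))
  show "r \<odot>\<^sub>?T e \<in>. ?T" "e \<triangleleft>\<^sub>?T r \<in>. ?T"
   using r e bimodule_left(3)[OF tensor_bimod(2)[OF P Q]] bimodule_right(3)[OF tensor_bimod(2)[OF P Q]] by auto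
 qed
 then show thesis by (intro that[OF e] ballI)
qed

lemma unit_expansion:
 obtains es where "set es \<subseteq> carrier P \<times> carrier Q" "lsum R (%e. pf (fst e) (snd e)) es = \<one>\<^sub>R"
proof -
 obtain e where e: "e \<in>. (tensor_bimod S P Q)" "f e = \<one>\<^sub>R" by (rule unit_element)
 obtain es where es: "set es \<subseteq> carrier P \<times> carrier Q"
   "e = lsum (tensor_bimod S P Q) (%p. ptens S (rpart P) Q (fst p) (snd p)) es"
  using T.expand[OF e(1)] by auto
 have "lsum R (%e. pf (fst e) (snd e)) es = f e"
  unfolding es(2) using es(1) T.closed by (subst add_lsum[OF f_add_hom T.T_abelian]) auto
 then show thesis using e(2) es(1) by (intro that[of es]) auto
qed

lemma dual_basis_P: "\<exists>bs. dual_basis_right S (rpart P) bs"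
proof -
 obtain es where es0: "set es \<subseteq> carrier P \<times> carrier Q" and es3: "lsum R (%e. pf (fst e) (snd e)) es = \<one>\<^sub>R"
  by (rule unit_expansion)
 have es: "!!e. e \<in> set es ==> fst e \<in>. P" "!!e. e \<in> set es ==> snd e \<in>. Q"
  using es0 by auto
 have "(%p. pg (snd e) p) \<in> rhom S (rpart P) (rpart (regular S))" if "e \<in> set es" for e
  using es(2)[OF that] pg_closed pg_add pg_right by (intro rmod_homI addI) simp_all
 moreover have "lsum P (%e. fst e \<triangleleft>\<^sub>P pg (snd e) p) es = p" if p: "p \<in>. P" for p
 proof -
  have "lsum P (%e. fst e \<triangleleft>\<^sub>P pg (snd e) p) es = lsum R (%e. pf (fst e) (snd e)) es \<odot>\<^sub>P p"
   using p es(1,2) pf_closed by (subst bimodule_left_lsum(2)[OF P]) (simp_all add: fg cong: lsum_cong)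
  then show ?thesis using p PL es3 by simp
 qed
 ultimately have "dual_basis_right S (rpart P) (map (%e. (fst e, %p. pg (snd e) p)) es)"
  using es by (auto simp: dual_basis_right_def lsum_map)
 then show ?thesis by blast
qed

end



section \<open>Transfer of right dual bases along Morita contexts\<close>

lemma right_part_restrict_bimod_module:
 assumes "ring R" "i \<in> ring_hom R S" "is_bimodule L S V"
 shows "rmod R (rpart (restrict_bimod (%s. s) i V))"
 using restrict_bimod_bimodule[OF lmodD(1)[OF bimoduleD(1)[OF assms(3)]] assms(1) id_ring_hom assms(2,3)] bimoduleD(2) by blast

lemma right_part_tensor_bimod: "rpart (tensor_bimod R A B) = tensor_rmod R (rpart A) B"
 by (simp add: right_part_def tensor_bimod_def tensor_rmod_def)

text \<open>As right \<open>R\<close>-modules, \<open>V\<close> is \<open>V \<otimes>\<^sub>S S\<close>, and dual bases can be tensored.\<close>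

lemma dual_basis_restrict_of_ring:
 assumes R: "ring R" and i: "i \<in> ring_hom R S" and V: "is_bimodule L S V"
  and Vb: "dual_basis_right S (rpart V) vs" and Sb: "dual_basis_right R (rpart (ring_bimod S (%s. s) i)) ss"
 shows "\<exists>bs. dual_basis_right R (rpart (restrict_bimod (%s. s) i V)) bs"
proof -
 note VD = bimodule_right[OF V] and iD = ring_homD[OF i]
 have S: "ring S" by (rule VD(1))
 let ?B = "ring_bimod S (%s. s) i" and ?A = "rpart V"
 have B: "is_bimodule S R ?B" by (rule ring_bimod_bimodule[OF S R S id_ring_hom i])
 let ?T = "tensor_rmod S ?A ?B" and ?p = "ptens S ?A ?B"
 note TB = tensor_rmod[OF bimoduleD(2)[OF V] B]
 interpret T: tensor S ?A ?B ?T ?p by (rule TB(1))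
 note RQ = right_part_restrict_bimod_module[OF R i V]
 let ?Q = "rpart (restrict_bimod (%s. s) i V)"
 obtain bs where bs: "dual_basis_right R ?T bs"
  using dual_basis_right_tensor[OF bimoduleD(2)[OF V] Vb B Sb] by blast
 have "balanced S ?A ?B V (%v s. v \<triangleleft>\<^sub>V s)"
  using VD by (intro balancedI) simp_all
 note \<mu> = T.tlift[OF bimodule_left(2)[OF V] this, simplified right_part_simps ring_bimod_simps]
 define m where "m = tlift ?A ?B ?T ?p V (%v s. v \<triangleleft>\<^sub>V s)"
 note m = \<mu>[folded m_def]
 have "m \<in> rhom R ?T ?Q"
 proof (rule rmod_homI)
  show "m \<in> add_homs ?T ?Q" using addD[OF m(1)] by (intro addI) simp_all
  fix r x assume r: "r \<in>. R" and "x \<in>. ?T"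
  from this(2) have "m (x \<star>\<^sub>?T r) = m x \<triangleleft>\<^sub>V i r"
  proof (induction x rule: T.induct)
   case (pure v s)
   then show ?case using r VD iD ring_simps[OF S] by (simp add: TB(3) m(2))
  next
   case (add x y)
   then show ?case using r VD iD rmodD[OF TB(2)] by (simp add: addD[OF m(1)])
  qed
  then show "m (x \<star>\<^sub>?T r) = m x \<star>\<^sub>?Q r" by simp
 qed
 moreover have "(%v. ?p v \<one>\<^sub>S) \<in> rhom R ?Q ?T"
 proof (rule rmod_homI)
  show "(%v. ?p v \<one>\<^sub>S) \<in> add_homs ?Q ?T"
   using T.closed T.add_left ring_simps[OF S] by (intro addI) simp_all
  fix r v assume "r \<in>. R" "v \<in>. ?Q"
  then show "?p (v \<star>\<^sub>?Q r) \<one>\<^sub>S = ?p v \<one>\<^sub>S \<star>\<^sub>?T r"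
   using iD ring_simps[OF S] T.move[of v "i r" "\<one>\<^sub>S"] by (simp add: TB(3))
 qed
 ultimately show ?thesis
  using dual_basis_right_retract[OF TB(2) RQ bs, of "%v. ?p v \<one>\<^sub>S" m] VD ring_simps[OF S] by (auto simp: m(2))
qed

text \<open>As right \<open>R\<close>-modules, \<open>S\<close> is \<open>V' \<otimes>\<^sub>S V\<close>.\<close>

lemma dual_basis_ring_of_restrict:
 assumes R: "ring R" and i: "i \<in> ring_hom R S" and ctx: "strict_morita_context S S V V' g g'"
  and Vb: "dual_basis_right R (rpart (restrict_bimod (%s. s) i V)) vs"
 shows "\<exists>bs. dual_basis_right R (rpart (ring_bimod S (%s. s) i)) bs"
proof -
 interpret M: morita S S V' V g' g by (rule morita.intro[OF strict_morita_context_sym[OF ctx]])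
 note iD = ring_homD[OF i] and S = M.PL(1)
 let ?B = "restrict_bimod (%s. s) i V" and ?A = "rpart V'" and ?Q = "rpart (ring_bimod S (%s. s) i)"
 have B: "is_bimodule S R ?B" by (rule restrict_bimod_bimodule[OF S R id_ring_hom i M.Q])
 let ?T = "tensor_rmod S ?A ?B" and ?p = "ptens S ?A ?B"
 note TB = tensor_rmod[OF M.PB(2) B] and TD = rmodD[OF tensor_rmod(2)[OF M.PB(2) B]]
 interpret T: tensor S ?A ?B ?T ?p by (rule TB(1))
 have Q: "rmod R ?Q" by (rule bimoduleD(2)[OF ring_bimod_bimodule[OF S R S id_ring_hom i]])
 obtain vs' where vs': "dual_basis_right S ?A vs'" using M.dual_basis_P by blast
 obtain bs where bs: "dual_basis_right R ?T bs"
  using dual_basis_right_tensor[OF M.PB(2) vs' B Vb] by blast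
 have "balanced S ?A ?B S M.pf"
  using M.pf_closed M.T.add_left M.T.add_right M.T.move M.T.closed M.QL by (intro balancedI) (simp_all add: M.fL(3))
 note m' = T.tlift[OF M.ag(1) this, simplified right_part_simps restrict_bimod_simps]
 define m where "m = tlift ?A ?B ?T ?p S M.pf"
 note m = m'[folded m_def]
 obtain es where es0: "set es \<subseteq> carrier V' \<times> carrier V" and es3: "lsum S (%e. M.pf (fst e) (snd e)) es = \<one>\<^sub>S"
  by (rule M.unit_expansion)
 have es: "!!e. e \<in> set es ==> fst e \<in>. V'" "!!e. e \<in> set es ==> snd e \<in>. V"
  using es0 by auto
 define k where "k s = lsum ?T (%e. ?p (fst e) (snd e \<triangleleft>\<^sub>V s)) es" for s
 have m_rmod: "m \<in> rhom R ?T ?Q"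
 proof (rule rmod_homI)
  show "m \<in> add_homs ?T ?Q" using addD[OF m(1)] by (intro addI) simp_all
  fix r x assume r: "r \<in>. R" and "x \<in>. ?T"
  from this(2) have "m (x \<star>\<^sub>?T r) = m x \<otimes>\<^sub>S i r"
  proof (induction x rule: T.induct)
   case (pure v s)
   then show ?case using r M.QR iD by (simp add: TB(3) m(2) M.pf_right)
  next
   case (add x y)
   then show ?case using r ring_distrib[OF S] iD TD by (simp add: addD[OF m(1)])
  qed
  then show "m (x \<star>\<^sub>?T r) = m x \<star>\<^sub>?Q r" by simp
 qed
 have k_rmod: "k \<in> rhom R ?Q ?T"
 proof (rule rmod_homI)
  show "k \<in> add_homs ?Q ?T" unfolding k_def
  proof (rule add_homs_lsum_pointwise[OF _ T.T_abelian rmodD(2)[OF Q]])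
   fix e assume e: "e \<in> set es"
   show "(%s. ?p (fst e) (snd e \<triangleleft>\<^sub>V s)) \<in> add_homs ?Q ?T"
   using es(1,2)[OF e] M.QR T.closed T.add_right by (intro addI) simp_all
  qed
  fix r s assume r: "r \<in>. R" and s: "s \<in>. ?Q"
  have "k s \<star>\<^sub>?T r = lsum ?T (%e. ?p (fst e) (snd e \<triangleleft>\<^sub>V s) \<star>\<^sub>?T r) es"
   unfolding k_def using es M.QR T.closed r s by (intro right_module_lsum(1)[OF TB(2)]) simp_all
  also have "... = k (s \<star>\<^sub>?Q r)"
   unfolding k_def using es M.QR r s iD by (intro lsum_cong) (simp_all add: TB(3))
  finally show "k (s \<star>\<^sub>?Q r) = k s \<star>\<^sub>?T r" by simp
 qed
 have "m (k s) = s" if s: "s \<in>. S" for s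
 proof -
  have "m (k s) = lsum S (%e. M.pf (fst e) (snd e) \<otimes>\<^sub>S s) es"
   unfolding k_def using s es M.QR T.closed by (subst add_lsum[OF m(1) T.T_abelian]) (simp_all add: m(2) M.pf_right cong: lsum_cong)
  also have "... = lsum S (%e. M.pf (fst e) (snd e)) es \<otimes>\<^sub>S s"
   using s es M.pf_closed bimodule_right_lsum(1)[OF ring_bimod_bimodule[OF S S S id_ring_hom id_ring_hom], of s es "%e. M.pf (fst e) (snd e)"] by simp
  finally show ?thesis using s es3 ring_simps[OF S] by simp
 qed
 then show ?thesis
  using dual_basis_right_retract[OF TB(2) Q bs k_rmod m_rmod] by auto
qed

text \<open>As right \<open>R\<close>-modules, \<open>V\<close> is \<open>W \<otimes>\<^sub>R U'\<close>.\<close>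

lemma dual_basis_restrict_of_tensor:
 assumes R: "ring R" and i: "i \<in> ring_hom R S" and V: "is_bimodule S S V" and ctx: "strict_morita_context R R U U' f f'"
  and Wb: "dual_basis_right R (rpart (VU R i V U)) ws"
 shows "\<exists>bs. dual_basis_right R (rpart (restrict_bimod (%s. s) i V)) bs"
proof -
 interpret M: morita R R U U' f f' by (rule morita.intro[OF ctx])
 interpret M': morita R R U' U f' f by (rule morita.intro[OF strict_morita_context_sym[OF ctx]])
 note iD = ring_homD[OF i] and VR = bimodule_right[OF V] and VL = bimodule_left[OF V]
 let ?V = "restrict_bimod (%s. s) i V" and ?W = "VU R i V U" and ?vu = "vu R i V U"
 have V': "is_bimodule S R ?V" by (rule restrict_bimod_bimodule[OF VL(1) R id_ring_hom i V])
 note WB = tensor_bimod[OF V' M.P, folded VU_def vu_def]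
 interpret W: tensor R "rpart ?V" U ?W ?vu by (rule WB(1))
 let ?A = "rpart ?W" and ?Q = "rpart ?V"
 let ?T = "tensor_rmod R ?A U'" and ?p = "ptens R ?A U'"
 note TB = tensor_rmod[OF bimoduleD(2)[OF WB(2)] M.Q] and TD = rmodD[OF tensor_rmod(2)[OF bimoduleD(2)[OF WB(2)] M.Q]]
 interpret T: tensor R ?A U' ?T ?p by (rule TB(1))
 note WR = bimodule_right[OF WB(2)] and WL = bimodule_left[OF WB(2)]
 obtain us where us: "dual_basis_right R (rpart U') us" using M'.dual_basis_P by blast
 obtain bs where bs: "dual_basis_right R ?T bs"
  using dual_basis_right_tensor[OF bimoduleD(2)[OF WB(2)] Wb M.Q us] by blast
 have Q: "rmod R ?Q" by (rule right_part_restrict_bimod_module[OF R i V])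
 \<comment> \<open>the map \<open>w \<otimes> u' \<mapsto> \<mu> u' w\<close>\<close>
 define n where "n u' = tlift (rpart ?V) U ?W ?vu V (%v u. v \<triangleleft>\<^sub>V i (M.pf u u'))" for u'
 have n: "n u' \<in> add_homs ?W V" "!!v u. v \<in>. V ==> u \<in>. U ==> n u' (?vu v u) = v \<triangleleft>\<^sub>V i (M.pf u u')"
  if u': "u' \<in>. U'" for u'
 proof -
  have "balanced R (rpart ?V) U V (%v u. v \<triangleleft>\<^sub>V i (M.pf u u'))"
   using u' VR iD M.pf_closed M.pf_left M.T.add_left M.T.closed by (intro balancedI) (simp_all add: M.fL(3))
  from W.tlift[OF VL(2) this] show "n u' \<in> add_homs ?W V" "!!v u. v \<in>. V ==> u \<in>. U ==> n u' (?vu v u) = v \<triangleleft>\<^sub>V i (M.pf u u')"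
   by (simp_all add: n_def)
 qed
 have n_add: "n (u \<oplus>\<^sub>U' u') w = n u w \<oplus>\<^sub>V n u' w" if u: "u \<in>. U'" "u' \<in>. U'" and w: "w \<in>. ?W" for u u' w
  using w
 proof (induction w rule: W.induct)
  case (pure v x)
  then show ?case using u VR iD M.pf_closed M.T.add_right M.T.closed M.QL(2) by (simp add: n M.fL(3))
 next
  case (add x y)
  then show ?case using u M.QL(2) VL(2) by (simp add: addD[OF n(1)] add_exchange)
 qed
 have n_move: "n u' (w \<triangleleft>\<^sub>?W r) = n (r \<odot>\<^sub>U' u') w" if u: "u' \<in>. U'" "r \<in>. R" and w: "w \<in>. ?W" for u' w r
  using w
 proof (induction w rule: W.induct)
  case (pure v x)
  then show ?case using u M.PR M.QL M.T.move by (simp add: WB(4) n)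
 next
  case (add x y)
  then show ?case using u M.QL(3) WR by (simp add: addD[OF n(1)])
 qed
 have n_right: "n (u' \<triangleleft>\<^sub>U' r) w = n u' w \<triangleleft>\<^sub>V i r" if u: "u' \<in>. U'" "r \<in>. R" and w: "w \<in>. ?W" for u' w r
  using w
 proof (induction w rule: W.induct)
  case (pure v x)
  then show ?case using u M.QR VR iD M.pf_closed by (simp add: n M.pf_right)
 next
  case (add x y)
  then show ?case using u M.QR VR iD by (simp add: addD[OF n(1)])
 qed
 have "balanced R ?A U' V (%w u'. n u' w)"
  using addD[OF n(1)] n_add n_move by (intro balancedI) simp_all
 note m' = T.tlift[OF VL(2) this, simplified right_part_simps]
 define m where "m = tlift ?A U' ?T ?p V (%w u'. n u' w)"
 note m = m'[folded m_def]
 have m_rmod: "m \<in> rhom R ?T ?Q"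
 proof (rule rmod_homI)
  show "m \<in> add_homs ?T ?Q" using addD[OF m(1)] by (intro addI) simp_all
  fix r x assume r: "r \<in>. R" and "x \<in>. ?T"
  from this(2) have "m (x \<star>\<^sub>?T r) = m x \<triangleleft>\<^sub>V i r"
  proof (induction x rule: T.induct)
   case (pure w u')
   then show ?case using r M.QR by (simp add: TB(3) m(2) n_right)
  next
   case (add x y)
   then show ?case using r VR iD TD by (simp add: addD[OF m(1)])
  qed
  then show "m (x \<star>\<^sub>?T r) = m x \<star>\<^sub>?Q r" by simp
 qed
 obtain e where e: "e \<in>. (tensor_bimod R U U')" "f e = \<one>\<^sub>R"
  and central: "\<forall>r\<in>carrier R. r \<odot>\<^sub>(tensor_bimod R U U') e = e \<triangleleft>\<^sub>(tensor_bimod R U U') r"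
  by (rule M.unit_element)
 let ?E = "tensor_bimod R U U'"
 define l where "l v = tlift (rpart U) U' ?E (ptens R (rpart U) U') ?T (%u u'. ?p (?vu v u) u')" for v
 have l: "l v \<in> add_homs ?E ?T" "!!u u'. u \<in>. U ==> u' \<in>. U' ==> l v (ptens R (rpart U) U' u u') = ?p (?vu v u) u'"
  if v: "v \<in>. V" for v
 proof -
  have "?p (?vu v (u \<triangleleft>\<^sub>U r)) u' = ?p (?vu v u) (r \<odot>\<^sub>U' u')" if "u \<in>. U" "r \<in>. R" "u' \<in>. U'" for u r u'
   using that v W.closed T.move[of "?vu v u" r u'] by (simp add: WB(4))
  then have "balanced R (rpart U) U' ?T (%u u'. ?p (?vu v u) u')"
   using v W.closed W.add_right T.closed T.add_left T.add_right by (intro balancedI) simp_all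
  from M.T.tlift[OF T.T_abelian this] show "l v \<in> add_homs ?E ?T"
   "!!u u'. u \<in>. U ==> u' \<in>. U' ==> l v (ptens R (rpart U) U' u u') = ?p (?vu v u) u'"
   by (simp_all add: l_def)
 qed
 have l_add: "l (v \<oplus>\<^sub>V v') y = l v y \<oplus>\<^sub>?T l v' y" if v: "v \<in>. V" "v' \<in>. V" and y: "y \<in>. ?E" for v v' y
  using y
 proof (induction y rule: M.T.induct)
  case (pure u u')
  then show ?case using v VL(2) W.add_left W.closed T.add_left by (simp add: l)
 next
  case (add x y)
  then show ?case using v VL(2) T.T_abelian by (simp add: addD[OF l(1)] add_exchange)
 qed
 note EL = bimodule_left[OF tensor_bimod(2)[OF M.P M.Q]] and ER = bimodule_right[OF tensor_bimod(2)[OF M.P M.Q]]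
 have l_left: "l (v \<triangleleft>\<^sub>V i r) y = l v (r \<odot>\<^sub>?E y)" if v: "v \<in>. V" "r \<in>. R" and y: "y \<in>. ?E" for v r y
  using y
 proof (induction y rule: M.T.induct)
  case (pure u u')
  then show ?case using v VR iD W.move[of v r u] M.PL by (simp add: l tensor_bimod(3)[OF M.P M.Q])
 next
  case (add x y)
  then show ?case using v VR iD EL by (simp add: addD[OF l(1)])
 qed
 have l_right: "l v (y \<triangleleft>\<^sub>?E r) = l v y \<star>\<^sub>?T r" if v: "v \<in>. V" "r \<in>. R" and y: "y \<in>. ?E" for v r y
  using y
 proof (induction y rule: M.T.induct)
  case (pure u u')
  then show ?case using v M.QR W.closed by (simp add: l tensor_bimod(4)[OF M.P M.Q] TB(3))
 next
  case (add x y)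
  then show ?case using v ER TD by (simp add: addD[OF l(1)])
 qed
 have k_rmod: "(%v. l v e) \<in> rhom R ?Q ?T"
 proof (rule rmod_homI)
  show "(%v. l v e) \<in> add_homs ?Q ?T"
   using e l_add addD(1)[OF l(1)] by (intro addI) simp_all
  fix r v assume "r \<in>. R" "v \<in>. ?Q"
  then show "l (v \<star>\<^sub>?Q r) e = l v e \<star>\<^sub>?T r"
   using e by (simp add: l_left l_right central)
 qed
 have ml: "m (l v y) = v \<triangleleft>\<^sub>V i (f y)" if v: "v \<in>. V" and y: "y \<in>. ?E" for v y
  using y
 proof (induction y rule: M.T.induct)
  case (pure u u')
  then show ?case using v W.closed by (simp add: l m n)
 next
  case (add x y)
  then show ?case using v addD(1)[OF l(1)[OF v]] VR iD M.fL(2) by (simp add: addD(2)[OF l(1)] addD(2)[OF m(1)] M.fL(3))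
 qed
 then have "m (l v e) = v" if "v \<in>. V" for v
  using that e iD VR by simp
 then show ?thesis
  using dual_basis_right_retract[OF TB(2) Q bs k_rmod m_rmod] by auto
qed

section \<open>Equivalence of the six conditions\<close>

locale tensor_data =
 fixes R :: "('r, 'a) ring_scheme" and S :: "('s, 'b) ring_scheme" and i :: "'r => 's"
  and U :: "('r, 'r, 'u) bimodule" and V :: "('s, 's, 'v) bimodule"
 assumes R: "ring R" and S: "ring S" and i: "i \<in> ring_hom R S"
  and U: "is_bimodule R R U" and V: "is_bimodule S S V"
begin

abbreviation "W \<equiv> VU R i V U"
abbreviation "VR \<equiv> restrict_bimod (%s. s) i V"

lemma VR: "is_bimodule S R VR"
 by (rule restrict_bimod_bimodule[OF S R id_ring_hom i V])

lemmas WT = tensor_bimod[OF VR U, folded VU_def vu_def]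

sublocale extension R S i W
 by (rule extension.intro[OF R S i WT(2)])

sublocale T: tensor R "rpart VR" U W "vu R i V U"
 by (rule WT(1))

definition pair_of :: "'v \<times> 'u \<times> 's => ('v, 'u) tens \<times> 's" where
 "pair_of q = (vu R i V U (fst q) (fst (snd q)), snd (snd q))"

lemma pairs_closed:
 assumes "set vs \<subseteq> carrier V \<times> carrier U \<times> carrier S"
 shows "set (map pair_of vs) \<subseteq> carrier W \<times> carrier S"
 using assms T.closed by (auto simp: pair_of_def)

lemma sum_on_pure_iff:
 assumes ws: "set ws \<subseteq> carrier W \<times> carrier S"
  and om: "om \<in> bimod_hom R R (restrict_bimod i (%r. r) W) (regular R)"
 shows "(\<forall>u\<in>carrier U. \<forall>v\<in>carrier V.
   lsum W (%p. fst p \<triangleleft>\<^sub>W om (vu R i V U (snd p \<odot>\<^sub>V v) u)) ws = vu R i V U v u) \<longleftrightarrow>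
   (\<forall>w\<in>carrier W. lsum W (%p. fst p \<triangleleft>\<^sub>W om (snd p \<odot>\<^sub>W w)) ws = w)" (is "?P \<longleftrightarrow> ?Q")
proof -
 note omD = omega_homD[OF om]
 have ws': "fst p \<in>. W" "snd p \<in>. S" if "p \<in> set ws" for p using ws that by auto
 have eq: "lsum W (%p. fst p \<triangleleft>\<^sub>W om (vu R i V U (snd p \<odot>\<^sub>V v) u)) ws =
   lsum W (%p. fst p \<triangleleft>\<^sub>W om (snd p \<odot>\<^sub>W vu R i V U v u)) ws" if "u \<in>. U" "v \<in>. V" for u v
  using ws' that by (intro lsum_cong) (simp_all add: WT(3))
 have hom: "(%w. lsum W (%p. fst p \<triangleleft>\<^sub>W om (snd p \<odot>\<^sub>W w)) ws) \<in> add_homs W W"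
 proof (rule add_homs_lsum_pointwise[OF _ ag(3) ag(3)])
  fix p assume p: "p \<in> set ws"
  show "(%w. fst p \<triangleleft>\<^sub>W om (snd p \<odot>\<^sub>W w)) \<in> add_homs W W"
   using ws'[OF p] omD WL WR by (intro addI) simp_all
 qed
 have id: "(%w. w) \<in> add_homs W W" by (rule addI) auto
 show ?thesis
 proof
  assume P: ?P
  show ?Q
  proof
   fix w assume w: "w \<in>. W"
   show "lsum W (%p. fst p \<triangleleft>\<^sub>W om (snd p \<odot>\<^sub>W w)) ws = w"
   by (rule T.ext[OF hom id w]) (use P eq in simp)
  qed
 next
  assume ?Q
  then show ?P using eq T.closed by simp
 qed
qed

lemma dual_system_pure:
 assumes "dual_system R S i W ws om"
 obtains vs where "set vs \<subseteq> carrier V \<times> carrier U \<times> carrier S" "dual_system R S i W (map pair_of vs) om"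
proof -
 interpret dual R S i W ws om by unfold_locales (rule assms)
 have "\<forall>w\<in>carrier W. \<exists>ps. set ps \<subseteq> carrier V \<times> carrier U \<and> w = lsum W (%p. vu R i V U (fst p) (snd p)) ps"
 proof
  fix w assume "w \<in>. W"
  then obtain ps where "set ps \<subseteq> carrier (rpart VR) \<times> carrier U" "w = lsum W (%p. vu R i V U (fst p) (snd p)) ps"
   by (rule T.expand)
  then show "\<exists>ps. set ps \<subseteq> carrier V \<times> carrier U \<and> w = lsum W (%p. vu R i V U (fst p) (snd p)) ps" by auto
 qed
 then have ex: "\<exists>ps. set ps \<subseteq> carrier V \<times> carrier U \<and> w = lsum W (%p. vu R i V U (fst p) (snd p)) ps"
  if "w \<in>. W" for w using that by blast
 define e where "e w = (SOME ps. set ps \<subseteq> carrier V \<times> carrier U \<and> w = lsum W (%p. vu R i V U (fst p) (snd p)) ps)" for w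
 have e: "set (e w) \<subseteq> carrier V \<times> carrier U" "w = lsum W (%p. vu R i V U (fst p) (snd p)) (e w)" if "w \<in>. W" for w
  using someI_ex[OF ex[OF that], folded e_def] by auto
 define vs where "vs = concat (map (%p. map (%q. (fst q, snd q, snd p)) (e (fst p))) ws)"
 have vs: "set vs \<subseteq> carrier V \<times> carrier U \<times> carrier S"
  using ws e(1) by (fastforce simp: vs_def)
 note vs' = pairs_closed[OF vs]
 have ep: "vu R i V U (fst q) (snd q) \<in>. W" if "p \<in> set ws" "q \<in> set (e (fst p))" for p q
  using e(1)[OF ws(1)[OF that(1)]] that(2) T.closed by auto
 have sumS: "lsum S (%p. i (om (t \<odot>\<^sub>W fst p)) \<otimes>\<^sub>S snd p) (map pair_of vs) = t" if t: "t \<in>. S" for t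
 proof -
  have "lsum S (%p. i (om (t \<odot>\<^sub>W fst p)) \<otimes>\<^sub>S snd p) (map pair_of vs) =
   lsum S (%p. lsum S (%q. i (om (t \<odot>\<^sub>W vu R i V U (fst q) (snd q))) \<otimes>\<^sub>S snd p) (e (fst p))) ws"
   unfolding lsum_map vs_def using t ep ws WL iD SS omegaD
   by (subst lsum_concat) (auto simp: lsum_map pair_of_def)
  also have "... = lsum S (%p. i (om (t \<odot>\<^sub>W fst p)) \<otimes>\<^sub>S snd p) ws"
  proof (rule lsum_cong[OF refl])
   fix p assume p: "p \<in> set ws"
   show "lsum S (%q. i (om (t \<odot>\<^sub>W vu R i V U (fst q) (snd q))) \<otimes>\<^sub>S snd p) (e (fst p)) = i (om (t \<odot>\<^sub>W fst p)) \<otimes>\<^sub>S snd p"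
   using add_lsum[OF i_hom_sum[OF ws(2)[OF p] t] ag(3) ag(2), of "e (fst p)" "%q. vu R i V U (fst q) (snd q)"]
   ep[OF p] e(2)[OF ws(1)[OF p]] by simp
  qed
  finally show ?thesis using t by (simp add: sum_S)
 qed
 have sumW: "lsum W (%p. fst p \<triangleleft>\<^sub>W om (snd p \<odot>\<^sub>W w)) (map pair_of vs) = w" if w: "w \<in>. W" for w
 proof -
  have "lsum W (%p. fst p \<triangleleft>\<^sub>W om (snd p \<odot>\<^sub>W w)) (map pair_of vs) =
   lsum W (%p. lsum W (%q. vu R i V U (fst q) (snd q) \<triangleleft>\<^sub>W om (snd p \<odot>\<^sub>W w)) (e (fst p))) ws"
   unfolding lsum_map vs_def using w ep ws WL WR omegaD
   by (subst lsum_concat) (auto simp: lsum_map pair_of_def)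
  also have "... = lsum W (%p. fst p \<triangleleft>\<^sub>W om (snd p \<odot>\<^sub>W w)) ws"
  proof (rule lsum_cong[OF refl])
   fix p assume p: "p \<in> set ws"
   show "lsum W (%q. vu R i V U (fst q) (snd q) \<triangleleft>\<^sub>W om (snd p \<odot>\<^sub>W w)) (e (fst p)) = fst p \<triangleleft>\<^sub>W om (snd p \<odot>\<^sub>W w)"
   using bimodule_right_lsum(1)[OF W, of "om (snd p \<odot>\<^sub>W w)" "e (fst p)" "%q. vu R i V U (fst q) (snd q)"]
   ep[OF p] ws[OF p] w WL omegaD e(2)[OF ws(1)[OF p]] by simp
  qed
  finally show ?thesis using w by (simp add: sum_W)
 qed
 have "dual_system R S i W (map pair_of vs) om"
  using vs' omega sumS sumW by (simp add: dual_system_def)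
 with vs show thesis by (rule that)
qed

lemma VUS_T: "tensor R (rpart W) SB (VUS R S i V U) (ptens R (rpart W) SB)"
 unfolding VUS_def by (rule tensor_bimod(1)[OF W SB])

lemma vus_conv: "vus R S i V U v u s = ptens R (rpart W) SB (fst (pair_of (v, u, s))) (snd (pair_of (v, u, s)))"
 by (simp add: vus_def pair_of_def)

end

context
 fixes R S :: "'u ring" and i :: "'u => 'u" and U V :: "('u, 'u, 'u) bimodule"
 assumes td: "tensor_data R S i U V"
begin

interpretation tensor_data R S i U V by (rule td)

lemma condition_vi_iff: "condition_vi R S i U V \<longleftrightarrow> (\<exists>ws om. dual_system R S i (VU R i V U) ws om)"
proof
 assume "condition_vi R S i U V"
 then obtain n :: nat and v u s om where
  vus: "v \<in> {..<n} \<rightarrow> carrier V" "u \<in> {..<n} \<rightarrow> carrier U" "s \<in> {..<n} \<rightarrow> carrier S"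
  and om: "om \<in> bimod_hom R R (restrict_bimod i (%r. r) W) (regular R)"
  and sumS: "\<forall>t\<in>carrier S. (\<Oplus>\<^bsub>S\<^esub>j\<in>{..<n}. i (om (vu R i V U (t \<odot>\<^sub>V v j) (u j))) \<otimes>\<^sub>S s j) = t"
  and sumW: "\<forall>u'\<in>carrier U. \<forall>v'\<in>carrier V.
   (\<Oplus>\<^bsub>W\<^esub>j\<in>{..<n}. vu R i V U (v j) (u j) \<triangleleft>\<^sub>W om (vu R i V U (s j \<odot>\<^sub>V v') u')) = vu R i V U v' u'"
  unfolding condition_vi_def by auto
 define vs where "vs = map (%j. (v j, u j, s j)) [0..<n]"
 note omD = omega_homD[OF om] and VL = bimodule_left[OF V]
 have vs: "set vs \<subseteq> carrier V \<times> carrier U \<times> carrier S" using vus by (auto simp: vs_def)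
 note pc = pairs_closed[OF vs]
 have c: "v j \<in>. V" "u j \<in>. U" "s j \<in>. S" if "j < n" for j using vus that by auto
 have "lsum S (%p. i (om (t \<odot>\<^sub>W fst p)) \<otimes>\<^sub>S snd p) (map pair_of vs) = t" if t: "t \<in>. S" for t
 proof -
  have "(\<Oplus>\<^bsub>S\<^esub>j\<in>{..<n}. i (om (vu R i V U (t \<odot>\<^sub>V v j) (u j))) \<otimes>\<^sub>S s j) =
   lsum S (%j. i (om (vu R i V U (t \<odot>\<^sub>V v j) (u j))) \<otimes>\<^sub>S s j) [0..<n]"
   using c t VL T.closed omD iD SS by (intro finsum_conv_lsum) auto
  also have "... = lsum S (%p. i (om (t \<odot>\<^sub>W fst p)) \<otimes>\<^sub>S snd p) (map pair_of vs)"
   unfolding vs_def lsum_map using c t by (intro lsum_cong) (auto simp: pair_of_def WT(3))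
  finally show ?thesis using sumS t by simp
 qed
 moreover have "lsum W (%p. fst p \<triangleleft>\<^sub>W om (vu R i V U (snd p \<odot>\<^sub>V v') u')) (map pair_of vs) = vu R i V U v' u'"
  if "u' \<in>. U" "v' \<in>. V" for u' v'
 proof -
  have "(\<Oplus>\<^bsub>W\<^esub>j\<in>{..<n}. vu R i V U (v j) (u j) \<triangleleft>\<^sub>W om (vu R i V U (s j \<odot>\<^sub>V v') u')) =
   lsum W (%j. vu R i V U (v j) (u j) \<triangleleft>\<^sub>W om (vu R i V U (s j \<odot>\<^sub>V v') u')) [0..<n]"
   using c that VL T.closed omD WR by (intro finsum_conv_lsum) auto
  also have "... = lsum W (%p. fst p \<triangleleft>\<^sub>W om (vu R i V U (snd p \<odot>\<^sub>V v') u')) (map pair_of vs)"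
   unfolding vs_def lsum_map by (simp add: pair_of_def)
  finally show ?thesis using sumW that by simp
 qed
 ultimately have "dual_system R S i W (map pair_of vs) om"
  using pc om sum_on_pure_iff[OF pc om] by (simp add: dual_system_def)
 then show "\<exists>ws om. dual_system R S i (VU R i V U) ws om" by blast
next
 assume "\<exists>ws om. dual_system R S i (VU R i V U) ws om"
 then obtain vs om where vs: "set vs \<subseteq> carrier V \<times> carrier U \<times> carrier S" and d: "dual_system R S i W (map pair_of vs) om"
  by (elim exE) (rule dual_system_pure)
 interpret dual R S i W "map pair_of vs" om by unfold_locales (rule d)
 note VL = bimodule_left[OF V] and pc = pairs_closed[OF vs]
 let ?v = "%j. fst (vs ! j)" and ?u = "%j. fst (snd (vs ! j))" and ?s = "%j. snd (snd (vs ! j))"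
 have q: "fst q \<in>. V" "fst (snd q) \<in>. U" "snd (snd q) \<in>. S" if "q \<in> set vs" for q
  using vs that by auto
 have c: "?v j \<in>. V" "?u j \<in>. U" "?s j \<in>. S" if "j < length vs" for j
  using q[OF nth_mem[OF that]] by auto
 interpret Z: tensor R "rpart W" SB "VUS R S i V U" "ptens R (rpart W) SB" by (rule VUS_T)
 have z: "(\<Oplus>\<^bsub>VUS R S i V U\<^esub>j\<in>{..<length vs}. vus R S i V U (?v j) (?u j) (?s j)) \<in>. (VUS R S i V U)"
  using c T.closed Z.closed by (intro abelian_monoid.finsum_closed[OF abelian_group.axioms(1)[OF Z.T_abelian]]) (auto simp: vus_conv pair_of_def)
 have sumS: "(\<Oplus>\<^bsub>S\<^esub>j\<in>{..<length vs}. i (om (vu R i V U (t \<odot>\<^sub>V ?v j) (?u j))) \<otimes>\<^sub>S ?s j) = t" if t: "t \<in>. S" for t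
 proof -
  have "(\<Oplus>\<^bsub>S\<^esub>j\<in>{..<length vs}. i (om (vu R i V U (t \<odot>\<^sub>V ?v j) (?u j))) \<otimes>\<^sub>S ?s j) =
   lsum S (%q. i (om (vu R i V U (t \<odot>\<^sub>V fst q) (fst (snd q)))) \<otimes>\<^sub>S snd (snd q)) vs"
   using q t VL T.closed omegaD iD SS by (intro lsum_conv_finsum) simp_all
  also have "... = lsum S (%p. i (om (t \<odot>\<^sub>W fst p)) \<otimes>\<^sub>S snd p) (map pair_of vs)"
   unfolding lsum_map using q t by (intro lsum_cong) (simp_all add: pair_of_def WT(3))
  finally show ?thesis using t by (simp add: sum_S del: map_map)
 qed
 have sumW: "(\<Oplus>\<^bsub>W\<^esub>j\<in>{..<length vs}. vu R i V U (?v j) (?u j) \<triangleleft>\<^sub>W om (vu R i V U (?s j \<odot>\<^sub>V v') u')) = vu R i V U v' u'"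
  if uv: "u' \<in>. U" "v' \<in>. V" for u' v'
 proof -
  have "(\<Oplus>\<^bsub>W\<^esub>j\<in>{..<length vs}. vu R i V U (?v j) (?u j) \<triangleleft>\<^sub>W om (vu R i V U (?s j \<odot>\<^sub>V v') u')) =
   lsum W (%q. vu R i V U (fst q) (fst (snd q)) \<triangleleft>\<^sub>W om (vu R i V U (snd (snd q) \<odot>\<^sub>V v') u')) vs"
   using q uv VL T.closed omegaD WR by (intro lsum_conv_finsum) simp_all
  also have "... = lsum W (%p. fst p \<triangleleft>\<^sub>W om (vu R i V U (snd p \<odot>\<^sub>V v') u')) (map pair_of vs)"
   unfolding lsum_map by (simp add: pair_of_def)
  finally show ?thesis using sum_on_pure_iff[OF pc omega] sum_W uv by simp
 qed
 show "condition_vi R S i U V"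
  unfolding condition_vi_def
  using z omega sumS sumW c
  by (intro exI[of _ "(\<Oplus>\<^bsub>VUS R S i V U\<^esub>j\<in>{..<length vs}. vus R S i V U (?v j) (?u j) (?s j))"]
   exI[of _ "length vs"] exI[of _ ?v] exI[of _ ?u] exI[of _ ?s] exI[of _ om]) auto
qed

lemma condition_v_iff: "condition_v R S i U V \<longleftrightarrow> (\<exists>ws om. dual_system R S i (VU R i V U) ws om)"
proof
 assume "condition_v R S i U V"
 then obtain n :: nat and v u s om where
  vus: "v \<in> {..<n} \<rightarrow> carrier V" "u \<in> {..<n} \<rightarrow> carrier U" "s \<in> {..<n} \<rightarrow> carrier S"
  and om: "om \<in> bimod_hom R R (restrict_bimod i (%r. r) W) (regular R)"
  and central: "(\<Oplus>\<^bsub>VUS R S i V U\<^esub>j\<in>{..<n}. vus R S i V U (v j) (u j) (s j)) \<in> centralizer S (VUS R S i V U)"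
  and sum1: "(\<Oplus>\<^bsub>S\<^esub>j\<in>{..<n}. i (om (vu R i V U (v j) (u j))) \<otimes>\<^sub>S s j) = \<one>\<^sub>S"
  and sumW: "\<forall>u'\<in>carrier U. \<forall>v'\<in>carrier V.
   (\<Oplus>\<^bsub>W\<^esub>j\<in>{..<n}. vu R i V U (v j) (u j) \<triangleleft>\<^sub>W om (vu R i V U (s j \<odot>\<^sub>V v') u')) = vu R i V U v' u'"
  unfolding condition_v_def by auto
 define vs where "vs = map (%j. (v j, u j, s j)) [0..<n]"
 note omD = omega_homD[OF om] and VL = bimodule_left[OF V]
 have vs: "set vs \<subseteq> carrier V \<times> carrier U \<times> carrier S" using vus by (auto simp: vs_def)
 note pc = pairs_closed[OF vs]
 have c: "v j \<in>. V" "u j \<in>. U" "s j \<in>. S" if "j < n" for j using vus that by auto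
 interpret Z: tensor R "rpart W" SB "VUS R S i V U" "ptens R (rpart W) SB" by (rule VUS_T)
 have one: "lsum S (%p. i (om (fst p)) \<otimes>\<^sub>S snd p) (map pair_of vs) = \<one>\<^sub>S"
 proof -
  have "(\<Oplus>\<^bsub>S\<^esub>j\<in>{..<n}. i (om (vu R i V U (v j) (u j))) \<otimes>\<^sub>S s j) =
   lsum S (%j. i (om (vu R i V U (v j) (u j))) \<otimes>\<^sub>S s j) [0..<n]"
   using c VL T.closed omD iD SS by (intro finsum_conv_lsum) auto
  also have "... = lsum S (%p. i (om (fst p)) \<otimes>\<^sub>S snd p) (map pair_of vs)"
   unfolding vs_def lsum_map by (simp add: pair_of_def)
  finally show ?thesis using sum1 by simp
 qed
 have z: "lsum (VUS R S i V U) (%p. ptens R (rpart W) SB (fst p) (snd p)) (map pair_of vs) \<in> centralizer S (VUS R S i V U)"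
 proof -
  have "(\<Oplus>\<^bsub>VUS R S i V U\<^esub>j\<in>{..<n}. vus R S i V U (v j) (u j) (s j)) = lsum (VUS R S i V U) (%j. vus R S i V U (v j) (u j) (s j)) [0..<n]"
   using c T.closed Z.closed by (intro finsum_conv_lsum Z.T_abelian) (auto simp: vus_conv pair_of_def)
  then show ?thesis using central by (simp add: vs_def lsum_map vus_conv)
 qed
 have sumS: "lsum S (%p. i (om (t \<odot>\<^sub>W fst p)) \<otimes>\<^sub>S snd p) (map pair_of vs) = t" if t: "t \<in>. S" for t
  by (rule sum_of_central[OF pc om z[unfolded VUS_def] one t])
 moreover have "lsum W (%p. fst p \<triangleleft>\<^sub>W om (vu R i V U (snd p \<odot>\<^sub>V v') u')) (map pair_of vs) = vu R i V U v' u'"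
  if "u' \<in>. U" "v' \<in>. V" for u' v'
 proof -
  have "(\<Oplus>\<^bsub>W\<^esub>j\<in>{..<n}. vu R i V U (v j) (u j) \<triangleleft>\<^sub>W om (vu R i V U (s j \<odot>\<^sub>V v') u')) =
   lsum W (%j. vu R i V U (v j) (u j) \<triangleleft>\<^sub>W om (vu R i V U (s j \<odot>\<^sub>V v') u')) [0..<n]"
   using c that VL T.closed omD WR by (intro finsum_conv_lsum) auto
  also have "... = lsum W (%p. fst p \<triangleleft>\<^sub>W om (vu R i V U (snd p \<odot>\<^sub>V v') u')) (map pair_of vs)"
   unfolding vs_def lsum_map by (simp add: pair_of_def)
  finally show ?thesis using sumW that by simp
 qed
 ultimately have "dual_system R S i W (map pair_of vs) om"
  using pc om sum_on_pure_iff[OF pc om] by (simp add: dual_system_def)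
 then show "\<exists>ws om. dual_system R S i (VU R i V U) ws om" by blast
next
 assume "\<exists>ws om. dual_system R S i (VU R i V U) ws om"
 then obtain vs om where vs: "set vs \<subseteq> carrier V \<times> carrier U \<times> carrier S" and d: "dual_system R S i W (map pair_of vs) om"
  by (elim exE) (rule dual_system_pure)
 interpret dual R S i W "map pair_of vs" om by unfold_locales (rule d)
 note VL = bimodule_left[OF V] and pc = pairs_closed[OF vs]
 let ?v = "%j. fst (vs ! j)" and ?u = "%j. fst (snd (vs ! j))" and ?s = "%j. snd (snd (vs ! j))"
 have q: "fst q \<in>. V" "fst (snd q) \<in>. U" "snd (snd q) \<in>. S" if "q \<in> set vs" for q
  using vs that by auto
 have c: "?v j \<in>. V" "?u j \<in>. U" "?s j \<in>. S" if "j < length vs" for j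
  using q[OF nth_mem[OF that]] by auto
 interpret Z: tensor R "rpart W" SB "VUS R S i V U" "ptens R (rpart W) SB" by (rule VUS_T)
 have z: "(\<Oplus>\<^bsub>VUS R S i V U\<^esub>j\<in>{..<length vs}. vus R S i V U (?v j) (?u j) (?s j)) \<in> centralizer S (VUS R S i V U)"
 proof -
  have "(\<Oplus>\<^bsub>VUS R S i V U\<^esub>j\<in>{..<length vs}. vus R S i V U (?v j) (?u j) (?s j)) =
   lsum (VUS R S i V U) (%q. vus R S i V U (fst q) (fst (snd q)) (snd (snd q))) vs"
   using q T.closed Z.closed by (intro lsum_conv_finsum Z.T_abelian) (simp add: vus_conv pair_of_def)
  also have "... = lsum (VUS R S i V U) (%p. ptens R (rpart W) SB (fst p) (snd p)) (map pair_of vs)"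
   by (simp add: lsum_map vus_conv)
  finally show ?thesis using casimir_central by (simp add: VUS_def)
 qed
 have sum1: "(\<Oplus>\<^bsub>S\<^esub>j\<in>{..<length vs}. i (om (vu R i V U (?v j) (?u j))) \<otimes>\<^sub>S ?s j) = \<one>\<^sub>S"
 proof -
  have "(\<Oplus>\<^bsub>S\<^esub>j\<in>{..<length vs}. i (om (vu R i V U (?v j) (?u j))) \<otimes>\<^sub>S ?s j) =
   lsum S (%q. i (om (vu R i V U (fst q) (fst (snd q)))) \<otimes>\<^sub>S snd (snd q)) vs"
   using q VL T.closed omegaD iD SS by (intro lsum_conv_finsum) simp_all
  also have "... = lsum S (%p. i (om (\<one>\<^sub>S \<odot>\<^sub>W fst p)) \<otimes>\<^sub>S snd p) (map pair_of vs)"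
   unfolding lsum_map using q T.closed WL by (intro lsum_cong) (simp_all add: pair_of_def)
  finally show ?thesis using sum_S SS by simp
 qed
 have sumW: "(\<Oplus>\<^bsub>W\<^esub>j\<in>{..<length vs}. vu R i V U (?v j) (?u j) \<triangleleft>\<^sub>W om (vu R i V U (?s j \<odot>\<^sub>V v') u')) = vu R i V U v' u'"
  if uv: "u' \<in>. U" "v' \<in>. V" for u' v'
 proof -
  have "(\<Oplus>\<^bsub>W\<^esub>j\<in>{..<length vs}. vu R i V U (?v j) (?u j) \<triangleleft>\<^sub>W om (vu R i V U (?s j \<odot>\<^sub>V v') u')) =
   lsum W (%q. vu R i V U (fst q) (fst (snd q)) \<triangleleft>\<^sub>W om (vu R i V U (snd (snd q) \<odot>\<^sub>V v') u')) vs"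
   using q uv VL T.closed omegaD WR by (intro lsum_conv_finsum) simp_all
  also have "... = lsum W (%p. fst p \<triangleleft>\<^sub>W om (vu R i V U (snd p \<odot>\<^sub>V v') u')) (map pair_of vs)"
   unfolding lsum_map by (simp add: pair_of_def)
  finally show ?thesis using sum_on_pure_iff[OF pc omega] sum_W uv by simp
 qed
 show "condition_v R S i U V"
  unfolding condition_v_def
  using z omega sum1 sumW c
  by (intro exI[of _ "(\<Oplus>\<^bsub>VUS R S i V U\<^esub>j\<in>{..<length vs}. vus R S i V U (?v j) (?u j) (?s j))"]
   exI[of _ "length vs"] exI[of _ ?v] exI[of _ ?u] exI[of _ ?s] exI[of _ om]) auto
qed

end

lemma condition_i_iff:
 assumes "tensor_data R S i U V"
 shows "condition_i R S i U V \<longleftrightarrow> (\<exists>ws om. dual_system R S i (VU R i V U) ws om)"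
proof -
 interpret tensor_data R S i U V by fact
 show ?thesis
 proof
  assume "condition_i R S i U V"
  then show "\<exists>ws om. dual_system R S i W ws om"
   unfolding condition_i_def by (rule dual_system_of_tensor_Hom_iso[OF extension_axioms])
 next
  assume "\<exists>ws om. dual_system R S i W ws om"
  then obtain ws om where "dual_system R S i W ws om" by blast
  then interpret dual R S i W ws om by unfold_locales
  show "condition_i R S i U V" unfolding condition_i_def by (rule tensor_Hom_isomorphic)
 qed
qed

lemma condition_ii_iff:
 fixes U V :: "('u::infinite, 'u, 'u) bimodule"
 assumes "tensor_data R S i U V"
 shows "condition_ii R S i U V \<longleftrightarrow> (\<exists>ws om. dual_system R S i (VU R i V U) ws om)"
proof -
 interpret tensor_data R S i U V by fact
 have "carrier (tensor_lmod R VR (lmod_of U)) = carrier W"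
  by (simp add: tensor_lmod_def VU_def tensor_bimod_def tensor_group_def tensor_kernel_def tensor_relations_def)
 then have e: "inj_on (universe_inj (tensor_lmod R VR (lmod_of U)) :: ('u, 'u) tens => 'u) (carrier W)"
  using universe_inj_tensor[of R VR "lmod_of U"] by simp
 show ?thesis
 proof
  assume "condition_ii R S i U V"
  then show "\<exists>ws om. dual_system R S i W ws om"
   unfolding condition_ii_def by (rule dual_system_of_right_tensor_Hom_iso[OF extension_axioms e])
 next
  assume "\<exists>ws om. dual_system R S i W ws om"
  then obtain ws om where "dual_system R S i W ws om" by blast
  then interpret dual R S i W ws om by unfold_locales
  show "condition_ii R S i U V" unfolding condition_ii_def by (rule right_tensor_Hom_isomorphic)
 qed
qed

lemma condition_iii_iff:
 fixes U V :: "('u::infinite, 'u, 'u) bimodule"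
 assumes "tensor_data R S i U V"
 shows "condition_iii R S i U V \<longleftrightarrow> (\<exists>ws om. dual_system R S i (VU R i V U) ws om)"
proof -
 interpret tensor_data R S i U V by fact
 note fp = fin_gen_projective_left_iff[OF bimoduleD(1)[OF SB]]
 show ?thesis
 proof
  assume "condition_iii R S i U V"
  then obtain bs \<Psi> where "dual_basis_left R SB bs" "\<Psi> \<in> bimod_iso S R W (lHom_bimod R SB (regular R))"
   using fp unfolding condition_iii_def by blast
  then show "\<exists>ws om. dual_system R S i W ws om" by (rule dual_system_of_lHom_iso)
 next
  assume "\<exists>ws om. dual_system R S i W ws om"
  then obtain ws om where "dual_system R S i W ws om" by blast
  then interpret dual R S i W ws om by unfold_locales
  show "condition_iii R S i U V" unfolding condition_iii_def using lHom_iso dual_basis_S fp by blast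
 qed
qed

lemma condition_iv_iff:
 fixes R S :: "'u::infinite ring" and U V :: "('u, 'u, 'u) bimodule"
 assumes td: "tensor_data R S i U V" and ctxU: "strict_morita_context R R U U' f f'" and ctxV: "strict_morita_context S S V V' g g'"
 shows "condition_iv R S i U V \<longleftrightarrow> (\<exists>ws om. dual_system R S i (VU R i V U) ws om)"
proof -
 interpret tensor_data R S i U V by fact
 interpret MU: morita R R U U' f f' by (rule morita.intro[OF ctxU])
 interpret MV: morita S S V V' g g' by (rule morita.intro[OF ctxV])
 let ?S = "ring_bimod S (%s. s) i"
 have "rmod R (rpart ?S)" by (rule bimoduleD(2)[OF ring_bimod_bimodule[OF S R S id_ring_hom i]])
 note fp = fin_gen_projective_right_iff[OF this]
 show ?thesis
 proof
  assume "condition_iv R S i U V"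
  then obtain ss \<Phi> where ss: "dual_basis_right R (rpart ?S) ss" and \<Phi>: "\<Phi> \<in> bimod_iso R S SB (rHom_bimod R W (regular R))"
   using fp unfolding condition_iv_def by blast
  obtain vs where "dual_basis_right S (rpart V) vs" using MV.dual_basis_P by blast
  from dual_basis_restrict_of_ring[OF R i V this ss]
  obtain vs' where vs': "dual_basis_right R (rpart VR) vs'" by blast
  obtain us where us: "dual_basis_right R (rpart U) us" using MU.dual_basis_P by blast
  from dual_basis_right_tensor[OF bimoduleD(2)[OF VR] vs' U us]
  obtain ws where "dual_basis_right R (rpart W) ws" by (auto simp: VU_def right_part_tensor_bimod)
  from dual_system_of_rHom_iso[OF this \<Phi>] show "\<exists>ws om. dual_system R S i W ws om" .
 next
  assume "\<exists>ws om. dual_system R S i W ws om"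
  then obtain ws om where "dual_system R S i W ws om" by blast
  then interpret dual R S i W ws om by unfold_locales
  from dual_basis_restrict_of_tensor[OF R i V ctxU dual_basis_W]
  obtain vs where "dual_basis_right R (rpart VR) vs" by blast
  from dual_basis_ring_of_restrict[OF R i ctxV this]
  show "condition_iv R S i U V" unfolding condition_iv_def using rHom_iso fp by blast
 qed
qed

section \<open>Functors between module categories\<close>

lemma lmod_cat_simps [simp]:
 "Ob (lmod_cat R) = {M. lmod R M}"
 "Dom (lmod_cat R) (M, f, N) = M" "Cod (lmod_cat R) (M, f, N) = N"
 "Idt (lmod_cat R) M = (M, \<lambda>x\<in>carrier M. x, M)"
 "Comp (lmod_cat R) (N', g, K) (M, f, N) = (M, compose (carrier M) g f, K)"
 "(M, f, N) \<in> Ar (lmod_cat R) \<longleftrightarrow> lmod R M \<and> lmod R N \<and> f \<in> lhom R M N \<and> f \<in> extensional (carrier M)"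
 by (auto simp: lmod_cat_def)

lemma Hom_lmod_cat:
 "a \<in> Hom (lmod_cat R) M N \<longleftrightarrow>
  (\<exists>f. a = (M, f, N) \<and> lmod R M \<and> lmod R N \<and> f \<in> lhom R M N \<and> f \<in> extensional (carrier M))"
 by (cases a) (auto simp: Hom_def)

lemma Ar_lmod_cat_cases:
 assumes "a \<in> Ar (lmod_cat R)"
 obtains M f N where "a = (M, f, N)" "lmod R M" "lmod R N" "f \<in> lhom R M N" "f \<in> extensional (carrier M)"
 using assms by (cases a) auto

text \<open>Arrows carry extensional functions. Restricting first lets \<open>fmap\<close> take any function, of which only the values on the carrier matter.\<close>

definition fmap ::
 "('r, 'm, 's, 'n) lmod_functor => ('r, 'm) module => ('r, 'm) module => ('m => 'm) => 'n => 'n" where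
 "fmap F M N h = fst (snd (on_ar F (M, restrict h (carrier M), N)))"

lemma fmap_cong: "(!!x. x \<in>. M ==> h x = h' x) ==> fmap F M N h = fmap F M N h'"
 unfolding fmap_def by (metis restrict_ext)

lemma fmap_comp_functor:
 fixes F :: "('r, 'm, 's, 'n) lmod_functor"
 assumes "lfunctor R S F" "lmod R M" "lmod R N" "h \<in> lhom R M N"
 shows "on_ar F (M, restrict h (carrier M), N) = (on_ob F M, fmap F M N h, on_ob F N)"
  "lmod S (on_ob F M)" "lmod S (on_ob F N)"
  "fmap F M N h \<in> lhom S (on_ob F M) (on_ob F N)" "fmap F M N h \<in> extensional (carrier (on_ob F M))"
proof -
 have "(M, restrict h (carrier M), N) \<in> Ar (lmod_cat R)"
  using assms lhom_restrict[OF assms(4,2)] by simp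
 then have "on_ar F (M, restrict h (carrier M), N) \<in> Hom (lmod_cat S) (on_ob F M) (on_ob F N)"
  using assms(1) unfolding is_functor_def by fastforce
 then show "on_ar F (M, restrict h (carrier M), N) = (on_ob F M, fmap F M N h, on_ob F N)"
  "lmod S (on_ob F M)" "lmod S (on_ob F N)"
  "fmap F M N h \<in> lhom S (on_ob F M) (on_ob F N)" "fmap F M N h \<in> extensional (carrier (on_ob F M))"
  by (auto simp: Hom_lmod_cat fmap_def)
qed

lemma functor_ob: "lfunctor R S F ==> lmod R M ==> lmod S (on_ob F M)"
 by (simp add: is_functor_def)

lemmas fmap_hom = fmap_comp_functor(4)
lemmas fmap_ext = fmap_comp_functor(5)

lemma on_ar_fmap:
 fixes F :: "('r, 'm, 's, 'n) lmod_functor"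
 assumes "lfunctor R S F" "(M, f, N) \<in> Ar (lmod_cat R)"
 shows "on_ar F (M, f, N) = (on_ob F M, fmap F M N f, on_ob F N)"
proof -
 have "restrict f (carrier M) = f" using assms(2) by (auto simp: extensional_restrict)
 then show ?thesis using fmap_comp_functor(1)[OF assms(1), of M N f] assms(2) by simp
qed

lemma fmap_id:
 fixes F :: "('r, 'm, 's, 'n) lmod_functor"
 assumes "lfunctor R S F" "lmod R M" "!!x. x \<in>. M ==> h x = x" "y \<in>. (on_ob F M)"
 shows "fmap F M M h y = y"
proof -
 have "fmap F M M h = fmap F M M (%x. x)" using assms(3) by (rule fmap_cong)
 moreover have "on_ar F (M, \<lambda>x\<in>carrier M. x, M) = (on_ob F M, \<lambda>x\<in>carrier (on_ob F M). x, on_ob F M)"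
  using assms(1,2) by (simp add: is_functor_def)
 ultimately show ?thesis using assms(4) by (simp add: fmap_def)
qed

lemma fmap_comp:
 fixes F :: "('r, 'm, 's, 'n) lmod_functor"
 assumes F: "lfunctor R S F" and M: "lmod R M" "lmod R N" "lmod R K"
  and f: "f \<in> lhom R M N" and g: "g \<in> lhom R N K" and y: "y \<in>. (on_ob F M)"
 shows "fmap F M K (%x. g (f x)) y = fmap F N K g (fmap F M N f y)"
proof -
 let ?f = "restrict f (carrier M)" and ?g = "restrict g (carrier N)"
 have ar: "(M, ?f, N) \<in> Ar (lmod_cat R)" "(N, ?g, K) \<in> Ar (lmod_cat R)"
  using M lhom_restrict[OF f M(1)] lhom_restrict[OF g M(2)] by auto
 have "on_ar F (Comp (lmod_cat R) (N, ?g, K) (M, ?f, N)) = Comp (lmod_cat S) (on_ar F (N, ?g, K)) (on_ar F (M, ?f, N))"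
  using F ar unfolding is_functor_def by (metis lmod_cat_simps(2,3))
 moreover have "compose (carrier M) ?g ?f = restrict (%x. g (f x)) (carrier M)"
  using lhomD(2)[OF f] by (auto simp: compose_def restrict_def fun_eq_iff)
 ultimately have "on_ar F (M, restrict (%x. g (f x)) (carrier M), K) =
   (on_ob F M, compose (carrier (on_ob F M)) (fmap F N K g) (fmap F M N f), on_ob F K)"
  using fmap_comp_functor(1)[OF F M(1,2) f] fmap_comp_functor(1)[OF F M(2,3) g] by simp
 then show ?thesis using y by (simp add: fmap_def compose_def)
qed

lemma lmod_functorI:
 fixes F :: "('r, 'm, 's, 'n) lmod_functor"
 assumes ob: "!!M. lmod R M ==> lmod S (on_ob F M)"
  and ar: "!!M N f. lmod R M ==> lmod R N ==> f \<in> lhom R M N ==> f \<in> extensional (carrier M) ==>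
   on_ar F (M, f, N) = (on_ob F M, A M f N, on_ob F N) \<and> A M f N \<in> lhom S (on_ob F M) (on_ob F N) \<and>
   A M f N \<in> extensional (carrier (on_ob F M))"
  and id: "!!M y. lmod R M ==> y \<in>. (on_ob F M) ==> A M (\<lambda>x\<in>carrier M. x) M y = y"
  and comp: "!!M N K f g y. lmod R M ==> lmod R N ==> lmod R K ==>
   f \<in> lhom R M N ==> f \<in> extensional (carrier M) ==> g \<in> lhom R N K ==> g \<in> extensional (carrier N) ==>
   y \<in>. (on_ob F M) ==> A M (compose (carrier M) g f) K y = A N g K (A M f N y)"
 shows "lfunctor R S F"
 unfolding is_functor_def
proof (intro conjI ballI impI)
 show "on_ob F M \<in> Ob (lmod_cat S)" if "M \<in> Ob (lmod_cat R)" for M using ob that by simp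
 fix a :: "('r, 'm) lmod_arrow" assume "a \<in> Ar (lmod_cat R)"
 then obtain M f N where a: "a = (M, f, N)" "lmod R M" "lmod R N" "f \<in> lhom R M N" "f \<in> extensional (carrier M)"
  by (rule Ar_lmod_cat_cases)
 show "on_ar F a \<in> Hom (lmod_cat S) (on_ob F (Dom (lmod_cat R) a)) (on_ob F (Cod (lmod_cat R) a))"
  using ar[OF a(2-5)] ob a(2,3) by (simp add: a(1) Hom_lmod_cat)
 fix b :: "('r, 'm) lmod_arrow" assume "b \<in> Ar (lmod_cat R)" and dc: "Dom (lmod_cat R) b = Cod (lmod_cat R) a"
 then obtain g K where b: "b = (N, g, K)" "lmod R K" "g \<in> lhom R N K" "g \<in> extensional (carrier N)"
  by (cases b) (auto simp: a(1))
 have gf: "compose (carrier M) g f \<in> lhom R M K" "compose (carrier M) g f \<in> extensional (carrier M)"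
  using lhom_restrict[OF lhom_comp[OF a(4) b(3)] a(2)] by (auto simp: compose_def)
 have "A M (compose (carrier M) g f) K = compose (carrier (on_ob F M)) (A N g K) (A M f N)"
  using ar[OF a(2) b(2) gf] comp[OF a(2,3) b(2) a(4,5) b(3,4)]
  by (intro extensionalityI[of _ "carrier (on_ob F M)"]) (auto simp: compose_def)
 then show "on_ar F (Comp (lmod_cat R) b a) = Comp (lmod_cat S) (on_ar F b) (on_ar F a)"
  using ar[OF a(2) b(2) gf] ar[OF a(2-5)] ar[OF a(3) b(2-4)] by (simp add: a(1) b(1))
next
 fix M :: "('r, 'm) module" assume "M \<in> Ob (lmod_cat R)"
 then have M: "lmod R M" by simp
 have i: "(\<lambda>x\<in>carrier M. x) \<in> lhom R M M" "(\<lambda>x\<in>carrier M. x) \<in> extensional (carrier M)"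
  using lhom_restrict[OF lmod_hom_id M] by auto
 have "A M (\<lambda>x\<in>carrier M. x) M = (\<lambda>x\<in>carrier (on_ob F M). x)"
  using ar[OF M M i] id[OF M] by (intro extensionalityI[of _ "carrier (on_ob F M)"]) auto
 then show "on_ar F (Idt (lmod_cat R) M) = Idt (lmod_cat S) (on_ob F M)"
  using ar[OF M M i] by simp
qed

lemma comp_functor_simps [simp]:
 "on_ob (comp_functor G F) M = on_ob G (on_ob F M)" "on_ar (comp_functor G F) a = on_ar G (on_ar F a)"
 by (auto simp: comp_functor_def)

lemma id_functor_simps [simp]: "on_ob id_functor M = M" "on_ar id_functor a = a"
 by (auto simp: id_functor_def)

lemma fmap_comp_functor_eq:
 fixes F :: "('r, 'm, 's, 'n) lmod_functor" and G :: "('s, 'n, 't, 'k) lmod_functor"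
 assumes F: "lfunctor R S F" and G: "lfunctor S T G"
  and M: "lmod R M" "lmod R N" "h \<in> lhom R M N"
 shows "fmap (comp_functor G F) M N h = fmap G (on_ob F M) (on_ob F N) (fmap F M N h)"
proof -
 have "restrict (fmap F M N h) (carrier (on_ob F M)) = fmap F M N h"
  using fmap_ext[OF F M] by (rule extensional_restrict)
 then show ?thesis
  using fmap_comp_functor(1)[OF F M] by (simp add: fmap_def[of "comp_functor G F"] fmap_def[of G])
qed

lemma is_functor_comp:
 fixes F :: "('r, 'm, 's, 'n) lmod_functor" and G :: "('s, 'n, 't, 'k) lmod_functor"
 assumes F: "lfunctor R S F" and G: "lfunctor S T G"
 shows "lfunctor R T (comp_functor G F)"
proof (rule lmod_functorI[where A = "%M f N. fmap G (on_ob F M) (on_ob F N) (fmap F M N f)"])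
 fix M N :: "('r, 'm) module" and f assume M: "lmod R M" "lmod R N" "f \<in> lhom R M N" "f \<in> extensional (carrier M)"
 note fm = fmap_comp_functor[OF F M(1-3)]
 have "on_ar F (M, f, N) = (on_ob F M, fmap F M N f, on_ob F N)" using on_ar_fmap[OF F] M by simp
 moreover have "on_ar G (on_ob F M, fmap F M N f, on_ob F N) =
   (on_ob G (on_ob F M), fmap G (on_ob F M) (on_ob F N) (fmap F M N f), on_ob G (on_ob F N))"
  using on_ar_fmap[OF G] fm by simp
 ultimately show "on_ar (comp_functor G F) (M, f, N) =
   (on_ob (comp_functor G F) M, fmap G (on_ob F M) (on_ob F N) (fmap F M N f), on_ob (comp_functor G F) N) \<and>
   fmap G (on_ob F M) (on_ob F N) (fmap F M N f) \<in> lhom T (on_ob (comp_functor G F) M) (on_ob (comp_functor G F) N) \<and>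
   fmap G (on_ob F M) (on_ob F N) (fmap F M N f) \<in> extensional (carrier (on_ob (comp_functor G F) M))"
  using fmap_comp_functor[OF G fm(2-4)] by simp
next
 fix M :: "('r, 'm) module" and y assume M: "lmod R M" and y: "y \<in>. (on_ob (comp_functor G F) M)"
 show "fmap G (on_ob F M) (on_ob F M) (fmap F M M (\<lambda>x\<in>carrier M. x)) y = y"
  using y by (intro fmap_id[OF G functor_ob[OF F M]] fmap_id[OF F M]) auto
next
 fix M N K :: "('r, 'm) module" and f g y
 assume M: "lmod R M" "lmod R N" "lmod R K" and f: "f \<in> lhom R M N" and g: "g \<in> lhom R N K"
  and y: "y \<in>. (on_ob (comp_functor G F) M)"
 have "fmap F M K (compose (carrier M) g f) = fmap F M K (%x. g (f x))"
  by (rule fmap_cong) (simp add: compose_def)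
 then have "fmap G (on_ob F M) (on_ob F K) (fmap F M K (compose (carrier M) g f)) =
   fmap G (on_ob F M) (on_ob F K) (%x. fmap F N K g (fmap F M N f x))"
  by (intro fmap_cong) (simp add: fmap_comp[OF F M f g])
 then show "fmap G (on_ob F M) (on_ob F K) (fmap F M K (compose (carrier M) g f)) y =
   fmap G (on_ob F N) (on_ob F K) (fmap F N K g) (fmap G (on_ob F M) (on_ob F N) (fmap F M N f) y)"
  using fmap_comp[OF G functor_ob[OF F M(1)] functor_ob[OF F M(2)] functor_ob[OF F M(3)] fmap_hom[OF F M(1,2) f] fmap_hom[OF F M(2,3) g]] y
  by simp
qed (use functor_ob[OF F] functor_ob[OF G] in auto)

lemma is_functor_id: "lfunctor R R id_functor"
 by (rule lmod_functorI[where A = "%M f N. f"]) (auto simp: compose_def)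

lemma fmap_id_functor: "fmap id_functor M N h = restrict h (carrier M)"
 by (simp add: fmap_def)

lemma isomorphism_lmod_catI:
 assumes "lmod R M" "lmod R N" "e \<in> lmod_iso R M N"
 shows "isomorphism (lmod_cat R) (M, restrict e (carrier M), N)"
proof -
 have e: "e \<in> lhom R M N" "bij_betw e (carrier M) (carrier N)" using assms(3) by (auto simp: lmod_iso_def)
 have d: "inv_into (carrier M) e \<in> lhom R N M" using lmod_iso_inv[OF assms(1,3)] by (simp add: lmod_iso_def)
 have im: "e x \<in>. N" if "x \<in>. M" for x using lhomD(2)[OF e(1) that] .
 have im': "inv_into (carrier M) e x \<in>. M" if "x \<in>. N" for x using lhomD(2)[OF d that] .
 show ?thesis
  unfolding isomorphism_def
 proof (intro conjI bexI[of _ "(N, restrict (inv_into (carrier M) e) (carrier N), M)"])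
  show "(M, restrict e (carrier M), N) \<in> Ar (lmod_cat R)"
   using assms lhom_restrict[OF e(1) assms(1)] by simp
  show "(N, restrict (inv_into (carrier M) e) (carrier N), M) \<in>
   Hom (lmod_cat R) (Cod (lmod_cat R) (M, restrict e (carrier M), N)) (Dom (lmod_cat R) (M, restrict e (carrier M), N))"
   using assms lhom_restrict[OF d assms(2)] by (simp add: Hom_lmod_cat)
 qed (use e(2) im im' in \<open>auto simp: compose_def restrict_def fun_eq_iff bij_betw_inv_into_left bij_betw_inv_into_right\<close>)
qed

lemma isomorphism_lmod_catD:
 assumes "isomorphism (lmod_cat R) (M, e, N)"
 shows "lmod R M" "lmod R N" "e \<in> lmod_iso R M N"
proof -
 from assms show M: "lmod R M" "lmod R N" by (auto simp: isomorphism_def)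
 from assms obtain d where e: "e \<in> lhom R M N" and d: "d \<in> lhom R N M"
   and c: "compose (carrier M) d e = (\<lambda>x\<in>carrier M. x)" "compose (carrier N) e d = (\<lambda>x\<in>carrier N. x)"
  unfolding isomorphism_def by (auto simp: Hom_lmod_cat)
 have "d (e x) = x" if "x \<in>. M" for x using fun_cong[OF c(1), of x] that by (simp add: compose_def)
 moreover have "e (d x) = x" if "x \<in>. N" for x using fun_cong[OF c(2), of x] that by (simp add: compose_def)
 ultimately have "bij_betw e (carrier M) (carrier N)"
  using lhomD(2)[OF e] lhomD(2)[OF d] by (intro bij_betw_byWitness[where f' = d]) auto
 with e show "e \<in> lmod_iso R M N" by (simp add: lmod_iso_def)
qed

lemma naturally_isomorphic_lmodI:
 fixes F G :: "('r, 'm, 's, 'n) lmod_functor"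
 assumes F: "lfunctor R S F" and G: "lfunctor R S G"
  and iso: "!!M. lmod R M ==> tt M \<in> lmod_iso S (on_ob F M) (on_ob G M)"
  and nat: "!!M N h x. lmod R M ==> lmod R N ==> h \<in> lhom R M N ==> x \<in>. (on_ob F M) ==>
   tt N (fmap F M N h x) = fmap G M N h (tt M x)"
 shows "naturally_isomorphic (lmod_cat R) (lmod_cat S) F G"
 unfolding naturally_isomorphic_def
proof (intro exI[of _ "%M. (on_ob F M, restrict (tt M) (carrier (on_ob F M)), on_ob G M)"] conjI ballI)
 fix M :: "('r, 'm) module" assume "M \<in> Ob (lmod_cat R)"
 then have M: "lmod R M" by simp
 note FM = functor_ob[OF F M] and GM = functor_ob[OF G M]
 have tt: "tt M \<in> lhom S (on_ob F M) (on_ob G M)" using iso[OF M] by (simp add: lmod_iso_def)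
 show "(on_ob F M, restrict (tt M) (carrier (on_ob F M)), on_ob G M) \<in> Hom (lmod_cat S) (on_ob F M) (on_ob G M)"
  using FM GM lhom_restrict[OF tt FM] by (simp add: Hom_lmod_cat)
 show "isomorphism (lmod_cat S) (on_ob F M, restrict (tt M) (carrier (on_ob F M)), on_ob G M)"
  by (rule isomorphism_lmod_catI[OF FM GM iso[OF M]])
next
 fix a :: "('r, 'm) lmod_arrow" assume a': "a \<in> Ar (lmod_cat R)"
 then obtain M f N where a: "a = (M, f, N)" "lmod R M" "lmod R N" "f \<in> lhom R M N" "f \<in> extensional (carrier M)"
  by (rule Ar_lmod_cat_cases)
 have tt: "tt M \<in> lhom S (on_ob F M) (on_ob G M)" using iso[OF a(2)] by (simp add: lmod_iso_def)
 have "on_ar F a = (on_ob F M, fmap F M N f, on_ob F N)" "on_ar G a = (on_ob G M, fmap G M N f, on_ob G N)"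
  using on_ar_fmap[OF F] on_ar_fmap[OF G] a' a(1) by auto
 then show "Comp (lmod_cat S) (on_ob F (Cod (lmod_cat R) a), restrict (tt (Cod (lmod_cat R) a)) (carrier (on_ob F (Cod (lmod_cat R) a))), on_ob G (Cod (lmod_cat R) a)) (on_ar F a) =
   Comp (lmod_cat S) (on_ar G a) (on_ob F (Dom (lmod_cat R) a), restrict (tt (Dom (lmod_cat R) a)) (carrier (on_ob F (Dom (lmod_cat R) a))), on_ob G (Dom (lmod_cat R) a))"
  using nat[OF a(2-4)] lhomD(2)[OF fmap_hom[OF F a(2-4)]] lhomD(2)[OF tt]
  by (auto simp: a(1) compose_def restrict_def fun_eq_iff)
qed

lemma naturally_isomorphic_lmodD:
 fixes F G :: "('r, 'm, 's, 'n) lmod_functor"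
 assumes ni: "naturally_isomorphic (lmod_cat R) (lmod_cat S) F G"
  and F: "lfunctor R S F" and G: "lfunctor R S G"
 obtains tt where "\<forall>M. lmod R M \<longrightarrow> tt M \<in> lmod_iso S (on_ob F M) (on_ob G M)"
  "\<forall>M N h x. lmod R M \<longrightarrow> lmod R N \<longrightarrow> h \<in> lhom R M N \<longrightarrow> x \<in>. (on_ob F M) \<longrightarrow>
   tt N (fmap F M N h x) = fmap G M N h (tt M x)"
proof -
 obtain t where t: "\<forall>M\<in>Ob (lmod_cat R). t M \<in> Hom (lmod_cat S) (on_ob F M) (on_ob G M) \<and> isomorphism (lmod_cat S) (t M)"
  and tn: "\<forall>f\<in>Ar (lmod_cat R). Comp (lmod_cat S) (t (Cod (lmod_cat R) f)) (on_ar F f) = Comp (lmod_cat S) (on_ar G f) (t (Dom (lmod_cat R) f))"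
  using ni unfolding naturally_isomorphic_def by blast
 define tt where "tt M = fst (snd (t M))" for M :: "('r, 'm) module"
 have t_eq: "t M = (on_ob F M, tt M, on_ob G M)" if "lmod R M" for M
  using t that by (auto simp: Hom_lmod_cat tt_def)
 have iso: "tt M \<in> lmod_iso S (on_ob F M) (on_ob G M)" if "lmod R M" for M
  using t that isomorphism_lmod_catD(3)[of S "on_ob F M" "tt M" "on_ob G M"] by (simp add: t_eq)
 have "tt N (fmap F M N h x) = fmap G M N h (tt M x)"
  if M: "lmod R M" "lmod R N" "h \<in> lhom R M N" and x: "x \<in>. (on_ob F M)" for M N h x
 proof -
  have "(M, restrict h (carrier M), N) \<in> Ar (lmod_cat R)" using M lhom_restrict[OF M(3,1)] by simp
  from bspec[OF tn this] have "compose (carrier (on_ob F M)) (tt N) (fmap F M N h) = compose (carrier (on_ob F M)) (fmap G M N h) (tt M)"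
   using fmap_comp_functor(1)[OF F M] fmap_comp_functor(1)[OF G M] M by (simp add: t_eq)
  from fun_cong[OF this, of x] x show ?thesis by (simp add: compose_def)
 qed
 with iso show thesis by (intro that[of tt]) auto
qed

text \<open>The bijection of the adjunction is \<open>k \<mapsto> G k \<circ> \<eta>\<close>, with inverse \<open>h \<mapsto> eps \<circ> F h\<close>.\<close>

lemma lmod_adjointI:
 fixes F :: "('r, 'm, 's, 'n) lmod_functor" and G :: "('s, 'n, 'r, 'm) lmod_functor"
 assumes F: "lfunctor R S F" and G: "lfunctor S R G"
  and \<eta>: "!!M. lmod R M ==> \<eta> M \<in> lhom R M (on_ob G (on_ob F M))"
  and eps: "!!N. lmod S N ==> eps N \<in> lhom S (on_ob F (on_ob G N)) N"
  and \<eta>_nat: "!!M N h x. lmod R M ==> lmod R N ==> h \<in> lhom R M N ==> x \<in>. M ==>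
   \<eta> N (h x) = fmap G (on_ob F M) (on_ob F N) (fmap F M N h) (\<eta> M x)"
  and eps_nat: "!!M N h x. lmod S M ==> lmod S N ==> h \<in> lhom S M N ==> x \<in>. (on_ob F (on_ob G M)) ==>
   eps N (fmap F (on_ob G M) (on_ob G N) (fmap G M N h) x) = h (eps M x)"
  and tri1: "!!M x. lmod R M ==> x \<in>. (on_ob F M) ==> eps (on_ob F M) (fmap F M (on_ob G (on_ob F M)) (\<eta> M) x) = x"
  and tri2: "!!N x. lmod S N ==> x \<in>. (on_ob G N) ==> fmap G (on_ob F (on_ob G N)) N (eps N) (\<eta> (on_ob G N) x) = x"
 shows "adjoint (lmod_cat R) (lmod_cat S) F G"
 unfolding adjoint_def
proof (intro conjI F G)
 define \<phi> where "\<phi> A B k = (A, \<lambda>x\<in>carrier A. fmap G (on_ob F A) B (fst (snd k)) (\<eta> A x), on_ob G B)"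
  for A B and k :: "('s, 'n) lmod_arrow"
 define \<psi> where "\<psi> A B h = (on_ob F A, \<lambda>y\<in>carrier (on_ob F A). eps B (fmap F A (on_ob G B) (fst (snd h)) y), B)"
  for A B and h :: "('r, 'm) lmod_arrow"
 note FO = functor_ob[OF F] and GO = functor_ob[OF G]
 have \<phi>_hom: "(%x. fmap G (on_ob F A) B k (\<eta> A x)) \<in> lhom R A (on_ob G B)"
  if "lmod R A" "lmod S B" "k \<in> lhom S (on_ob F A) B" for A B k
  by (rule lhom_comp[OF \<eta>[OF that(1)] fmap_hom[OF G FO[OF that(1)] that(2,3)]])
 have \<psi>_hom: "(%y. eps B (fmap F A (on_ob G B) h y)) \<in> lhom S (on_ob F A) B"
  if "lmod R A" "lmod S B" "h \<in> lhom R A (on_ob G B)" for A B h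
  by (rule lhom_comp[OF fmap_hom[OF F that(1) GO[OF that(2)] that(3)] eps[OF that(2)]])
 have \<psi>\<phi>: "eps B (fmap F A (on_ob G B) (%x. fmap G (on_ob F A) B k (\<eta> A x)) y) = k y"
  if A: "lmod R A" and B: "lmod S B" and k: "k \<in> lhom S (on_ob F A) B" and y: "y \<in>. (on_ob F A)" for A B k y
 proof -
  let ?GF = "on_ob G (on_ob F A)"
  have "fmap F A (on_ob G B) (%x. fmap G (on_ob F A) B k (\<eta> A x)) y =
   fmap F ?GF (on_ob G B) (fmap G (on_ob F A) B k) (fmap F A ?GF (\<eta> A) y)"
   by (rule fmap_comp[OF F A GO[OF FO[OF A]] GO[OF B] \<eta>[OF A] fmap_hom[OF G FO[OF A] B k] y])
  then show ?thesis
   using eps_nat[OF FO[OF A] B k lhomD(2)[OF fmap_hom[OF F A GO[OF FO[OF A]] \<eta>[OF A]] y]] tri1[OF A y] by simp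
 qed
 have \<phi>\<psi>: "fmap G (on_ob F A) B (%y. eps B (fmap F A (on_ob G B) h y)) (\<eta> A x) = h x"
  if A: "lmod R A" and B: "lmod S B" and h: "h \<in> lhom R A (on_ob G B)" and x: "x \<in>. A" for A B h x
 proof -
  let ?FG = "on_ob F (on_ob G B)"
  have "fmap G (on_ob F A) B (%y. eps B (fmap F A (on_ob G B) h y)) (\<eta> A x) =
   fmap G ?FG B (eps B) (fmap G (on_ob F A) ?FG (fmap F A (on_ob G B) h) (\<eta> A x))"
   by (rule fmap_comp[OF G FO[OF A] FO[OF GO[OF B]] B fmap_hom[OF F A GO[OF B] h] eps[OF B] lhomD(2)[OF \<eta>[OF A] x]])
  then show ?thesis
   using \<eta>_nat[OF A GO[OF B] h x] tri2[OF B lhomD(2)[OF h x]] by simp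
 qed
 show "\<exists>\<phi>. (\<forall>A\<in>Ob (lmod_cat R). \<forall>B\<in>Ob (lmod_cat S).
   bij_betw (\<phi> A B) (Hom (lmod_cat S) (on_ob F A) B) (Hom (lmod_cat R) A (on_ob G B))) \<and>
   (\<forall>f\<in>Ar (lmod_cat R). \<forall>B\<in>Ob (lmod_cat S). \<forall>h\<in>Hom (lmod_cat S) (on_ob F (Cod (lmod_cat R) f)) B.
   \<phi> (Dom (lmod_cat R) f) B (Comp (lmod_cat S) h (on_ar F f)) = Comp (lmod_cat R) (\<phi> (Cod (lmod_cat R) f) B h) f) \<and>
   (\<forall>A\<in>Ob (lmod_cat R). \<forall>g\<in>Ar (lmod_cat S). \<forall>h\<in>Hom (lmod_cat S) (on_ob F A) (Dom (lmod_cat S) g).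
   \<phi> A (Cod (lmod_cat S) g) (Comp (lmod_cat S) g h) = Comp (lmod_cat R) (on_ar G g) (\<phi> A (Dom (lmod_cat S) g) h))"
 proof (intro exI[of _ \<phi>] conjI ballI)
  fix A :: "('r, 'm) module" and B :: "('s, 'n) module" assume "A \<in> Ob (lmod_cat R)" "B \<in> Ob (lmod_cat S)"
  then have A: "lmod R A" and B: "lmod S B" by auto
  show "bij_betw (\<phi> A B) (Hom (lmod_cat S) (on_ob F A) B) (Hom (lmod_cat R) A (on_ob G B))"
  proof (rule bij_betw_byWitness[where f' = "\<psi> A B"])
   show "\<forall>k\<in>Hom (lmod_cat S) (on_ob F A) B. \<psi> A B (\<phi> A B k) = k"
   proof
   fix k :: "('s, 'n) lmod_arrow" assume "k \<in> Hom (lmod_cat S) (on_ob F A) B"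
   then obtain k' where k: "k = (on_ob F A, k', B)" "k' \<in> lhom S (on_ob F A) B" "k' \<in> extensional (carrier (on_ob F A))"
   by (auto simp: Hom_lmod_cat)
   have "fmap F A (on_ob G B) (\<lambda>x\<in>carrier A. fmap G (on_ob F A) B k' (\<eta> A x)) = fmap F A (on_ob G B) (%x. fmap G (on_ob F A) B k' (\<eta> A x))"
   by (rule fmap_cong) simp
   then show "\<psi> A B (\<phi> A B k) = k"
   using \<psi>\<phi>[OF A B k(2)] k(3) by (auto simp: \<phi>_def \<psi>_def k(1) intro!: extensionalityI[of _ "carrier (on_ob F A)"])
   qed
   show "\<forall>h\<in>Hom (lmod_cat R) A (on_ob G B). \<phi> A B (\<psi> A B h) = h"
   proof
   fix h :: "('r, 'm) lmod_arrow" assume "h \<in> Hom (lmod_cat R) A (on_ob G B)"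
   then obtain h' where h: "h = (A, h', on_ob G B)" "h' \<in> lhom R A (on_ob G B)" "h' \<in> extensional (carrier A)"
   by (auto simp: Hom_lmod_cat)
   have "fmap G (on_ob F A) B (\<lambda>y\<in>carrier (on_ob F A). eps B (fmap F A (on_ob G B) h' y)) = fmap G (on_ob F A) B (%y. eps B (fmap F A (on_ob G B) h' y))"
   by (rule fmap_cong) simp
   then show "\<phi> A B (\<psi> A B h) = h"
   using \<phi>\<psi>[OF A B h(2)] h(3) by (auto simp: \<phi>_def \<psi>_def h(1) intro!: extensionalityI[of _ "carrier A"])
   qed
   show "\<phi> A B ` Hom (lmod_cat S) (on_ob F A) B \<subseteq> Hom (lmod_cat R) A (on_ob G B)"
   using lhom_restrict[OF \<phi>_hom[OF A B] A] A GO[OF B] by (auto simp: Hom_lmod_cat \<phi>_def)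
   show "\<psi> A B ` Hom (lmod_cat R) A (on_ob G B) \<subseteq> Hom (lmod_cat S) (on_ob F A) B"
   using lhom_restrict[OF \<psi>_hom[OF A B] FO[OF A]] B FO[OF A] by (auto simp: Hom_lmod_cat \<psi>_def)
  qed
 next
  fix a :: "('r, 'm) lmod_arrow" and B :: "('s, 'n) module" and h assume a': "a \<in> Ar (lmod_cat R)" and B: "B \<in> Ob (lmod_cat S)" and h: "h \<in> Hom (lmod_cat S) (on_ob F (Cod (lmod_cat R) a)) B"
  obtain M f N where a: "a = (M, f, N)" "lmod R M" "lmod R N" "f \<in> lhom R M N" "f \<in> extensional (carrier M)"
   using a' by (rule Ar_lmod_cat_cases)
  obtain h' where h': "h = (on_ob F N, h', B)" "h' \<in> lhom S (on_ob F N) B" using h by (auto simp: Hom_lmod_cat a(1))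
  have B: "lmod S B" using B by simp
  have e1: "fmap G (on_ob F M) B (compose (carrier (on_ob F M)) h' (fmap F M N f)) = fmap G (on_ob F M) B (%y. h' (fmap F M N f y))"
   by (rule fmap_cong) (simp add: compose_def)
  have "fmap G (on_ob F M) B (%y. h' (fmap F M N f y)) (\<eta> M x) = fmap G (on_ob F N) B h' (\<eta> N (f x))" if x: "x \<in>. M" for x
   using fmap_comp[OF G FO[OF a(2)] FO[OF a(3)] B fmap_hom[OF F a(2-4)] h'(2) lhomD(2)[OF \<eta>[OF a(2)] x]] \<eta>_nat[OF a(2-4) x] by simp
  then show "\<phi> (Dom (lmod_cat R) a) B (Comp (lmod_cat S) h (on_ar F a)) = Comp (lmod_cat R) (\<phi> (Cod (lmod_cat R) a) B h) a"
   using on_ar_fmap[OF F a'[unfolded a(1)]] lhomD(2)[OF a(4)]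
   by (simp add: \<phi>_def h'(1) a(1) e1) (auto simp: compose_def restrict_def fun_eq_iff)
 next
  fix A :: "('r, 'm) module" and b :: "('s, 'n) lmod_arrow" and h assume A: "A \<in> Ob (lmod_cat R)" and b': "b \<in> Ar (lmod_cat S)" and h: "h \<in> Hom (lmod_cat S) (on_ob F A) (Dom (lmod_cat S) b)"
  obtain N g K where b: "b = (N, g, K)" "lmod S N" "lmod S K" "g \<in> lhom S N K" "g \<in> extensional (carrier N)"
   using b' by (rule Ar_lmod_cat_cases)
  obtain h' where h': "h = (on_ob F A, h', N)" "h' \<in> lhom S (on_ob F A) N" using h by (auto simp: Hom_lmod_cat b(1))
  have A: "lmod R A" using A by simp
  have e1: "fmap G (on_ob F A) K (compose (carrier (on_ob F A)) g h') = fmap G (on_ob F A) K (%y. g (h' y))"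
   by (rule fmap_cong) (simp add: compose_def)
  have "fmap G (on_ob F A) K (%y. g (h' y)) (\<eta> A x) = fmap G N K g (fmap G (on_ob F A) N h' (\<eta> A x))" if x: "x \<in>. A" for x
   by (rule fmap_comp[OF G FO[OF A] b(2,3) h'(2) b(4) lhomD(2)[OF \<eta>[OF A] x]])
  then show "\<phi> A (Cod (lmod_cat S) b) (Comp (lmod_cat S) b h) = Comp (lmod_cat R) (on_ar G b) (\<phi> A (Dom (lmod_cat S) b) h)"
   using on_ar_fmap[OF G b'[unfolded b(1)]]
   by (simp add: \<phi>_def h'(1) b(1) e1) (auto simp: compose_def restrict_def fun_eq_iff)
 qed
qed

section \<open>Tensor functors on the universe\<close>

definition copy_functor ::
 "('r, 'a) ring_scheme => ('s, 'r, 'u) bimodule => ('r, 'u, 's, 'u) lmod_functor" where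
 "copy_functor R A = comp_functor universe_copy_functor (tensor_functor_left R A)"

definition tc :: "('r, 'a) ring_scheme => ('s, 'r, 'u) bimodule => ('r, 'u) module => ('s, 'u) module" where
 "tc R A M = universe_copy (tensor_lmod R A M)"

definition cp :: "('r, 'a) ring_scheme => ('s, 'r, 'u) bimodule => ('r, 'u) module => 'u => 'u => 'u" where
 "cp R A M a m = universe_inj (tensor_lmod R A M) (ptens R (rpart A) M a m)"

lemma on_ob_tensor_copy [simp]: "on_ob (copy_functor R A) M = tc R A M"
 by (simp add: copy_functor_def universe_copy_functor_def tensor_functor_left_def tc_def)

lemma tc:
 fixes A :: "('s, 'r, 'u::infinite) bimodule"
 assumes A: "is_bimodule S R A" and M: "lmod R M"
 shows "tensor R (rpart A) M (tc R A M) (cp R A M)" "lmod S (tc R A M)"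
  "!!s a m. s \<in>. S ==> a \<in>. A ==> m \<in>. M ==> s \<odot>\<^sub>(tc R A M) cp R A M a m = cp R A M (s \<odot>\<^sub>A a) m"
  "universe_inj (tensor_lmod R A M) \<in> lmod_iso S (tensor_lmod R A M) (tc R A M)"
proof -
 note TM = tensor_lmod[OF A M]
 note uc = universe_copy_module[OF TM(2) universe_inj_tensor, folded tc_def]
 have e: "universe_inj (tensor_lmod R A M) \<in> lhom S (tensor_lmod R A M) (tc R A M)"
  using uc(2) by (simp add: lmod_iso_def)
 show "lmod S (tc R A M)" "universe_inj (tensor_lmod R A M) \<in> lmod_iso S (tensor_lmod R A M) (tc R A M)"
  by (fact uc)+
 show "tensor R (rpart A) M (tc R A M) (cp R A M)"
  using tensor.transport[OF TM(1) lmodD(2)[OF uc(1)] lhomD(1)[OF e]] uc(2)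
  unfolding cp_def by (simp add: lmod_iso_def)
 show "s \<odot>\<^sub>(tc R A M) cp R A M a m = cp R A M (s \<odot>\<^sub>A a) m" if "s \<in>. S" "a \<in>. A" "m \<in>. M" for s a m
  unfolding cp_def using that TM(3) tensor.closed[OF TM(1)] by (simp add: lhomD(4)[OF e, symmetric])
qed

lemma tensor_copy_on_ar:
 fixes A :: "('s, 'r, 'u::infinite) bimodule"
 assumes A: "is_bimodule S R A" and MN: "lmod R M" "lmod R N" and h: "h \<in> lhom R M N"
 defines "g \<equiv> fst (snd (on_ar (copy_functor R A) (M, h, N)))"
 shows "on_ar (copy_functor R A) (M, h, N) = (tc R A M, g, tc R A N)"
  "g \<in> lhom S (tc R A M) (tc R A N)" "g \<in> extensional (carrier (tc R A M))"
  "!!a m. a \<in>. A ==> m \<in>. M ==> g (cp R A M a m) = cp R A N a (h m)"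
proof -
 let ?F = "fst (snd (on_ar (tensor_functor_left R A) (M, h, N)))"
 let ?T = "tensor_lmod R A"
 let ?e = "%M. universe_inj (?T M) :: _ => 'u"
 interpret F: tensor R "rpart A" M "?T M" "ptens R (rpart A) M" by (rule tensor_lmod(1)[OF A MN(1)])
 have g: "g = (\<lambda>x\<in>carrier (tc R A M). ?e N (?F (inv_into (carrier (?T M)) (?e M) x)))"
  by (simp add: g_def copy_functor_def universe_copy_functor_def tensor_functor_left_def tc_def)
 show "on_ar (copy_functor R A) (M, h, N) = (tc R A M, g, tc R A N)"
  by (simp add: g_def copy_functor_def universe_copy_functor_def tensor_functor_left_def tc_def)
 show "g \<in> extensional (carrier (tc R A M))" unfolding g by simp
 note TM = tensor_lmod[OF A MN(1)] and TN = tensor_lmod[OF A MN(2)]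
 note e = tc(4)[OF A MN(1)] and e' = tc(4)[OF A MN(2)]
 have d: "inv_into (carrier (?T M)) (?e M) \<in> lhom S (tc R A M) (?T M)"
  using lmod_iso_inv[OF TM(2) e] by (simp add: lmod_iso_def)
 have e'h: "?e N \<in> lhom S (?T N) (tc R A N)" using e' by (simp add: lmod_iso_def)
 have eM: "?e M y \<in>. (tc R A M)" "inv_into (carrier (?T M)) (?e M) (?e M y) = y" if "y \<in>. (?T M)" for y
  using e that by (auto simp: lmod_iso_def bij_betw_def)
 have "(%x. ?e N (?F (inv_into (carrier (?T M)) (?e M) x))) \<in> lhom S (tc R A M) (tc R A N)"
  by (rule lhom_comp[OF lhom_comp[OF d tensor_functor_left_hom[OF A MN h]] e'h])
 from lhom_restrict[OF this tc(2)[OF A MN(1)]] show "g \<in> lhom S (tc R A M) (tc R A N)" unfolding g .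
 show "g (cp R A M a m) = cp R A N a (h m)" if "a \<in>. A" "m \<in>. M" for a m
  using eM[OF F.closed] that tensor_functor_left_on_pure[OF A MN h that] by (simp add: g cp_def)
qed

lemma tensor_copy_ext:
 fixes A :: "('s, 'r, 'u::infinite) bimodule"
 assumes A: "is_bimodule S R A" and M: "lmod R M" and f: "f \<in> add_homs (tc R A M) Y" and g: "g \<in> add_homs (tc R A M) Y"
  and y: "y \<in>. (tc R A M)" and eq: "!!a m. a \<in>. A ==> m \<in>. M ==> f (cp R A M a m) = g (cp R A M a m)"
 shows "f y = g y"
 using tensor.ext[OF tc(1)[OF A M] f g y] eq by simp

lemma is_functor_copy:
 fixes A :: "('s, 'r, 'u::infinite) bimodule"
 assumes A: "is_bimodule S R A"
 shows "lfunctor R S (copy_functor R A)"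
proof (rule lmod_functorI[where A = "%M f N. fst (snd (on_ar (copy_functor R A) (M, f, N)))"])
 show "lmod S (on_ob (copy_functor R A) M)" if "lmod R M" for M
  using tc(2)[OF A that] by simp
 fix M N :: "('r, 'u) module" and f
 assume M: "lmod R M" "lmod R N" and f: "f \<in> lhom R M N" "f \<in> extensional (carrier M)"
 show "on_ar (copy_functor R A) (M, f, N) =
   (on_ob (copy_functor R A) M, fst (snd (on_ar (copy_functor R A) (M, f, N))), on_ob (copy_functor R A) N) \<and>
  fst (snd (on_ar (copy_functor R A) (M, f, N))) \<in> lhom S (on_ob (copy_functor R A) M) (on_ob (copy_functor R A) N) \<and>
  fst (snd (on_ar (copy_functor R A) (M, f, N))) \<in> extensional (carrier (on_ob (copy_functor R A) M))"
  using tensor_copy_on_ar[OF A M f(1)] by simp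
next
 fix M :: "('r, 'u) module" and y assume M: "lmod R M" and y: "y \<in>. (on_ob (copy_functor R A) M)"
 have i: "(\<lambda>x\<in>carrier M. x) \<in> lhom R M M" using lhom_restrict[OF lmod_hom_id M] .
 note ar = tensor_copy_on_ar[OF A M M i]
 show "fst (snd (on_ar (copy_functor R A) (M, \<lambda>x\<in>carrier M. x, M))) y = y"
  by (rule tensor_copy_ext[OF A M lhomD(1)[OF ar(2)] lhomD(1)[OF lmod_hom_id]]) (use y ar(4) in auto)
next
 fix M N K :: "('r, 'u) module" and f g y
 assume M: "lmod R M" "lmod R N" "lmod R K" and f: "f \<in> lhom R M N" and g: "g \<in> lhom R N K"
  and y: "y \<in>. (on_ob (copy_functor R A) M)"
 let ?A = "%M f N. fst (snd (on_ar (copy_functor R A) (M, f, N)))"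
 have gf: "compose (carrier M) g f \<in> lhom R M K"
  using lhom_restrict[OF lhom_comp[OF f g] M(1)] by (simp add: compose_def)
 note a1 = tensor_copy_on_ar[OF A M(1,2) f] and a2 = tensor_copy_on_ar[OF A M(2,3) g] and a3 = tensor_copy_on_ar[OF A M(1,3) gf]
 show "?A M (compose (carrier M) g f) K y = ?A N g K (?A M f N y)"
  by (rule tensor_copy_ext[OF A M(1) lhomD(1)[OF a3(2)] lhomD(1)[OF lhom_comp[OF a1(2) a2(2)]]])
   (use y a1(4) a2(4) a3(4) lhomD(2)[OF f] in \<open>auto simp: compose_def\<close>)
qed

lemma fmap_cp:
 fixes A :: "('s, 'r, 'u::infinite) bimodule"
 assumes A: "is_bimodule S R A" and M: "lmod R M" "lmod R N" and h: "h \<in> lhom R M N"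
  and am: "a \<in>. A" "m \<in>. M"
 shows "fmap (copy_functor R A) M N h (cp R A M a m) = cp R A N a (h m)"
 unfolding fmap_def using tensor_copy_on_ar(4)[OF A M lhom_restrict[OF h M(1)] am] am by simp

subsection \<open>Morita contexts give equivalences\<close>

text \<open>The isomorphism is \<open>p \<otimes> (q \<otimes> m) \<mapsto> f(p \<otimes> q) m\<close>; an expansion of \<open>1\<close> gives its inverse \<open>m \<mapsto> \<Sum> p\<^sub>j \<otimes> (q\<^sub>j \<otimes> m)\<close>.\<close>

lemma tensor_copy_morita_iso:
 fixes P Q :: "('u::infinite, 'u, 'u) bimodule" and R S :: "'u ring"
 assumes ctx: "strict_morita_context R S P Q f g"
 shows "naturally_isomorphic (lmod_cat R) (lmod_cat R) (comp_functor (copy_functor S P) (copy_functor R Q)) id_functor"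
proof -
 interpret C: morita R S P Q f g by (rule morita.intro[OF ctx])
 let ?FQ = "copy_functor R Q" and ?FP = "copy_functor S P"
 note FQ = is_functor_copy[OF C.Q] and FP = is_functor_copy[OF C.P]
 let ?q = "cp R Q" and ?TQ = "tc R Q"
 let ?p = "%M. cp S P (tc R Q M)" and ?TP = "%M. tc S P (tc R Q M)"
 define ka where "ka M p = tlift (rpart Q) M (?TQ M) (?q M) M (%q m. C.pf p q \<odot>\<^sub>M m)" for M :: "('u, 'u) module" and p
 define tt where "tt M = tlift (rpart P) (?TQ M) (?TP M) (?p M) M (%p y. ka M p y)" for M :: "('u, 'u) module"
 obtain es where es0: "set es \<subseteq> carrier P \<times> carrier Q" and es1: "lsum R (%e. C.pf (fst e) (snd e)) es = \<one>\<^sub>R"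
  by (rule C.unit_expansion)
 have es: "!!e. e \<in> set es ==> fst e \<in>. P" "!!e. e \<in> set es ==> snd e \<in>. Q" using es0 by auto
 have main: "tt M \<in> lmod_iso R (?TP M) M \<and> (\<forall>p\<in>carrier P. \<forall>q\<in>carrier Q. \<forall>m\<in>carrier M. tt M (?p M p (?q M q m)) = C.pf p q \<odot>\<^sub>M m)"
  if M: "lmod R M" for M
 proof -
  note MD = lmodD[OF M]
  note TQ = tc[OF C.Q M] and TP = tc[OF C.P tc(2)[OF C.Q M]]
  interpret Q: tensor R "rpart Q" M "?TQ M" "?q M" by (rule TQ(1))
  interpret P: tensor S "rpart P" "?TQ M" "?TP M" "?p M" by (rule TP(1))
  note QD = lmodD[OF TQ(2)] and PD = lmodD[OF TP(2)]
  have ka: "ka M p \<in> add_homs (?TQ M) M" "!!q m. q \<in>. Q ==> m \<in>. M ==> ka M p (?q M q m) = C.pf p q \<odot>\<^sub>M m"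
   if p: "p \<in>. P" for p
  proof -
   have "balanced R (rpart Q) M M (%q m. C.pf p q \<odot>\<^sub>M m)"
   using p MD C.pf_closed C.pf_right C.T.add_right C.T.closed by (intro balancedI) (simp_all add: C.fL(3))
   from Q.tlift[OF MD(2) this] show "ka M p \<in> add_homs (?TQ M) M"
   "!!q m. q \<in>. Q ==> m \<in>. M ==> ka M p (?q M q m) = C.pf p q \<odot>\<^sub>M m" by (simp_all add: ka_def)
  qed
  have ka_add: "ka M (p \<oplus>\<^sub>P p') y = ka M p y \<oplus>\<^sub>M ka M p' y" if p: "p \<in>. P" "p' \<in>. P" and y: "y \<in>. (?TQ M)" for p p' y
   using y
  proof (induction y rule: Q.induct)
   case (pure q m)
   then show ?case using p MD C.pf_closed C.T.add_left C.T.closed by (simp add: ka C.fL(3))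
  next
   case (add x y)
   then show ?case using p MD(2) by (simp add: addD[OF ka(1)] add_exchange)
  qed
  have ka_move: "ka M (p \<triangleleft>\<^sub>P s) y = ka M p (s \<odot>\<^sub>(?TQ M) y)" if p: "p \<in>. P" "s \<in>. S" and y: "y \<in>. (?TQ M)" for p s y
   using y
  proof (induction y rule: Q.induct)
   case (pure q m)
   then show ?case using p C.PR C.QL C.T.move by (simp add: ka TQ(3))
  next
   case (add x y)
   then show ?case using p C.PR QD by (simp add: addD[OF ka(1)])
  qed
  have ka_left: "ka M (r \<odot>\<^sub>P p) y = r \<odot>\<^sub>M ka M p y" if p: "p \<in>. P" "r \<in>. R" and y: "y \<in>. (?TQ M)" for p r y
   using y
  proof (induction y rule: Q.induct)
   case (pure q m)
   then show ?case using p C.PL C.pf_left C.pf_closed MD by (simp add: ka)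
  next
   case (add x y)
   then show ?case using p C.PL MD by (simp add: addD[OF ka(1)])
  qed
  have "balanced S (rpart P) (?TQ M) M (%p y. ka M p y)"
   using ka_add ka_move by (intro balancedI) (simp_all add: addD[OF ka(1)])
  note tt = P.tlift[OF MD(2) this, folded tt_def, simplified right_part_simps]
  have lin: "tt M (r \<odot>\<^sub>(?TP M) x) = r \<odot>\<^sub>M tt M x" if r: "r \<in>. R" and x: "x \<in>. (?TP M)" for r x
   using x
  proof (induction x rule: P.induct)
   case (pure p y)
   then show ?case using r C.PL by (simp add: TP(3) tt(2) ka_left)
  next
   case (add x y)
   then show ?case using r PD MD by (simp add: addD[OF tt(1)])
  qed
  define G where "G m = lsum (?TP M) (%e. ?p M (fst e) (?q M (snd e) m)) es" for m
  have Gc: "G m \<in>. (?TP M)" if "m \<in>. M" for m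
   unfolding G_def using that es P.closed Q.closed PD(2) by (intro lsum_closed) simp_all
  have Gh: "G \<in> add_homs M (?TP M)" unfolding G_def
  proof (rule add_homs_lsum_pointwise[OF _ PD(2) MD(2)])
   fix e assume e: "e \<in> set es"
   show "(%m. ?p M (fst e) (?q M (snd e) m)) \<in> add_homs M (?TP M)"
   using es(1)[OF e] es(2)[OF e] P.closed Q.closed P.add_right Q.add_right by (intro addI) simp_all
  qed
  have ttG: "tt M (G m) = m" if m: "m \<in>. M" for m
  proof -
   have "tt M (G m) = lsum M (%e. C.pf (fst e) (snd e) \<odot>\<^sub>M m) es"
   unfolding G_def using m es P.closed Q.closed MD(2) PD(2)
   by (subst add_lsum[OF tt(1)]) (simp_all add: tt(2) ka cong: lsum_cong)
   also have "... = lsum R (%e. C.pf (fst e) (snd e)) es \<odot>\<^sub>M m"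
   using m es C.pf_closed by (subst left_module_lsum(2)[OF M]) simp_all
   finally show ?thesis using m MD es1 by simp
  qed
  have Gtt: "G (tt M x) = x" if x: "x \<in>. (?TP M)" for x
   using x
  proof (induction x rule: P.induct)
   case (pure p y)
   then have p: "p \<in>. P" by simp
   have Gka: "G (ka M p y) = ?p M p y" if y: "y \<in>. (?TQ M)" for y
   using y
   proof (induction y rule: Q.induct)
   case (pure q m)
   then have q: "q \<in>. Q" and m: "m \<in>. M" by auto
   have "G (ka M p (?q M q m)) = lsum (?TP M) (%e. ?p M (C.pf (fst e) (snd e) \<odot>\<^sub>P p) (?q M q m)) es"
   proof -
   have "?p M (fst e) (?q M (snd e) (C.pf p q \<odot>\<^sub>M m)) = ?p M (C.pf (fst e) (snd e) \<odot>\<^sub>P p) (?q M q m)" if e: "e \<in> set es" for e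
   proof -
   note e' = es(1)[OF e] es(2)[OF e]
   have "?q M (snd e) (C.pf p q \<odot>\<^sub>M m) = C.pg (snd e) p \<odot>\<^sub>(?TQ M) ?q M q m"
   using Q.move[of "snd e" "C.pf p q" m] e' p q m C.pf_closed C.pg_closed C.gf[of "snd e" p q] by (simp add: TQ(3))
   then have "?p M (fst e) (?q M (snd e) (C.pf p q \<odot>\<^sub>M m)) = ?p M (fst e \<triangleleft>\<^sub>P C.pg (snd e) p) (?q M q m)"
   using P.move[of "fst e" "C.pg (snd e) p" "?q M q m"] e' p q m C.pg_closed Q.closed by simp
   then show ?thesis using C.fg[of "fst e" "snd e" p] e' p by simp
   qed
   then show ?thesis unfolding G_def using p q m by (simp add: ka cong: lsum_cong)
   qed
   also have "... = ?p M (lsum R (%e. C.pf (fst e) (snd e)) es \<odot>\<^sub>P p) (?q M q m)"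
   using es p q m C.pf_closed Q.closed C.PL by (subst bimodule_left_lsum(2)[OF C.P]) (simp_all add: P.lsum_left[simplified])
   finally show ?case using p C.PL by (simp add: es1)
   next
   case (add x y)
   then show ?case using p by (simp add: addD[OF ka(1)[OF p]] addD[OF Gh] P.add_right)
   qed
   then show ?case using pure by (simp add: tt(2))
  next
   case (add x y)
   then show ?case by (simp add: addD[OF tt(1)] addD[OF Gh])
  qed
  have "bij_betw (tt M) (carrier (?TP M)) (carrier M)"
   using Gtt ttG Gc addD(1)[OF tt(1)] by (intro bij_betw_byWitness[where f' = G]) blast+
  then have "tt M \<in> lmod_iso R (?TP M) M" using lhomI[OF tt(1) lin] by (simp add: lmod_iso_def)
  moreover have "tt M (?p M p (?q M q m)) = C.pf p q \<odot>\<^sub>M m" if "p \<in>. P" "q \<in>. Q" "m \<in>. M" for p q m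
   using that Q.closed by (simp add: tt(2) ka)
  ultimately show ?thesis by blast
 qed
 show ?thesis
 proof (rule naturally_isomorphic_lmodI[OF is_functor_comp[OF FQ FP] is_functor_id])
  show "tt M \<in> lmod_iso R (on_ob (comp_functor ?FP ?FQ) M) (on_ob id_functor M)" if "lmod R M" for M
   using main[OF that] by simp
  fix M N :: "('u, 'u) module" and h x
  assume M: "lmod R M" and N: "lmod R N" and h: "h \<in> lhom R M N" and x0: "x \<in>. (on_ob (comp_functor ?FP ?FQ) M)"
  note TQ = tc[OF C.Q M] and TP = tc[OF C.P tc(2)[OF C.Q M]]
  interpret Q: tensor R "rpart Q" M "?TQ M" "?q M" by (rule TQ(1))
  interpret P: tensor S "rpart P" "?TQ M" "?TP M" "?p M" by (rule TP(1))
  have x: "x \<in>. (?TP M)" using x0 by simp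
  let ?fQ = "fmap ?FQ M N h" and ?fP = "fmap ?FP (?TQ M) (?TQ N) (fmap ?FQ M N h)"
  have fQ: "?fQ \<in> lhom S (?TQ M) (?TQ N)" using fmap_hom[OF FQ M N h] by simp
  have fP: "?fP \<in> lhom R (?TP M) (?TP N)" using fmap_hom[OF FP tc(2)[OF C.Q M] tc(2)[OF C.Q N] fQ] by simp
  have tth: "tt M \<in> lhom R (?TP M) M" "tt N \<in> lhom R (?TP N) N" using main M N by (auto simp: lmod_iso_def)
  have "tt N (?fP x) = h (tt M x)"
  proof (rule P.ext[OF lhomD(1)[OF lhom_comp[OF fP tth(2)]] lhomD(1)[OF lhom_comp[OF tth(1) h]] x])
   fix p y assume p: "p \<in>. (rpart P)" and y: "y \<in>. (?TQ M)"
   from y show "tt N (?fP (?p M p y)) = h (tt M (?p M p y))"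
   proof (induction y rule: Q.induct)
   case (pure q m)
   then show ?case using p main[OF M] main[OF N] lhomD[OF h] Q.closed C.pf_closed
   by (simp add: fmap_cp[OF C.P tc(2)[OF C.Q M] tc(2)[OF C.Q N] fQ] fmap_cp[OF C.Q M N h])
   next
   case (add x y)
   then show ?case using p P.closed
   by (simp add: P.add_right lhomD[OF fP] lhomD[OF tth(1)] lhomD[OF tth(2)] lhomD[OF h])
   qed
  qed
  then show "tt N (fmap (comp_functor ?FP ?FQ) M N h x) = fmap id_functor M N h (tt M x)"
   using fmap_comp_functor_eq[OF FQ FP M N h] lhomD(2)[OF tth(1) x] by (simp add: fmap_id_functor)
 qed
qed

lemma tensor_copy_equivalence:
 fixes U U' :: "('u::infinite, 'u, 'u) bimodule" and R :: "'u ring"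
 assumes ctx: "strict_morita_context R R U U' f f'"
 shows "is_equivalence (lmod_cat R) (lmod_cat R) (copy_functor R U)"
proof -
 interpret C: morita R R U U' f f' by (rule morita.intro[OF ctx])
 show ?thesis
  unfolding is_equivalence_def
  using is_functor_copy[OF C.P] is_functor_copy[OF C.Q]
   tensor_copy_morita_iso[OF ctx] tensor_copy_morita_iso[OF strict_morita_context_sym[OF ctx]] by blast
qed

section \<open>From a dual system to a Frobenius pair\<close>

lemma restriction_functor_simps [simp]:
 "on_ob (restriction_functor i) N = restrict_lmod i N"
 "fmap (restriction_functor i) M N h = restrict h (carrier M)"
 by (auto simp: restriction_functor_def fmap_def)

lemma restrict_lmod_hom:
 assumes "i \<in> ring_hom R S" "h \<in> lhom S M N"
 shows "h \<in> lhom R (restrict_lmod i M) (restrict_lmod i N)"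
 using lhomD[OF assms(2)] ring_homD[OF assms(1)] by (intro lhomI addI) auto

lemma is_functor_restriction:
 assumes R: "ring R" and i: "i \<in> ring_hom R S"
 shows "lfunctor S R (restriction_functor i)"
proof (rule lmod_functorI[where A = "%M f N. f"])
 show "lmod R (on_ob (restriction_functor i) M)" if "lmod S M" for M
  using restrict_lmod_module[OF R i that] by simp
qed (use restrict_lmod_hom[OF i] in \<open>auto simp: restriction_functor_def compose_def\<close>)

locale ring_extension =
 fixes R S :: "'u::infinite ring" and i :: "'u => 'u"
 assumes R: "ring R" and S: "ring S" and i: "i \<in> ring_hom R S"
begin

abbreviation "B \<equiv> ring_bimod S (%s. s) i"

lemmas iD = ring_homD[OF i]
lemmas RS = ring_simps[OF R]
lemmas SS = ring_simps[OF S]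

lemma B: "is_bimodule S R B"
 by (rule ring_bimod_bimodule[OF S R S id_ring_hom i])

lemma induction_functor_eq: "induction_functor R S i = copy_functor R B"
 by (simp add: induction_functor_def copy_functor_def)

lemma F: "lfunctor R S (copy_functor R B)"
 by (rule is_functor_copy[OF B])

lemma G: "lfunctor S R (restriction_functor i)"
 by (rule is_functor_restriction[OF R i])

lemma restrict_module: "lmod S N ==> lmod R (restrict_lmod i N)"
 by (rule restrict_lmod_module[OF R i])

lemma unit_hom:
 assumes M: "lmod R M"
 shows "(%m. cp R B M \<one>\<^sub>S m) \<in> lhom R M (restrict_lmod i (tc R B M))"
proof -
 interpret T: tensor R "rpart B" M "tc R B M" "cp R B M" by (rule tc(1)[OF B M])
 have "cp R B M \<one>\<^sub>S (r \<odot>\<^sub>M x) = i r \<odot>\<^sub>(tc R B M) cp R B M \<one>\<^sub>S x" if "r \<in>. R" "x \<in>. M" for r x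
  using T.move[of "\<one>\<^sub>S" r x] that SS iD by (simp add: tc(3)[OF B M])
 then show ?thesis
  using T.closed T.add_right SS lmodD[OF M] by (intro lhomI addI) simp_all
qed

text \<open>The unit is \<open>m \<mapsto> 1 \<otimes> m\<close>, the counit \<open>s \<otimes> n \<mapsto> s n\<close>.\<close>

theorem induction_restriction_adjoint:
 "adjoint (lmod_cat R) (lmod_cat S) (induction_functor R S i) (restriction_functor i)"
 unfolding induction_functor_eq
proof -
 let ?r = "restrict_lmod i"
 define eps where "eps N = tlift (rpart B) (?r N) (tc R B (?r N)) (cp R B (?r N)) N (%s n. s \<odot>\<^sub>N n)" for N :: "('u, 'u) module"
 have eps: "eps N \<in> lhom S (tc R B (?r N)) N \<and> (\<forall>s\<in>carrier S. \<forall>n\<in>carrier N. eps N (cp R B (?r N) s n) = s \<odot>\<^sub>N n)"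
  if N: "lmod S N" for N
 proof -
  note ND = lmodD[OF N] and N' = restrict_module[OF N]
  interpret T: tensor R "rpart B" "?r N" "tc R B (?r N)" "cp R B (?r N)" by (rule tc(1)[OF B N'])
  have "balanced R (rpart B) (?r N) N (%s n. s \<odot>\<^sub>N n)"
   using ND iD by (intro balancedI) simp_all
  note eps = T.tlift[OF ND(2) this, folded eps_def, simplified right_part_simps ring_bimod_simps restrict_lmod_simps]
  have lin: "eps N (s \<odot>\<^sub>(tc R B (?r N)) x) = s \<odot>\<^sub>N eps N x" if s: "s \<in>. S" and x: "x \<in>. (tc R B (?r N))" for s x
   using x
  proof (induction x rule: T.induct)
   case (pure t n)
   then show ?case using s ND SS by (simp add: tc(3)[OF B N'] eps(2))
  next
   case (add x y)
   then show ?case using s ND lmodD[OF tc(2)[OF B N']] by (simp add: addD[OF eps(1)])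
  qed
  show ?thesis using lhomI[OF eps(1) lin] eps(2) by simp
 qed
 show "adjoint (lmod_cat R) (lmod_cat S) (copy_functor R B) (restriction_functor i)"
 proof (rule lmod_adjointI[OF F G, where \<eta> = "%M m. cp R B M \<one>\<^sub>S m" and eps = eps])
  fix M :: "('u, 'u) module" assume M: "lmod R M"
  show "(%m. cp R B M \<one>\<^sub>S m) \<in> lhom R M (on_ob (restriction_functor i) (on_ob (copy_functor R B) M))"
   using unit_hom[OF M] by simp
 next
  fix N :: "('u, 'u) module" assume N: "lmod S N"
  show "eps N \<in> lhom S (on_ob (copy_functor R B) (on_ob (restriction_functor i) N)) N"
   using eps[OF N] by simp
 next
  fix M N :: "('u, 'u) module" and h x
  assume M: "lmod R M" "lmod R N" and h: "h \<in> lhom R M N" and x: "x \<in>. M"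
  show "cp R B N \<one>\<^sub>S (h x) = fmap (restriction_functor i) (on_ob (copy_functor R B) M) (on_ob (copy_functor R B) N)
   (fmap (copy_functor R B) M N h) (cp R B M \<one>\<^sub>S x)"
   using x SS fmap_cp[OF B M h] tensor.closed[OF tc(1)[OF B M(1)]] by simp
 next
  fix M N :: "('u, 'u) module" and h x
  assume M: "lmod S M" "lmod S N" and h: "h \<in> lhom S M N"
   and x0: "x \<in> carrier (on_ob (copy_functor R B) (on_ob (restriction_functor i) M))"
  have x: "x \<in>. (tc R B (?r M))" using x0 by simp
  note M' = restrict_module[OF M(1)] and N' = restrict_module[OF M(2)]
  have h': "restrict h (carrier M) \<in> lhom R (?r M) (?r N)" using lhom_restrict[OF restrict_lmod_hom[OF i h] M'] by simp
  have Fh: "fmap (copy_functor R B) (?r M) (?r N) (restrict h (carrier M)) \<in> lhom S (tc R B (?r M)) (tc R B (?r N))"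
   using fmap_hom[OF F M' N' h'] by simp
  have "eps N (fmap (copy_functor R B) (?r M) (?r N) (restrict h (carrier M)) x) = h (eps M x)"
   by (rule tensor_copy_ext[OF B M' lhomD(1)[OF lhom_comp[OF Fh conjunct1[OF eps[OF M(2)]]]]
   lhomD(1)[OF lhom_comp[OF conjunct1[OF eps[OF M(1)]] h]] x])
   (use eps[OF M(1)] eps[OF M(2)] lhomD[OF h] in \<open>simp add: fmap_cp[OF B M' N' h']\<close>)
  then show "eps N (fmap (copy_functor R B) (on_ob (restriction_functor i) M) (on_ob (restriction_functor i) N)
   (fmap (restriction_functor i) M N h) x) = h (eps M x)" by simp
 next
  fix M :: "('u, 'u) module" and x assume M: "lmod R M" and x0: "x \<in>. (on_ob (copy_functor R B) M)"
  have x: "x \<in>. (tc R B M)" using x0 by simp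
  note T = tc(2)[OF B M]
  note T' = restrict_module[OF T] and u = unit_hom[OF M] and epsT = eps[OF T]
  have Fu: "fmap (copy_functor R B) M (?r (tc R B M)) (%m. cp R B M \<one>\<^sub>S m) \<in> lhom S (tc R B M) (tc R B (?r (tc R B M)))"
   using fmap_hom[OF F M T' u] by simp
  have "eps (tc R B M) (fmap (copy_functor R B) M (?r (tc R B M)) (%m. cp R B M \<one>\<^sub>S m) x) = x"
   by (rule tensor_copy_ext[OF B M lhomD(1)[OF lhom_comp[OF Fu conjunct1[OF epsT]]] lhomD(1)[OF lmod_hom_id] x])
   (use epsT SS tensor.closed[OF tc(1)[OF B M]] in \<open>simp add: fmap_cp[OF B M T' u] tc(3)[OF B M]\<close>)
  then show "eps (on_ob (copy_functor R B) M) (fmap (copy_functor R B) M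
   (on_ob (restriction_functor i) (on_ob (copy_functor R B) M)) (%m. cp R B M \<one>\<^sub>S m) x) = x" by simp
 next
  fix N :: "('u, 'u) module" and x assume N: "lmod S N" and x0: "x \<in>. (on_ob (restriction_functor i) N)"
  have x: "x \<in>. N" using x0 by simp
  show "fmap (restriction_functor i) (on_ob (copy_functor R B) (on_ob (restriction_functor i) N)) N (eps N)
   (cp R B (on_ob (restriction_functor i) N) \<one>\<^sub>S x) = x"
   using x SS eps[OF N] lmodD[OF N] tensor.closed[OF tc(1)[OF B restrict_module[OF N]]] by simp
 qed
qed

end

locale frobenius_data = ring_extension R S i + MU: morita R R U U' f f' + MV: morita S S V V' g g'
 for R S :: "'u::infinite ring" and i and U U' V V' :: "('u, 'u, 'u) bimodule" and f f' g g' +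
 fixes ws :: "(('u, 'u) tens \<times> 'u) list" and om
 assumes dual: "dual_system R S i (VU R i V U) ws om"
begin

sublocale D: tensor_data R S i U V
 by (rule tensor_data.intro[OF R S i MU.P MV.P])

sublocale W: dual R S i D.W ws om
 by unfold_locales (rule dual)

abbreviation "\<alpha> \<equiv> copy_functor R U"
abbreviation "\<beta> \<equiv> copy_functor S V"
abbreviation "FB \<equiv> copy_functor R B"
abbreviation "K \<equiv> comp_functor \<beta> (comp_functor FB \<alpha>)"
abbreviation "vu' \<equiv> vu R i V U"

lemma \<alpha>: "lfunctor R R \<alpha>" and \<beta>: "lfunctor S S \<beta>"
 by (rule is_functor_copy[OF MU.P], rule is_functor_copy[OF MV.P])

lemma K: "lfunctor R S K"
 by (rule is_functor_comp[OF is_functor_comp[OF \<alpha> F] \<beta>])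

definition "M1 M = tc R U M" for M :: "('u, 'u) module"
definition "M2 M = tc R B (M1 M)" for M :: "('u, 'u) module"
definition "M3 M = tc S V (M2 M)" for M :: "('u, 'u) module"

lemma K_ob: "on_ob K M = M3 M"
 by (simp add: M1_def M2_def M3_def)

text \<open>The tensor \<open>v \<otimes> (1 \<otimes> (u \<otimes> m))\<close>. These generate, as \<open>v \<otimes> (s \<otimes> x) = v s \<otimes> (1 \<otimes> x)\<close>.\<close>

definition ka :: "('u, 'u) module => 'u => 'u => 'u => 'u" where
 "ka M v u m = cp S V (M2 M) v (cp R B (M1 M) \<one>\<^sub>S (cp R U M u m))"

context
 fixes M :: "('u, 'u) module"
 assumes M: "lmod R M"
begin

lemmas MD = lmodD[OF M]
lemmas tc1 = tc[OF MU.P M, folded M1_def]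
lemmas tc2 = tc[OF B tc1(2), folded M2_def]
lemmas tc3 = tc[OF MV.P tc2(2), folded M3_def]

interpretation T1: tensor R "rpart U" M "M1 M" "cp R U M" by (rule tc1(1))
interpretation T2: tensor R "rpart B" "M1 M" "M2 M" "cp R B (M1 M)" by (rule tc2(1))
interpretation T3: tensor S "rpart V" "M2 M" "M3 M" "cp S V (M2 M)" by (rule tc3(1))

lemmas D1 = lmodD[OF tc1(2)]
lemmas D2 = lmodD[OF tc2(2)]
lemmas D3 = lmodD[OF tc3(2)]

lemma M3_module: "lmod S (M3 M)" by (rule tc3(2))

lemma ka_closed: "v \<in>. V ==> u \<in>. U ==> m \<in>. M ==> ka M v u m \<in>. (M3 M)"
 using SS T1.closed T2.closed T3.closed by (simp add: ka_def)

lemma ka_add: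
 "v \<in>. V ==> v' \<in>. V ==> u \<in>. U ==> m \<in>. M ==> ka M (v \<oplus>\<^sub>V v') u m = ka M v u m \<oplus>\<^sub>(M3 M) ka M v' u m"
 "v \<in>. V ==> u \<in>. U ==> u' \<in>. U ==> m \<in>. M ==> ka M v (u \<oplus>\<^sub>U u') m = ka M v u m \<oplus>\<^sub>(M3 M) ka M v u' m"
 "v \<in>. V ==> u \<in>. U ==> m \<in>. M ==> m' \<in>. M ==> ka M v u (m \<oplus>\<^sub>M m') = ka M v u m \<oplus>\<^sub>(M3 M) ka M v u m'"
 using SS T1.closed T2.closed T3.closed T1.add_left T1.add_right T2.add_right T3.add_left T3.add_right by (simp_all add: ka_def)

lemma ka_left: "s \<in>. S ==> v \<in>. V ==> u \<in>. U ==> m \<in>. M ==> s \<odot>\<^sub>(M3 M) ka M v u m = ka M (s \<odot>\<^sub>V v) u m"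
 using SS T1.closed T2.closed by (simp add: ka_def tc3(3))

lemma unit_scalar: "r \<in>. R ==> x \<in>. (M1 M) ==> i r \<odot>\<^sub>(M2 M) cp R B (M1 M) \<one>\<^sub>S x = cp R B (M1 M) \<one>\<^sub>S (r \<odot>\<^sub>(M1 M) x)"
 using T2.move[of "\<one>\<^sub>S" r x] SS iD by (simp add: tc2(3))

lemma ka_move: "v \<in>. V ==> r \<in>. R ==> u \<in>. U ==> m \<in>. M ==> ka M (v \<triangleleft>\<^sub>V i r) u m = ka M v (r \<odot>\<^sub>U u) m"
 using SS iD T1.closed T2.closed T3.move[of v "i r"] by (simp add: ka_def unit_scalar tc1(3))

lemma ka_move': "v \<in>. V ==> r \<in>. R ==> u \<in>. U ==> m \<in>. M ==> ka M v (u \<triangleleft>\<^sub>U r) m = ka M v u (r \<odot>\<^sub>M m)"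
 using T1.move by (simp add: ka_def)

lemma K_induct [consumes 1, case_names pure add]:
 assumes "y \<in>. (M3 M)"
  and pure: "!!v u m. v \<in>. V ==> u \<in>. U ==> m \<in>. M ==> P (ka M v u m)"
  and add: "!!x y. x \<in>. (M3 M) ==> y \<in>. (M3 M) ==> P x ==> P y ==> P (x \<oplus>\<^sub>(M3 M) y)"
 shows "P y"
 using assms(1)
proof (induction y rule: T3.induct)
 case (pure v y)
 then have v: "v \<in>. V" by simp
 from pure(2) show ?case
 proof (induction y rule: T2.induct)
  case (pure s x)
  then have s: "s \<in>. S" by simp
  have vs: "v \<triangleleft>\<^sub>V s \<in>. V" using v s MV.PR by simp
  have eq: "cp S V (M2 M) v (cp R B (M1 M) s x) = cp S V (M2 M) (v \<triangleleft>\<^sub>V s) (cp R B (M1 M) \<one>\<^sub>S x)" if "x \<in>. (M1 M)" for x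
   using T3.move[of v s "cp R B (M1 M) \<one>\<^sub>S x"] v s that SS T2.closed by (simp add: tc2(3))
  have "P (cp S V (M2 M) (v \<triangleleft>\<^sub>V s) (cp R B (M1 M) \<one>\<^sub>S x))" using pure(2)
  proof (induction x rule: T1.induct)
   case (pure u m)
   then show ?case using assms(2)[OF vs, of u m] by (simp add: ka_def)
  next
   case (add x y)
   then show ?case using vs SS T2.closed T3.closed by (simp add: T2.add_right T3.add_right assms(3))
  qed
  then show ?case using eq pure by simp
 next
  case (add x y)
  then show ?case using v T3.closed by (simp add: T3.add_right assms(3))
 qed
qed (rule add)

text \<open>The tensor \<open>w \<otimes> m\<close>, seen in \<open>V \<otimes> (S \<otimes> (U \<otimes> M))\<close>.\<close>

definition "lam m = tlift (rpart D.VR) U D.W vu' (M3 M) (%v u. ka M v u m)"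

lemma lam:
 assumes m: "m \<in>. M"
 shows "lam m \<in> add_homs D.W (M3 M)" "v \<in>. V ==> u \<in>. U ==> lam m (vu' v u) = ka M v u m"
proof -
 have "balanced R (rpart D.VR) U (M3 M) (%v u. ka M v u m)"
  using m ka_closed ka_add ka_move by (intro balancedI) simp_all
 from D.T.tlift[OF D3(2) this] show "lam m \<in> add_homs D.W (M3 M)"
  "v \<in>. V ==> u \<in>. U ==> lam m (vu' v u) = ka M v u m" by (simp_all add: lam_def)
qed

lemma lam_closed: "m \<in>. M ==> w \<in>. D.W ==> lam m w \<in>. (M3 M)"
 using addD(1)[OF lam(1)] .

lemma lam_add: "m \<in>. M ==> m' \<in>. M ==> w \<in>. D.W ==> lam (m \<oplus>\<^sub>M m') w = lam m w \<oplus>\<^sub>(M3 M) lam m' w"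
proof -
 assume m: "m \<in>. M" "m' \<in>. M" and w: "w \<in>. D.W"
 from w show ?thesis
 proof (induction w rule: D.T.induct)
  case (pure v u)
  then show ?case using m MD(2) by (simp add: lam ka_add)
 next
  case (add x y)
  then show ?case using m MD(2) D3(2) lam_closed by (simp add: addD(2)[OF lam(1)] add_exchange)
 qed
qed

lemma lam_right: "m \<in>. M ==> r \<in>. R ==> w \<in>. D.W ==> lam m (w \<triangleleft>\<^sub>D.W r) = lam (r \<odot>\<^sub>M m) w"
proof -
 assume m: "m \<in>. M" "r \<in>. R" and w: "w \<in>. D.W"
 from w show ?thesis
 proof (induction w rule: D.T.induct)
  case (pure v u)
  then show ?case using m MD MU.PR by (simp add: lam D.WT(4) ka_move')
 next
  case (add x y)
  then show ?case using m MD D.WR by (simp add: addD(2)[OF lam(1)])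
 qed
qed

lemma lam_left: "m \<in>. M ==> s \<in>. S ==> w \<in>. D.W ==> lam m (s \<odot>\<^sub>D.W w) = s \<odot>\<^sub>(M3 M) lam m w"
proof -
 assume m: "m \<in>. M" "s \<in>. S" and w: "w \<in>. D.W"
 from w show ?thesis
 proof (induction w rule: D.T.induct)
  case (pure v u)
  then show ?case using m MV.PL by (simp add: lam D.WT(3) ka_left)
 next
  case (add x y)
  then show ?case using m D.WL D3 lam_closed by (simp add: addD(2)[OF lam(1)])
 qed
qed

lemma lam_lsum: "(!!x. x \<in> set xs ==> h x \<in>. M) ==> w \<in>. D.W ==>
  lam (lsum M h xs) w = lsum (M3 M) (%x. lam (h x) w) xs"
proof -
 assume h: "!!x. x \<in> set xs ==> h x \<in>. M" and w: "w \<in>. D.W"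
 have "(%m. lam m w) \<in> add_homs M (M3 M)"
  using w lam_add lam_closed by (intro addI) simp_all
 from add_lsum[OF this MD(2) D3(2) h] show ?thesis .
qed

text \<open>The counit \<open>v \<otimes> (s \<otimes> (u \<otimes> m)) \<mapsto> om (v s \<otimes> u) m\<close> is lifted through one tensor product at a time.\<close>

definition "Om1 v = tlift (rpart U) M (M1 M) (cp R U M) M (%u m. om (vu' v u) \<odot>\<^sub>M m)"
definition "Om2 v = tlift (rpart B) (M1 M) (M2 M) (cp R B (M1 M)) M (%s x. Om1 (v \<triangleleft>\<^sub>V s) x)"
definition "Om = tlift (rpart V) (M2 M) (M3 M) (cp S V (M2 M)) M (%v y. Om2 v y)"

lemma Om1:
 assumes v: "v \<in>. V"
 shows "Om1 v \<in> add_homs (M1 M) M" "u \<in>. U ==> m \<in>. M ==> Om1 v (cp R U M u m) = om (vu' v u) \<odot>\<^sub>M m"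
proof -
 have "om (vu' v (u \<triangleleft>\<^sub>U r)) = om (vu' v u) \<otimes>\<^sub>R r" if "u \<in>. U" "r \<in>. R" for u r
  using D.WT(4)[of r v u] W.omegaD(4)[of r "vu' v u"] D.T.closed that v by simp
 then have "balanced R (rpart U) M M (%u m. om (vu' v u) \<odot>\<^sub>M m)"
  using v MD D.T.closed D.T.add_right W.omegaD by (intro balancedI) simp_all
 from T1.tlift[OF MD(2) this] show "Om1 v \<in> add_homs (M1 M) M"
  "u \<in>. U ==> m \<in>. M ==> Om1 v (cp R U M u m) = om (vu' v u) \<odot>\<^sub>M m" by (simp_all add: Om1_def)
qed

lemma Om1_add: "v \<in>. V ==> v' \<in>. V ==> x \<in>. (M1 M) ==> Om1 (v \<oplus>\<^sub>V v') x = Om1 v x \<oplus>\<^sub>M Om1 v' x"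
proof -
 assume v: "v \<in>. V" "v' \<in>. V" and x: "x \<in>. (M1 M)"
 from x show ?thesis
 proof (induction x rule: T1.induct)
  case (pure u m)
  then show ?case using v MD D.T.closed D.T.add_left W.omegaD by (simp add: Om1)
 next
  case (add x y)
  then show ?case using v MD(2) by (simp add: addD[OF Om1(1)] add_exchange)
 qed
qed

lemma Om1_move: "v \<in>. V ==> r \<in>. R ==> x \<in>. (M1 M) ==> Om1 (v \<triangleleft>\<^sub>V i r) x = Om1 v (r \<odot>\<^sub>(M1 M) x)"
proof -
 assume v: "v \<in>. V" "r \<in>. R" and x: "x \<in>. (M1 M)"
 from x show ?thesis
 proof (induction x rule: T1.induct)
  case (pure u m)
  then show ?case using v MV.PR MU.PL iD D.T.move[of v r u] by (simp add: Om1 tc1(3))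
 next
  case (add x y)
  then show ?case using v MV.PR iD D1 by (simp add: addD[OF Om1(1)])
 qed
qed

lemma Om2:
 assumes v: "v \<in>. V"
 shows "Om2 v \<in> add_homs (M2 M) M" "s \<in>. S ==> x \<in>. (M1 M) ==> Om2 v (cp R B (M1 M) s x) = Om1 (v \<triangleleft>\<^sub>V s) x"
proof -
 have "balanced R (rpart B) (M1 M) M (%s x. Om1 (v \<triangleleft>\<^sub>V s) x)"
  using v MV.PR iD by (intro balancedI) (simp_all add: addD[OF Om1(1)] Om1_add Om1_move)
 from T2.tlift[OF MD(2) this] show "Om2 v \<in> add_homs (M2 M) M"
  "s \<in>. S ==> x \<in>. (M1 M) ==> Om2 v (cp R B (M1 M) s x) = Om1 (v \<triangleleft>\<^sub>V s) x" by (simp_all add: Om2_def)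
qed

lemma Om2_add: "v \<in>. V ==> v' \<in>. V ==> y \<in>. (M2 M) ==> Om2 (v \<oplus>\<^sub>V v') y = Om2 v y \<oplus>\<^sub>M Om2 v' y"
proof -
 assume v: "v \<in>. V" "v' \<in>. V" and y: "y \<in>. (M2 M)"
 from y show ?thesis
 proof (induction y rule: T2.induct)
  case (pure s x)
  then show ?case using v MV.PR by (simp add: Om2 Om1_add)
 next
  case (add x y)
  then show ?case using v MD(2) by (simp add: addD[OF Om2(1)] add_exchange)
 qed
qed

lemma Om2_move: "v \<in>. V ==> s \<in>. S ==> y \<in>. (M2 M) ==> Om2 (v \<triangleleft>\<^sub>V s) y = Om2 v (s \<odot>\<^sub>(M2 M) y)"
proof -
 assume v: "v \<in>. V" "s \<in>. S" and y: "y \<in>. (M2 M)"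
 from y show ?thesis
 proof (induction y rule: T2.induct)
  case (pure t x)
  then show ?case using v MV.PR SS by (simp add: Om2 tc2(3))
 next
  case (add x y)
  then show ?case using v MV.PR D2 by (simp add: addD[OF Om2(1)])
 qed
qed

lemma Om: "Om \<in> add_homs (M3 M) M" "v \<in>. V ==> u \<in>. U ==> m \<in>. M ==> Om (ka M v u m) = om (vu' v u) \<odot>\<^sub>M m"
proof -
 have "balanced S (rpart V) (M2 M) M (%v y. Om2 v y)"
  using Om2_add Om2_move by (intro balancedI) (simp_all add: addD[OF Om2(1)])
 note tl = T3.tlift[OF MD(2) this, folded Om_def, simplified right_part_simps]
 show "Om \<in> add_homs (M3 M) M" by (rule tl(1))
 show "v \<in>. V ==> u \<in>. U ==> m \<in>. M ==> Om (ka M v u m) = om (vu' v u) \<odot>\<^sub>M m"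
  using SS T1.closed T2.closed MV.PR by (simp add: ka_def tl(2) Om2 Om1)
qed

lemma Om_lmod_hom: "Om \<in> lhom R (restrict_lmod i (M3 M)) M"
proof (rule lhomI)
 show "Om \<in> add_homs (restrict_lmod i (M3 M)) M" using addD[OF Om(1)] by (intro addI) simp_all
 fix r y assume r: "r \<in>. R" and "y \<in>. (restrict_lmod i (M3 M))"
 then have "y \<in>. (M3 M)" by simp
 then have "Om (i r \<odot>\<^sub>(M3 M) y) = r \<odot>\<^sub>M Om y"
 proof (induction y rule: K_induct)
  case (pure v u m)
  have "om (vu' (i r \<odot>\<^sub>V v) u) = r \<otimes>\<^sub>R om (vu' v u)"
   using D.WT(3)[of "i r" v u] W.omegaD(3)[of r "vu' v u"] pure r iD D.T.closed by simp
  then show ?case using pure r iD MV.PL MD D.T.closed W.omegaD by (simp add: ka_left Om(2))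
 next
  case (add x y)
  then show ?case using r iD D3 MD by (simp add: addD[OF Om(1)])
 qed
 then show "Om (r \<odot>\<^sub>(restrict_lmod i (M3 M)) y) = r \<odot>\<^sub>M Om y" by simp
qed

lemma Om_lam:
 assumes m: "m \<in>. M" and w: "w \<in>. D.W"
 shows "Om (lam m w) = om w \<odot>\<^sub>M m"
 using w
proof (induction w rule: D.T.induct)
 case (pure v u)
 then show ?case using m by (simp add: lam Om(2))
next
 case (add x y)
 then show ?case using m MD W.omegaD lam_closed by (simp add: addD(2)[OF lam(1)] addD(2)[OF Om(1)])
qed

end

lemma K_fmap:
 assumes M: "lmod R M" and N: "lmod R N" and h: "h \<in> lhom R M N"
 shows "fmap K M N h \<in> lhom S (M3 M) (M3 N)"
  "v \<in>. V ==> u \<in>. U ==> m \<in>. M ==> fmap K M N h (ka M v u m) = ka N v u (h m)"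
  "m \<in>. M ==> w \<in>. D.W ==> fmap K M N h (lam M m w) = lam N (h m) w"
proof -
 show Kh: "fmap K M N h \<in> lhom S (M3 M) (M3 N)" using fmap_hom[OF K M N h] by (simp add: K_ob[symmetric])
 note m1 = tc1(2)[OF M] tc1(2)[OF N] and m2 = tc2(2)[OF M] tc2(2)[OF N]
 have h1: "fmap \<alpha> M N h \<in> lhom R (M1 M) (M1 N)" using fmap_hom[OF \<alpha> M N h] by (simp add: M1_def)
 have h2: "fmap FB (M1 M) (M1 N) (fmap \<alpha> M N h) \<in> lhom S (M2 M) (M2 N)" using fmap_hom[OF F m1 h1] by (simp add: M2_def)
 have eq: "fmap K M N h = fmap \<beta> (M2 M) (M2 N) (fmap FB (M1 M) (M1 N) (fmap \<alpha> M N h))"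
  using fmap_comp_functor_eq[OF is_functor_comp[OF \<alpha> F] \<beta> M N h] fmap_comp_functor_eq[OF \<alpha> F M N h]
  by (simp add: M1_def M2_def)
 show ka: "fmap K M N h (ka M v u m) = ka N v u (h m)" if "v \<in>. V" "u \<in>. U" "m \<in>. M" for v u m
 proof -
  have c1: "cp R U M u m \<in>. (M1 M)" using that tensor.closed[OF tc1(1)[OF M]] by simp
  have c2: "cp R B (M1 M) \<one>\<^sub>S (cp R U M u m) \<in>. (M2 M)" using c1 SS tensor.closed[OF tc2(1)[OF M]] by simp
  show ?thesis
   using that c1 c2 SS fmap_cp[OF MV.P m2 h2] fmap_cp[OF B m1 h1] fmap_cp[OF MU.P M N h] by (simp add: eq ka_def)
 qed
 show "fmap K M N h (lam M m w) = lam N (h m) w" if m: "m \<in>. M" and w: "w \<in>. D.W" for m w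
  using w
 proof (induction w rule: D.T.induct)
  case (pure v u)
  then show ?case using m lhomD(2)[OF h] by (simp add: lam[OF M] lam[OF N] ka)
 next
  case (add x y)
  then show ?case using m lhomD(2)[OF h] lam_closed[OF M]
   by (simp add: addD(2)[OF lam(1)[OF M]] addD(2)[OF lam(1)[OF N]] lhomD(3)[OF Kh])
 qed
qed

theorem restriction_twisted_induction_adjoint:
 "adjoint (lmod_cat S) (lmod_cat R) (restriction_functor i) (comp_functor \<beta> (comp_functor (induction_functor R S i) \<alpha>))"
 unfolding induction_functor_eq
proof -
 let ?r = "restrict_lmod i"
 define \<eta> where "\<eta> N n = lsum (M3 (?r N)) (%p. lam (?r N) (snd p \<odot>\<^sub>N n) (fst p)) ws" for N :: "('u, 'u) module" and n
 have \<eta>: "\<eta> N \<in> lhom S N (M3 (?r N))" if N: "lmod S N" for N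
 proof -
  note ND = lmodD[OF N] and N' = restrict_module[OF N]
  note l = lam[OF N'] and lc = lam_closed[OF N'] and ladd = lam_add[OF N'] and K3 = lmodD[OF M3_module[OF N']]
  show ?thesis
  proof (rule lhomI)
   show "\<eta> N \<in> add_homs N (M3 (?r N))" unfolding \<eta>_def
   proof (rule add_homs_lsum_pointwise[OF _ K3(2) ND(2)])
   fix p assume "p \<in> set ws"
   then show "(%n. lam (?r N) (snd p \<odot>\<^sub>N n) (fst p)) \<in> add_homs N (M3 (?r N))"
   using W.ws ND lc ladd[simplified] by (intro addI) simp_all
   qed
   fix t n assume t: "t \<in>. S" and n: "n \<in>. N"
   have "t \<odot>\<^sub>(M3 (?r N)) \<eta> N n = lsum (M3 (?r N)) (%p. lam (?r N) (snd p \<odot>\<^sub>N n) (t \<odot>\<^sub>D.W fst p)) ws"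
   unfolding \<eta>_def using t n W.ws ND lc lam_left[OF N']
   by (subst left_module_lsum(1)[OF M3_module[OF N']]) (simp_all cong: lsum_cong)
   also have "... = lsum (M3 (?r N)) (%p. lsum (M3 (?r N)) (%q. lam (?r N) (i (om (snd q \<odot>\<^sub>D.W (t \<odot>\<^sub>D.W fst p))) \<odot>\<^sub>N (snd p \<odot>\<^sub>N n)) (fst q)) ws) ws"
   proof (rule lsum_cong[OF refl])
   fix p assume p: "p \<in> set ws"
   let ?w = "t \<odot>\<^sub>D.W fst p" and ?m = "snd p \<odot>\<^sub>N n"
   have w: "?w \<in>. D.W" and m: "?m \<in>. N" using t n p W.ws D.WL ND by auto
   have "lam (?r N) ?m ?w = lam (?r N) ?m (lsum D.W (%q. fst q \<triangleleft>\<^sub>D.W om (snd q \<odot>\<^sub>D.W ?w)) ws)"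
   using w by (simp add: W.sum_W)
   also have "... = lsum (M3 (?r N)) (%q. lam (?r N) ?m (fst q \<triangleleft>\<^sub>D.W om (snd q \<odot>\<^sub>D.W ?w))) ws"
   using w m W.ws D.WL D.WR W.omegaD K3(2) by (subst add_lsum[OF l(1)]) simp_all
   also have "... = lsum (M3 (?r N)) (%q. lam (?r N) (i (om (snd q \<odot>\<^sub>D.W ?w)) \<odot>\<^sub>N ?m) (fst q)) ws"
   using w m W.ws D.WL W.omegaD lam_right[OF N'] by (intro lsum_cong) simp_all
   finally show "lam (?r N) ?m ?w = lsum (M3 (?r N)) (%q. lam (?r N) (i (om (snd q \<odot>\<^sub>D.W ?w)) \<odot>\<^sub>N ?m) (fst q)) ws" .
   qed
   also have "... = lsum (M3 (?r N)) (%q. lsum (M3 (?r N)) (%p. lam (?r N) ((i (om ((snd q \<otimes>\<^sub>S t) \<odot>\<^sub>D.W fst p)) \<otimes>\<^sub>S snd p) \<odot>\<^sub>N n) (fst q)) ws) ws"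
   using t n W.ws D.WL W.omegaD iD ND SS lc K3(2) by (subst lsum_swap) (simp_all cong: lsum_cong)
   also have "... = lsum (M3 (?r N)) (%q. lam (?r N) ((snd q \<otimes>\<^sub>S t) \<odot>\<^sub>N n) (fst q)) ws"
   proof (rule lsum_cong[OF refl])
   fix q assume q: "q \<in> set ws"
   let ?g = "%p. i (om ((snd q \<otimes>\<^sub>S t) \<odot>\<^sub>D.W fst p)) \<otimes>\<^sub>S snd p"
   have st: "snd q \<otimes>\<^sub>S t \<in>. S" using q t W.ws SS by simp
   have g: "?g p \<in>. S" if "p \<in> set ws" for p using that st W.ws D.WL W.omegaD iD SS by simp
   have "lsum (M3 (?r N)) (%p. lam (?r N) (?g p \<odot>\<^sub>N n) (fst q)) ws = lam (?r N) (lsum (?r N) (%p. ?g p \<odot>\<^sub>N n) ws) (fst q)"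
   using g n q W.ws ND by (subst lam_lsum[where xs = ws and h = "%p. ?g p \<odot>\<^sub>N n" and w = "fst q", OF N']) simp_all
   also have "lsum (?r N) (%p. ?g p \<odot>\<^sub>N n) ws = lsum N (%p. ?g p \<odot>\<^sub>N n) ws"
   by (induction ws) auto
   also have "... = lsum S ?g ws \<odot>\<^sub>N n" using g n by (intro left_module_lsum(2)[OF N, symmetric])
   finally show "lsum (M3 (?r N)) (%p. lam (?r N) (?g p \<odot>\<^sub>N n) (fst q)) ws = lam (?r N) ((snd q \<otimes>\<^sub>S t) \<odot>\<^sub>N n) (fst q)"
   using st by (simp add: W.sum_S)
   qed
   also have "... = \<eta> N (t \<odot>\<^sub>N n)" unfolding \<eta>_def using t n W.ws ND by (intro lsum_cong) simp_all
   finally show "\<eta> N (t \<odot>\<^sub>N n) = t \<odot>\<^sub>(M3 (?r N)) \<eta> N n" by simp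
  qed
 qed
 show "adjoint (lmod_cat S) (lmod_cat R) (restriction_functor i) K"
 proof (rule lmod_adjointI[OF G K, where \<eta> = \<eta> and eps = Om])
  show "\<eta> N \<in> lhom S N (on_ob K (on_ob (restriction_functor i) N))" if "lmod S N" for N
   using \<eta>[OF that] by (simp only: K_ob restriction_functor_simps)
  show "Om M \<in> lhom R (on_ob (restriction_functor i) (on_ob K M)) M" if "lmod R M" for M
   using Om_lmod_hom[OF that] by (simp only: K_ob restriction_functor_simps)
 next
  fix M N :: "('u, 'u) module" and h x
  assume M: "lmod S M" and N: "lmod S N" and h: "h \<in> lhom S M N" and x: "x \<in>. M"
  note M' = restrict_module[OF M] and N' = restrict_module[OF N] and MD = lmodD[OF M]
  have h': "restrict h (carrier M) \<in> lhom R (?r M) (?r N)" using lhom_restrict[OF restrict_lmod_hom[OF i h] M'] by simp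
  note Kh = K_fmap[OF M' N' h']
  have "fmap K (?r M) (?r N) (restrict h (carrier M)) (\<eta> M x) = \<eta> N (h x)"
   unfolding \<eta>_def using x W.ws MD lam_closed[OF M'] lhomD[OF h] lmodD(2)[OF M3_module[OF M']] lmodD(2)[OF M3_module[OF N']]
   by (subst add_lsum[OF lhomD(1)[OF Kh(1)]]) (simp_all add: Kh(3) cong: lsum_cong)
  then show "\<eta> N (h x) = fmap K (on_ob (restriction_functor i) M) (on_ob (restriction_functor i) N) (fmap (restriction_functor i) M N h) (\<eta> M x)"
   by (simp only: restriction_functor_simps)
 next
  fix M N :: "('u, 'u) module" and h x
  assume M: "lmod R M" and N: "lmod R N" and h: "h \<in> lhom R M N" and x: "x \<in>. (on_ob (restriction_functor i) (on_ob K M))"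
  note Kh = K_fmap[OF M N h]
  have x: "x \<in>. (M3 M)" using x by (simp only: K_ob restriction_functor_simps restrict_lmod_simps)
  then have "Om N (fmap K M N h x) = h (Om M x)"
  proof (induction x rule: K_induct[OF M, consumes 1, case_names pure add])
   case (pure v u m)
   then show ?case using lhomD[OF h] D.T.closed W.omegaD by (simp add: Kh(2) Om[OF M] Om[OF N])
  next
   case (add x y)
   then show ?case
   by (simp add: lhomD[OF Kh(1)] lhomD[OF h] addD[OF Om(1)[OF M]] addD[OF Om(1)[OF N]])
  qed
  then show "Om N (fmap (restriction_functor i) (on_ob K M) (on_ob K N) (fmap K M N h) x) = h (Om M x)"
   using x by (simp add: K_ob del: comp_functor_simps)
 next
  fix N :: "('u, 'u) module" and x assume N: "lmod S N" and x: "x \<in>. (on_ob (restriction_functor i) N)"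
  note N' = restrict_module[OF N] and ND = lmodD[OF N]
  have x: "x \<in>. N" using x by simp
  have "Om (?r N) (\<eta> N x) = lsum (?r N) (%p. i (om (fst p)) \<odot>\<^sub>N (snd p \<odot>\<^sub>N x)) ws"
   unfolding \<eta>_def using x W.ws ND lam_closed[OF N'] lmodD(2)[OF M3_module[OF N']] lmodD(2)[OF N']
   by (subst add_lsum[OF Om(1)[OF N']]) (simp_all add: Om_lam[OF N'] cong: lsum_cong)
  also have "... = lsum N (%p. i (om (fst p)) \<odot>\<^sub>N (snd p \<odot>\<^sub>N x)) ws"
   by (induction ws) auto
  also have "... = lsum N (%p. (i (om (\<one>\<^sub>S \<odot>\<^sub>D.W fst p)) \<otimes>\<^sub>S snd p) \<odot>\<^sub>N x) ws"
   using x W.ws ND iD W.omegaD D.WL by (intro lsum_cong) simp_all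
  also have "... = lsum S (%p. i (om (\<one>\<^sub>S \<odot>\<^sub>D.W fst p)) \<otimes>\<^sub>S snd p) ws \<odot>\<^sub>N x"
   using x W.ws ND iD W.omegaD D.WL SS by (intro left_module_lsum(2)[OF N, symmetric]) simp_all
  also have "... = x" using x ND SS by (simp add: W.sum_S)
  finally show "Om (on_ob (restriction_functor i) N)
   (fmap (restriction_functor i) N (on_ob K (on_ob (restriction_functor i) N)) (\<eta> N) x) = x"
   using x by simp
 next
  fix M :: "('u, 'u) module" and x assume M: "lmod R M" and x: "x \<in>. (on_ob K M)"
  note K3 = M3_module[OF M]
  note K3' = restrict_module[OF K3] and Omh = Om_lmod_hom[OF M]
  note KOm = K_fmap[OF K3' M Omh]
  note \<eta>h = \<eta>[OF K3]
  have x: "x \<in>. (M3 M)" using x by (simp only: K_ob)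
  then have "fmap K (?r (M3 M)) M (Om M) (\<eta> (M3 M) x) = x"
  proof (induction x rule: K_induct[OF M, consumes 1, case_names pure add])
   case (pure v u m)
   have y: "ka M v u m \<in>. (M3 M)" using ka_closed[OF M] pure by simp
   note KD = lmodD[OF K3] and MD = lmodD[OF M]
   have vu: "vu' v u \<in>. D.W" using D.T.closed pure by simp
   have "fmap K (?r (M3 M)) M (Om M) (\<eta> (M3 M) (ka M v u m)) = lsum (M3 M) (%p. lam M (Om M (snd p \<odot>\<^sub>(M3 M) ka M v u m)) (fst p)) ws"
   unfolding \<eta>_def using y W.ws KD lam_closed[OF K3'] lmodD(2)[OF M3_module[OF K3']]
   by (subst add_lsum[OF lhomD(1)[OF KOm(1)]]) (simp_all add: KOm(3) cong: lsum_cong)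
   also have "... = lsum (M3 M) (%p. lam M m (fst p \<triangleleft>\<^sub>D.W om (snd p \<odot>\<^sub>D.W vu' v u))) ws"
   proof (rule lsum_cong[OF refl])
   fix p assume p: "p \<in> set ws"
   have "Om M (snd p \<odot>\<^sub>(M3 M) ka M v u m) = om (snd p \<odot>\<^sub>D.W vu' v u) \<odot>\<^sub>M m"
   using pure W.ws[OF p] MV.PL by (simp add: ka_left[OF M] Om(2)[OF M] D.WT(3))
   then show "lam M (Om M (snd p \<odot>\<^sub>(M3 M) ka M v u m)) (fst p) = lam M m (fst p \<triangleleft>\<^sub>D.W om (snd p \<odot>\<^sub>D.W vu' v u))"
   using pure W.ws[OF p] vu D.WL W.omegaD by (simp add: lam_right[OF M])
   qed
   also have "... = lam M m (lsum D.W (%p. fst p \<triangleleft>\<^sub>D.W om (snd p \<odot>\<^sub>D.W vu' v u)) ws)"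
   using pure W.ws vu D.WL D.WR W.omegaD KD(2) by (subst add_lsum[OF lam(1)[OF M]]) simp_all
   also have "... = ka M v u m" using pure vu by (simp add: W.sum_W lam(2)[OF M])
   finally show ?case .
  next
   case (add x y)
   then show ?case by (simp add: lhomD[OF \<eta>h] lhomD[OF KOm(1)])
  qed
  then show "fmap K (on_ob (restriction_functor i) (on_ob K M)) M (Om M) (\<eta> (on_ob K M) x) = x"
   by (simp only: K_ob restriction_functor_simps)
 qed
qed

theorem frobenius_pair:
 "frobenius_pair_second_kind (lmod_cat R) (lmod_cat S) (induction_functor R S i) (restriction_functor i)"
 unfolding frobenius_pair_second_kind_def
 using tensor_copy_equivalence[OF MU.morita] tensor_copy_equivalence[OF MV.morita]
  induction_restriction_adjoint restriction_twisted_induction_adjoint by blast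

end

section \<open>Equivalences preserve generation and addition\<close>

definition spans :: "('m, 'z) ring_scheme => 'm set => bool" where
 "spans N Y \<longleftrightarrow> Y \<subseteq> carrier N \<and> (\<forall>y\<in>carrier N. \<exists>ys. set ys \<subseteq> Y \<and> y = lsum N (%x. x) ys)"

lemma spansD:
 assumes "spans N Y" "abelian_group N" "abelian_group K" "h \<in> add_homs N K" "h' \<in> add_homs N K"
  "!!y. y \<in> Y ==> h y = h' y" "x \<in>. N"
 shows "h x = h' x"
proof -
 obtain ys where ys: "set ys \<subseteq> Y" "x = lsum N (%x. x) ys" using assms(1,7) by (auto simp: spans_def)
 have Y: "y \<in>. N" if "y \<in> set ys" for y using ys(1) that assms(1) by (auto simp: spans_def)
 have "lsum K h ys = lsum K h' ys" using ys(1) assms(6) by (intro lsum_cong) auto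
 then show ?thesis
  using add_lsum[OF assms(4,2,3), of ys "%x. x"] add_lsum[OF assms(5,2,3), of ys "%x. x"] Y by (simp add: ys(2))
qed

text \<open>The quotient consists of chosen representatives of the cosets and so stays in the type of \<open>N\<close>.\<close>

lemma quotient_lmod:
 fixes N :: "('r, 'm) module"
 assumes N: "lmod R N" and H: "H \<subseteq> carrier N" "\<zero>\<^sub>N \<in> H" "!!x y. x \<in> H ==> y \<in> H ==> x \<oplus>\<^sub>N y \<in> H"
  "!!r x. r \<in>. R ==> x \<in> H ==> r \<odot>\<^sub>N x \<in> H"
 obtains Q :: "('r, 'm) module" and p where "lmod R Q" "p \<in> lhom R N Q" "\<forall>x\<in>carrier N. p x = \<zero>\<^sub>Q \<longleftrightarrow> x \<in> H"
proof -
 note ND = lmodD[OF N] and am = abelian_group.axioms(1)[OF lmodD(2)[OF N]]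
 have inH: "x \<in>. N" if "x \<in> H" for x using H(1) that by auto
 have minus: "\<ominus>\<^sub>N x \<in> H" if "x \<in> H" for x
  using H(4)[of "\<ominus>\<^sub>R \<one>\<^sub>R" x] add_homs_minus[OF left_module_add_homs(2)[OF N inH[OF that]] ring_abelian[OF ND(1)] ND(2), of "\<one>\<^sub>R"]
   that inH[OF that] ND ring_simps[OF ND(1)] by simp
 define E where "E x = (%h. x \<oplus>\<^sub>N h) ` H" for x
 define p where "p x = (SOME y. y \<in> E x)" for x
 have "x \<oplus>\<^sub>N \<zero>\<^sub>N \<in> E x" for x using H(2) by (simp add: E_def)
 then have "p x \<in> E x" for x unfolding p_def by (rule someI)
 then have p: "\<exists>h\<in>H. p x = x \<oplus>\<^sub>N h" for x by (auto simp: E_def)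
 have sub: "E (x \<oplus>\<^sub>N h) \<subseteq> E x" if "x \<in>. N" "h \<in> H" for x h
  using that inH H(3) by (auto simp: E_def abelian_monoid.a_assoc[OF am])
 have p_eq: "p (x \<oplus>\<^sub>N h) = p x" if x: "x \<in>. N" and h: "h \<in> H" for x h
 proof -
  have "E ((x \<oplus>\<^sub>N h) \<oplus>\<^sub>N \<ominus>\<^sub>N h) \<subseteq> E (x \<oplus>\<^sub>N h)" using x h inH minus ND by (intro sub) auto
  moreover have "(x \<oplus>\<^sub>N h) \<oplus>\<^sub>N \<ominus>\<^sub>N h = x" using x inH[OF h] ND by (simp add: abelian_monoid.a_assoc[OF am])
  ultimately show ?thesis unfolding p_def using sub[OF x h] by (simp add: subset_antisym)
 qed
 define Q :: "('r, 'm) module" where "Q = \<lparr>carrier = p ` carrier N, monoid.mult = undefined, one = undefined, ring.zero = p \<zero>\<^sub>N,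
   ring.add = (%x y. p (x \<oplus>\<^sub>N y)), smult = (%r x. p (r \<odot>\<^sub>N x))\<rparr>"
 have padd: "p (p x \<oplus>\<^sub>N p y) = p (x \<oplus>\<^sub>N y)" if xy: "x \<in>. N" "y \<in>. N" for x y
 proof -
  obtain h k where hk: "h \<in> H" "p x = x \<oplus>\<^sub>N h" "k \<in> H" "p y = y \<oplus>\<^sub>N k" using p[of x] p[of y] by auto
  then have "p x \<oplus>\<^sub>N p y = (x \<oplus>\<^sub>N y) \<oplus>\<^sub>N (h \<oplus>\<^sub>N k)" using xy inH by (simp add: add_exchange[OF ND(2)])
  then show ?thesis using p_eq[of "x \<oplus>\<^sub>N y" "h \<oplus>\<^sub>N k"] xy hk H(3) ND by simp
 qed
 have psm: "p (r \<odot>\<^sub>N p x) = p (r \<odot>\<^sub>N x)" if rx: "r \<in>. R" "x \<in>. N" for r x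
 proof -
  obtain h where "h \<in> H" "p x = x \<oplus>\<^sub>N h" using p[of x] by auto
  then show ?thesis using rx p_eq[of "r \<odot>\<^sub>N x" "r \<odot>\<^sub>N h"] H(4) inH ND by simp
 qed
 have Qs: "carrier Q = p ` carrier N" "\<zero>\<^sub>Q = p \<zero>\<^sub>N" "!!x y. x \<oplus>\<^sub>Q y = p (x \<oplus>\<^sub>N y)" "!!r x. r \<odot>\<^sub>Q x = p (r \<odot>\<^sub>N x)"
  by (simp_all add: Q_def)
 have Q: "lmod R Q" "p \<in> lhom R N Q"
  by (rule image_module[OF N, where e = p and C = Q]; simp add: Qs padd psm)+
 have "p x = p \<zero>\<^sub>N \<longleftrightarrow> x \<in> H" if x: "x \<in>. N" for x
 proof
  assume "x \<in> H"
  then show "p x = p \<zero>\<^sub>N" using p_eq[of "\<zero>\<^sub>N" x] x ND by simp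
 next
  assume eq: "p x = p \<zero>\<^sub>N"
  obtain h k where hk: "h \<in> H" "p x = x \<oplus>\<^sub>N h" "k \<in> H" "p \<zero>\<^sub>N = \<zero>\<^sub>N \<oplus>\<^sub>N k" using p[of x] p[of "\<zero>\<^sub>N"] by auto
  have "(x \<oplus>\<^sub>N h) \<oplus>\<^sub>N \<ominus>\<^sub>N h = k \<oplus>\<^sub>N \<ominus>\<^sub>N h" using hk eq inH ND by simp
  moreover have "(x \<oplus>\<^sub>N h) \<oplus>\<^sub>N \<ominus>\<^sub>N h = x" using x inH[OF hk(1)] ND by (simp add: abelian_monoid.a_assoc[OF am])
  ultimately show "x \<in> H" using H(3)[OF hk(3) minus[OF hk(1)]] by simp
 qed
 with Q show thesis by (intro that[of Q p]) (simp_all add: Qs(2))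
qed

definition biproduct :: "('r, 'm) module => ('r, 'm \<times> 'm) module" where
 "biproduct N = \<lparr>carrier = carrier N \<times> carrier N, monoid.mult = undefined, one = undefined, ring.zero = (\<zero>\<^sub>N, \<zero>\<^sub>N),
   ring.add = (%x y. (fst x \<oplus>\<^sub>N fst y, snd x \<oplus>\<^sub>N snd y)), smult = (%r x. (r \<odot>\<^sub>N fst x, r \<odot>\<^sub>N snd x))\<rparr>"

text \<open>An infinite type is in bijection with its square, so that \<open>N \<times> N\<close> has a copy in the universe.\<close>

lemma biproduct_copy:
 fixes N :: "('r, 'u::infinite) module"
 assumes N: "lmod R N"
 obtains P :: "('r, 'u) module" and p1 p2 i1 i2 where "lmod R P"
  "p1 \<in> lhom R P N" "p2 \<in> lhom R P N" "i1 \<in> lhom R N P" "i2 \<in> lhom R N P"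
  "\<forall>x\<in>carrier N. p1 (i1 x) = x \<and> p2 (i1 x) = \<zero>\<^sub>N \<and> p1 (i2 x) = \<zero>\<^sub>N \<and> p2 (i2 x) = x"
  "\<forall>w\<in>carrier P. w = i1 (p1 w) \<oplus>\<^sub>P i2 (p2 w)"
proof -
 note ND = lmodD[OF N] and am = abelian_group.axioms(1)[OF lmodD(2)[OF N]]
 let ?B = "biproduct N"
 have Bs: "carrier ?B = carrier N \<times> carrier N" "\<zero>\<^sub>?B = (\<zero>\<^sub>N, \<zero>\<^sub>N)"
  "!!x y. x \<oplus>\<^sub>?B y = (fst x \<oplus>\<^sub>N fst y, snd x \<oplus>\<^sub>N snd y)" "!!r x. r \<odot>\<^sub>?B x = (r \<odot>\<^sub>N fst x, r \<odot>\<^sub>N snd x)"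
  by (simp_all add: biproduct_def)
 have "\<exists>z\<in>carrier N \<times> carrier N. (fst z \<oplus>\<^sub>N x, snd z \<oplus>\<^sub>N y) = (\<zero>\<^sub>N, \<zero>\<^sub>N)" if "x \<in>. N" "y \<in>. N" for x y
  using that ND by (intro bexI[of _ "(\<ominus>\<^sub>N x, \<ominus>\<^sub>N y)"]) auto
 then have "abelian_group ?B"
  using ND by (intro abelian_groupI) (auto simp: Bs abelian_monoid.a_ac[OF am])
 then have B: "lmod R ?B"
  using ND by (intro left_moduleI) (auto simp: Bs)
 have "carrier ?B \<lesssim> (UNIV :: ('u \<times> 'u) set)" by (rule subset_imp_lepoll) simp
 also have "(UNIV :: ('u \<times> 'u) set) \<approx> (UNIV :: 'u set)"
  using card_of_Times_same_infinite[OF infinite_UNIV[where 'a = 'u]] by (simp add: eqpoll_iff_card_of_ordIso)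
 finally have inj: "inj_on (universe_inj ?B :: _ => 'u) (carrier ?B)" by (rule universe_inj_inj)
 let ?P = "universe_copy ?B :: ('r, 'u) module"
 let ?e = "universe_inj ?B :: _ => 'u"
 let ?d = "inv_into (carrier ?B) ?e"
 note P = universe_copy_module[OF B inj]
 have e: "?e \<in> lhom R ?B ?P" and d: "?d \<in> lhom R ?P ?B"
  using P(2) lmod_iso_inv[OF B P(2)] by (auto simp: lmod_iso_def)
 have ed: "?e (?d w) = w" "?d w \<in>. ?B" if "w \<in>. ?P" for w
  using that P(2) lhomD(2)[OF d that] by (auto simp: lmod_iso_def bij_betw_inv_into_right)
 have de: "?d (?e (x, y)) = (x, y)" if "x \<in>. N" "y \<in>. N" for x y using that inj by (simp add: Bs(1) del: split_paired_All)
 have pr: "fst \<in> lhom R ?B N" "snd \<in> lhom R ?B N"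
  by (auto intro!: lhomI addI simp: Bs)
 have inc: "(%x. (x, \<zero>\<^sub>N)) \<in> lhom R N ?B" "(%x. (\<zero>\<^sub>N, x)) \<in> lhom R N ?B"
  using ND left_module_lsum(3)[OF N] by (auto intro!: lhomI addI simp: Bs)
 show thesis
 proof (rule that[OF P(1) lhom_comp[OF d pr(1)] lhom_comp[OF d pr(2)] lhom_comp[OF inc(1) e] lhom_comp[OF inc(2) e]])
  show "\<forall>x\<in>carrier N. fst (?d (?e (x, \<zero>\<^sub>N))) = x \<and> snd (?d (?e (x, \<zero>\<^sub>N))) = \<zero>\<^sub>N \<and>
   fst (?d (?e (\<zero>\<^sub>N, x))) = \<zero>\<^sub>N \<and> snd (?d (?e (\<zero>\<^sub>N, x))) = x"
   using ND by (simp add: de)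
  show "\<forall>w\<in>carrier ?P. w = ?e (fst (?d w), \<zero>\<^sub>N) \<oplus>\<^sub>?P ?e (\<zero>\<^sub>N, snd (?d w))"
  proof
   fix w assume w: "w \<in>. ?P"
   have c: "fst (?d w) \<in>. N" "snd (?d w) \<in>. N" using ed(2)[OF w] by (auto simp: Bs)
   have "?e (fst (?d w), \<zero>\<^sub>N) \<oplus>\<^sub>?P ?e (\<zero>\<^sub>N, snd (?d w)) = ?e ((fst (?d w), \<zero>\<^sub>N) \<oplus>\<^sub>?B (\<zero>\<^sub>N, snd (?d w)))"
   using c ND by (subst lhomD(3)[OF e]) (simp_all add: Bs)
   also have "... = w" using c ND ed(1)[OF w] by (simp add: Bs)
   finally show "w = ?e (fst (?d w), \<zero>\<^sub>N) \<oplus>\<^sub>?P ?e (\<zero>\<^sub>N, snd (?d w))" by simp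
  qed
 qed
qed

definition additive_functor :: "('r, 'a) ring_scheme => ('r, 'm, 's, 'n) lmod_functor => bool" where
 "additive_functor R F \<longleftrightarrow> (\<forall>M N h k. \<forall>y\<in>carrier (on_ob F M). lmod R M \<longrightarrow> lmod R N \<longrightarrow>
   h \<in> lhom R M N \<longrightarrow> k \<in> lhom R M N \<longrightarrow>
   fmap F M N (%x. h x \<oplus>\<^sub>N k x) y = fmap F M N h y \<oplus>\<^sub>(on_ob F N) fmap F M N k y)"

lemma lmod_hom_add:
 assumes "lmod R N" "h \<in> lhom R M N" "k \<in> lhom R M N"
 shows "(%x. h x \<oplus>\<^sub>N k x) \<in> lhom R M N"
 using lmodD[OF assms(1)] lhomD[OF assms(2)] lhomD[OF assms(3)]
 by (intro lhomI addI) (simp_all add: add_exchange)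

lemma lmod_hom_zero: "lmod R N ==> (%x. \<zero>\<^sub>N) \<in> lhom R M N"
 using lmodD[of R N] left_module_lsum(3)[of R N] by (intro lhomI addI) simp_all

lemma lmod_hom_lsum:
 assumes "lmod R N" "\<forall>p\<in>set xs. h p \<in> lhom R M N"
 shows "(%x. lsum N (%p. h p x) xs) \<in> lhom R M N"
 using assms(2)
proof (induction xs)
 case (Cons p xs)
 have "(%x. lsum N (%p. h p x) xs) \<in> lhom R M N" by (rule Cons.IH) (use Cons.prems in simp)
 then show ?case using lmod_hom_add[OF assms(1), of "h p" M "%x. lsum N (%p. h p x) xs"] Cons.prems by simp
qed (simp add: lmod_hom_zero[OF assms(1)])

lemma additive_fmap_lsum:
 fixes F :: "('r, 'm, 's, 'n) lmod_functor"
 assumes F: "lfunctor R S F" "additive_functor R F" and M: "lmod R M" "lmod R N"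
  and h: "\<forall>p\<in>set xs. h p \<in> lhom R M N" and y: "y \<in>. (on_ob F M)"
 shows "fmap F M N (%x. lsum N (%p. h p x) xs) y = lsum (on_ob F N) (%p. fmap F M N (h p) y) xs"
 using h
proof (induction xs)
 case Nil
 note z = lmod_hom_zero[OF M(2), of M]
 have "fmap F M N (%x. \<zero>\<^sub>N \<oplus>\<^sub>N \<zero>\<^sub>N) y = fmap F M N (%x. \<zero>\<^sub>N) y \<oplus>\<^sub>(on_ob F N) fmap F M N (%x. \<zero>\<^sub>N) y"
  by (rule F(2)[unfolded additive_functor_def, rule_format, OF y M z z])
 then show ?case
  using lmodD(2)[OF M(2)] lmodD(2)[OF functor_ob[OF F(1) M(2)]] lhomD(2)[OF fmap_hom[OF F(1) M z] y]
  by (simp add: idempotent_zero)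
next
 case (Cons p xs)
 have hp: "h p \<in> lhom R M N" "(%x. lsum N (%p. h p x) xs) \<in> lhom R M N"
  by (use Cons.prems in simp) (rule lmod_hom_lsum[OF M(2)], use Cons.prems in simp)
 have "fmap F M N (%x. h p x \<oplus>\<^sub>N lsum N (%p. h p x) xs) y =
   fmap F M N (h p) y \<oplus>\<^sub>(on_ob F N) fmap F M N (%x. lsum N (%p. h p x) xs) y"
  by (rule F(2)[unfolded additive_functor_def, rule_format, OF y M hp])
 then show ?case using Cons by simp
qed

locale module_equivalence =
 fixes R :: "'u::infinite ring" and \<alpha> \<gamma> :: "('u, 'u, 'u, 'u) lmod_functor" and \<eta> eps :: "('u, 'u) module => 'u => 'u"
 assumes R: "ring R"
  and \<alpha>: "lfunctor R R \<alpha>" and \<gamma>: "lfunctor R R \<gamma>"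
  and \<eta>: "!!M. lmod R M ==> \<eta> M \<in> lmod_iso R (on_ob \<gamma> (on_ob \<alpha> M)) M"
  and \<eta>_nat: "!!M N h x. lmod R M ==> lmod R N ==> h \<in> lhom R M N ==> x \<in>. (on_ob \<gamma> (on_ob \<alpha> M)) ==>
   \<eta> N (fmap \<gamma> (on_ob \<alpha> M) (on_ob \<alpha> N) (fmap \<alpha> M N h) x) = h (\<eta> M x)"
  and eps: "!!M. lmod R M ==> eps M \<in> lmod_iso R (on_ob \<alpha> (on_ob \<gamma> M)) M"
  and eps_nat: "!!M N h x. lmod R M ==> lmod R N ==> h \<in> lhom R M N ==> x \<in>. (on_ob \<alpha> (on_ob \<gamma> M)) ==>
   eps N (fmap \<alpha> (on_ob \<gamma> M) (on_ob \<gamma> N) (fmap \<gamma> M N h) x) = h (eps M x)"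

lemma module_equivalence_exists:
 fixes \<alpha> :: "('u::infinite, 'u, 'u, 'u) lmod_functor"
 assumes R: "ring R" and eq: "is_equivalence (lmod_cat R) (lmod_cat R) \<alpha>"
 shows "\<exists>\<gamma> \<eta> eps. module_equivalence R \<alpha> \<gamma> \<eta> eps"
proof -
 let ?id = "id_functor :: ('u, 'u, 'u, 'u) lmod_functor"
 obtain \<gamma> where \<alpha>: "lfunctor R R \<alpha>" and \<gamma>: "lfunctor R R \<gamma>"
  and n: "naturally_isomorphic (lmod_cat R) (lmod_cat R) (comp_functor \<gamma> \<alpha>) id_functor"
   "naturally_isomorphic (lmod_cat R) (lmod_cat R) (comp_functor \<alpha> \<gamma>) id_functor"
  using eq unfolding is_equivalence_def by blast
 obtain \<eta> where \<eta>: "\<forall>M. lmod R M \<longrightarrow> \<eta> M \<in> lmod_iso R (on_ob (comp_functor \<gamma> \<alpha>) M) (on_ob ?id M)"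
  "\<forall>M N h x. lmod R M \<longrightarrow> lmod R N \<longrightarrow> h \<in> lhom R M N \<longrightarrow> x \<in>. (on_ob (comp_functor \<gamma> \<alpha>) M) \<longrightarrow>
   \<eta> N (fmap (comp_functor \<gamma> \<alpha>) M N h x) = fmap ?id M N h (\<eta> M x)"
  by (rule naturally_isomorphic_lmodD[OF n(1) is_functor_comp[OF \<alpha> \<gamma>] is_functor_id])
 obtain eps where eps: "\<forall>M. lmod R M \<longrightarrow> eps M \<in> lmod_iso R (on_ob (comp_functor \<alpha> \<gamma>) M) (on_ob ?id M)"
  "\<forall>M N h x. lmod R M \<longrightarrow> lmod R N \<longrightarrow> h \<in> lhom R M N \<longrightarrow> x \<in>. (on_ob (comp_functor \<alpha> \<gamma>) M) \<longrightarrow>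
   eps N (fmap (comp_functor \<alpha> \<gamma>) M N h x) = fmap ?id M N h (eps M x)"
  by (rule naturally_isomorphic_lmodD[OF n(2) is_functor_comp[OF \<gamma> \<alpha>] is_functor_id])
 have in1: "\<eta> M x \<in>. M" if "lmod R M" "x \<in>. (on_ob \<gamma> (on_ob \<alpha> M))" for M x
  using \<eta>(1) that by (auto simp: lmod_iso_def bij_betw_def)
 have in2: "eps M x \<in>. M" if "lmod R M" "x \<in>. (on_ob \<alpha> (on_ob \<gamma> M))" for M x
  using eps(1) that by (auto simp: lmod_iso_def bij_betw_def)
 have "module_equivalence R \<alpha> \<gamma> \<eta> eps"
 proof (rule module_equivalence.intro[OF R \<alpha> \<gamma>])
  show "\<eta> M \<in> lmod_iso R (on_ob \<gamma> (on_ob \<alpha> M)) M" "eps M \<in> lmod_iso R (on_ob \<alpha> (on_ob \<gamma> M)) M" if "lmod R M" for M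
   using \<eta>(1) eps(1) that by simp_all
  fix M N :: "('u, 'u) module" and h x assume M: "lmod R M" "lmod R N" "h \<in> lhom R M N"
  show "\<eta> N (fmap \<gamma> (on_ob \<alpha> M) (on_ob \<alpha> N) (fmap \<alpha> M N h) x) = h (\<eta> M x)" if "x \<in>. (on_ob \<gamma> (on_ob \<alpha> M))"
   using \<eta>(2)[rule_format, OF M, of x] that in1[OF M(1)] by (simp add: fmap_comp_functor_eq[OF \<alpha> \<gamma> M] fmap_id_functor)
  show "eps N (fmap \<alpha> (on_ob \<gamma> M) (on_ob \<gamma> N) (fmap \<gamma> M N h) x) = h (eps M x)" if "x \<in>. (on_ob \<alpha> (on_ob \<gamma> M))"
   using eps(2)[rule_format, OF M, of x] that in2[OF M(1)] by (simp add: fmap_comp_functor_eq[OF \<gamma> \<alpha> M] fmap_id_functor)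
 qed
 then show ?thesis by (intro exI)
qed

context module_equivalence
begin

abbreviation "a M \<equiv> on_ob \<alpha> M"
abbreviation "c M \<equiv> on_ob \<gamma> M"

lemma swap: "module_equivalence R \<gamma> \<alpha> eps \<eta>"
 by (rule module_equivalence.intro[OF R \<gamma> \<alpha> eps eps_nat \<eta> \<eta>_nat])

lemmas a = functor_ob[OF \<alpha>]
lemmas c = functor_ob[OF \<gamma>]

definition "\<eta>' M = inv_into (carrier (c (a M))) (\<eta> M)"

lemma \<eta>':
 assumes M: "lmod R M"
 shows "\<eta>' M \<in> lhom R M (c (a M))" "x \<in>. M ==> \<eta> M (\<eta>' M x) = x"
  "z \<in>. (c (a M)) ==> \<eta>' M (\<eta> M z) = z" "\<eta> M \<in> lhom R (c (a M)) M"
proof -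
 have b: "bij_betw (\<eta> M) (carrier (c (a M))) (carrier M)" using \<eta>[OF M] by (simp add: lmod_iso_def)
 show "\<eta>' M \<in> lhom R M (c (a M))" "\<eta> M \<in> lhom R (c (a M)) M"
  using lmod_iso_inv[OF c[OF a[OF M]] \<eta>[OF M]] \<eta>[OF M] by (auto simp: lmod_iso_def \<eta>'_def)
 show "x \<in>. M ==> \<eta> M (\<eta>' M x) = x" "z \<in>. (c (a M)) ==> \<eta>' M (\<eta> M z) = z"
  using b by (auto simp: \<eta>'_def bij_betw_inv_into_left bij_betw_inv_into_right)
qed

lemma \<eta>'_nat:
 assumes M: "lmod R M" "lmod R N" "h \<in> lhom R M N" and x: "x \<in>. M"
 shows "fmap \<gamma> (a M) (a N) (fmap \<alpha> M N h) (\<eta>' M x) = \<eta>' N (h x)"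
proof -
 have e: "\<eta>' M x \<in>. (c (a M))" using lhomD(2)[OF \<eta>'(1)[OF M(1)] x] .
 have "fmap \<gamma> (a M) (a N) (fmap \<alpha> M N h) (\<eta>' M x) \<in>. (c (a N))"
  using lhomD(2)[OF fmap_hom[OF \<gamma> a[OF M(1)] a[OF M(2)] fmap_hom[OF \<alpha> M]] e] .
 from \<eta>'(3)[OF M(2) this] show ?thesis by (simp add: \<eta>_nat[OF M e] \<eta>'(2)[OF M(1) x])
qed

lemma faithful:
 assumes M: "lmod R M" "lmod R N" and h: "h \<in> lhom R M N" "k \<in> lhom R M N"
  and eq: "!!y. y \<in>. (a M) ==> fmap \<alpha> M N h y = fmap \<alpha> M N k y" and x: "x \<in>. M"
 shows "h x = k x"
proof -
 have e: "\<eta>' M x \<in>. (c (a M))" using lhomD(2)[OF \<eta>'(1)[OF M(1)] x] .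
 have "fmap \<gamma> (a M) (a N) (fmap \<alpha> M N h) = fmap \<gamma> (a M) (a N) (fmap \<alpha> M N k)"
  using eq by (rule fmap_cong)
 then show ?thesis
  using \<eta>_nat[OF M h(1) e] \<eta>_nat[OF M h(2) e] by (simp add: \<eta>'(2)[OF M(1) x])
qed

lemma full:
 assumes M: "lmod R M" "lmod R N" and g: "g \<in> lhom R (a M) (a N)"
 obtains h where "h \<in> lhom R M N" "\<forall>y\<in>carrier (a M). fmap \<alpha> M N h y = g y"
proof -
 interpret S: module_equivalence R \<gamma> \<alpha> eps \<eta> by (rule swap)
 let ?h = "%x. \<eta> N (fmap \<gamma> (a M) (a N) g (\<eta>' M x))"
 note aM = a[OF M(1)] and aN = a[OF M(2)]
 note gg = fmap_hom[OF \<gamma> aM aN g]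
 have h: "?h \<in> lhom R M N"
  by (rule lhom_comp[OF lhom_comp[OF \<eta>'(1)[OF M(1)] gg] \<eta>'(4)[OF M(2)]])
 have "fmap \<gamma> (a M) (a N) (fmap \<alpha> M N ?h) z = fmap \<gamma> (a M) (a N) g z" if z: "z \<in>. (c (a M))" for z
 proof -
  have x: "\<eta> M z \<in>. M" using lhomD(2)[OF \<eta>'(4)[OF M(1)] z] .
  have "fmap \<gamma> (a M) (a N) (fmap \<alpha> M N ?h) (\<eta>' M (\<eta> M z)) = \<eta>' N (?h (\<eta> M z))"
   by (rule \<eta>'_nat[OF M h x])
  then show ?thesis using lhomD(2)[OF gg z] by (simp add: \<eta>'(3)[OF M(1) z] \<eta>'(3)[OF M(2)])
 qed
 from S.faithful[OF aM aN fmap_hom[OF \<alpha> M h] g this] h show thesis by (intro that[of ?h]) auto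
qed

text \<open>The functor \<open>\<gamma>\<close> is faithful, and \<open>\<gamma> \<alpha> (f j)\<close> is \<open>f j\<close> up to \<open>\<eta>\<close>; so the maps \<open>\<gamma> k\<close> and \<open>\<gamma> l\<close> agree on generators.\<close>

lemma agree_on_images:
 fixes N K :: "('u, 'u) module" and D :: "'j => ('u, 'u) module"
 assumes N: "lmod R N" and D: "!!j. j \<in> I ==> lmod R (D j)" "!!j. j \<in> I ==> f j \<in> lhom R (D j) N"
  and span: "spans N (\<Union>j\<in>I. f j ` carrier (D j))"
  and K: "lmod R K" and kl: "k \<in> lhom R (a N) K" "l \<in> lhom R (a N) K"
  and eq: "!!j y. j \<in> I ==> y \<in>. (a (D j)) ==> k (fmap \<alpha> (D j) N (f j) y) = l (fmap \<alpha> (D j) N (f j) y)"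
  and y: "y \<in>. (a N)"
 shows "k y = l y"
proof -
 interpret S: module_equivalence R \<gamma> \<alpha> eps \<eta> by (rule swap)
 note aN = a[OF N] and ck = fmap_hom[OF \<gamma> a[OF N] K kl(1)] and cl = fmap_hom[OF \<gamma> a[OF N] K kl(2)]
 note hk = lhom_comp[OF \<eta>'(1)[OF N] ck] and hl = lhom_comp[OF \<eta>'(1)[OF N] cl]
 have "fmap \<gamma> (a N) K k (\<eta>' N x) = fmap \<gamma> (a N) K l (\<eta>' N x)" if x: "x \<in>. N" for x
 proof (rule spansD[OF span lmodD(2)[OF N] lmodD(2)[OF c[OF K]] lhomD(1)[OF hk] lhomD(1)[OF hl] _ x])
  fix w assume "w \<in> (\<Union>j\<in>I. f j ` carrier (D j))"
  then obtain j v where j: "j \<in> I" and v: "v \<in>. (D j)" and w: "w = f j v" by (elim UN_E imageE)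
  note Dj = D(1)[OF j] and fj = D(2)[OF j]
  note af = fmap_hom[OF \<alpha> Dj N fj] and nat = \<eta>'_nat[OF Dj N fj v]
  have e: "\<eta>' (D j) v \<in> carrier (c (a (D j)))" using lhomD(2)[OF \<eta>'(1)[OF Dj] v] .
  have "fmap \<gamma> (a (D j)) K (%y. k (fmap \<alpha> (D j) N (f j) y)) = fmap \<gamma> (a (D j)) K (%y. l (fmap \<alpha> (D j) N (f j) y))"
   using eq[OF j] by (rule fmap_cong)
  then have "fmap \<gamma> (a N) K k (fmap \<gamma> (a (D j)) (a N) (fmap \<alpha> (D j) N (f j)) (\<eta>' (D j) v)) =
   fmap \<gamma> (a N) K l (fmap \<gamma> (a (D j)) (a N) (fmap \<alpha> (D j) N (f j)) (\<eta>' (D j) v))"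
   unfolding fmap_comp[OF \<gamma> a[OF Dj] aN K af kl(1) e, symmetric] fmap_comp[OF \<gamma> a[OF Dj] aN K af kl(2) e, symmetric]
   by (rule fun_cong)
  then show "fmap \<gamma> (a N) K k (\<eta>' N w) = fmap \<gamma> (a N) K l (\<eta>' N w)" unfolding w nat .
 qed
 note eqN = this
 have "fmap \<gamma> (a N) K k z = fmap \<gamma> (a N) K l z" if z: "z \<in>. (c (a N))" for z
  using eqN[OF lhomD(2)[OF \<eta>'(4)[OF N] z]] by (simp only: \<eta>'(3)[OF N z])
 from S.faithful[OF aN K kl this y] show ?thesis .
qed

text \<open>The projection of \<open>\<alpha> N\<close> modulo the span of the images agrees with the zero map on the images, hence is zero.\<close>

lemma span_image:
 fixes N :: "('u, 'u) module" and D :: "'j => ('u, 'u) module"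
 assumes N: "lmod R N" and D: "!!j. j \<in> I ==> lmod R (D j)" "!!j. j \<in> I ==> f j \<in> lhom R (D j) N"
  and span: "spans N (\<Union>j\<in>I. f j ` carrier (D j))"
 shows "spans (a N) (\<Union>j\<in>I. fmap \<alpha> (D j) N (f j) ` carrier (a (D j)))"
proof -
 let ?Y = "\<Union>j\<in>I. fmap \<alpha> (D j) N (f j) ` carrier (a (D j))"
 define H where "H = {lsum (a N) (%x. x) ys | ys. set ys \<subseteq> ?Y}"
 note aN = a[OF N]
 note AD = lmodD[OF aN]
 note af = fmap_hom[OF \<alpha> D(1) N D(2)]
 have Y: "?Y \<subseteq> carrier (a N)" using lhomD(2)[OF af] by auto
 then have Yc: "y \<in>. (a N)" if "set ys \<subseteq> ?Y" "y \<in> set ys" for y ys using that by blast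
 have smul: "r \<odot>\<^sub>(a N) y \<in> ?Y" if "r \<in>. R" and y: "y \<in> ?Y" for r y
 proof -
  obtain j v where j: "j \<in> I" "v \<in>. (a (D j))" "y = fmap \<alpha> (D j) N (f j) v" using y by (elim UN_E imageE)
  have "r \<odot>\<^sub>(a N) y = fmap \<alpha> (D j) N (f j) (r \<odot>\<^sub>(a (D j)) v)"
   using that(1) j(2) lhomD(4)[OF af[OF j(1) j(1)]] by (simp add: j(3))
  moreover have "r \<odot>\<^sub>(a (D j)) v \<in>. (a (D j))" using that(1) j(2) lmodD(3)[OF a[OF D(1)[OF j(1)]]] by simp
  ultimately show ?thesis by (intro UN_I[OF j(1)] image_eqI)
 qed
 have HI: "lsum (a N) (%x. x) ys \<in> H" if "set ys \<subseteq> ?Y" for ys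
  unfolding H_def by (intro CollectI exI[of _ ys] conjI refl that)
 have HE: "\<exists>ys. set ys \<subseteq> ?Y \<and> x = lsum (a N) (%x. x) ys" if "x \<in> H" for x
  using that unfolding H_def by (elim CollectE exE conjE) (intro exI conjI)
 have H1: "H \<subseteq> carrier (a N)"
 proof
  fix x assume "x \<in> H"
  from HE[OF this] show "x \<in>. (a N)" using Yc AD(2) by (elim exE conjE) (simp only: lsum_closed)
 qed
 have H2: "\<zero>\<^sub>(a N) \<in> H" using HI[of "[]"] by simp
 have H3: "x \<oplus>\<^sub>(a N) y \<in> H" if xH: "x \<in> H" and yH: "y \<in> H" for x y
 proof -
  obtain xs ys where xs: "set xs \<subseteq> ?Y" "x = lsum (a N) (%x. x) xs" and ys: "set ys \<subseteq> ?Y" "y = lsum (a N) (%x. x) ys"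
   using HE[OF xH] HE[OF yH] by (elim exE conjE)
  have "x \<oplus>\<^sub>(a N) y = lsum (a N) (%x. x) (xs @ ys)"
   using Yc[OF xs(1)] Yc[OF ys(1)] unfolding xs(2) ys(2) by (subst lsum_append[OF AD(2)]) auto
  moreover have "set (xs @ ys) \<subseteq> ?Y" using xs(1) ys(1) by (simp only: set_append Un_least)
  ultimately show ?thesis using HI by (simp only:)
 qed
 have H4: "r \<odot>\<^sub>(a N) x \<in> H" if r: "r \<in>. R" and "x \<in> H" for r x
 proof -
  obtain xs where xs: "set xs \<subseteq> ?Y" "x = lsum (a N) (%x. x) xs" using HE[OF \<open>x \<in> H\<close>] by (elim exE conjE)
  have "r \<odot>\<^sub>(a N) x = lsum (a N) (%x. x) (map (%x. r \<odot>\<^sub>(a N) x) xs)"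
   using left_module_lsum(1)[OF aN r, of xs "%x. x"] Yc[OF xs(1)] by (simp add: xs(2) lsum_map)
  moreover have "set (map (%x. r \<odot>\<^sub>(a N) x) xs) \<subseteq> ?Y"
   unfolding set_map by (intro image_subsetI smul[OF r] subsetD[OF xs(1)])
  ultimately show ?thesis using HI by (simp only:)
 qed
 obtain Q :: "('u, 'u) module" and p where Q: "lmod R Q" and p: "p \<in> lhom R (a N) Q"
  and pH: "\<forall>x\<in>carrier (a N). p x = \<zero>\<^sub>Q \<longleftrightarrow> x \<in> H"
  by (rule quotient_lmod[OF aN H1 H2 H3 H4])
 have YH: "y \<in> H" if y: "y \<in> ?Y" for y
  using HI[of "[y]"] y subsetD[OF Y y] AD(2) by simp
 have "p y = \<zero>\<^sub>Q" if y: "y \<in>. (a N)" for y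
 proof (rule agree_on_images[OF N D span Q p lmod_hom_zero[OF Q] _ y])
  fix j v assume j: "j \<in> I" and v: "v \<in>. (a (D j))"
  have "fmap \<alpha> (D j) N (f j) v \<in> H" by (rule YH, rule UN_I[OF j], rule imageI[OF v])
  then show "p (fmap \<alpha> (D j) N (f j) v) = \<zero>\<^sub>Q" using bspec[OF pH subsetD[OF H1]] by simp
 qed
 then have yH: "y \<in> H" if "y \<in>. (a N)" for y using bspec[OF pH that] that by simp
 show ?thesis unfolding spans_def by (intro conjI ballI Y HE yH)
qed

text \<open>The zero map of \<open>\<alpha> N\<close> is some \<open>\<alpha> g\<close> by fullness, and \<open>\<alpha> 0 = \<alpha> (g 0) = 0 (\<alpha> 0)\<close>.\<close>

lemma fmap_zero:
 assumes N: "lmod R N" and y: "y \<in>. (a N)"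
 shows "fmap \<alpha> N N (%x. \<zero>\<^sub>N) y = \<zero>\<^sub>(a N)"
proof -
 note aN = a[OF N] and z = lmod_hom_zero[OF N, of N]
 obtain g where g: "g \<in> lhom R N N" "\<forall>y\<in>carrier (a N). fmap \<alpha> N N g y = \<zero>\<^sub>(a N)"
  by (rule full[OF N N lmod_hom_zero[OF aN]])
 have "g \<zero>\<^sub>N = \<zero>\<^sub>N" using add_homs_zero[OF lhomD(1)[OF g(1)]] lmodD(2)[OF N] by simp
 then show ?thesis
  using fmap_comp[OF \<alpha> N N N z g(1) y] g(2) lhomD(2)[OF fmap_hom[OF \<alpha> N N z] y] by simp
qed

text \<open>On the biproduct, \<open>\<alpha> (p1 + p2)\<close> and \<open>\<alpha> p1 + \<alpha> p2\<close> agree on the images of both inclusions, which generate. Then \<open>h + k\<close> is \<open>p1 + p2\<close> after \<open>(h, k)\<close>.\<close>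

lemma additive: "additive_functor R \<alpha>"
 unfolding additive_functor_def
proof (intro allI ballI impI)
 fix M N :: "('u, 'u) module" and h k y
 assume y: "y \<in>. (a M)" and M: "lmod R M" and N: "lmod R N" and h: "h \<in> lhom R M N" and k: "k \<in> lhom R M N"
 obtain P :: "('u, 'u) module" and p1 p2 i1 i2 where P: "lmod R P"
  and p: "p1 \<in> lhom R P N" "p2 \<in> lhom R P N" and i: "i1 \<in> lhom R N P" "i2 \<in> lhom R N P"
  and pi: "\<forall>x\<in>carrier N. p1 (i1 x) = x \<and> p2 (i1 x) = \<zero>\<^sub>N \<and> p1 (i2 x) = \<zero>\<^sub>N \<and> p2 (i2 x) = x"
  and ip: "\<forall>w\<in>carrier P. w = i1 (p1 w) \<oplus>\<^sub>P i2 (p2 w)"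
  by (rule biproduct_copy[OF N])
 note PD = lmodD[OF P] and ND = lmodD[OF N] and aN = a[OF N] and aM = a[OF M] and aP = a[OF P]
 let ?s = "%w. p1 w \<oplus>\<^sub>N p2 w" and ?d = "%x. i1 (h x) \<oplus>\<^sub>P i2 (k x)"
 note s = lmod_hom_add[OF N p] and d = lmod_hom_add[OF P lhom_comp[OF h i(1)] lhom_comp[OF k i(2)]]
 note ap = fmap_hom[OF \<alpha> P N p(1)] fmap_hom[OF \<alpha> P N p(2)] and as = fmap_hom[OF \<alpha> P N s]
 have "spans P (\<Union>j\<in>{i1, i2}. j ` carrier N)" (is "spans P ?Y")
  unfolding spans_def
 proof (intro conjI ballI)
  show "?Y \<subseteq> carrier P" using lhomD(2)[OF i(1)] lhomD(2)[OF i(2)] by auto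
  fix w assume w: "w \<in>. P"
  have c: "p1 w \<in>. N" "p2 w \<in>. N" using w lhomD(2)[OF p(1)] lhomD(2)[OF p(2)] by auto
  have "w = lsum P (%x. x) [i1 (p1 w), i2 (p2 w)]"
   using c ip w PD(2) lhomD(2)[OF i(2)] by simp
  moreover have "set [i1 (p1 w), i2 (p2 w)] \<subseteq> ?Y" using c by simp
  ultimately show "\<exists>ys. set ys \<subseteq> ?Y \<and> w = lsum P (%x. x) ys" by blast
 qed
 note span = this
 have id: "fmap \<alpha> N N g z = z" if "!!x. x \<in>. N ==> g x = x" "z \<in>. (a N)" for g z
  by (rule fmap_id[OF \<alpha> N that])
 have zero: "fmap \<alpha> N N g z = \<zero>\<^sub>(a N)" if "!!x. x \<in>. N ==> g x = \<zero>\<^sub>N" "z \<in>. (a N)" for g z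
  using fmap_cong[of N g "%x. \<zero>\<^sub>N" \<alpha> N] that fmap_zero[OF N] by simp
 have comp: "fmap \<alpha> P N q (fmap \<alpha> N P j z) = fmap \<alpha> N N (%x. q (j x)) z"
  if "q \<in> lhom R P N" "j \<in> {i1, i2}" "z \<in>. (a N)" for q j z
  using fmap_comp[OF \<alpha> N P N _ that(1,3), of j] that(2) i by auto
 have sum: "fmap \<alpha> P N ?s w = fmap \<alpha> P N p1 w \<oplus>\<^sub>(a N) fmap \<alpha> P N p2 w" if w: "w \<in>. (a P)" for w
 proof (rule agree_on_images[where I = "{i1, i2}" and D = "%_. N" and f = "%j. j", OF P N _ span aN as lmod_hom_add[OF aN ap] _ w])
  show "j \<in> lhom R N P" if "j \<in> {i1, i2}" for j using that i by auto
  fix j z assume j: "j \<in> {i1, i2}" and z: "z \<in>. (a N)"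
  have j': "(\<forall>x\<in>carrier N. p1 (j x) = x \<and> p2 (j x) = \<zero>\<^sub>N) \<or> (\<forall>x\<in>carrier N. p1 (j x) = \<zero>\<^sub>N \<and> p2 (j x) = x)"
   using j pi by blast
  have "fmap \<alpha> N N (%x. ?s (j x)) z = z"
   by (rule id[OF _ z]) (use j' ND(2) in auto)
  moreover have "fmap \<alpha> N N (%x. p1 (j x)) z \<oplus>\<^sub>(a N) fmap \<alpha> N N (%x. p2 (j x)) z = z"
   using j'
  proof
   assume j1: "\<forall>x\<in>carrier N. p1 (j x) = x \<and> p2 (j x) = \<zero>\<^sub>N"
   have "fmap \<alpha> N N (%x. p1 (j x)) z = z" "fmap \<alpha> N N (%x. p2 (j x)) z = \<zero>\<^sub>(a N)"
   by (rule id[OF _ z], use j1 in blast) (rule zero[OF _ z], use j1 in blast)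
   then show ?thesis using z lmodD(2)[OF aN] by simp
  next
   assume j2: "\<forall>x\<in>carrier N. p1 (j x) = \<zero>\<^sub>N \<and> p2 (j x) = x"
   have "fmap \<alpha> N N (%x. p1 (j x)) z = \<zero>\<^sub>(a N)" "fmap \<alpha> N N (%x. p2 (j x)) z = z"
   by (rule zero[OF _ z], use j2 in blast) (rule id[OF _ z], use j2 in blast)
   then show ?thesis using z lmodD(2)[OF aN] by simp
  qed
  ultimately show "fmap \<alpha> P N ?s (fmap \<alpha> N P j z) = fmap \<alpha> P N p1 (fmap \<alpha> N P j z) \<oplus>\<^sub>(a N) fmap \<alpha> P N p2 (fmap \<alpha> N P j z)"
   by (simp only: comp[OF s j z] comp[OF p(1) j z] comp[OF p(2) j z])
 qed
 have pd: "p1 (?d x) = h x \<and> p2 (?d x) = k x" if x: "x \<in>. M" for x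
 proof -
  have hx: "h x \<in>. N" "k x \<in>. N" using lhomD(2)[OF h x] lhomD(2)[OF k x] .
  note ix = lhomD(2)[OF i(1) hx(1)] lhomD(2)[OF i(2) hx(2)]
  show ?thesis
   using bspec[OF pi hx(1)] bspec[OF pi hx(2)] ND(2) hx by (simp only: lhomD(3)[OF p(1) ix] lhomD(3)[OF p(2) ix] add_zero)
 qed
 have p1d: "fmap \<alpha> M N (%x. p1 (?d x)) = fmap \<alpha> M N h" and p2d: "fmap \<alpha> M N (%x. p2 (?d x)) = fmap \<alpha> M N k"
  and sd: "fmap \<alpha> M N (%x. ?s (?d x)) = fmap \<alpha> M N (%x. h x \<oplus>\<^sub>N k x)"
  by (rule fmap_cong; simp only: pd)+
 have "fmap \<alpha> M N (%x. ?s (?d x)) y = fmap \<alpha> M N (%x. p1 (?d x)) y \<oplus>\<^sub>(a N) fmap \<alpha> M N (%x. p2 (?d x)) y"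
  unfolding fmap_comp[OF \<alpha> M P N d s y] fmap_comp[OF \<alpha> M P N d p(1) y] fmap_comp[OF \<alpha> M P N d p(2) y]
  by (rule sum[OF lhomD(2)[OF fmap_hom[OF \<alpha> M P d] y]])
 then show "fmap \<alpha> M N (%x. h x \<oplus>\<^sub>N k x) y = fmap \<alpha> M N h y \<oplus>\<^sub>(a N) fmap \<alpha> M N k y"
  unfolding p1d p2d sd .
qed

end

section \<open>Morita contexts from equivalences\<close>

text \<open>Surjectivity and compatibility imply bijectivity: since \<open>pf p q \<cdot> p\<^sub>j \<otimes> q\<^sub>j = p \<otimes> q \<cdot> pf p\<^sub>j q\<^sub>j\<close>, the map \<open>r \<mapsto> \<Sum> r p\<^sub>j \<otimes> q\<^sub>j\<close> is inverse to \<open>f\<close>.\<close>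

lemma morita_pairing_iso:
 fixes P :: "('r, 's, 'p) bimodule" and Q :: "('s, 'r, 'q) bimodule"
 assumes P: "is_bimodule R S P" and Q: "is_bimodule S R Q"
  and cl: "!!p q. p \<in>. P ==> q \<in>. Q ==> pf p q \<in>. R"
   "!!p q. p \<in>. P ==> q \<in>. Q ==> pg q p \<in>. S"
  and pf: "!!p p' q. p \<in>. P ==> p' \<in>. P ==> q \<in>. Q ==> pf (p \<oplus>\<^sub>P p') q = pf p q \<oplus>\<^sub>R pf p' q"
   "!!p q q'. p \<in>. P ==> q \<in>. Q ==> q' \<in>. Q ==> pf p (q \<oplus>\<^sub>Q q') = pf p q \<oplus>\<^sub>R pf p q'"
   "!!p s q. p \<in>. P ==> s \<in>. S ==> q \<in>. Q ==> pf (p \<triangleleft>\<^sub>P s) q = pf p (s \<odot>\<^sub>Q q)"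
   "!!r p q. r \<in>. R ==> p \<in>. P ==> q \<in>. Q ==> pf (r \<odot>\<^sub>P p) q = r \<otimes>\<^sub>R pf p q"
   "!!r p q. r \<in>. R ==> p \<in>. P ==> q \<in>. Q ==> pf p (q \<triangleleft>\<^sub>Q r) = pf p q \<otimes>\<^sub>R r"
  and fg: "!!p q p'. p \<in>. P ==> q \<in>. Q ==> p' \<in>. P ==> pf p q \<odot>\<^sub>P p' = p \<triangleleft>\<^sub>P pg q p'"
  and gf: "!!q p q'. q \<in>. Q ==> p \<in>. P ==> q' \<in>. Q ==> pg q p \<odot>\<^sub>Q q' = q \<triangleleft>\<^sub>Q pf p q'"
  and es0: "set es \<subseteq> carrier P \<times> carrier Q" and es1: "lsum R (%e. pf (fst e) (snd e)) es = \<one>\<^sub>R"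
 obtains f where "f \<in> bimod_iso R R (tensor_bimod S P Q) (regular R)"
  "\<forall>p\<in>carrier P. \<forall>q\<in>carrier Q. f (ptens S (rpart P) Q p q) = pf p q"
proof -
 let ?T = "tensor_bimod S P Q" and ?t = "ptens S (rpart P) Q"
 note TB = tensor_bimod[OF P Q]
 interpret T: tensor S "rpart P" Q ?T ?t by (rule TB(1))
 note PL = bimodule_left[OF P] and PR = bimodule_right[OF P] and QL = bimodule_left[OF Q] and QR = bimodule_right[OF Q]
 note TL = bimodule_left[OF TB(2)] and TR = bimodule_right[OF TB(2)] and RS = ring_simps[OF PL(1)]
 define f where "f = tlift (rpart P) Q ?T ?t R pf"
 have "balanced S (rpart P) Q R pf"
  using cl(1) pf(1-3) by (intro balancedI) simp_all
 note f = T.tlift[OF ring_abelian[OF PL(1)] this, folded f_def, simplified right_part_simps]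
 have fL: "f (r \<odot>\<^sub>?T x) = r \<otimes>\<^sub>R f x" and fR: "f (x \<triangleleft>\<^sub>?T r) = f x \<otimes>\<^sub>R r"
  if r: "r \<in>. R" and x: "x \<in>. ?T" for r x
  using x
 proof (induction x rule: T.induct)
  case (pure p q)
  { case 1 then show ?case using pure r PL pf(4) by (simp add: TB(3) f(2)) }
  { case 2 then show ?case using pure r QR pf(5) by (simp add: TB(4) f(2)) }
 next
  case (add x y)
  { case 1 then show ?case using add r TL ring_distrib[OF PL(1)] by (simp add: addD[OF f(1)]) }
  { case 2 then show ?case using add r TR ring_distrib[OF PL(1)] by (simp add: addD[OF f(1)]) }
 qed
 have es: "!!e. e \<in> set es ==> fst e \<in>. P" "!!e. e \<in> set es ==> snd e \<in>. Q" using es0 by auto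
 define k where "k r = lsum ?T (%e. ?t (r \<odot>\<^sub>P fst e) (snd e)) es" for r
 have tcl: "?t p q \<in>. ?T" if "p \<in>. P" "q \<in>. Q" for p q using T.closed that by simp
 have kh: "k \<in> add_homs R ?T" unfolding k_def
 proof (rule add_homs_lsum_pointwise[OF _ TL(2) ring_abelian[OF PL(1)]])
  fix e assume "e \<in> set es"
  then show "(%r. ?t (r \<odot>\<^sub>P fst e) (snd e)) \<in> add_homs R ?T"
   using es PL tcl T.add_left by (intro addI) simp_all
 qed
 have fk: "f (k r) = r" if r: "r \<in>. R" for r
 proof -
  have "f (k r) = lsum R (%e. r \<otimes>\<^sub>R pf (fst e) (snd e)) es"
   unfolding k_def using r es PL tcl by (subst add_lsum[OF f(1) TL(2)]) (simp_all add: f(2) pf(4) cong: lsum_cong)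
  also have "... = r \<otimes>\<^sub>R lsum R (%e. pf (fst e) (snd e)) es"
   using left_module_lsum(1)[OF bimoduleD(1)[OF ring_bimod_bimodule[OF PL(1) PL(1) PL(1) id_ring_hom id_ring_hom]] r, of es "%e. pf (fst e) (snd e)"]
   es cl(1) by simp
  finally show ?thesis using r RS es1 by simp
 qed
 have kf: "k (f x) = x" if x: "x \<in>. ?T" for x
 proof (rule T.ext[OF add_homs_comp[OF f(1) kh] _ x, where h' = "%x. x"])
  fix p q assume "p \<in>. (rpart P)" and q: "q \<in>. Q"
  then have p: "p \<in>. P" by simp
  have "k (f (?t p q)) = lsum ?T (%e. ?t p (q \<triangleleft>\<^sub>Q pf (fst e) (snd e))) es"
   unfolding k_def f(2)[OF p q]
  proof (rule lsum_cong[OF refl])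
   fix e assume e: "e \<in> set es"
   show "?t (pf p q \<odot>\<^sub>P fst e) (snd e) = ?t p (q \<triangleleft>\<^sub>Q pf (fst e) (snd e))"
   using T.move[of p "pg q (fst e)" "snd e"] p q es[OF e] cl by (simp add: fg gf)
  qed
  also have "... = ?t p (q \<triangleleft>\<^sub>Q lsum R (%e. pf (fst e) (snd e)) es)"
   using p q es cl(1) QR by (subst bimodule_right_lsum(2)[OF Q q]) (simp_all add: T.lsum_right)
  finally show "k (f (?t p q)) = ?t p q" using q QR es1 by simp
 qed (simp add: hom_def)
 have "f \<in> bimod_iso R R ?T (regular R)"
  unfolding bimod_iso_def bimod_hom_def
 proof (intro CollectI conjI IntI)
  show "f \<in> lhom R ?T (regular R)" using fL by (intro lhomI addI) (simp_all add: addD[OF f(1)])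
  show "f \<in> rhom R (rpart ?T) (rpart (regular R))" using fR by (intro rmod_homI addI) (simp_all add: addD[OF f(1)])
  show "bij_betw f (carrier ?T) (carrier (regular R))"
   by (rule bij_betw_byWitness[where f' = k]) (use fk kf addD(1)[OF f(1)] addD(1)[OF kh] in auto)
 qed
 then show thesis using f(2) by (intro that) auto
qed

abbreviation "left_regular R \<equiv> lmod_of (regular R)"

lemma left_regular: "ring R ==> lmod R (left_regular R)"
 by (rule lmod_of_module[OF bimoduleD(1)[OF ring_bimod_bimodule[OF _ _ _ id_ring_hom id_ring_hom]]])

lemma scalar_hom: "lmod R M ==> m \<in>. M ==> (%r. r \<odot>\<^sub>M m) \<in> lhom R (left_regular R) M"
 using lmodD[of R M] by (intro lhomI addI) simp_all

lemma left_regular_hom: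
 assumes "ring R" "h \<in> lhom R (left_regular R) M" "r \<in>. R"
 shows "h r = r \<odot>\<^sub>M h \<one>\<^sub>R"
 using lhomD(4)[OF assms(2,3), of "\<one>\<^sub>R"] assms(3) ring_simps[OF assms(1)] by simp

lemma spans_scalar:
 assumes M: "lmod R M"
 shows "spans M (\<Union>m\<in>carrier M. (%r. r \<odot>\<^sub>M m) ` carrier (left_regular R))" (is "spans M ?Y")
proof -
 note MD = lmodD[OF M] and RS = ring_simps[OF lmodD(1)[OF M]]
 have "m \<in> ?Y" if m: "m \<in>. M" for m
  by (rule UN_I[OF m], rule image_eqI[of _ _ "\<one>\<^sub>R"]) (use m MD RS in simp_all)
 then have "\<exists>ys. set ys \<subseteq> ?Y \<and> m = lsum M (%x. x) ys" if "m \<in>. M" for m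
  using that MD(2) by (intro exI[of _ "[m]"]) simp
 moreover have "?Y \<subseteq> carrier M" using MD by auto
 ultimately show ?thesis unfolding spans_def by (intro conjI ballI)
qed

lemma spans_pairs:
 assumes "spans N (\<Union>m\<in>A. f m ` B)" "y \<in>. N"
 obtains es where "set es \<subseteq> B \<times> A" "y = lsum N (%e. f (snd e) (fst e)) es"
proof -
 obtain ys where ys: "set ys \<subseteq> (\<Union>m\<in>A. f m ` B)" "y = lsum N (%x. x) ys" using assms by (auto simp: spans_def)
 have "\<exists>es. set es \<subseteq> B \<times> A \<and> lsum N (%x. x) ys = lsum N (%e. f (snd e) (fst e)) es"
  using ys(1)
 proof (induction ys)
  case (Cons z ys)
  then obtain es where "set es \<subseteq> B \<times> A" "lsum N (%x. x) ys = lsum N (%e. f (snd e) (fst e)) es" by auto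
  moreover obtain m b where "m \<in> A" "b \<in> B" "z = f m b" using Cons.prems by auto
  ultimately show ?case by (intro exI[of _ "(b, m) # es"]) simp
 qed (simp add: exI[of _ "[]"])
 then show thesis using that ys(2) by auto
qed

text \<open>The Eilenberg--Watts map \<open>F(R) \<otimes> M \<rightarrow> F(M)\<close> on \<open>u \<otimes> m\<close>. For \<open>M = R\<close> it is the right action on \<open>F(R)\<close>.\<close>

definition watts :: "('r, 'a) ring_scheme => ('r, 'r, 's, 'n) lmod_functor => ('r, 'r) module => 'n => 'r => 'n" where
 "watts R F M u m = fmap F (left_regular R) M (%r. r \<odot>\<^sub>M m) u"

definition functor_bimod :: "('r, 'a) ring_scheme => ('r, 'r, 's, 'n) lmod_functor => ('s, 'r, 'n) bimodule" where
 "functor_bimod R F = \<lparr>carrier = carrier (on_ob F (left_regular R)), monoid.mult = undefined, one = undefined,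
   ring.zero = \<zero>\<^sub>(on_ob F (left_regular R)), ring.add = ring.add (on_ob F (left_regular R)),
   smult = smult (on_ob F (left_regular R)), bract = watts R F (left_regular R)\<rparr>"

lemma functor_bimod_simps [simp]:
 "carrier (functor_bimod R F) = carrier (on_ob F (left_regular R))" "\<zero>\<^sub>(functor_bimod R F) = \<zero>\<^sub>(on_ob F (left_regular R))"
 "x \<oplus>\<^sub>(functor_bimod R F) y = x \<oplus>\<^sub>(on_ob F (left_regular R)) y" "s \<odot>\<^sub>(functor_bimod R F) x = s \<odot>\<^sub>(on_ob F (left_regular R)) x"
 "x \<triangleleft>\<^sub>(functor_bimod R F) r = watts R F (left_regular R) x r"
 by (auto simp: functor_bimod_def)

lemma lsum_functor_bimod [simp]: "lsum (functor_bimod R F) f xs = lsum (on_ob F (left_regular R)) f xs"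
 by (induction xs) auto

locale additive_lmod_functor =
 fixes R :: "('r, 'a) ring_scheme" and S :: "('s, 'b) ring_scheme" and F :: "('r, 'r, 's, 'n) lmod_functor"
 assumes R: "ring R" and F: "lfunctor R S F" and add: "additive_functor R F"
begin

abbreviation "RL \<equiv> left_regular R"
lemmas RL = left_regular[OF R]

lemma watts_hom: "lmod R M ==> m \<in>. M ==> (%u. watts R F M u m) \<in> lhom S (on_ob F RL) (on_ob F M)"
 unfolding watts_def by (rule fmap_hom[OF F RL _ scalar_hom])

lemma watts_add:
 assumes M: "lmod R M" and m: "m \<in>. M" "m' \<in>. M" and u: "u \<in>. (on_ob F RL)"
 shows "watts R F M u (m \<oplus>\<^sub>M m') = watts R F M u m \<oplus>\<^sub>(on_ob F M) watts R F M u m'"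
proof -
 have "fmap F RL M (%r. r \<odot>\<^sub>M (m \<oplus>\<^sub>M m')) = fmap F RL M (%r. r \<odot>\<^sub>M m \<oplus>\<^sub>M r \<odot>\<^sub>M m')"
  by (rule fmap_cong) (use lmodD[OF M] m in simp)
 then show ?thesis
  unfolding watts_def by (simp only: add[unfolded additive_functor_def, rule_format, OF u RL M scalar_hom[OF M m(1)] scalar_hom[OF M m(2)]])
qed

lemma watts_nat:
 assumes M: "lmod R M" "lmod R N" and h: "h \<in> lhom R M N" and m: "m \<in>. M" and u: "u \<in>. (on_ob F RL)"
 shows "watts R F N u (h m) = fmap F M N h (watts R F M u m)"
proof -
 have "fmap F RL N (%r. r \<odot>\<^sub>N h m) = fmap F RL N (%r. h (r \<odot>\<^sub>M m))"
  by (rule fmap_cong) (use lhomD(4)[OF h] m in simp)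
 then show ?thesis unfolding watts_def by (simp only: fmap_comp[OF F RL M scalar_hom[OF M(1) m] h u])
qed

lemma watts_move:
 assumes M: "lmod R M" and m: "m \<in>. M" and r: "r \<in>. R" and u: "u \<in>. (on_ob F RL)"
 shows "watts R F M u (r \<odot>\<^sub>M m) = watts R F M (watts R F RL u r) m"
 using watts_nat[OF RL M scalar_hom[OF M m] _ u, of r] r by (simp add: watts_def)

lemma watts_one: "u \<in>. (on_ob F RL) ==> watts R F RL u \<one>\<^sub>R = u"
 unfolding watts_def by (rule fmap_id[OF F RL]) (use ring_simps[OF R] in simp_all)

lemma functor_bimod: "is_bimodule S R (functor_bimod R F)"
proof -
 note FR = functor_ob[OF F RL]
 note FD = lmodD[OF FR]
 have ag: "abelian_group (functor_bimod R F)" "abelian_group (rpart (functor_bimod R F))"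
  by (rule abelian_group_cong[OF FD(2)]; simp)+
 have w: "(%u. watts R F RL u r) \<in> lhom S (on_ob F RL) (on_ob F RL)" if "r \<in>. R" for r
  using watts_hom[OF RL] that by simp
 have "lmod S (functor_bimod R F)"
  using FD by (intro left_moduleI[OF FD(1) ag(1)]) simp_all
 moreover have "rmod R (rpart (functor_bimod R F))"
  using lhomD[OF w] watts_add[OF RL] watts_move[OF RL] watts_one
  by (intro right_moduleI[OF R ag(2)]) simp_all
 ultimately show ?thesis unfolding is_bimodule_def using lhomD(4)[OF w] by simp
qed

end

context module_equivalence
begin

abbreviation "RL \<equiv> left_regular R"
lemmas RL = left_regular[OF R]
lemmas RS = ring_simps[OF R]

lemma watts_span:
 assumes M: "lmod R M" and y: "y \<in>. (a M)"
 obtains es where "set es \<subseteq> carrier (a RL) \<times> carrier M" "y = lsum (a M) (%e. watts R \<alpha> M (fst e) (snd e)) es"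
proof (rule spans_pairs[OF span_image[OF M _ _ spans_scalar[OF M]] y])
 show "lmod R RL" "m \<in>. M ==> (%r. r \<odot>\<^sub>M m) \<in> lhom R RL M" for m
  by (rule RL, rule scalar_hom[OF M])
 fix es assume "set es \<subseteq> carrier (a RL) \<times> carrier M" "y = lsum (a M) (%e. fmap \<alpha> RL M (%r. r \<odot>\<^sub>M snd e) (fst e)) es"
 then show thesis by (intro that) (simp_all add: watts_def)
qed

sublocale A: additive_lmod_functor R R \<alpha>
 by (rule additive_lmod_functor.intro[OF R \<alpha> additive])

sublocale C: additive_lmod_functor R R \<gamma>
 by (rule additive_lmod_functor.intro[OF R \<gamma> module_equivalence.additive[OF swap]])

text \<open>The pairing of \<open>\<alpha>(R)\<close> with \<open>\<gamma>(R)\<close> is the Eilenberg--Watts map into \<open>\<alpha>(\<gamma>(R))\<close>, followed by the counit.\<close>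

definition "pf p q = eps RL (watts R \<alpha> (c RL) p q)"

lemma eps_hom: "lmod R M ==> eps M \<in> lhom R (a (c M)) M"
 using eps by (simp add: lmod_iso_def)

lemmas cRL = c[OF RL] and aRL = a[OF RL]

lemma pf_hom: "q \<in>. (c RL) ==> (%p. pf p q) \<in> lhom R (a RL) RL"
 unfolding pf_def by (rule lhom_comp[OF A.watts_hom[OF cRL] eps_hom[OF RL]])

lemmas pfD = lhomD[OF pf_hom, simplified]

lemma pf_add: "p \<in>. (a RL) ==> q \<in>. (c RL) ==> q' \<in>. (c RL) ==> pf p (q \<oplus>\<^sub>(c RL) q') = pf p q \<oplus>\<^sub>R pf p q'"
 using lhomD(2)[OF A.watts_hom[OF cRL]] by (simp add: pf_def A.watts_add[OF cRL] lhomD(3)[OF eps_hom[OF RL]])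

lemma pf_move: "p \<in>. (a RL) ==> q \<in>. (c RL) ==> r \<in>. R ==> pf (watts R \<alpha> RL p r) q = pf p (r \<odot>\<^sub>(c RL) q)"
 by (simp add: pf_def A.watts_move[OF cRL])

lemma eps_watts:
 assumes M: "lmod R M" and p: "p \<in>. (a RL)" and q: "q \<in>. (c RL)" and m: "m \<in>. M"
 shows "eps M (watts R \<alpha> (c M) p (watts R \<gamma> M q m)) = pf p q \<odot>\<^sub>M m"
proof -
 note s = scalar_hom[OF M m]
 have "watts R \<alpha> (c M) p (watts R \<gamma> M q m) = fmap \<alpha> (c RL) (c M) (fmap \<gamma> RL M (%r. r \<odot>\<^sub>M m)) (watts R \<alpha> (c RL) p q)"
  unfolding watts_def[of R \<gamma>] by (rule A.watts_nat[OF cRL c[OF M] fmap_hom[OF \<gamma> RL M s] q p])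
 then show ?thesis
  unfolding pf_def using eps_nat[OF RL M s] lhomD(2)[OF A.watts_hom[OF cRL q] p] by simp
qed

lemma pf_right: "p \<in>. (a RL) ==> q \<in>. (c RL) ==> r \<in>. R ==> pf p (watts R \<gamma> RL q r) = pf p q \<otimes>\<^sub>R r"
 using eps_watts[OF RL] by (simp add: pf_def)

lemma watts_inj:
 assumes M: "lmod R M" and m: "m \<in>. M" "m' \<in>. M"
  and eq: "!!u. u \<in>. (a RL) ==> watts R \<alpha> M u m = watts R \<alpha> M u m'"
 shows "m = m'"
 using faithful[OF RL M scalar_hom[OF M m(1)] scalar_hom[OF M m(2)] eq[unfolded watts_def], of "\<one>\<^sub>R"] m RS lmodD[OF M] by simp

lemma pf_inj:
 assumes q: "q \<in>. (c RL)" "q' \<in>. (c RL)" and eq: "!!p. p \<in>. (a RL) ==> pf p q = pf p q'"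
 shows "q = q'"
proof (rule watts_inj[OF cRL q])
 fix u assume u: "u \<in>. (a RL)"
 have "inj_on (eps RL) (carrier (a (c RL)))" using eps[OF RL] by (simp add: lmod_iso_def bij_betw_def)
 then show "watts R \<alpha> (c RL) u q = watts R \<alpha> (c RL) u q'"
  using eq[OF u] lhomD(2)[OF A.watts_hom[OF cRL q(1)] u] lhomD(2)[OF A.watts_hom[OF cRL q(2)] u]
  unfolding pf_def by (rule inj_onD)
qed

text \<open>The second pairing is determined by the first and one compatibility condition: \<open>p' \<mapsto> pf p' q \<cdot> p\<close> is an endomorphism of \<open>\<alpha>(R)\<close>, hence right multiplication by a unique \<open>r\<close>. Using the unit of the equivalence here instead would require the triangle identities.\<close>

definition "pg q p = (SOME r. r \<in>. R \<and> (\<forall>p'\<in>carrier (a RL). pf p' q \<odot>\<^sub>(a RL) p = watts R \<alpha> RL p' r))"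

lemma pg:
 assumes q: "q \<in>. (c RL)" and p: "p \<in>. (a RL)"
 shows "pg q p \<in>. R" "p' \<in>. (a RL) ==> pf p' q \<odot>\<^sub>(a RL) p = watts R \<alpha> RL p' (pg q p)"
proof -
 have "(%p'. pf p' q \<odot>\<^sub>(a RL) p) \<in> lhom R (a RL) (a RL)"
  using lhom_comp[OF pf_hom[OF q] scalar_hom[OF aRL p]] .
 then obtain h where h: "h \<in> lhom R RL RL" "\<forall>p'\<in>carrier (a RL). fmap \<alpha> RL RL h p' = pf p' q \<odot>\<^sub>(a RL) p"
  by (rule full[OF RL RL])
 have "fmap \<alpha> RL RL h = fmap \<alpha> RL RL (%r. r \<odot>\<^sub>RL h \<one>\<^sub>R)"
  by (rule fmap_cong) (use left_regular_hom[OF R h(1)] in simp)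
 then have "h \<one>\<^sub>R \<in>. R \<and> (\<forall>p'\<in>carrier (a RL). pf p' q \<odot>\<^sub>(a RL) p = watts R \<alpha> RL p' (h \<one>\<^sub>R))"
  using h(2) lhomD(2)[OF h(1), of "\<one>\<^sub>R"] RS by (simp add: watts_def)
 from someI[where P = "%r. r \<in>. R \<and> (\<forall>p'\<in>carrier (a RL). pf p' q \<odot>\<^sub>(a RL) p = watts R \<alpha> RL p' r)", OF this]
 show "pg q p \<in>. R" "p' \<in>. (a RL) ==> pf p' q \<odot>\<^sub>(a RL) p = watts R \<alpha> RL p' (pg q p)"
  unfolding pg_def by auto
qed

lemma pgI:
 assumes "q \<in>. (c RL)" "p \<in>. (a RL)" "r \<in>. R"
  "!!p'. p' \<in>. (a RL) ==> pf p' q \<odot>\<^sub>(a RL) p = watts R \<alpha> RL p' r"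
 shows "pg q p = r"
 using watts_inj[OF RL, of "pg q p" r] pg[OF assms(1,2)] assms(3,4) by simp

lemma pf_unit:
 obtains es where "set es \<subseteq> carrier (a RL) \<times> carrier (c RL)" "lsum R (%e. pf (fst e) (snd e)) es = \<one>\<^sub>R"
proof -
 interpret S: module_equivalence R \<gamma> \<alpha> eps \<eta> by (rule swap)
 have y: "S.\<eta>' RL \<one>\<^sub>R \<in>. (a (c RL))" "eps RL (S.\<eta>' RL \<one>\<^sub>R) = \<one>\<^sub>R"
  using lhomD(2)[OF S.\<eta>'(1)[OF RL], of "\<one>\<^sub>R"] S.\<eta>'(2)[OF RL, of "\<one>\<^sub>R"] RS by simp_all
 obtain es where es: "set es \<subseteq> carrier (a RL) \<times> carrier (c RL)"
   "S.\<eta>' RL \<one>\<^sub>R = lsum (a (c RL)) (%e. watts R \<alpha> (c RL) (fst e) (snd e)) es"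
  by (rule watts_span[OF cRL y(1)])
 have "watts R \<alpha> (c RL) (fst e) (snd e) \<in>. (a (c RL))" if "e \<in> set es" for e
  using es(1) that lhomD(2)[OF A.watts_hom[OF cRL]] by auto
 then have "eps RL (lsum (a (c RL)) (%e. watts R \<alpha> (c RL) (fst e) (snd e)) es) = lsum RL (%e. pf (fst e) (snd e)) es"
  unfolding pf_def by (rule add_lsum[OF lhomD(1)[OF eps_hom[OF RL]] lmodD(2)[OF a[OF cRL]] lmodD(2)[OF RL]])
 then show thesis using es y(2) by (intro that[OF es(1)]) simp
qed

text \<open>Expand \<open>\<eta>\<inverse>(1) \<in> \<gamma>(\<alpha>(R))\<close> as \<open>\<Sum> q\<^sub>j p\<^sub>j\<close>. Then \<open>u \<mapsto> \<Sum> pf u q\<^sub>j \<cdot> p\<^sub>j\<close> has a left inverse \<open>\<xi>\<close>, built from \<open>\<alpha> \<eta>\<close> and the inverse counit; the basis consists of the \<open>\<xi> p\<^sub>j\<close>.\<close>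

lemma left_dual_basis:
 obtains es where "set es \<subseteq> carrier (c RL) \<times> carrier (a RL)"
  "\<forall>u\<in>carrier (a RL). lsum (a RL) (%e. pf u (fst e) \<odot>\<^sub>(a RL) snd e) es = u"
proof -
 interpret S: module_equivalence R \<gamma> \<alpha> eps \<eta> by (rule swap)
 let ?U = "a RL" and ?z = "\<eta>' RL \<one>\<^sub>R"
 note caRL = c[OF aRL]
 note acaRL = a[OF caRL]
 have z: "?z \<in>. (c ?U)" "\<eta> RL ?z = \<one>\<^sub>R"
  using lhomD(2)[OF \<eta>'(1)[OF RL], of "\<one>\<^sub>R"] \<eta>'(2)[OF RL, of "\<one>\<^sub>R"] RS by simp_all
 obtain es where es0: "set es \<subseteq> carrier (c RL) \<times> carrier ?U" and es1: "?z = lsum (c ?U) (%e. watts R \<gamma> ?U (fst e) (snd e)) es"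
  by (rule S.watts_span[OF aRL z(1)])
 have es: "!!e. e \<in> set es ==> fst e \<in>. (c RL)" "!!e. e \<in> set es ==> snd e \<in>. ?U" using es0 by auto
 define \<xi> where "\<xi> v = fmap \<alpha> (c ?U) RL (\<eta> RL) (S.\<eta>' ?U v)" for v
 have \<xi>: "\<xi> \<in> lhom R ?U ?U"
  unfolding \<xi>_def by (rule lhom_comp[OF S.\<eta>'(1)[OF aRL] fmap_hom[OF \<alpha> caRL RL \<eta>'(4)[OF RL]]])
 have u_eq: "u = lsum ?U (%e. pf u (fst e) \<odot>\<^sub>?U \<xi> (snd e)) es" if u: "u \<in>. ?U" for u
 proof -
  have ww: "watts R \<gamma> ?U (fst e) (snd e) \<in>. (c ?U)" if "e \<in> set es" for e
   using lhomD(2)[OF C.watts_hom[OF aRL es(2)[OF that]] es(1)[OF that]] .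
  have wh: "(%m. watts R \<alpha> (c ?U) u m) \<in> add_homs (c ?U) (a (c ?U))"
   using A.watts_add[OF caRL _ _ u] lhomD(2)[OF A.watts_hom[OF caRL] u] by (intro addI) simp_all
  note epsw = add_homs_comp[OF wh lhomD(1)[OF eps_hom[OF aRL]]]
  have "eps ?U (watts R \<alpha> (c ?U) u ?z) = lsum ?U (%e. eps ?U (watts R \<alpha> (c ?U) u (watts R \<gamma> ?U (fst e) (snd e)))) es"
   unfolding es1 by (rule add_lsum[OF epsw lmodD(2)[OF caRL] lmodD(2)[OF aRL] ww])
  also have "... = lsum ?U (%e. pf u (fst e) \<odot>\<^sub>?U snd e) es"
   using es u by (intro lsum_cong) (simp_all add: eps_watts[OF aRL])
  finally have e1: "eps ?U (watts R \<alpha> (c ?U) u ?z) = lsum ?U (%e. pf u (fst e) \<odot>\<^sub>?U snd e) es" .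
  have wz: "watts R \<alpha> (c ?U) u ?z \<in>. (a (c ?U))" using addD(1)[OF wh z(1)] .
  have "\<xi> (eps ?U (watts R \<alpha> (c ?U) u ?z)) = fmap \<alpha> (c ?U) RL (\<eta> RL) (watts R \<alpha> (c ?U) u ?z)"
   unfolding \<xi>_def by (simp only: S.\<eta>'(3)[OF aRL wz])
  also have "... = u"
   using A.watts_nat[OF caRL RL \<eta>'(4)[OF RL] z(1) u] A.watts_one[OF u] by (simp add: z(2))
  finally have "u = \<xi> (lsum ?U (%e. pf u (fst e) \<odot>\<^sub>?U snd e) es)" by (simp only: e1)
  also have "... = lsum ?U (%e. \<xi> (pf u (fst e) \<odot>\<^sub>?U snd e)) es"
   using es u pfD(2) lmodD[OF aRL] by (intro add_lsum[OF lhomD(1)[OF \<xi>]]) simp_all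
  also have "... = lsum ?U (%e. pf u (fst e) \<odot>\<^sub>?U \<xi> (snd e)) es"
   using es u pfD(2) by (intro lsum_cong) (simp_all add: lhomD(4)[OF \<xi>])
  finally show ?thesis .
 qed
 show thesis
  by (rule that[of "map (%e. (fst e, \<xi> (snd e))) es"])
   (use es lhomD(2)[OF \<xi>] u_eq[symmetric] in \<open>auto simp: lsum_map\<close>)
qed

lemma pg_unit:
 obtains es where "set es \<subseteq> carrier (c RL) \<times> carrier (a RL)" "lsum R (%e. pg (fst e) (snd e)) es = \<one>\<^sub>R"
proof -
 let ?U = "a RL"
 obtain es where es0: "set es \<subseteq> carrier (c RL) \<times> carrier ?U"
  and es1: "\<forall>u\<in>carrier ?U. lsum ?U (%e. pf u (fst e) \<odot>\<^sub>?U snd e) es = u" by (rule left_dual_basis)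
 have es: "!!e. e \<in> set es ==> fst e \<in>. (c RL)" "!!e. e \<in> set es ==> snd e \<in>. ?U" using es0 by auto
 have pgR: "pg (fst e) (snd e) \<in>. R" if "e \<in> set es" for e using pg(1)[OF es[OF that]] .
 have "lsum R (%e. pg (fst e) (snd e)) es = \<one>\<^sub>R"
 proof (rule watts_inj[OF RL])
  show "lsum R (%e. pg (fst e) (snd e)) es \<in>. RL" "\<one>\<^sub>R \<in>. RL" using RS R pgR by simp_all
  fix u assume u: "u \<in>. ?U"
  have wh: "(%r. watts R \<alpha> RL u r) \<in> add_homs RL ?U"
   using A.watts_add[OF RL _ _ u] lhomD(2)[OF A.watts_hom[OF RL] u] by (intro addI) simp_all
  have "watts R \<alpha> RL u (lsum RL (%e. pg (fst e) (snd e)) es) = lsum ?U (%e. watts R \<alpha> RL u (pg (fst e) (snd e))) es"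
   using pgR by (intro add_lsum[OF wh lmodD(2)[OF RL] lmodD(2)[OF aRL]]) simp
  also have "... = lsum ?U (%e. pf u (fst e) \<odot>\<^sub>?U snd e) es"
   using es u by (intro lsum_cong) (simp_all add: pg(2))
  also have "... = watts R \<alpha> RL u \<one>\<^sub>R" using bspec[OF es1 u] A.watts_one[OF u] by simp
  finally show "watts R \<alpha> RL u (lsum R (%e. pg (fst e) (snd e)) es) = watts R \<alpha> RL u \<one>\<^sub>R" by simp
 qed
 with es0 show thesis by (rule that)
qed

theorem morita_context:
 obtains f g where "strict_morita_context R R (functor_bimod R \<alpha>) (functor_bimod R \<gamma>) f g"
proof -
 let ?U = "functor_bimod R \<alpha>" and ?U' = "functor_bimod R \<gamma>"
 note U = A.functor_bimod and U' = C.functor_bimod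
 note UL = lmodD[OF aRL] and UR = bimodule_right[OF U, simplified] and CL = lmodD[OF cRL] and CR = bimodule_right[OF U', simplified]
 have fg: "pf p q \<odot>\<^sub>(a RL) p' = watts R \<alpha> RL p (pg q p')" if "p \<in>. (a RL)" "q \<in>. (c RL)" "p' \<in>. (a RL)" for p q p'
  by (rule pg(2)[OF that(2,3,1)])
 have gf: "pg q p \<odot>\<^sub>(c RL) q' = watts R \<gamma> RL q (pf p q')" if q: "q \<in>. (c RL)" and p: "p \<in>. (a RL)" and q': "q' \<in>. (c RL)" for q p q'
 proof (rule pf_inj)
  note c = pg(1)[OF q p]
  show "pg q p \<odot>\<^sub>(c RL) q' \<in>. (c RL)" "watts R \<gamma> RL q (pf p q') \<in>. (c RL)" using c CL CR q q' p pfD by simp_all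
  fix p' assume p': "p' \<in>. (a RL)"
  have "pf p' (pg q p \<odot>\<^sub>(c RL) q') = pf (pf p' q \<odot>\<^sub>(a RL) p) q'"
   using pf_move[OF p' q' c] fg[OF p' q p] by simp
  also have "... = pf p' (watts R \<gamma> RL q (pf p q'))"
   using p p' q q' pfD pf_right by simp
  finally show "pf p' (pg q p \<odot>\<^sub>(c RL) q') = pf p' (watts R \<gamma> RL q (pf p q'))" .
 qed
 have pg_add1: "pg (q \<oplus>\<^sub>(c RL) q') p = pg q p \<oplus>\<^sub>R pg q' p" and pg_add2: "pg q (p \<oplus>\<^sub>(a RL) p') = pg q p \<oplus>\<^sub>R pg q p'"
  if "q \<in>. (c RL)" "q' \<in>. (c RL)" "p \<in>. (a RL)" "p' \<in>. (a RL)" for q q' p p'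
  using that CL UL UR pg(1) pfD fg R by (auto intro!: pgI simp: pf_add)
 have pg_move: "pg (watts R \<gamma> RL q r) p = pg q (r \<odot>\<^sub>(a RL) p)" and pg_left: "pg (r \<odot>\<^sub>(c RL) q) p = r \<otimes>\<^sub>R pg q p"
  and pg_right: "pg q (watts R \<alpha> RL p r) = pg q p \<otimes>\<^sub>R r"
  if q: "q \<in>. (c RL)" and p: "p \<in>. (a RL)" and r: "r \<in>. R" for q p r
 proof -
  show "pg (watts R \<gamma> RL q r) p = pg q (r \<odot>\<^sub>(a RL) p)"
   using q p r CR UL pg(1) pfD fg by (intro pgI) (simp_all add: pf_right)
  show "pg (r \<odot>\<^sub>(c RL) q) p = r \<otimes>\<^sub>R pg q p"
   using q p r CL UR pg(1) RS fg by (intro pgI) (simp_all add: pf_move[symmetric])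
  show "pg q (watts R \<alpha> RL p r) = pg q p \<otimes>\<^sub>R r"
   using q p r UR pg(1) RS pfD lhomD(4)[OF A.watts_hom[OF RL], of r, symmetric] fg by (intro pgI) simp_all
 qed
 obtain es where "set es \<subseteq> carrier (a RL) \<times> carrier (c RL)" and es1: "lsum R (%e. pf (fst e) (snd e)) es = \<one>\<^sub>R"
  by (rule pf_unit)
 then have es: "set es \<subseteq> carrier ?U \<times> carrier ?U'" by simp
 obtain es' where "set es' \<subseteq> carrier (c RL) \<times> carrier (a RL)" and es1': "lsum R (%e. pg (fst e) (snd e)) es' = \<one>\<^sub>R"
  by (rule pg_unit)
 then have es': "set es' \<subseteq> carrier ?U' \<times> carrier ?U" by simp
 obtain f where f: "f \<in> bimod_iso R R (tensor_bimod R ?U ?U') (regular R)"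
  "\<forall>p\<in>carrier ?U. \<forall>q\<in>carrier ?U'. f (ptens R (rpart ?U) ?U' p q) = pf p q"
  by (rule morita_pairing_iso[OF U U' _ _ _ _ _ _ _ _ _ es es1, where pg = pg])
   (use pfD pg(1) pf_add pf_move pf_right fg gf in simp_all)
 obtain g where g: "g \<in> bimod_iso R R (tensor_bimod R ?U' ?U) (regular R)"
  "\<forall>q\<in>carrier ?U'. \<forall>p\<in>carrier ?U. g (ptens R (rpart ?U') ?U q p) = pg q p"
  by (rule morita_pairing_iso[OF U' U _ _ _ _ _ _ _ _ _ es' es1', where pg = pf])
   (use pfD pg(1) pg_add1 pg_add2 pg_move pg_left pg_right fg gf in simp_all)
 have "strict_morita_context R R ?U ?U' f g"
  unfolding strict_morita_context_def using U U' f g fg gf by simp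
 then show thesis by (rule that)
qed

end

section \<open>From a Frobenius pair to a dual system\<close>

lemma additive_tensor_copy:
 fixes A :: "('s, 'r, 'u::infinite) bimodule"
 assumes A: "is_bimodule S R A"
 shows "additive_functor R (copy_functor R A)"
 unfolding additive_functor_def
proof (intro allI ballI impI)
 fix M N :: "('r, 'u) module" and h k y
 assume y: "y \<in>. (on_ob (copy_functor R A) M)" and M: "lmod R M" and N: "lmod R N"
  and h: "h \<in> lhom R M N" and k: "k \<in> lhom R M N"
 let ?F = "copy_functor R A"
 note F = is_functor_copy[OF A]
 note hk = lmod_hom_add[OF N h k]
 show "fmap ?F M N (%x. h x \<oplus>\<^sub>N k x) y = fmap ?F M N h y \<oplus>\<^sub>(on_ob ?F N) fmap ?F M N k y"
 proof (rule tensor_copy_ext[OF A M, where f = "fmap ?F M N (%x. h x \<oplus>\<^sub>N k x)" and Y = "on_ob ?F N"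
   and g = "%y. fmap ?F M N h y \<oplus>\<^sub>(on_ob ?F N) fmap ?F M N k y"])
  show "fmap ?F M N (%x. h x \<oplus>\<^sub>N k x) \<in> add_homs (tc R A M) (on_ob ?F N)"
   using lhomD(1)[OF fmap_hom[OF F M N hk]] by simp
  show "(%y. fmap ?F M N h y \<oplus>\<^sub>(on_ob ?F N) fmap ?F M N k y) \<in> add_homs (tc R A M) (on_ob ?F N)"
   using lhomD(1)[OF lmod_hom_add[OF functor_ob[OF F N] fmap_hom[OF F M N h] fmap_hom[OF F M N k]]] by simp
  fix a m assume am: "a \<in>. A" "m \<in>. M"
  then show "fmap ?F M N (%x. h x \<oplus>\<^sub>N k x) (cp R A M a m) = fmap ?F M N h (cp R A M a m) \<oplus>\<^sub>(on_ob ?F N) fmap ?F M N k (cp R A M a m)"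
   using lhomD(2)[OF h am(2)] lhomD(2)[OF k am(2)]
   by (simp add: fmap_cp[OF A M N] h k hk tensor.add_right[OF tc(1)[OF A N]])
 qed (use y in simp)
qed

lemma additive_comp_functor:
 fixes F :: "('r, 'm, 's, 'n) lmod_functor" and G :: "('s, 'n, 't, 'k) lmod_functor"
 assumes F: "lfunctor R S F" "additive_functor R F"
  and G: "lfunctor S T G" "additive_functor S G"
 shows "additive_functor R (comp_functor G F)"
 unfolding additive_functor_def
proof (intro allI ballI impI)
 fix M N :: "('r, 'm) module" and h k y
 assume y: "y \<in>. (on_ob (comp_functor G F) M)" and M: "lmod R M" and N: "lmod R N"
  and h: "h \<in> lhom R M N" and k: "k \<in> lhom R M N"
 have "fmap G (on_ob F M) (on_ob F N) (fmap F M N (%x. h x \<oplus>\<^sub>N k x)) =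
   fmap G (on_ob F M) (on_ob F N) (%x. fmap F M N h x \<oplus>\<^sub>(on_ob F N) fmap F M N k x)"
  by (rule fmap_cong) (rule F(2)[unfolded additive_functor_def, rule_format, OF _ M N h k])
 moreover have y': "y \<in>. (on_ob G (on_ob F M))" using y by simp
 ultimately show "fmap (comp_functor G F) M N (%x. h x \<oplus>\<^sub>N k x) y =
   fmap (comp_functor G F) M N h y \<oplus>\<^sub>(on_ob (comp_functor G F) N) fmap (comp_functor G F) M N k y"
  unfolding fmap_comp_functor_eq[OF F(1) G(1) M N h] fmap_comp_functor_eq[OF F(1) G(1) M N k]
   fmap_comp_functor_eq[OF F(1) G(1) M N lmod_hom_add[OF N h k]] comp_functor_simps
  by (simp only: G(2)[unfolded additive_functor_def, rule_format, OF y' functor_ob[OF F(1) M] functor_ob[OF F(1) N] fmap_hom[OF F(1) M N h] fmap_hom[OF F(1) M N k]])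
qed

lemma tensor_copy_span:
 fixes A :: "('s, 'r, 'u::infinite) bimodule" and M :: "('r, 'u) module" and D :: "'j => ('r, 'u) module"
 assumes A: "is_bimodule S R A" and M: "lmod R M"
  and D: "!!j. j \<in> I ==> lmod R (D j)" "!!j. j \<in> I ==> f j \<in> lhom R (D j) M"
  and span: "spans M (\<Union>j\<in>I. f j ` carrier (D j))"
 shows "spans (tc R A M) (\<Union>j\<in>I. fmap (copy_functor R A) (D j) M (f j) ` carrier (tc R A (D j)))" (is "spans _ ?Y")
proof -
 let ?F = "copy_functor R A"
 note F = is_functor_copy[OF A] and TD = lmodD[OF tc(2)[OF A M]]
 interpret T: tensor R "rpart A" M "tc R A M" "cp R A M" by (rule tc(1)[OF A M])
 have Y: "?Y \<subseteq> carrier (tc R A M)"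
 proof (intro UN_least image_subsetI)
  fix j x assume j: "j \<in> I" and x: "x \<in>. (tc R A (D j))"
  show "fmap ?F (D j) M (f j) x \<in>. (tc R A M)"
   using lhomD(2)[OF fmap_hom[OF F D(1)[OF j] M D(2)[OF j]]] x by simp
 qed
 have "\<exists>ys. set ys \<subseteq> ?Y \<and> y = lsum (tc R A M) (%x. x) ys" if "y \<in>. (tc R A M)" for y
  using that
 proof (induction y rule: T.induct)
  case (pure a m)
  then have a: "a \<in>. A" by simp
  obtain ms where ms: "set ms \<subseteq> (\<Union>j\<in>I. f j ` carrier (D j))" "m = lsum M (%x. x) ms"
   using span pure(2) unfolding spans_def by blast
  have msM: "x \<in>. M" if "x \<in> set ms" for x using ms(1) that span unfolding spans_def by blast
  have "cp R A M a x \<in> ?Y" if x: "x \<in> set ms" for x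
  proof -
   obtain j d where j: "j \<in> I" "d \<in>. (D j)" "x = f j d" using subsetD[OF ms(1) x] by (elim UN_E imageE)
   have "cp R A M a x = fmap ?F (D j) M (f j) (cp R A (D j) a d)"
   using fmap_cp[OF A D(1)[OF j(1)] M D(2)[OF j(1)] a j(2)] by (simp add: j(3))
   moreover have "cp R A (D j) a d \<in>. (tc R A (D j))" using tensor.closed[OF tc(1)[OF A D(1)[OF j(1)]]] a j(2) by simp
   ultimately show ?thesis by (intro UN_I[OF j(1)] image_eqI)
  qed
  then have "set (map (cp R A M a) ms) \<subseteq> ?Y" unfolding set_map by (intro image_subsetI)
  moreover have "cp R A M a m = lsum (tc R A M) (%x. x) (map (cp R A M a) ms)"
   unfolding ms(2) lsum_map using a msM by (intro T.lsum_right) simp_all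
  ultimately show ?case by (intro exI conjI)
 next
  case (add x y)
  obtain xs where xs: "set xs \<subseteq> ?Y" "x = lsum (tc R A M) (%x. x) xs" using add.IH(1) by (elim exE conjE)
  obtain ys where ys: "set ys \<subseteq> ?Y" "y = lsum (tc R A M) (%x. x) ys" using add.IH(2) by (elim exE conjE)
  have sub: "set (xs @ ys) \<subseteq> ?Y" using xs(1) ys(1) by (simp only: set_append Un_least)
  have "x \<oplus>\<^sub>(tc R A M) y = lsum (tc R A M) (%x. x) (xs @ ys)"
   unfolding xs(2) ys(2) using subsetD[OF Y subsetD[OF sub]] by (subst lsum_append[OF TD(2)]) simp_all
  with sub show ?case by (intro exI[of _ "xs @ ys"] conjI)
 qed
 with Y show ?thesis unfolding spans_def by (intro conjI ballI)
qed

context ring_extension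
begin

abbreviation "SM \<equiv> restrict_lmod i (left_regular S)"

lemma SM: "lmod R SM"
 by (rule restrict_module[OF left_regular[OF S]])

lemma right_mult_hom: "t \<in>. S ==> (%s. s \<otimes>\<^sub>S t) \<in> lhom S (left_regular S) (left_regular S)"
 using scalar_hom[OF left_regular[OF S]] by simp

text \<open>The element is the value at \<open>1\<close> of the map \<open>S \<rightarrow> K(S)\<close> adjoint to the identity. Maps \<open>S \<rightarrow> K(N)\<close> correspond to elements of \<open>K(N)\<close> and, by adjunction, to maps \<open>S \<rightarrow> N\<close>.\<close>

lemma universal_element:
 fixes K :: "('u, 'u, 'u, 'u) lmod_functor"
 assumes adj: "adjoint (lmod_cat S) (lmod_cat R) (restriction_functor i) K"
 obtains z where "z \<in>. (on_ob K SM)"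
  "\<forall>N y. lmod R N \<longrightarrow> y \<in>. (on_ob K N) \<longrightarrow> (\<exists>h\<in>lhom R SM N. fmap K SM N h z = y)"
  "\<forall>N h k. lmod R N \<longrightarrow> h \<in> lhom R SM N \<longrightarrow> k \<in> lhom R SM N \<longrightarrow>
   fmap K SM N h z = fmap K SM N k z \<longrightarrow> (\<forall>s\<in>carrier S. h s = k s)"
  "\<forall>t\<in>carrier S. fmap K SM SM (%s. s \<otimes>\<^sub>S t) z = t \<odot>\<^sub>(on_ob K SM) z"
proof -
 let ?C = "lmod_cat S :: (('u, 'u) module, ('u, 'u) lmod_arrow) category"
 let ?D = "lmod_cat R :: (('u, 'u) module, ('u, 'u) lmod_arrow) category"
 let ?G = "restriction_functor i" and ?L = "left_regular S"
 have K: "is_functor ?D ?C K" using adj by (simp add: adjoint_def)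
 obtain \<phi> where bij: "\<forall>A\<in>Ob ?C. \<forall>B\<in>Ob ?D. bij_betw (\<phi> A B) (Hom ?D (on_ob ?G A) B) (Hom ?C A (on_ob K B))"
  and nat1: "\<forall>f\<in>Ar ?C. \<forall>B\<in>Ob ?D. \<forall>h\<in>Hom ?D (on_ob ?G (Cod ?C f)) B.
   \<phi> (Dom ?C f) B (Comp ?D h (on_ar ?G f)) = Comp ?C (\<phi> (Cod ?C f) B h) f"
  and nat2: "\<forall>A\<in>Ob ?C. \<forall>g\<in>Ar ?D. \<forall>h\<in>Hom ?D (on_ob ?G A) (Dom ?D g).
   \<phi> A (Cod ?D g) (Comp ?D g h) = Comp ?C (on_ar K g) (\<phi> A (Dom ?D g) h)"
  using adj unfolding adjoint_def by (elim conjE exE)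
 note L = left_regular[OF S]
 note bijL = bij[rule_format, of ?L, simplified, OF L]
 define idS where "idS = (SM, \<lambda>x\<in>carrier S. x, SM)"
 have id: "idS \<in> Hom ?D SM SM"
  using SM lhom_restrict[OF lmod_hom_id SM] by (simp add: idS_def Hom_lmod_cat)
 then have "\<phi> ?L SM idS \<in> Hom ?C ?L (on_ob K SM)" using bijL[OF SM] by (auto simp: bij_betw_def)
 then obtain e where e: "\<phi> ?L SM idS = (?L, e, on_ob K SM)" "e \<in> lhom S ?L (on_ob K SM)"
  unfolding Hom_lmod_cat by (elim exE conjE)
 define z where "z = e \<one>\<^sub>S"
 have z: "z \<in>. (on_ob K SM)" using lhomD(2)[OF e(2)] SS by (simp add: z_def)
 have ez: "e s = s \<odot>\<^sub>(on_ob K SM) z" if "s \<in>. S" for s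
  unfolding z_def by (rule left_regular_hom[OF S e(2) that])
 have \<phi>: "\<phi> ?L N (SM, restrict h (carrier S), N) = (?L, \<lambda>s\<in>carrier S. s \<odot>\<^sub>(on_ob K N) fmap K SM N h z, on_ob K N)"
  and ar: "(SM, restrict h (carrier S), N) \<in> Hom ?D SM N"
  if N: "lmod R N" and h: "h \<in> lhom R SM N" for N :: "('u, 'u) module" and h
 proof -
  let ?g = "(SM, restrict h (carrier S), N)"
  have g: "?g \<in> Ar ?D" using SM N lhom_restrict[OF h SM] by simp
  then show "?g \<in> Hom ?D SM N" by (simp add: Hom_lmod_cat)
  have "Comp ?D ?g idS = ?g" by (simp add: idS_def compose_def restrict_def fun_eq_iff)
  then have "\<phi> ?L N ?g = Comp ?C (on_ar K ?g) (?L, e, on_ob K SM)"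
   using nat2[rule_format, of ?L ?g idS] g L id e(1) by simp
  also have "on_ar K ?g = (on_ob K SM, fmap K SM N h, on_ob K N)"
   using fmap_comp_functor(1)[OF K SM N h] by simp
  finally show "\<phi> ?L N ?g = (?L, \<lambda>s\<in>carrier S. s \<odot>\<^sub>(on_ob K N) fmap K SM N h z, on_ob K N)"
   using ez lhomD(4)[OF fmap_hom[OF K SM N h]] z by (simp add: compose_def restrict_def fun_eq_iff)
 qed
 have fmapK: "fmap K SM N h z \<in>. (on_ob K N)" if "lmod R N" "h \<in> lhom R SM N" for N :: "('u, 'u) module" and h
  using lhomD(2)[OF fmap_hom[OF K SM that] z] .
 show thesis
 proof (rule that[OF z], intro allI impI)
  fix N :: "('u, 'u) module" and y assume N: "lmod R N" and y: "y \<in>. (on_ob K N)"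
  note KN = functor_ob[OF K N]
  have "(?L, \<lambda>s\<in>carrier ?L. s \<odot>\<^sub>(on_ob K N) y, on_ob K N) \<in> Hom ?C ?L (on_ob K N)"
   using lhom_restrict[OF scalar_hom[OF KN y] L] L KN by (simp add: Hom_lmod_cat)
  then have "(?L, \<lambda>s\<in>carrier ?L. s \<odot>\<^sub>(on_ob K N) y, on_ob K N) \<in> \<phi> ?L N ` Hom ?D SM N"
   using bijL[OF N] by (simp add: bij_betw_def)
  then obtain g where g: "g \<in> Hom ?D SM N" "\<phi> ?L N g = (?L, \<lambda>s\<in>carrier S. s \<odot>\<^sub>(on_ob K N) y, on_ob K N)"
   by (elim imageE) simp
  from g(1) obtain h where h: "g = (SM, h, N)" "h \<in> lhom R SM N" "h \<in> extensional (carrier SM)"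
   unfolding Hom_lmod_cat by (elim exE conjE)
  have "restrict h (carrier S) = h" using h(3) by (simp add: extensional_restrict)
  then have "(\<lambda>s\<in>carrier S. s \<odot>\<^sub>(on_ob K N) fmap K SM N h z) = (\<lambda>s\<in>carrier S. s \<odot>\<^sub>(on_ob K N) y)"
   using \<phi>[OF N h(2)] g(2) by (simp add: h(1))
  from fun_cong[OF this, of "\<one>\<^sub>S"] have "fmap K SM N h z = y"
   using SS lmodD(7)[OF KN] y fmapK[OF N h(2)] by simp
  with h(2) show "\<exists>h\<in>lhom R SM N. fmap K SM N h z = y" by (intro bexI)
 next
  show "\<forall>N h k. lmod R N \<longrightarrow> h \<in> lhom R SM N \<longrightarrow> k \<in> lhom R SM N \<longrightarrow>
   fmap K SM N h z = fmap K SM N k z \<longrightarrow> (\<forall>s\<in>carrier S. h s = k s)"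
  proof (intro allI impI ballI)
   fix N :: "('u, 'u) module" and h k s
   assume N: "lmod R N" and h: "h \<in> lhom R SM N" and k: "k \<in> lhom R SM N"
   and eq: "fmap K SM N h z = fmap K SM N k z" and s: "s \<in>. S"
   have "\<phi> ?L N (SM, restrict h (carrier S), N) = \<phi> ?L N (SM, restrict k (carrier S), N)"
   unfolding \<phi>[OF N h] \<phi>[OF N k] eq ..
   then have "(SM, restrict h (carrier S), N) = (SM, restrict k (carrier S), N)"
   using inj_onD[OF bij_betw_imp_inj_on[OF bijL[OF N]] _ ar[OF N h] ar[OF N k]] by simp
   then have "restrict h (carrier S) = restrict k (carrier S)" by simp
   from fun_cong[OF this, of s] s show "h s = k s" by simp
  qed
  show "\<forall>t\<in>carrier S. fmap K SM SM (%s. s \<otimes>\<^sub>S t) z = t \<odot>\<^sub>(on_ob K SM) z"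
  proof
   fix t assume t: "t \<in>. S"
   let ?r = "\<lambda>s\<in>carrier S. s \<otimes>\<^sub>S t"
   have r: "(%s. s \<otimes>\<^sub>S t) \<in> lhom R SM SM" by (rule restrict_lmod_hom[OF i right_mult_hom[OF t]])
   have f: "(?L, ?r, ?L) \<in> Ar ?C" using lhom_restrict[OF right_mult_hom[OF t] L] L by simp
   have "on_ar ?G (?L, ?r, ?L) = (SM, ?r, SM)" by (simp add: restriction_functor_def)
   moreover have "Comp ?D idS (SM, ?r, SM) = (SM, ?r, SM)"
   using t SS by (simp add: idS_def compose_def restrict_def fun_eq_iff)
   ultimately have "\<phi> ?L SM (SM, ?r, SM) = Comp ?C (?L, e, on_ob K SM) (?L, ?r, ?L)"
   using bspec[OF bspec[OF bspec[OF nat1 f], of SM], of idS] SM id e(1) by simp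
   then have "(\<lambda>s\<in>carrier S. s \<odot>\<^sub>(on_ob K SM) fmap K SM SM (%s. s \<otimes>\<^sub>S t) z) = compose (carrier S) e ?r"
   using \<phi>[OF SM r] by simp
   from fun_cong[OF this, of "\<one>\<^sub>S"] show "fmap K SM SM (%s. s \<otimes>\<^sub>S t) z = t \<odot>\<^sub>(on_ob K SM) z"
   using SS t ez fmapK[OF SM r] lmodD(7)[OF functor_ob[OF K SM]] by (simp add: compose_def)
  qed
 qed
qed

end

locale frobenius_adjoint = ring_extension R S i + \<alpha>: module_equivalence R \<alpha> \<gamma> \<eta> eps + \<beta>: module_equivalence S \<beta> \<delta> \<eta>' eps'
 for R S :: "'u::infinite ring" and i \<alpha> \<gamma> \<eta> eps \<beta> \<delta> \<eta>' eps' +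
 assumes adj: "adjoint (lmod_cat S) (lmod_cat R) (restriction_functor i) (comp_functor \<beta> (comp_functor (copy_functor R B) \<alpha>))"
begin

abbreviation "RL \<equiv> left_regular R"
abbreviation "SL \<equiv> left_regular S"
abbreviation "FB \<equiv> copy_functor R B"
abbreviation "K \<equiv> comp_functor \<beta> (comp_functor FB \<alpha>)"
abbreviation "U0 \<equiv> on_ob \<alpha> RL"
abbreviation "F0 \<equiv> tc R B U0"
abbreviation "K0 \<equiv> on_ob \<beta> F0"
abbreviation "j u \<equiv> cp R B U0 \<one>\<^sub>S u"
abbreviation "Ub \<equiv> functor_bimod R \<alpha>"
abbreviation "Vb \<equiv> functor_bimod S \<beta>"
abbreviation "vt \<equiv> vu R i Vb Ub"

lemmas RL = left_regular[OF R] and SL = left_regular[OF S]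
lemmas U0 = functor_ob[OF \<alpha>.\<alpha> RL]
lemmas F0 = tc(2)[OF B U0]
lemmas K0 = functor_ob[OF \<beta>.\<alpha> F0]
lemmas U0D = lmodD[OF U0] and F0D = lmodD[OF F0] and K0D = lmodD[OF K0]

lemma K: "lfunctor R S K"
 by (rule is_functor_comp[OF is_functor_comp[OF \<alpha>.\<alpha> F] \<beta>.\<alpha>])

sublocale KK: additive_lmod_functor R S K
 by (rule additive_lmod_functor.intro[OF R K additive_comp_functor[OF is_functor_comp[OF \<alpha>.\<alpha> F]
   additive_comp_functor[OF \<alpha>.\<alpha> \<alpha>.additive F additive_tensor_copy[OF B]] \<beta>.\<alpha> \<beta>.additive]])

lemma fmap_K: "lmod R M ==> lmod R N ==> h \<in> lhom R M N ==>
  fmap K M N h = fmap \<beta> (tc R B (on_ob \<alpha> M)) (tc R B (on_ob \<alpha> N)) (fmap FB (on_ob \<alpha> M) (on_ob \<alpha> N) (fmap \<alpha> M N h))"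
 using fmap_comp_functor_eq[OF is_functor_comp[OF \<alpha>.\<alpha> F] \<beta>.\<alpha>] fmap_comp_functor_eq[OF \<alpha>.\<alpha> F] by simp

lemma K_span:
 assumes M: "lmod R M" and y: "y \<in>. (on_ob K M)"
 obtains es where "set es \<subseteq> carrier K0 \<times> carrier M" "y = lsum (on_ob K M) (%e. watts R K M (fst e) (snd e)) es"
proof -
 note s = scalar_hom[OF M]
 note \<alpha>s = fmap_hom[OF \<alpha>.\<alpha> RL M s]
 have F\<alpha>s: "fmap FB U0 (on_ob \<alpha> M) (fmap \<alpha> RL M (%r. r \<odot>\<^sub>M m)) \<in> lhom S F0 (tc R B (on_ob \<alpha> M))" if "m \<in>. M" for m
  using fmap_hom[OF F U0 functor_ob[OF \<alpha>.\<alpha> M] \<alpha>s[OF that]] by simp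
 note s1 = \<alpha>.span_image[OF M RL s spans_scalar[OF M]]
 note s2 = tensor_copy_span[OF B functor_ob[OF \<alpha>.\<alpha> M] U0 \<alpha>s s1]
 note s3 = \<beta>.span_image[OF tc(2)[OF B functor_ob[OF \<alpha>.\<alpha> M]] F0 F\<alpha>s s2]
 have y': "y \<in> carrier (on_ob \<beta> (tc R B (on_ob \<alpha> M)))" using y by simp
 obtain es where es: "set es \<subseteq> carrier K0 \<times> carrier M"
  "y = lsum (on_ob \<beta> (tc R B (on_ob \<alpha> M))) (%e. fmap \<beta> F0 (tc R B (on_ob \<alpha> M)) (fmap FB U0 (on_ob \<alpha> M) (fmap \<alpha> RL M (%r. r \<odot>\<^sub>M snd e))) (fst e)) es"
  by (rule spans_pairs[OF s3 y'])
 have "y = lsum (on_ob \<beta> (tc R B (on_ob \<alpha> M))) (%e. watts R K M (fst e) (snd e)) es"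
  unfolding es(2)
 proof (rule lsum_cong[OF refl])
  fix e assume "e \<in> set es"
  then have "snd e \<in>. M" using es(1) by auto
  then show "fmap \<beta> F0 (tc R B (on_ob \<alpha> M)) (fmap FB U0 (on_ob \<alpha> M) (fmap \<alpha> RL M (%r. r \<odot>\<^sub>M snd e))) (fst e) = watts R K M (fst e) (snd e)"
   unfolding watts_def by (simp only: fmap_K[OF RL M s])
 qed
 with es(1) show thesis by (intro that) simp_all
qed

sublocale D: tensor_data R S i Ub Vb
 by (rule tensor_data.intro[OF R S i \<alpha>.A.functor_bimod \<beta>.A.functor_bimod])

lemma j: "u \<in>. U0 ==> j u \<in>. F0" "u \<in>. U0 ==> u' \<in>. U0 ==> j (u \<oplus>\<^sub>U0 u') = j u \<oplus>\<^sub>F0 j u'"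
 "u \<in>. U0 ==> r \<in>. R ==> j (r \<odot>\<^sub>U0 u) = i r \<odot>\<^sub>F0 j u"
 using lhomD[OF unit_hom[OF U0]] by simp_all

text \<open>The map \<open>W \<rightarrow> K(R)\<close> is the Eilenberg--Watts map of \<open>\<beta>\<close> at \<open>S \<otimes> \<alpha>(R)\<close>, restricted to tensors \<open>1 \<otimes> u\<close>.\<close>

definition "tt = tlift (rpart D.VR) Ub D.W vt K0 (%v u. watts S \<beta> F0 v (j u))"

lemma tt: "tt \<in> add_homs D.W K0" "v \<in>. (on_ob \<beta> SL) ==> u \<in>. U0 ==> tt (vt v u) = watts S \<beta> F0 v (j u)"
proof -
 note w = lhomD[OF \<beta>.A.watts_hom[OF F0]]
 have "balanced R (rpart D.VR) Ub K0 (%v u. watts S \<beta> F0 v (j u))"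
  using w j \<beta>.A.watts_add[OF F0] \<beta>.A.watts_move[OF F0] iD by (intro balancedI) simp_all
 from D.T.tlift[OF K0D(2) this, folded tt_def]
 show "tt \<in> add_homs D.W K0" "v \<in>. (on_ob \<beta> SL) ==> u \<in>. U0 ==> tt (vt v u) = watts S \<beta> F0 v (j u)" by simp_all
qed

lemma vt_simps:
 "v \<in>. (on_ob \<beta> SL) ==> u \<in>. U0 ==> vt v u \<in>. D.W"
 "v \<in>. (on_ob \<beta> SL) ==> u \<in>. U0 ==> s \<in>. S ==> s \<odot>\<^sub>D.W vt v u = vt (s \<odot>\<^sub>(on_ob \<beta> SL) v) u"
 "v \<in>. (on_ob \<beta> SL) ==> u \<in>. U0 ==> r \<in>. R ==> vt v u \<triangleleft>\<^sub>D.W r = vt v (watts R \<alpha> RL u r)"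
 "v \<in>. (on_ob \<beta> SL) ==> u \<in>. U0 ==> r \<in>. R ==> vt (watts S \<beta> SL v (i r)) u = vt v (r \<odot>\<^sub>U0 u)"
 using D.T.closed D.WT(3) D.WT(4) D.T.move by simp_all

lemma tt_left: "s \<in>. S ==> w \<in>. D.W ==> tt (s \<odot>\<^sub>D.W w) = s \<odot>\<^sub>K0 tt w"
proof -
 assume s: "s \<in>. S" and w: "w \<in>. D.W"
 from w show ?thesis
 proof (induction w rule: D.T.induct)
  case (pure v u)
  then show ?case using s j lmodD(3)[OF functor_ob[OF \<beta>.\<alpha> SL]]
   by (simp add: vt_simps tt(2) lhomD(4)[OF \<beta>.A.watts_hom[OF F0]])
 next
  case (add x y)
  then show ?case using s D.WL K0D by (simp add: addD[OF tt(1)])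
 qed
qed

lemma K0_bimod: "is_bimodule S R (functor_bimod R K)"
 by (rule KK.functor_bimod)

lemmas KR = bimodule_right[OF K0_bimod, simplified]

lemma tt_right: "r \<in>. R ==> w \<in>. D.W ==> tt (w \<triangleleft>\<^sub>D.W r) = watts R K RL (tt w) r"
proof -
 assume r: "r \<in>. R" and w: "w \<in>. D.W"
 from w show ?thesis
 proof (induction w rule: D.T.induct)
  case (pure v u)
  then have v: "v \<in>. (on_ob \<beta> SL)" and u: "u \<in>. U0" by simp_all
  let ?s = "%x. x \<odot>\<^sub>RL r"
  have s: "?s \<in> lhom R RL RL" using scalar_hom[OF RL] r by simp
  note \<alpha>s = fmap_hom[OF \<alpha>.\<alpha> RL RL s]
  have F\<alpha>s: "fmap FB U0 U0 (fmap \<alpha> RL RL ?s) \<in> lhom S F0 F0" using fmap_hom[OF F U0 U0 \<alpha>s] by simp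
  have ur: "watts R \<alpha> RL u r \<in>. U0" using lhomD(2)[OF \<alpha>.A.watts_hom[OF RL]] u r by simp
  have "tt (vt v u \<triangleleft>\<^sub>D.W r) = watts S \<beta> F0 v (j (fmap \<alpha> RL RL ?s u))"
   using v u r ur by (simp add: vt_simps tt(2) watts_def[of R \<alpha>])
  also have "j (fmap \<alpha> RL RL ?s u) = fmap FB U0 U0 (fmap \<alpha> RL RL ?s) (j u)"
   using fmap_cp[OF B U0 U0 \<alpha>s, of "\<one>\<^sub>S" u] u SS by simp
  also have "watts S \<beta> F0 v ... = fmap \<beta> F0 F0 (fmap FB U0 U0 (fmap \<alpha> RL RL ?s)) (watts S \<beta> F0 v (j u))"
   by (rule \<beta>.A.watts_nat[OF F0 F0 F\<alpha>s j(1)[OF u] v])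
  also have "... = watts R K RL (tt (vt v u)) r"
   unfolding watts_def[of R K] fmap_K[OF RL RL s] tt(2)[OF v u] ..
  finally show ?case .
 next
  case (add x y)
  then show ?case using r D.WR KR addD(1)[OF tt(1)] by (simp add: addD(2)[OF tt(1)])
 qed
qed

text \<open>The left dual basis of \<open>\<alpha>(R)\<close> induces coordinate maps \<open>S \<otimes> \<alpha>(R) \<rightarrow> S\<close>, to which \<open>\<beta>\<close> is applied.\<close>

lemma tt_inverse:
 obtains \<psi> where "\<psi> \<in> add_homs K0 D.W" "\<forall>w\<in>carrier D.W. \<psi> (tt w) = w" "\<forall>y\<in>carrier K0. tt (\<psi> y) = y"
proof -
 interpret T: tensor R "rpart B" U0 F0 "cp R B U0" by (rule tc(1)[OF B U0])
 obtain bs where bs0: "set bs \<subseteq> carrier (on_ob \<gamma> RL) \<times> carrier U0"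
  and bs1: "\<forall>u\<in>carrier U0. lsum U0 (%e. \<alpha>.pf u (fst e) \<odot>\<^sub>U0 snd e) bs = u" by (rule \<alpha>.left_dual_basis)
 have bs: "!!e. e \<in> set bs ==> fst e \<in>. (on_ob \<gamma> RL)" "!!e. e \<in> set bs ==> snd e \<in>. U0" using bs0 by auto
 note pfD = \<alpha>.pfD
 define h where "h q = tlift (rpart B) U0 F0 (cp R B U0) SL (%s u. s \<otimes>\<^sub>S i (\<alpha>.pf u q))" for q
 have h: "h q \<in> lhom S F0 SL \<and> (\<forall>s\<in>carrier S. \<forall>u\<in>carrier U0. h q (cp R B U0 s u) = s \<otimes>\<^sub>S i (\<alpha>.pf u q))"
  if q: "q \<in>. (on_ob \<gamma> RL)" for q
 proof -
  have "balanced R (rpart B) U0 SL (%s u. s \<otimes>\<^sub>S i (\<alpha>.pf u q))"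
   using pfD(2-4)[OF q] iD SS ring_distrib[OF S] by (intro balancedI) simp_all
  note t = T.tlift[OF lmodD(2)[OF SL] this, folded h_def, simplified right_part_simps ring_bimod_simps]
  have "h q (s \<odot>\<^sub>F0 x) = s \<odot>\<^sub>SL h q x" if s: "s \<in>. S" and x: "x \<in>. F0" for s x
   using x
  proof (induction x rule: T.induct)
   case (pure t u)
   then show ?case using s SS iD pfD(2)[OF q] by (simp add: tc(3)[OF B U0] t(2))
  next
   case (add x y)
   then show ?case using s F0D lmodD[OF SL] addD[OF t(1)] by simp
  qed
  then show ?thesis using t by (intro conjI lhomI) simp_all
 qed
 note hh = conjunct1[OF h]
 have hj: "h q (j u) = i (\<alpha>.pf u q)" if "q \<in>. (on_ob \<gamma> RL)" "u \<in>. U0" for q u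
  using h[OF that(1)] that(2) SS iD pfD(2)[OF that] by simp
 note \<beta>h = fmap_hom[OF \<beta>.\<alpha> F0 SL hh[OF bs(1)]]
 define \<psi> where "\<psi> y = lsum D.W (%e. vt (fmap \<beta> F0 SL (h (fst e)) y) (snd e)) bs" for y
 have \<psi>: "\<psi> \<in> add_homs K0 D.W" unfolding \<psi>_def
 proof (rule add_homs_lsum_pointwise[OF _ D.WL(2) K0D(2)])
  fix e assume e: "e \<in> set bs"
  show "(%y. vt (fmap \<beta> F0 SL (h (fst e)) y) (snd e)) \<in> add_homs K0 D.W"
   using vt_simps(1) D.T.add_left[simplified] lhomD[OF \<beta>h[OF e]] bs(2)[OF e] by (intro addI) simp_all
 qed
 have "\<psi> (tt w) = w" if w: "w \<in>. D.W" for w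
 proof (rule D.T.ext[OF add_homs_comp[OF tt(1) \<psi>] _ w, where h' = "%w. w"])
  fix v u assume "v \<in>. (rpart D.VR)" "u \<in>. Ub"
  then have v: "v \<in>. (on_ob \<beta> SL)" and u: "u \<in>. U0" by simp_all
  have "\<psi> (tt (vt v u)) = lsum D.W (%e. vt v (\<alpha>.pf u (fst e) \<odot>\<^sub>U0 snd e)) bs"
   unfolding \<psi>_def tt(2)[OF v u]
  proof (rule lsum_cong[OF refl])
   fix e assume e: "e \<in> set bs"
   have "fmap \<beta> F0 SL (h (fst e)) (watts S \<beta> F0 v (j u)) = watts S \<beta> SL v (i (\<alpha>.pf u (fst e)))"
   using \<beta>.A.watts_nat[OF F0 SL hh[OF bs(1)[OF e]] j(1)[OF u] v] hj[OF bs(1)[OF e] u] by simp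
   then show "vt (fmap \<beta> F0 SL (h (fst e)) (watts S \<beta> F0 v (j u))) (snd e) = vt v (\<alpha>.pf u (fst e) \<odot>\<^sub>U0 snd e)"
   using v u bs[OF e] pfD(2) by (simp add: vt_simps(4))
  qed
  also have "... = vt v (lsum Ub (%e. \<alpha>.pf u (fst e) \<odot>\<^sub>U0 snd e) bs)"
   using v u bs pfD(2) U0D by (subst D.T.lsum_right) simp_all
  finally show "\<psi> (tt (vt v u)) = vt v u" using bs1 u by simp
 qed (simp add: hom_def)
 moreover have "tt (\<psi> y) = y" if y: "y \<in>. K0" for y
 proof -
  have s: "(%t. t \<odot>\<^sub>F0 j (snd e)) \<in> lhom S SL F0" if "e \<in> set bs" for e
   by (rule scalar_hom[OF F0 j(1)[OF bs(2)[OF that]]])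
  note hs = lhom_comp[OF hh[OF bs(1)] s]
  have id: "lsum F0 (%e. h (fst e) x \<odot>\<^sub>F0 j (snd e)) bs = x" if x: "x \<in>. F0" for x
  proof (rule T.ext[OF _ _ x, where h' = "%x. x"])
   show "(%x. lsum F0 (%e. h (fst e) x \<odot>\<^sub>F0 j (snd e)) bs) \<in> add_homs F0 F0"
   by (rule lhomD(1)[OF lmod_hom_lsum[OF F0]]) (use hs in blast)
   fix t u assume "t \<in>. (rpart B)" and u: "u \<in>. U0"
   then have t: "t \<in>. S" by simp
   have "lsum F0 (%e. h (fst e) (cp R B U0 t u) \<odot>\<^sub>F0 j (snd e)) bs = lsum F0 (%e. cp R B U0 t (\<alpha>.pf u (fst e) \<odot>\<^sub>U0 snd e)) bs"
   proof (rule lsum_cong[OF refl])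
   fix e assume e: "e \<in> set bs"
   show "h (fst e) (cp R B U0 t u) \<odot>\<^sub>F0 j (snd e) = cp R B U0 t (\<alpha>.pf u (fst e) \<odot>\<^sub>U0 snd e)"
   using h[OF bs(1)[OF e]] T.move[of t "\<alpha>.pf u (fst e)" "snd e"] t u bs[OF e] pfD(2) SS iD by (simp add: tc(3)[OF B U0])
   qed
   also have "... = cp R B U0 t (lsum U0 (%e. \<alpha>.pf u (fst e) \<odot>\<^sub>U0 snd e) bs)"
   using t u bs pfD(2) U0D by (intro T.lsum_right[symmetric]) simp_all
   finally show "lsum F0 (%e. h (fst e) (cp R B U0 t u) \<odot>\<^sub>F0 j (snd e)) bs = cp R B U0 t u" using bs1 u by simp
  qed (simp add: hom_def)
  have "tt (\<psi> y) = lsum K0 (%e. tt (vt (fmap \<beta> F0 SL (h (fst e)) y) (snd e))) bs"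
   unfolding \<psi>_def using y vt_simps(1) lhomD(2)[OF \<beta>h] bs(2) by (intro add_lsum[OF tt(1) D.WL(2) K0D(2)]) simp
  also have "... = lsum K0 (%e. fmap \<beta> F0 F0 (%x. h (fst e) x \<odot>\<^sub>F0 j (snd e)) y) bs"
  proof (rule lsum_cong[OF refl])
   fix e assume e: "e \<in> set bs"
   show "tt (vt (fmap \<beta> F0 SL (h (fst e)) y) (snd e)) = fmap \<beta> F0 F0 (%x. h (fst e) x \<odot>\<^sub>F0 j (snd e)) y"
   unfolding tt(2)[OF lhomD(2)[OF \<beta>h[OF e] y] bs(2)[OF e]] watts_def
   by (rule fmap_comp[OF \<beta>.\<alpha> F0 SL F0 hh[OF bs(1)[OF e]] s[OF e] y, symmetric])
  qed
  also have "... = fmap \<beta> F0 F0 (%x. lsum F0 (%e. h (fst e) x \<odot>\<^sub>F0 j (snd e)) bs) y"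
   by (rule additive_fmap_lsum[OF \<beta>.\<alpha> \<beta>.additive F0 F0 _ y, symmetric]) (use hs in blast)
  also have "... = y" by (rule fmap_id[OF \<beta>.\<alpha> F0 id y])
  finally show ?thesis .
 qed
 ultimately show thesis using \<psi> by (intro that[of \<psi>] ballI)
qed

text \<open>For \<open>y \<in> K(R)\<close> let \<open>ch y : S \<rightarrow> R\<close> be the map with \<open>K(ch y)(z) = y\<close>. If \<open>z\<close> is expanded as \<open>\<Sum> K(\<rho>\<^sub>j)(x\<^sub>j)\<close> with \<open>\<rho>\<^sub>j r = i(r) s\<^sub>j\<close>, then \<open>\<Sum> ch x\<^sub>j (t) s\<^sub>j = t\<close> because both sides send \<open>z\<close> to \<open>z\<close> under \<open>K\<close>, and applying \<open>K(ch y)\<close> to the expansion gives \<open>\<Sum> x\<^sub>j \<cdot> ch y (s\<^sub>j) = y\<close>.\<close>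

lemma dual_system_exists: "\<exists>ws om. dual_system R S i (VU R i Vb Ub) ws om"
proof -
 obtain z where z: "z \<in>. (on_ob K SM)"
  and ex: "\<forall>N y. lmod R N \<longrightarrow> y \<in>. (on_ob K N) \<longrightarrow> (\<exists>h\<in>lhom R SM N. fmap K SM N h z = y)"
  and uniq: "\<forall>N h k. lmod R N \<longrightarrow> h \<in> lhom R SM N \<longrightarrow> k \<in> lhom R SM N \<longrightarrow>
   fmap K SM N h z = fmap K SM N k z \<longrightarrow> (\<forall>s\<in>carrier S. h s = k s)"
  and zt: "\<forall>t\<in>carrier S. fmap K SM SM (%s. s \<otimes>\<^sub>S t) z = t \<odot>\<^sub>(on_ob K SM) z"
  by (rule universal_element[OF adj])
 note uniq = uniq[rule_format]
 obtain \<psi> where \<psi>: "\<psi> \<in> add_homs K0 D.W" and \<psi>tt: "\<forall>w\<in>carrier D.W. \<psi> (tt w) = w" and tt\<psi>: "\<forall>y\<in>carrier K0. tt (\<psi> y) = y"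
  by (rule tt_inverse)
 obtain es where es0: "set es \<subseteq> carrier K0 \<times> carrier SM" and es1: "z = lsum (on_ob K SM) (%e. watts R K SM (fst e) (snd e)) es"
  by (rule K_span[OF SM z])
 have es: "!!e. e \<in> set es ==> fst e \<in>. K0" "!!e. e \<in> set es ==> snd e \<in>. S" using es0 by auto
 define ch where "ch y = (SOME h. h \<in> lhom R SM RL \<and> fmap K SM RL h z = y)" for y
 have ch0: "ch y \<in> lhom R SM RL \<and> fmap K SM RL (ch y) z = y" if y: "y \<in>. K0" for y
 proof -
  obtain h where "h \<in> lhom R SM RL" "fmap K SM RL h z = y" using ex[rule_format, OF RL, of y] y by auto
  then have "h \<in> lhom R SM RL \<and> fmap K SM RL h z = y" ..
  then show ?thesis unfolding ch_def by (rule someI[where P = "%h. h \<in> lhom R SM RL \<and> fmap K SM RL h z = y"])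
 qed
 note ch1 = conjunct1[OF ch0] and ch2 = conjunct2[OF ch0]
 note chD = lhomD[OF ch1, simplified]
 have ch_add: "ch (y \<oplus>\<^sub>K0 y') s = ch y s \<oplus>\<^sub>R ch y' s" if y: "y \<in>. K0" "y' \<in>. K0" and s: "s \<in>. S" for y y' s
 proof -
  have yy: "y \<oplus>\<^sub>K0 y' \<in>. K0" using y K0D by simp
  have "fmap K SM RL (ch (y \<oplus>\<^sub>K0 y')) z = fmap K SM RL (%x. ch y x \<oplus>\<^sub>RL ch y' x) z"
   using KK.add[unfolded additive_functor_def, rule_format, OF z SM RL ch1[OF y(1)] ch1[OF y(2)]] ch2[OF y(1)] ch2[OF y(2)] ch2[OF yy]
   by simp
  from uniq[OF RL ch1[OF yy] lmod_hom_add[OF RL ch1[OF y(1)] ch1[OF y(2)]] this s] show ?thesis by simp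
 qed
 have ch_left: "ch (t \<odot>\<^sub>K0 y) s = ch y (s \<otimes>\<^sub>S t)" if y: "y \<in>. K0" and t: "t \<in>. S" and s: "s \<in>. S" for y s t
 proof -
  have ty: "t \<odot>\<^sub>K0 y \<in>. K0" using y t K0D by simp
  have r: "(%s. s \<otimes>\<^sub>S t) \<in> lhom R SM SM" by (rule restrict_lmod_hom[OF i right_mult_hom[OF t]])
  have "fmap K SM RL (%s. ch y (s \<otimes>\<^sub>S t)) z = fmap K SM RL (ch y) (t \<odot>\<^sub>(on_ob K SM) z)"
   using fmap_comp[OF K SM SM RL r ch1[OF y] z] bspec[OF zt t] by simp
  also have "... = t \<odot>\<^sub>K0 y" using lhomD(4)[OF fmap_hom[OF K SM RL ch1[OF y]] t z] ch2[OF y] by simp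
  finally have "fmap K SM RL (ch (t \<odot>\<^sub>K0 y)) z = fmap K SM RL (%s. ch y (s \<otimes>\<^sub>S t)) z" using ch2[OF ty] by simp
  from uniq[OF RL ch1[OF ty] lhom_comp[OF r ch1[OF y]] this s] show ?thesis .
 qed
 have ch_right: "ch (watts R K RL y r) s = ch y s \<otimes>\<^sub>R r" if y: "y \<in>. K0" and r: "r \<in>. R" and s: "s \<in>. S" for y s r
 proof -
  have yr: "watts R K RL y r \<in>. K0" using KR y r by simp
  have m: "(%x. x \<odot>\<^sub>RL r) \<in> lhom R RL RL" using scalar_hom[OF RL] r by simp
  have "fmap K SM RL (%s. ch y s \<odot>\<^sub>RL r) z = watts R K RL y r"
   using fmap_comp[OF K SM RL RL ch1[OF y] m z] ch2[OF y] by (simp add: watts_def)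
  then have "fmap K SM RL (ch (watts R K RL y r)) z = fmap K SM RL (%s. ch y s \<odot>\<^sub>RL r) z" using ch2[OF yr] by simp
  from uniq[OF RL ch1[OF yr] lhom_comp[OF ch1[OF y] m] this s] show ?thesis by simp
 qed
 have wz: "watts R K SM (fst e) (snd e) \<in>. (on_ob K SM)" if "e \<in> set es" for e
  using lhomD(2)[OF KK.watts_hom[OF SM]] es[OF that] by simp
 have sum_S: "lsum S (%e. i (ch (fst e) t) \<otimes>\<^sub>S snd e) es = t" if t: "t \<in>. S" for t
 proof -
  have s: "(%r. r \<odot>\<^sub>SM snd e) \<in> lhom R RL SM" if "e \<in> set es" for e using scalar_hom[OF SM] es(2)[OF that] by simp
  note sc = lhom_comp[OF ch1[OF es(1)] s]
  have sc': "\<forall>e\<in>set es. (%t. ch (fst e) t \<odot>\<^sub>SM snd e) \<in> lhom R SM SM" using sc by blast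
  have "fmap K SM SM (%t. lsum SM (%e. ch (fst e) t \<odot>\<^sub>SM snd e) es) z =
   lsum (on_ob K SM) (%e. fmap K SM SM (%t. ch (fst e) t \<odot>\<^sub>SM snd e) z) es"
   by (rule additive_fmap_lsum[OF K KK.add SM SM sc' z])
  also have "... = z"
  proof -
   have "fmap K SM SM (%t. ch (fst e) t \<odot>\<^sub>SM snd e) z = watts R K SM (fst e) (snd e)" if e: "e \<in> set es" for e
   unfolding fmap_comp[OF K SM RL SM ch1[OF es(1)[OF e]] s[OF e] z] ch2[OF es(1)[OF e]] watts_def ..
   then have "lsum (on_ob K SM) (%e. fmap K SM SM (%t. ch (fst e) t \<odot>\<^sub>SM snd e) z) es = lsum (on_ob K SM) (%e. watts R K SM (fst e) (snd e)) es"
   by (intro lsum_cong[OF refl])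
   then show ?thesis using es1 by simp
  qed
  also have "z = fmap K SM SM (%x. x) z" using fmap_id[OF K SM _ z, of "%x. x"] by simp
  finally have "lsum SM (%e. ch (fst e) t \<odot>\<^sub>SM snd e) es = t"
   by (rule uniq[OF SM lmod_hom_lsum[OF SM sc'] lmod_hom_id _ t])
  moreover have "lsum SM f es = lsum S f es" for f :: "_ => 'u" by (induction es) auto
  ultimately show ?thesis by simp
 qed
 have sum_K: "lsum K0 (%e. watts R K RL (fst e) (ch y (snd e))) es = y" if y: "y \<in>. K0" for y
 proof -
  have "y = fmap K SM RL (ch y) (lsum (on_ob K SM) (%e. watts R K SM (fst e) (snd e)) es)" using ch2[OF y] es1 by simp
  also have "... = lsum (on_ob K RL) (%e. fmap K SM RL (ch y) (watts R K SM (fst e) (snd e))) es"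
   using wz by (intro add_lsum[OF lhomD(1)[OF fmap_hom[OF K SM RL ch1[OF y]]] lmodD(2)[OF functor_ob[OF K SM]] lmodD(2)[OF functor_ob[OF K RL]]])
  also have "... = lsum (on_ob K RL) (%e. watts R K RL (fst e) (ch y (snd e))) es"
   by (rule lsum_cong[OF refl], rule KK.watts_nat[OF SM RL ch1[OF y], symmetric]) (use es in simp_all)
  finally show ?thesis by simp
 qed
 note ttc = addD(1)[OF tt(1)]
 define om where "om w = ch (tt w) \<one>\<^sub>S" for w
 have om_left: "om (s \<odot>\<^sub>D.W w) = ch (tt w) s" if "s \<in>. S" "w \<in>. D.W" for s w
  unfolding om_def using that ttc SS by (simp add: tt_left ch_left)
 have \<psi>c: "\<psi> (fst e) \<in>. D.W" if "e \<in> set es" for e using addD(1)[OF \<psi> es(1)[OF that]] .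
 have "dual_system R S i D.W (map (%e. (\<psi> (fst e), snd e)) es) om"
  unfolding dual_system_def
 proof (intro conjI ballI)
  show "set (map (%e. (\<psi> (fst e), snd e)) es) \<subseteq> carrier D.W \<times> carrier S" using \<psi>c es(2) by auto
  show "om \<in> bimod_hom R R (restrict_bimod i (%r. r) D.W) (regular R)"
  proof (rule D.omega_homI)
   show "om w \<in>. R" if "w \<in>. D.W" for w unfolding om_def using chD(2)[OF ttc[OF that]] SS by simp
   show "om (w \<oplus>\<^sub>D.W w') = om w \<oplus>\<^sub>R om w'" if "w \<in>. D.W" "w' \<in>. D.W" for w w'
   unfolding om_def using that ttc SS by (simp add: addD(2)[OF tt(1)] ch_add)
   show "om (i r \<odot>\<^sub>D.W w) = r \<otimes>\<^sub>R om w" if "r \<in>. R" "w \<in>. D.W" for r w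
   using om_left[of "i r" w] chD(4)[OF ttc[OF that(2)] that(1), of "\<one>\<^sub>S"] that iD SS by (simp add: om_def)
   show "om (w \<triangleleft>\<^sub>D.W r) = om w \<otimes>\<^sub>R r" if "r \<in>. R" "w \<in>. D.W" for r w
   unfolding om_def using that ttc SS by (simp add: tt_right ch_right)
  qed
  show "lsum S (%p. i (om (t \<odot>\<^sub>D.W fst p)) \<otimes>\<^sub>S snd p) (map (%e. (\<psi> (fst e), snd e)) es) = t" if t: "t \<in>. S" for t
   using sum_S[OF t] t \<psi>c es(1) tt\<psi> by (simp add: lsum_map om_left cong: lsum_cong)
  show "lsum D.W (%p. fst p \<triangleleft>\<^sub>D.W om (snd p \<odot>\<^sub>D.W w)) (map (%e. (\<psi> (fst e), snd e)) es) = w" (is "?L = w") if w: "w \<in>. D.W" for w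
  proof -
   have c: "\<psi> (fst e) \<triangleleft>\<^sub>D.W ch (tt w) (snd e) \<in>. D.W" if "e \<in> set es" for e
   using D.WR(3) \<psi>c[OF that] chD(2)[OF ttc[OF w]] es(2)[OF that] by simp
   have L: "?L = lsum D.W (%e. \<psi> (fst e) \<triangleleft>\<^sub>D.W ch (tt w) (snd e)) es"
   using w es(2) by (simp add: lsum_map om_left cong: lsum_cong)
   have "tt ?L = lsum K0 (%e. tt (\<psi> (fst e) \<triangleleft>\<^sub>D.W ch (tt w) (snd e))) es"
   unfolding L by (rule add_lsum[OF tt(1) D.WL(2) K0D(2) c])
   also have "... = lsum K0 (%e. watts R K RL (fst e) (ch (tt w) (snd e))) es"
   using \<psi>c chD(2)[OF ttc[OF w]] es tt\<psi> by (intro lsum_cong) (simp_all add: tt_right)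
   also have "... = tt w" by (rule sum_K[OF ttc[OF w]])
   finally have "\<psi> (tt ?L) = \<psi> (tt w)" by simp
   moreover have "?L \<in>. D.W" unfolding L using c D.WL(2) by simp
   ultimately show ?thesis using \<psi>tt w by simp
  qed
 qed
 then show ?thesis by (intro exI)
qed

end

section \<open>Frobenius pairs of the second kind and the six conditions\<close>

theorem theorem2p7:
  fixes R S :: "('u::infinite) ring" and i :: "'u \<Rightarrow> 'u"
  assumes "ring R" and "ring S" and "i \<in> ring_hom R S"
  shows
    "(frobenius_pair_second_kind (lmod_cat R) (lmod_cat S)
        (induction_functor R S i) (restriction_functor i)
      \<longleftrightarrow>
      (\<exists>(U :: ('u, 'u, 'u) bimodule) (U' :: ('u, 'u, 'u) bimodule) f f'
         (V :: ('u, 'u, 'u) bimodule) (V' :: ('u, 'u, 'u) bimodule) g g'.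
         strict_morita_context R R U U' f f' \<and> strict_morita_context S S V V' g g' \<and>
         (condition_i R S i U V \<or> condition_ii R S i U V \<or> condition_iii R S i U V \<or>
          condition_iv R S i U V \<or> condition_v R S i U V \<or> condition_vi R S i U V)))
     \<and>
     (\<forall>(U :: ('u, 'u, 'u) bimodule) (U' :: ('u, 'u, 'u) bimodule) f f'
        (V :: ('u, 'u, 'u) bimodule) (V' :: ('u, 'u, 'u) bimodule) g g'.
        strict_morita_context R R U U' f f' \<longrightarrow> strict_morita_context S S V V' g g' \<longrightarrow>
        (condition_i R S i U V \<longleftrightarrow> condition_ii R S i U V) \<and>
        (condition_ii R S i U V \<longleftrightarrow> condition_iii R S i U V) \<and>
        (condition_iii R S i U V \<longleftrightarrow> condition_iv R S i U V) \<and>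
        (condition_iv R S i U V \<longleftrightarrow> condition_v R S i U V) \<and>
        (condition_v R S i U V \<longleftrightarrow> condition_vi R S i U V))"
proof -
 interpret E: ring_extension R S i by (rule ring_extension.intro[OF assms])
 let ?dual = "%U V :: ('u, 'u, 'u) bimodule. \<exists>ws om. dual_system R S i (VU R i V U) ws om"
 have conds: "condition_i R S i U V = ?dual U V" "condition_ii R S i U V = ?dual U V" "condition_iii R S i U V = ?dual U V"
  "condition_iv R S i U V = ?dual U V" "condition_v R S i U V = ?dual U V" "condition_vi R S i U V = ?dual U V"
  if c: "strict_morita_context R R U U' f f'" "strict_morita_context S S V V' g g'"
  for U U' V V' :: "('u, 'u, 'u) bimodule" and f f' g g'
 proof -
  have "is_bimodule R R U" "is_bimodule S S V" using c by (simp_all add: strict_morita_context_def)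
  note D = tensor_data.intro[OF assms this]
  show "condition_i R S i U V = ?dual U V" "condition_ii R S i U V = ?dual U V" "condition_iii R S i U V = ?dual U V"
   "condition_iv R S i U V = ?dual U V" "condition_v R S i U V = ?dual U V" "condition_vi R S i U V = ?dual U V"
   by (rule condition_i_iff[OF D] condition_ii_iff[OF D] condition_iii_iff[OF D]
   condition_iv_iff[OF D c] condition_v_iff[OF D] condition_vi_iff[OF D])+
 qed
 have "frobenius_pair_second_kind (lmod_cat R) (lmod_cat S) (induction_functor R S i) (restriction_functor i)" (is ?frob)
  if c: "strict_morita_context R R U U' f f'" "strict_morita_context S S V V' g g'" and d: "?dual U V"
  for U U' V V' :: "('u, 'u, 'u) bimodule" and f f' g g'
 proof -
  obtain ws om where "dual_system R S i (VU R i V U) ws om" using d by (elim exE)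
  then have "frobenius_data R S i U U' V V' f f' g g' ws om"
   using c by (intro frobenius_data.intro E.ring_extension_axioms morita.intro frobenius_data_axioms.intro)
  then show ?frob by (rule frobenius_data.frobenius_pair)
 qed
 note from_dual = this
 have to_dual: "\<exists>(U :: ('u, 'u, 'u) bimodule) (U' :: ('u, 'u, 'u) bimodule) f f' (V :: ('u, 'u, 'u) bimodule) (V' :: ('u, 'u, 'u) bimodule) g g'.
   strict_morita_context R R U U' f f' \<and> strict_morita_context S S V V' g g' \<and> ?dual U V" if f: ?frob
 proof -
  obtain \<alpha> \<beta> :: "('u, 'u, 'u, 'u) lmod_functor" where \<alpha>: "is_equivalence (lmod_cat R) (lmod_cat R) \<alpha>" and \<beta>: "is_equivalence (lmod_cat S) (lmod_cat S) \<beta>"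
   and "adjoint (lmod_cat R) (lmod_cat S) (copy_functor R E.B) (restriction_functor i)"
   and adj: "adjoint (lmod_cat S) (lmod_cat R) (restriction_functor i) (comp_functor \<beta> (comp_functor (copy_functor R E.B) \<alpha>))"
   using f unfolding frobenius_pair_second_kind_def E.induction_functor_eq by (elim exE conjE)
  obtain \<gamma> \<eta> eps where A: "module_equivalence R \<alpha> \<gamma> \<eta> eps" using module_equivalence_exists[OF assms(1) \<alpha>] by (elim exE)
  obtain \<delta> \<eta>' eps' where C: "module_equivalence S \<beta> \<delta> \<eta>' eps'" using module_equivalence_exists[OF assms(2) \<beta>] by (elim exE)
  have "frobenius_adjoint R S i \<alpha> \<gamma> \<eta> eps \<beta> \<delta> \<eta>' eps'"
   by (rule frobenius_adjoint.intro[OF E.ring_extension_axioms A C frobenius_adjoint_axioms.intro[OF adj]])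
  note d = frobenius_adjoint.dual_system_exists[OF this]
  obtain f f' where c: "strict_morita_context R R (functor_bimod R \<alpha>) (functor_bimod R \<gamma>) f f'"
   by (rule module_equivalence.morita_context[OF A])
  obtain g g' where c': "strict_morita_context S S (functor_bimod S \<beta>) (functor_bimod S \<delta>) g g'"
   by (rule module_equivalence.morita_context[OF C])
  show ?thesis by ((rule exI)+, intro conjI, rule c, rule c', rule d)
 qed
 show ?thesis
 proof (intro conjI allI impI iffI)
  assume ?frob
  from to_dual[OF this] show "\<exists>(U :: ('u, 'u, 'u) bimodule) (U' :: ('u, 'u, 'u) bimodule) f f'
   (V :: ('u, 'u, 'u) bimodule) (V' :: ('u, 'u, 'u) bimodule) g g'.
   strict_morita_context R R U U' f f' \<and> strict_morita_context S S V V' g g' \<and>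
   (condition_i R S i U V \<or> condition_ii R S i U V \<or> condition_iii R S i U V \<or>
   condition_iv R S i U V \<or> condition_v R S i U V \<or> condition_vi R S i U V)"
   by (elim ex_forward) (elim conjE, intro conjI, assumption, assumption, rule disjI1, subst conds(1), assumption, assumption, assumption)
 next
  assume "\<exists>(U :: ('u, 'u, 'u) bimodule) (U' :: ('u, 'u, 'u) bimodule) f f'
   (V :: ('u, 'u, 'u) bimodule) (V' :: ('u, 'u, 'u) bimodule) g g'.
   strict_morita_context R R U U' f f' \<and> strict_morita_context S S V V' g g' \<and>
   (condition_i R S i U V \<or> condition_ii R S i U V \<or> condition_iii R S i U V \<or>
   condition_iv R S i U V \<or> condition_v R S i U V \<or> condition_vi R S i U V)"
  then obtain U U' V V' :: "('u, 'u, 'u) bimodule" and f f' g g' where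
   c: "strict_morita_context R R U U' f f'" "strict_morita_context S S V V' g g'" and
   d: "condition_i R S i U V \<or> condition_ii R S i U V \<or> condition_iii R S i U V \<or>
   condition_iv R S i U V \<or> condition_v R S i U V \<or> condition_vi R S i U V"
   by (elim exE conjE)
  from d show ?frob unfolding conds[OF c] by (intro from_dual[OF c]) (elim disjE)
 qed (simp_all only: conds)
qed

end
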